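(* Let $d,\alpha\in\mathbb{N}$, let $[\boldsymbol a,\boldsymbol b]\subset\mathbb{R}^d$ be a box and let $f\in\mathcal{H}(K^{\mathrm{Sob},[\boldsymbol a,\boldsymbol b]}_{\alpha,d})$. Then the function $F^{[\boldsymbol a,\boldsymbol b]}\in\mathcal{H}(K^{\mathrm{Kor},[\boldsymbol a,\boldsymbol b]}_{\alpha,d})$ obtained from $f$ by the Bernoulli polynomial method on the box $[\boldsymbol a,\boldsymbol b]$ is equal to the orthogonal projection of $f$ on $\mathcal{H}(K^{\mathrm{Kor},[\boldsymbol a,\boldsymbol b]}_{\alpha,d})$, i.e., for all $\boldsymbol x\in[\boldsymbol a,\boldsymbol b]$, $$F^{[\boldsymbol a,\boldsymbol b]}(\boldsymbol x)=\left\langle f,K^{\mathrm{Kor},[\boldsymbol a,\boldsymbol b]}_{\alpha,d}(\cdot,\boldsymbol x)\right\rangle_{K^{\mathrm{Sob},[\boldsymbol a,\boldsymbol b]}_{\alpha,d}}.$$ Furthermore $$\int_{[\boldsymbol a,\boldsymbol b]}F^{[\boldsymbol a,\boldsymbol b]}(\boldsymbol x)\,\mathrm{d}\boldsymbol x=\int_{[\boldsymbol a,\boldsymbol b]}f(\boldsymbol x)\,\mathrm{d}\boldsymbol x$$ and $$\|F^{[\boldsymbol a,\boldsymbol b]}\|_{K^{\mathrm{Kor},[\boldsymbol a,\boldsymbol b]}_{\alpha,d}}=\|F^{[\boldsymbol a,\boldsymbol b]}\|_{K^{\mathrm{Sob},[\boldsymbol a,\boldsymbol b]}_{\alpha,d}}\le\|f\|_{K^{\mathrm{Sob},[\boldsymbol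 a,\boldsymbol b]}_{\alpha,d}}.$$
   Context: Notation: $f^{(\boldsymbol\tau)}=\partial^{\tau_1+\cdots+\tau_d}f/\partial x_1^{\tau_1}\cdots\partial x_d^{\tau_d}$; $\mathrm{supp}(\boldsymbol\tau)=\{j:\tau_j\ne0\}$. A box is $[\boldsymbol a,\boldsymbol b]=\prod_{j=1}^d[a_j,b_j]$, $a_j<b_j$ finite. For $\mathfrak w\subseteq\{1,\ldots,d\}$, $-\mathfrak w$ is its complement, $\boldsymbol x_{\mathfrak w}=(x_j)_{j\in\mathfrak w}$, $[\boldsymbol a_{\mathfrak w},\boldsymbol b_{\mathfrak w}]=\prod_{j\in\mathfrak w}[a_j,b_j]$; an integral over an empty set of variables is the identity operation. With $B_\tau$ the Bernoulli polynomial of degree $\tau$, the scaled Bernoulli polynomials are $B^{[a,b]}_\tau(x)=(b-a)^{\tau-1}B_\tau((x-a)/(b-a))$, and $\widetilde B^{[a,b]}_\tau$ is the $(b-a)$-periodic function equal to $B^{[a,b]}_\tau$ on $[a,b]$ for $\tau\ge2$ and on $(a,b)$ for $\tau=1$. $\mathcal{H}(K^{\mathrm{Sob},[\boldsymbol a,\boldsymbol b]}_{\alpha,d})$ is the unanchored Sobolev space on $[\boldsymbol a,\boldsymbol b]$: the $d$-fold Hilbert tensor product of the one-dimensional spaces of real functions on $[a_j,b_j]$ whose derivatives of order $0,\ldots,\alpha-1$ are absolutely continuous and whose $\alpha$-th derivative is in $L_2([a_j,b_j])$, with inner product $$\langle f,g\rangle_{K^{\mathrm{Sob},[\boldsymbol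 a,\boldsymbol b]}_{\alpha,d}}=\sum_{\boldsymbol\tau\in\{0,\ldots,\alpha\}^d,\ \mathfrak w:=\{j:\tau_j=\alpha\}}\int_{[\boldsymbol a_{\mathfrak w},\boldsymbol b_{\mathfrak w}]}\left(\int_{[\boldsymbol a_{-\mathfrak w},\boldsymbol b_{-\mathfrak w}]}f^{(\boldsymbol\tau)}(\boldsymbol x)\,\mathrm{d}\boldsymbol x_{-\mathfrak w}\right)\left(\int_{[\boldsymbol a_{-\mathfrak w},\boldsymbol b_{-\mathfrak w}]}g^{(\boldsymbol\tau)}(\boldsymbol x)\,\mathrm{d}\boldsymbol x_{-\mathfrak w}\right)\mathrm{d}\boldsymbol x_{\mathfrak w}.$$ $\mathcal{H}(K^{\mathrm{Kor},[\boldsymbol a,\boldsymbol b]}_{\alpha,d})\subset\mathcal{H}(K^{\mathrm{Sob},[\boldsymbol a,\boldsymbol b]}_{\alpha,d})$ is the Korobov space of real functions on $[\boldsymbol a,\boldsymbol b]$ given by absolutely converging Fourier series $f=\sum_{\boldsymbol h\in\mathbb{Z}^d}\widehat f^{[\boldsymbol a,\boldsymbol b]}(\boldsymbol h)\varphi^{[\boldsymbol a,\boldsymbol b]}_{\boldsymbol h}$, with $\varphi^{[\boldsymbol a,\boldsymbol b]}_{\boldsymbol h}(\boldsymbol x)=\prod_{j=1}^d\frac{\exp(2\pi\mathrm i\,h_j(x_j-a_j)/(b_j-a_j))}{\sqrt{b_j-a_j}}$ and $\widehat f^{[\boldsymbol a,\boldsymbol b]}(\boldsymbol h)=\int_{[\boldsymbol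 a,\boldsymbol b]}f\,\overline{\varphi^{[\boldsymbol a,\boldsymbol b]}_{\boldsymbol h}}\,\mathrm{d}\boldsymbol x$, with finite norm for the inner product $\langle f,g\rangle_{K^{\mathrm{Kor},[\boldsymbol a,\boldsymbol b]}_{\alpha,d}}=\sum_{\boldsymbol h}\widehat f^{[\boldsymbol a,\boldsymbol b]}(\boldsymbol h)\overline{\widehat g^{[\boldsymbol a,\boldsymbol b]}(\boldsymbol h)}[r^{[\boldsymbol a,\boldsymbol b]}_{\alpha,d}(\boldsymbol h)]^2$, where $r^{[\boldsymbol a,\boldsymbol b]}_{\alpha,d}(\boldsymbol h)=\prod_{j=1}^dr^{[a_j,b_j]}_\alpha(h_j)$, $r^{[a,b]}_\alpha(0)=\sqrt{b-a}$, $r^{[a,b]}_\alpha(h)=|2\pi h|^\alpha/(b-a)^\alpha$ for $h\ne0$. Its reproducing kernel is $$K^{\mathrm{Kor},[\boldsymbol a,\boldsymbol b]}_{\alpha,d}(\boldsymbol x,\boldsymbol y)=\prod_{j=1}^d\left(\frac1{(b_j-a_j)^2}+(-1)^{\alpha+1}\frac{\widetilde B^{[a_j,b_j]}_{2\alpha}(x_j-y_j+a_j)}{(2\alpha)!}\right).$$ Bernoulli polynomial method on the box: $$F^{[\boldsymbol a,\boldsymbol b]}(\boldsymbol x)=f(\boldsymbol x)+\sum_{\boldsymbol0\ne\boldsymbol\tau\in\{0,\ldots,\alpha\}^d,\ \mathfrak u:=\mathrm{supp}(\boldsymbol\tau)}(-1)^{|\mathfrak u|}\left[\prod_{j\in\mathfrak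 u}\frac{B^{[a_j,b_j]}_{\tau_j}(x_j)}{\tau_j!}\right]\int_{[\boldsymbol a_{\mathfrak u},\boldsymbol b_{\mathfrak u}]}f^{(\boldsymbol\tau)}(\boldsymbol x)\,\mathrm{d}\boldsymbol x_{\mathfrak u}.$$ *)

theory Defs
  imports "HOL-Analysis.Analysis"
begin

text \<open>
  Points are vectors of type \<^typ>\<open>real ^ 'n\<close>, so \<open>d\<close> is \<open>CARD('n)\<close>. A function on the box \<open>[a, b]\<close>
  is a total function; every notion below depends only on its values on \<^term>\<open>cbox a b\<close>.
  Multi-indices have type \<^typ>\<open>'n \<Rightarrow> nat\<close>.
\<close>

section \<open>Bernoulli polynomials\<close>

fun bernoulli :: "nat \<Rightarrow> real" where
  "bernoulli n =
     (if n = 0 then 1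
      else - (\<Sum>k<n. real ((n + 1) choose k) * bernoulli k) / (real n + 1))"

declare bernoulli.simps [simp del]

definition bernpoly :: "nat \<Rightarrow> real \<Rightarrow> real" where
  "bernpoly n x = (\<Sum>k\<le>n. real (n choose k) * bernoulli k * x ^ (n - k))"

text \<open>Only used for degree at least 1, where the truncated exponent is harmless.\<close>

definition scaled_bernpoly :: "real \<Rightarrow> real \<Rightarrow> nat \<Rightarrow> real \<Rightarrow> real" where
  "scaled_bernpoly a b n x = (b - a) ^ (n - 1) * bernpoly n ((x - a) / (b - a))"

text \<open>The argument is shifted by a multiple of the period into \<open>[a, b)\<close>.\<close>

definition periodic_bernpoly :: "real \<Rightarrow> real \<Rightarrow> nat \<Rightarrow> real \<Rightarrow> real" where
  "periodic_bernpoly a b n x = scaled_bernpoly a b n (a + (b - a) * frac ((x - a) / (b - a)))"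

section \<open>Integration over some of the coordinates\<close>

text \<open>The point whose coordinates in \<open>w\<close> are those of \<open>y\<close> and whose other coordinates are those of \<open>x\<close>.\<close>

definition replace_coords :: "'n set \<Rightarrow> ('n \<Rightarrow> real) \<Rightarrow> real ^ 'n \<Rightarrow> real ^ 'n" where
  "replace_coords w y x = (\<chi> j. if j \<in> w then y j else x $ j)"

text \<open>
  The integral of \<open>h\<close> over its variables in \<open>w\<close>, as a function of the full point \<open>x\<close>;
  it does not depend on the coordinates of \<open>x\<close> in \<open>w\<close>. For empty \<open>w\<close> it is \<open>h\<close> itself.
\<close>

definition partial_integral ::
    "'n::finite set \<Rightarrow> real ^ 'n \<Rightarrow> real ^ 'n \<Rightarrow> (real ^ 'n \<Rightarrow> real) \<Rightarrow> real ^ 'n \<Rightarrow> real" where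
  "partial_integral w a b h x =
     (LINT y : (PiE w (\<lambda>j. {a $ j .. b $ j})) | (PiM w (\<lambda>_. lborel)). h (replace_coords w y x))"

definition partial_integrable ::
    "'n::finite set \<Rightarrow> real ^ 'n \<Rightarrow> real ^ 'n \<Rightarrow> (real ^ 'n \<Rightarrow> real) \<Rightarrow> real ^ 'n \<Rightarrow> bool" where
  "partial_integrable w a b h x \<longleftrightarrow>
     set_integrable (PiM w (\<lambda>_. lborel)) (PiE w (\<lambda>j. {a $ j .. b $ j}))
       (\<lambda>y. h (replace_coords w y x))"

section \<open>Mixed derivatives\<close>

definition multi_supp :: "('n \<Rightarrow> nat) \<Rightarrow> 'n set" where
  "multi_supp \<tau> = {j. \<tau> j \<noteq> 0}"

text \<open>
  \<open>\<Phi> 0\<close> is an infinitely differentiable function on the whole space, \<open>\<Phi> \<sigma>\<close> is its classical partial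
  derivative of multi-index \<open>\<sigma>\<close>, and in the coordinates in \<open>u\<close> the support of \<open>\<Phi> 0\<close> lies in a
  compact subset of the open box. With the coordinates outside \<open>u\<close> frozen these are exactly
  the usual test functions in the variables in \<open>u\<close>.
\<close>

definition test_jet ::
    "'n::finite set \<Rightarrow> real ^ 'n \<Rightarrow> real ^ 'n \<Rightarrow> (('n \<Rightarrow> nat) \<Rightarrow> real ^ 'n \<Rightarrow> real) \<Rightarrow> bool" where
  "test_jet u a b \<Phi> \<longleftrightarrow>
     (\<forall>\<sigma>. continuous_on UNIV (\<Phi> \<sigma>)) \<and>
     (\<forall>\<sigma> j x. ((\<lambda>t. \<Phi> \<sigma> (x + t *\<^sub>R axis j 1)) has_real_derivative
                \<Phi> (\<sigma>(j := Suc (\<sigma> j))) x) (at 0)) \<and>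
     (\<exists>c d. (\<forall>j\<in>u. a $ j < c $ j \<and> d $ j < b $ j) \<and>
            (\<forall>x. \<Phi> (\<lambda>_. 0) x \<noteq> 0 \<longrightarrow> (\<forall>j\<in>u. c $ j \<le> x $ j \<and> x $ j \<le> d $ j)))"

text \<open>
  \<open>g\<close> is the weak derivative of \<open>f\<close> of multi-index \<open>\<tau>\<close> on the box. The defining identity is required
  in the variables in which one differentiates, for \<^emph>\<open>every\<close> value of the remaining ones, and not only
  after integrating over those as well. Hence \<open>g\<close> is determined, for every choice of the
  coordinates outside \<^term>\<open>multi_supp \<tau>\<close>, up to a null set of coordinates in \<^term>\<open>multi_supp \<tau>\<close>;
  the integrals over the latter in the Bernoulli polynomial method are then defined at every point.
  For \<open>\<tau> = 0\<close> one gets \<open>g = f\<close> on the box.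
\<close>

definition is_mixed_deriv ::
    "real ^ 'n \<Rightarrow> real ^ 'n \<Rightarrow> ('n::finite \<Rightarrow> nat) \<Rightarrow> (real ^ 'n \<Rightarrow> real) \<Rightarrow> (real ^ 'n \<Rightarrow> real) \<Rightarrow> bool" where
  "is_mixed_deriv a b \<tau> f g \<longleftrightarrow>
     set_borel_measurable lborel (cbox a b) g \<and>
     (\<forall>x\<in>cbox a b.
        partial_integrable (multi_supp \<tau>) a b f x \<and>
        partial_integrable (multi_supp \<tau>) a b g x \<and>
        (\<forall>\<Phi>. test_jet (multi_supp \<tau>) a b \<Phi> \<longrightarrow>
           partial_integral (multi_supp \<tau>) a b (\<lambda>y. f y * \<Phi> \<tau> y) x =
           (-1) ^ (\<Sum>j\<in>UNIV. \<tau> j) *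
           partial_integral (multi_supp \<tau>) a b (\<lambda>y. g y * \<Phi> (\<lambda>_. 0) y) x))"

definition mixed_deriv ::
    "real ^ 'n \<Rightarrow> real ^ 'n \<Rightarrow> ('n::finite \<Rightarrow> nat) \<Rightarrow> (real ^ 'n \<Rightarrow> real) \<Rightarrow> real ^ 'n \<Rightarrow> real" where
  "mixed_deriv a b \<tau> f = (SOME g. is_mixed_deriv a b \<tau> f g)"

definition multi_le :: "nat \<Rightarrow> ('n \<Rightarrow> nat) set" where
  "multi_le \<alpha> = {\<tau>. \<forall>j. \<tau> j \<le> \<alpha>}"

section \<open>The one-dimensional Sobolev space\<close>

definition abs_continuous_on :: "real \<Rightarrow> real \<Rightarrow> (real \<Rightarrow> real) \<Rightarrow> bool" where
  "abs_continuous_on a b f \<longleftrightarrow>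
     (\<forall>e>0. \<exists>\<delta>>0. \<forall>P.
        finite P \<and> (\<forall>(l, r)\<in>P. a \<le> l \<and> l \<le> r \<and> r \<le> b) \<and>
        disjoint_family_on (\<lambda>(l, r). {l<..<r}) P \<and> (\<Sum>(l, r)\<in>P. r - l) < \<delta> \<longrightarrow>
        (\<Sum>(l, r)\<in>P. \<bar>f r - f l\<bar>) < e)"

text \<open>
  \<open>D k\<close> is the derivative of \<open>f\<close> of order \<open>k\<close>, for \<open>k \<le> \<alpha>\<close>. It is classical for \<open>k < \<alpha>\<close>, one-sided at the
  end points; the derivative of order \<open>\<alpha>\<close> of a function of the space exists almost everywhere only.
\<close>

definition sob1_jet ::
    "nat \<Rightarrow> real \<Rightarrow> real \<Rightarrow> (real \<Rightarrow> real) \<Rightarrow> (nat \<Rightarrow> real \<Rightarrow> real) \<Rightarrow> bool" where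
  "sob1_jet \<alpha> a b f D \<longleftrightarrow>
     (\<forall>x\<in>{a..b}. D 0 x = f x) \<and>
     (\<forall>k<\<alpha>. abs_continuous_on a b (D k)) \<and>
     (\<forall>k. Suc k < \<alpha> \<longrightarrow>
        (\<forall>x\<in>{a..b}. (D k has_real_derivative D (Suc k) x) (at x within {a..b}))) \<and>
     (\<forall>k. Suc k = \<alpha> \<longrightarrow>
        (AE x\<in>{a..b} in lborel. (D k has_real_derivative D (Suc k) x) (at x within {a..b}))) \<and>
     set_borel_measurable lborel {a..b} (D \<alpha>) \<and>
     set_integrable lborel {a..b} (\<lambda>x. (D \<alpha> x)\<^sup>2)"

definition sob1 :: "nat \<Rightarrow> real \<Rightarrow> real \<Rightarrow> (real \<Rightarrow> real) set" where
  "sob1 \<alpha> a b = {f. \<exists>D. sob1_jet \<alpha> a b f D}"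

definition sob1_deriv :: "nat \<Rightarrow> real \<Rightarrow> real \<Rightarrow> (real \<Rightarrow> real) \<Rightarrow> nat \<Rightarrow> real \<Rightarrow> real" where
  "sob1_deriv \<alpha> a b f = (SOME D. sob1_jet \<alpha> a b f D)"

definition sob1_inner :: "nat \<Rightarrow> real \<Rightarrow> real \<Rightarrow> (real \<Rightarrow> real) \<Rightarrow> (real \<Rightarrow> real) \<Rightarrow> real" where
  "sob1_inner \<alpha> a b f g =
     (\<Sum>k<\<alpha>. (LINT x:{a..b}|lborel. sob1_deriv \<alpha> a b f k x) *
             (LINT x:{a..b}|lborel. sob1_deriv \<alpha> a b g k x)) +
     (LINT x:{a..b}|lborel. sob1_deriv \<alpha> a b f \<alpha> x * sob1_deriv \<alpha> a b g \<alpha> x)"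

section \<open>The Sobolev space on the box\<close>

text \<open>
  A list of families \<open>(g\<^sub>j)\<close> stands for the finite sum of the elementary tensors \<open>\<Otimes>\<^sub>j g\<^sub>j\<close>, which
  is the function \<open>x \<mapsto> \<Sum> \<Prod>\<^sub>j g\<^sub>j (x\<^sub>j)\<close>. The inner product is the bilinear extension
  of \<open>\<langle>\<Otimes>\<^sub>j g\<^sub>j, \<Otimes>\<^sub>j h\<^sub>j\<rangle> = \<Prod>\<^sub>j \<langle>g\<^sub>j, h\<^sub>j\<rangle>\<close>.
\<close>

definition tensor_eval :: "('n::finite \<Rightarrow> real \<Rightarrow> real) list \<Rightarrow> real ^ 'n \<Rightarrow> real" where
  "tensor_eval s x = (\<Sum>g\<leftarrow>s. \<Prod>j\<in>UNIV. g j (x $ j))"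

definition tensor_inner ::
    "nat \<Rightarrow> real ^ 'n \<Rightarrow> real ^ 'n \<Rightarrow> ('n::finite \<Rightarrow> real \<Rightarrow> real) list \<Rightarrow> ('n \<Rightarrow> real \<Rightarrow> real) list \<Rightarrow> real" where
  "tensor_inner \<alpha> a b s t =
     (\<Sum>g\<leftarrow>s. \<Sum>h\<leftarrow>t. \<Prod>j\<in>UNIV. sob1_inner \<alpha> (a $ j) (b $ j) (g j) (h j))"

definition tensor_dist ::
    "nat \<Rightarrow> real ^ 'n \<Rightarrow> real ^ 'n \<Rightarrow> ('n::finite \<Rightarrow> real \<Rightarrow> real) list \<Rightarrow> ('n \<Rightarrow> real \<Rightarrow> real) list \<Rightarrow> real" where
  "tensor_dist \<alpha> a b s t =
     sqrt (tensor_inner \<alpha> a b s s - 2 * tensor_inner \<alpha> a b s t + tensor_inner \<alpha> a b t t)"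

text \<open>
  The Hilbert tensor product of the spaces \<^term>\<open>sob1 \<alpha> (a $ j) (b $ j)\<close>, i.e. the completion of their
  algebraic tensor product. Point evaluations are continuous on these spaces, so the completion is
  a space of functions on the box: a Cauchy sequence is identified with its pointwise limit.
\<close>

definition sobolev :: "nat \<Rightarrow> real ^ 'n \<Rightarrow> real ^ 'n \<Rightarrow> (real ^ 'n::finite \<Rightarrow> real) set" where
  "sobolev \<alpha> a b =
     {f. \<exists>s :: nat \<Rightarrow> ('n \<Rightarrow> real \<Rightarrow> real) list.
           (\<forall>n. \<forall>g\<in>set (s n). \<forall>j. g j \<in> sob1 \<alpha> (a $ j) (b $ j)) \<and>
           (\<forall>e>0. \<exists>N. \<forall>m\<ge>N. \<forall>n\<ge>N. tensor_dist \<alpha> a b (s m) (s n) < e) \<and>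
           (\<forall>x\<in>cbox a b. (\<lambda>n. tensor_eval (s n) x) \<longlonglongrightarrow> f x)}"

text \<open>
  After all coordinates have been integrated out, the result is a constant function,
  which is evaluated at \<open>a\<close>.
\<close>

definition sob_inner ::
    "nat \<Rightarrow> real ^ 'n \<Rightarrow> real ^ 'n \<Rightarrow> (real ^ 'n::finite \<Rightarrow> real) \<Rightarrow> (real ^ 'n \<Rightarrow> real) \<Rightarrow> real" where
  "sob_inner \<alpha> a b f g =
     (\<Sum>\<tau>\<in>multi_le \<alpha>.
        let w = {j. \<tau> j = \<alpha>} in
        partial_integral w a b
          (\<lambda>x. partial_integral (- w) a b (mixed_deriv a b \<tau> f) x *
               partial_integral (- w) a b (mixed_deriv a b \<tau> g) x) a)"

definition sob_norm :: "nat \<Rightarrow> real ^ 'n \<Rightarrow> real ^ 'n \<Rightarrow> (real ^ 'n::finite \<Rightarrow> real) \<Rightarrow> real" where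
  "sob_norm \<alpha> a b f = sqrt (sob_inner \<alpha> a b f f)"

definition is_sob_projection ::
    "nat \<Rightarrow> real ^ 'n \<Rightarrow> real ^ 'n \<Rightarrow> (real ^ 'n::finite \<Rightarrow> real) set \<Rightarrow>
     (real ^ 'n \<Rightarrow> real) \<Rightarrow> (real ^ 'n \<Rightarrow> real) \<Rightarrow> bool" where
  "is_sob_projection \<alpha> a b V f p \<longleftrightarrow>
     V \<subseteq> sobolev \<alpha> a b \<and> p \<in> V \<and> (\<forall>g\<in>V. sob_inner \<alpha> a b (\<lambda>x. f x - p x) g = 0)"

section \<open>The Korobov space on the box\<close>

definition fourier_basis :: "real ^ 'n \<Rightarrow> real ^ 'n \<Rightarrow> int ^ 'n::finite \<Rightarrow> real ^ 'n \<Rightarrow> complex" where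
  "fourier_basis a b h x =
     (\<Prod>j\<in>UNIV. exp (\<i> * of_real (2 * pi * of_int (h $ j) * (x $ j - a $ j) / (b $ j - a $ j))) /
                of_real (sqrt (b $ j - a $ j)))"

definition fourier_coeff :: "real ^ 'n \<Rightarrow> real ^ 'n \<Rightarrow> (real ^ 'n::finite \<Rightarrow> real) \<Rightarrow> int ^ 'n \<Rightarrow> complex" where
  "fourier_coeff a b f h = (LINT x : cbox a b | lborel. of_real (f x) * cnj (fourier_basis a b h x))"

definition kor_weight1 :: "nat \<Rightarrow> real \<Rightarrow> real \<Rightarrow> int \<Rightarrow> real" where
  "kor_weight1 \<alpha> a b h =
     (if h = 0 then sqrt (b - a) else \<bar>2 * pi * of_int h\<bar> ^ \<alpha> / (b - a) ^ \<alpha>)"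

definition kor_weight :: "nat \<Rightarrow> real ^ 'n \<Rightarrow> real ^ 'n \<Rightarrow> int ^ 'n::finite \<Rightarrow> real" where
  "kor_weight \<alpha> a b h = (\<Prod>j\<in>UNIV. kor_weight1 \<alpha> (a $ j) (b $ j) (h $ j))"

definition korobov :: "nat \<Rightarrow> real ^ 'n \<Rightarrow> real ^ 'n \<Rightarrow> (real ^ 'n::finite \<Rightarrow> real) set" where
  "korobov \<alpha> a b =
     {f. (\<forall>x\<in>cbox a b.
            (\<lambda>h. norm (fourier_coeff a b f h * fourier_basis a b h x)) summable_on UNIV \<and>
            ((\<lambda>h. fourier_coeff a b f h * fourier_basis a b h x) has_sum of_real (f x)) UNIV) \<and>
         (\<lambda>h. (norm (fourier_coeff a b f h))\<^sup>2 * (kor_weight \<alpha> a b h)\<^sup>2) summable_on UNIV}"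

definition kor_inner ::
    "nat \<Rightarrow> real ^ 'n \<Rightarrow> real ^ 'n \<Rightarrow> (real ^ 'n::finite \<Rightarrow> real) \<Rightarrow> (real ^ 'n \<Rightarrow> real) \<Rightarrow> complex" where
  "kor_inner \<alpha> a b f g =
     (\<Sum>\<^sub>\<infinity>h. fourier_coeff a b f h * cnj (fourier_coeff a b g h) * of_real ((kor_weight \<alpha> a b h)\<^sup>2))"

definition kor_norm :: "nat \<Rightarrow> real ^ 'n \<Rightarrow> real ^ 'n \<Rightarrow> (real ^ 'n::finite \<Rightarrow> real) \<Rightarrow> real" where
  "kor_norm \<alpha> a b f = sqrt (Re (kor_inner \<alpha> a b f f))"

definition kor_kernel :: "nat \<Rightarrow> real ^ 'n \<Rightarrow> real ^ 'n \<Rightarrow> real ^ 'n \<Rightarrow> real ^ 'n::finite \<Rightarrow> real" where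
  "kor_kernel \<alpha> a b x y =
     (\<Prod>j\<in>UNIV. 1 / (b $ j - a $ j)\<^sup>2 +
        (-1) ^ (\<alpha> + 1) * periodic_bernpoly (a $ j) (b $ j) (2 * \<alpha>) (x $ j - y $ j + a $ j) / fact (2 * \<alpha>))"

section \<open>The Bernoulli polynomial method\<close>

definition bernoulli_method ::
    "nat \<Rightarrow> real ^ 'n \<Rightarrow> real ^ 'n \<Rightarrow> (real ^ 'n::finite \<Rightarrow> real) \<Rightarrow> real ^ 'n \<Rightarrow> real" where
  "bernoulli_method \<alpha> a b f x =
     f x + (\<Sum>\<tau>\<in>multi_le \<alpha> - {\<lambda>_. 0}.
       let u = multi_supp \<tau> in
       (-1) ^ card u * (\<Prod>j\<in>u. scaled_bernpoly (a $ j) (b $ j) (\<tau> j) (x $ j) / fact (\<tau> j)) *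
       partial_integral u a b (mixed_deriv a b \<tau> f) x)"

end

theory Submission imports Defs
begin

text \<open>
  In one variable, a function of the Sobolev space is determined by its data: the derivative of order \<open>\<alpha>\<close>
  and the integrals of the lower derivatives. It is recovered from them by integration against a kernel
  made of Bernoulli polynomials and their periodic extensions. Taking products, \<open>f\<close> corresponds isometrically to a
  square-integrable function \<open>H\<close> on a product measure space: \<open>f(x) = \<integral> H(T) (\<Prod>j. k(x\<^sub>j, T\<^sub>j)) dT\<close>, the mixed derivatives
  are obtained by differentiating the kernel, and the Sobolev inner product becomes \<open>\<integral> H G\<close>.

  In these terms the Bernoulli polynomial method replaces \<open>k\<close> by a kernel that lacks its polynomial part, namely the one
  whose expansion in the normalised data \<open>\<psi>\<^sub>h\<close> of the exponentials has the coefficients \<open>\<phi>\<^sub>h(x) / r(h)\<close>. The products \<open>\<Psi>\<^sub>h\<close> of the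
  \<open>\<psi>\<^sub>h\<close> are orthonormal, their closed span consists of the data of the Korobov space, and the Fourier
  coefficients of \<open>F\<close> are \<open>\<langle>H, \<Psi>\<^sub>h\<rangle> / r(h)\<close>. So \<open>F\<close> is the projection of \<open>f\<close>, and both norms of \<open>F\<close> are given by Parseval's identity.
\<close>

section \<open>Absolutely continuous functions\<close>

text \<open>Members of the Hilbert tensor product are only pointwise limits of tensors, so every
  statement is moved to the data \<open>H\<close> by Fubini; there derivatives fall on explicit
  kernels and an integration by parts in one variable suffices. Two choices made by
  \<open>SOME\<close> must be controlled. The jets in \<open>sob1_inner\<close> are unique up to
  null sets. \<open>mixed_deriv\<close> is unique up to null sets on every fibre, which needs test
  functions that separate on each fibre; this is why smooth bumps are constructed. The alternating
  sum of the method factors: the sum over all \<tau> of products is the product over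
  \<open>j\<close> of sums over \<open>k \<le> \<alpha>\<close>, so the identity for
  \<open>proj_ker\<close> is one-dimensional. That the kernel of the method lies in the closed span
  of the \<open>Psi h\<close> is Parseval's equality for that kernel. Both of its sides are
  explicit: the norm comes from a convolution of Bernoulli kernels, the sum over frequencies from
  Euler's even power sums, which are in turn reduced to the Basel sum.\<close>

definition ac_deriv :: "real \<Rightarrow> real \<Rightarrow> (real \<Rightarrow> real) \<Rightarrow> (real \<Rightarrow> real) \<Rightarrow> bool" where
  "ac_deriv a b D \<delta> \<longleftrightarrow> abs_continuous_on a b D \<and>
     (AE x\<in>{a..b} in lborel. (D has_real_derivative \<delta> x) (at x within {a..b}))"

lemma ac_deriv_subset:
  assumes "ac_deriv a b D \<delta>" "a \<le> c" "d \<le> b"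
  shows "ac_deriv c d D \<delta>"
proof -
  have "abs_continuous_on c d D"
    unfolding abs_continuous_on_def
  proof (intro allI impI)
    fix e :: real assume "e > 0"
    then obtain \<delta> where \<delta>: "\<delta> > 0" "\<forall>P. finite P \<and> (\<forall>(l, r)\<in>P. a \<le> l \<and> l \<le> r \<and> r \<le> b) \<and>
        disjoint_family_on (\<lambda>(l, r). {l<..<r}) P \<and> (\<Sum>(l, r)\<in>P. r - l) < \<delta> \<longrightarrow>
        (\<Sum>(l, r)\<in>P. \<bar>D r - D l\<bar>) < e"
      using assms(1) unfolding ac_deriv_def abs_continuous_on_def by blast
    show "\<exists>\<delta>>0. \<forall>P. finite P \<and> (\<forall>(l, r)\<in>P. c \<le> l \<and> l \<le> r \<and> r \<le> d) \<and>
        disjoint_family_on (\<lambda>(l, r). {l<..<r}) P \<and> (\<Sum>(l, r)\<in>P. r - l) < \<delta> \<longrightarrow>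
        (\<Sum>(l, r)\<in>P. \<bar>D r - D l\<bar>) < e"
      using \<delta> assms(2,3) by (intro exI[of _ \<delta>]) fastforce
  qed
  moreover have "AE x\<in>{c..d} in lborel. (D has_real_derivative \<delta> x) (at x within {c..d})"
  proof -
    have "AE x\<in>{a..b} in lborel. (D has_real_derivative \<delta> x) (at x within {a..b})"
      using assms(1) by (simp add: ac_deriv_def)
    then show ?thesis
      by eventually_elim (use assms(2,3) in \<open>auto intro: DERIV_subset[of _ _ _ "{a..b}"]\<close>)
  qed
  ultimately show ?thesis by (simp add: ac_deriv_def)
qed

lemma abs_continuous_single:
  assumes "abs_continuous_on a b D" "e > 0"
  shows "\<exists>\<delta>>0. \<forall>l r. a \<le> l \<and> l \<le> r \<and> r \<le> b \<and> r - l < \<delta> \<longrightarrow> \<bar>D r - D l\<bar> < e"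
proof -
  from assms obtain \<delta> where "\<delta> > 0" and \<delta>: "\<And>P. finite P \<and> (\<forall>(l, r)\<in>P. a \<le> l \<and> l \<le> r \<and> r \<le> b) \<and>
        disjoint_family_on (\<lambda>(l, r). {l<..<r}) P \<and> (\<Sum>(l, r)\<in>P. r - l) < \<delta> \<Longrightarrow>
        (\<Sum>(l, r)\<in>P. \<bar>D r - D l\<bar>) < e"
    unfolding abs_continuous_on_def by blast
  show ?thesis
    using \<open>\<delta> > 0\<close> \<delta>[of "{(l, r)}" for l r]
    by (intro exI[of _ \<delta>]) (auto simp: disjoint_family_on_def)
qed

lemma abs_continuous_imp_continuous_on:
  assumes "abs_continuous_on a b D"
  shows "continuous_on {a..b} D"
  unfolding continuous_on_iff
proof (intro ballI allI impI)
  fix x e assume x: "x \<in> {a..b}" and "e > (0::real)"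
  from abs_continuous_single[OF assms this(2)] obtain \<delta> where \<delta>: "\<delta> > 0"
    "\<And>l r. a \<le> l \<and> l \<le> r \<and> r \<le> b \<and> r - l < \<delta> \<Longrightarrow> \<bar>D r - D l\<bar> < e" by blast
  show "\<exists>d>0. \<forall>x'\<in>{a..b}. dist x' x < d \<longrightarrow> dist (D x') (D x) < e"
  proof (intro exI[of _ \<delta>] conjI ballI impI)
    fix y assume y: "y \<in> {a..b}" "dist y x < \<delta>"
    show "dist (D y) (D x) < e"
      using \<delta>(2)[of x y] \<delta>(2)[of y x] x y by (cases "x \<le> y") (auto simp: dist_real_def)
  qed (rule \<delta>)
qed

lemma lipschitz_imp_abs_continuous:
  assumes L: "\<And>x y. x \<in> {a..b} \<Longrightarrow> y \<in> {a..b} \<Longrightarrow> \<bar>D x - D y\<bar> \<le> L * \<bar>x - y\<bar>"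
  shows "abs_continuous_on a b D"
  unfolding abs_continuous_on_def
proof (intro allI impI)
  fix e :: real assume e: "e > 0"
  show "\<exists>\<delta>>0. \<forall>P. finite P \<and> (\<forall>(l, r)\<in>P. a \<le> l \<and> l \<le> r \<and> r \<le> b) \<and>
        disjoint_family_on (\<lambda>(l, r). {l<..<r}) P \<and> (\<Sum>(l, r)\<in>P. r - l) < \<delta> \<longrightarrow>
        (\<Sum>(l, r)\<in>P. \<bar>D r - D l\<bar>) < e"
  proof (intro exI[of _ "e / (\<bar>L\<bar> + 1)"] conjI allI impI)
    fix P assume P: "finite P \<and> (\<forall>(l, r)\<in>P. a \<le> l \<and> l \<le> r \<and> r \<le> b) \<and>
        disjoint_family_on (\<lambda>(l, r). {l<..<r}) P \<and> (\<Sum>(l, r)\<in>P. r - l) < e / (\<bar>L\<bar> + 1)"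
    have "(\<Sum>(l, r)\<in>P. \<bar>D r - D l\<bar>) \<le> (\<Sum>(l, r)\<in>P. (\<bar>L\<bar> + 1) * (r - l))"
    proof (intro sum_mono, clarify)
      fix l r assume lr: "(l, r) \<in> P"
      with P have "a \<le> l" "l \<le> r" "r \<le> b" by auto
      then have "\<bar>D r - D l\<bar> \<le> L * (r - l)" using L[of r l] by auto
      also have "\<dots> \<le> (\<bar>L\<bar> + 1) * (r - l)" using \<open>l \<le> r\<close> by (intro mult_right_mono) auto
      finally show "\<bar>D r - D l\<bar> \<le> (\<bar>L\<bar> + 1) * (r - l)" .
    qed
    also have "\<dots> = (\<bar>L\<bar> + 1) * (\<Sum>(l, r)\<in>P. r - l)"
      by (simp add: sum_distrib_left case_prod_unfold)
    also have "\<dots> < e" using P by (simp add: field_simps)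
    finally show "(\<Sum>(l, r)\<in>P. \<bar>D r - D l\<bar>) < e" .
  qed (use e in auto)
qed

lemma abs_continuous_mult:
  assumes D: "abs_continuous_on a b D" and G: "abs_continuous_on a b G"
  shows "abs_continuous_on a b (\<lambda>x. G x * D x)"
proof -
  have "bounded (D ` {a..b})" "bounded (G ` {a..b})"
    using D G by (auto intro!: compact_imp_bounded compact_continuous_image abs_continuous_imp_continuous_on)
  then obtain B1 B2 where "\<And>x. x \<in> {a..b} \<Longrightarrow> \<bar>D x\<bar> \<le> B1" "\<And>x. x \<in> {a..b} \<Longrightarrow> \<bar>G x\<bar> \<le> B2"
    unfolding bounded_iff real_norm_def by (metis imageI)
  then have "\<exists>B>0. (\<forall>x\<in>{a..b}. \<bar>D x\<bar> \<le> B) \<and> (\<forall>x\<in>{a..b}. \<bar>G x\<bar> \<le> B)"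
    by (intro exI[of _ "max 1 (max B1 B2)"]) (fastforce simp: le_max_iff_disj)
  then obtain B where B: "B > 0" "\<And>x. x \<in> {a..b} \<Longrightarrow> \<bar>D x\<bar> \<le> B" "\<And>x. x \<in> {a..b} \<Longrightarrow> \<bar>G x\<bar> \<le> B"
    by blast
  show ?thesis
    unfolding abs_continuous_on_def
  proof (intro allI impI)
    fix e :: real assume e: "e > 0"
    then have e': "e / (2 * B) > 0" using B by simp
    obtain d1 where d1: "d1 > 0" "\<And>P. finite P \<and> (\<forall>(l, r)\<in>P. a \<le> l \<and> l \<le> r \<and> r \<le> b) \<and>
        disjoint_family_on (\<lambda>(l, r). {l<..<r}) P \<and> (\<Sum>(l, r)\<in>P. r - l) < d1 \<Longrightarrow>
        (\<Sum>(l, r)\<in>P. \<bar>D r - D l\<bar>) < e / (2 * B)"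
      using D e' unfolding abs_continuous_on_def by meson
    obtain d2 where d2: "d2 > 0" "\<And>P. finite P \<and> (\<forall>(l, r)\<in>P. a \<le> l \<and> l \<le> r \<and> r \<le> b) \<and>
        disjoint_family_on (\<lambda>(l, r). {l<..<r}) P \<and> (\<Sum>(l, r)\<in>P. r - l) < d2 \<Longrightarrow>
        (\<Sum>(l, r)\<in>P. \<bar>G r - G l\<bar>) < e / (2 * B)"
      using G e' unfolding abs_continuous_on_def by meson
    show "\<exists>\<delta>>0. \<forall>P. finite P \<and> (\<forall>(l, r)\<in>P. a \<le> l \<and> l \<le> r \<and> r \<le> b) \<and>
        disjoint_family_on (\<lambda>(l, r). {l<..<r}) P \<and> (\<Sum>(l, r)\<in>P. r - l) < \<delta> \<longrightarrow>
        (\<Sum>(l, r)\<in>P. \<bar>G r * D r - G l * D l\<bar>) < e"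
    proof (intro exI[of _ "min d1 d2"] conjI allI impI)
      fix P assume P: "finite P \<and> (\<forall>(l, r)\<in>P. a \<le> l \<and> l \<le> r \<and> r \<le> b) \<and>
        disjoint_family_on (\<lambda>(l, r). {l<..<r}) P \<and> (\<Sum>(l, r)\<in>P. r - l) < min d1 d2"
      have "(\<Sum>(l, r)\<in>P. \<bar>G r * D r - G l * D l\<bar>) \<le> (\<Sum>(l, r)\<in>P. B * \<bar>D r - D l\<bar> + B * \<bar>G r - G l\<bar>)"
      proof (intro sum_mono, clarify)
        fix l r assume lr: "(l, r) \<in> P"
        with P have "a \<le> l" "l \<le> r" "r \<le> b" by auto
        then have m: "l \<in> {a..b}" "r \<in> {a..b}" by auto
        have "G r * D r - G l * D l = G r * (D r - D l) + D l * (G r - G l)"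
          by (simp add: algebra_simps)
        also have "\<bar>\<dots>\<bar> \<le> \<bar>G r\<bar> * \<bar>D r - D l\<bar> + \<bar>D l\<bar> * \<bar>G r - G l\<bar>"
          by (metis abs_mult abs_triangle_ineq)
        also have "\<dots> \<le> B * \<bar>D r - D l\<bar> + B * \<bar>G r - G l\<bar>"
          using B m by (intro add_mono mult_right_mono) auto
        finally show "\<bar>G r * D r - G l * D l\<bar> \<le> B * \<bar>D r - D l\<bar> + B * \<bar>G r - G l\<bar>" .
      qed
      also have "\<dots> = B * (\<Sum>(l, r)\<in>P. \<bar>D r - D l\<bar>) + B * (\<Sum>(l, r)\<in>P. \<bar>G r - G l\<bar>)"
        by (simp add: sum_distrib_left sum.distrib case_prod_unfold)
      also have "\<dots> < B * (e / (2 * B)) + B * (e / (2 * B))"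
        using B P by (intro add_strict_mono mult_strict_left_mono d1 d2) auto
      also have "\<dots> = e" using B by (simp add: field_simps)
      finally show "(\<Sum>(l, r)\<in>P. \<bar>G r * D r - G l * D l\<bar>) < e" .
    qed (use d1 d2 in auto)
  qed
qed

text \<open>
  On tags where the derivative exists, Henstock's gauge controls the increments; the intervals tagged
  in the exceptional null set lie in an open set of small measure, where absolute continuity applies.
\<close>

theorem ac_deriv_has_integral:
  assumes ac: "ac_deriv a b f g" and ab: "a \<le> b"
  shows "(g has_integral f b - f a) {a..b}"
proof -
  have AC: "abs_continuous_on a b f"
    using ac by (simp add: ac_deriv_def)
  have "AE x in lborel. x \<in> {a..b} \<longrightarrow> (f has_real_derivative g x) (at x within {a..b})"
    using ac by (simp add: ac_deriv_def)
  then obtain N where N0: "\<And>x. x \<in> space lborel - N \<Longrightarrow> x \<in> {a..b} \<longrightarrow> (f has_real_derivative g x) (at x within {a..b})"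
    "N \<in> null_sets lborel"
    by (rule AE_E3) blast
  then have N: "\<And>x. x \<in> {a..b} - N \<Longrightarrow> (f has_real_derivative g x) (at x within {a..b})"
    "N \<in> null_sets lborel" by simp_all
  then have negN: "negligible N"
    using N(2) by (simp add: negligible_iff_null_sets null_sets_completionI)
  \<comment> \<open>With the value 0 on \<open>N\<close>, tags in \<open>N\<close> add nothing to
    the Riemann sum, and only their increments of \<open>f\<close> remain to be bounded.\<close>
  define g0 where "g0 x = (if x \<in> N then 0 else g x)" for x
  have "(g0 has_integral f b - f a) (cbox a b)"
    unfolding has_integral
  proof (intro allI impI)
    fix e :: real assume e: "e > 0"
    \<comment> \<open>The tags off \<open>N\<close> cost at most \<open>e1 * (b - a)\<close>, which
      is below \<open>e / 2\<close>; the added 1 covers \<open>a = b\<close>.\<close>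
    define e1 where "e1 = e / (2 * (b - a + 1))"
    have e1: "e1 > 0" using e ab by (simp add: e1_def)
    have "e / 2 > 0" using e by simp
    with AC obtain \<delta> where \<delta>: "\<delta> > 0" "\<And>P. finite P \<and> (\<forall>(l, r)\<in>P. a \<le> l \<and> l \<le> r \<and> r \<le> b) \<and>
        disjoint_family_on (\<lambda>(l, r). {l<..<r}) P \<and> (\<Sum>(l, r)\<in>P. r - l) < \<delta> \<Longrightarrow>
        (\<Sum>(l, r)\<in>P. \<bar>f r - f l\<bar>) < e / 2"
      unfolding abs_continuous_on_def by blast
    have Nl: "N \<in> sets lebesgue" "emeasure lebesgue N = 0"
      using N(2) by (auto simp: null_sets_def)
    obtain U where U: "open U" "N \<subseteq> U" "U - N \<in> lmeasurable" "emeasure lebesgue (U - N) < ennreal \<delta>"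
      using sets_lebesgue_outer_open[OF Nl(1) \<delta>(1)] by blast
    have emU: "emeasure lborel U < ennreal \<delta>"
    proof -
      have "emeasure lebesgue U = emeasure lebesgue ((U - N) \<union> N)"
        using U(2) by (simp add: Un_absorb2)
      also have "\<dots> \<le> emeasure lebesgue (U - N) + emeasure lebesgue N"
        using U(3) Nl(1) by (intro emeasure_subadditive) (auto simp: fmeasurableD)
      finally have "emeasure lebesgue U < ennreal \<delta>" using U(4) Nl(2) by simp
      then show ?thesis using U(1) by simp
    qed
    have "\<exists>d>0. x \<in> {a..b} - N \<longrightarrow> (\<forall>y\<in>{a..b}. \<bar>y - x\<bar> < d \<longrightarrow> \<bar>f y - f x - g x * (y - x)\<bar> \<le> e1 * \<bar>y - x\<bar>)" for x
    proof (cases "x \<in> {a..b} - N")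
      case True
      then have "(f has_real_derivative g x) (at x within {a..b})" by (rule N(1))
      then have "(f has_derivative (*) (g x)) (at x within {a..b})"
        by (simp add: has_field_derivative_def)
      then obtain d where "d > 0" "\<forall>y\<in>{a..b}. norm (y - x) < d \<longrightarrow> norm (f y - f x - g x * (y - x)) \<le> e1 * norm (y - x)"
        using e1 unfolding has_derivative_within_alt by blast
      then show ?thesis by auto
    qed (auto intro: exI[of _ 1])
    then obtain d where d: "\<And>x. d x > 0" "\<And>x y. x \<in> {a..b} - N \<Longrightarrow> y \<in> {a..b} \<Longrightarrow> \<bar>y - x\<bar> < d x \<Longrightarrow>
        \<bar>f y - f x - g x * (y - x)\<bar> \<le> e1 * \<bar>y - x\<bar>"
      by metis
    \<comment> \<open>For a tag in \<open>N\<close> the gauge confines the interval to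
      \<open>U\<close>, so that the total length of these intervals stays below
      \<open>\<delta>\<close>; elsewhere it enforces the estimate by the derivative.\<close>
    define \<gamma> where "\<gamma> x = (if x \<in> N then U else ball x (d x))" for x
    have gauge: "gauge \<gamma>" using U d by (auto simp: gauge_def \<gamma>_def)
    have est: "norm ((\<Sum>(x, k)\<in>\<D>. measure lborel k *\<^sub>R g0 x) - (f b - f a)) < e"
      if tag: "\<D> tagged_division_of cbox a b" and fine: "\<gamma> fine \<D>" for \<D>
    proof -
      have fin: "finite \<D>" using tag by blast
      have el: "Inf k \<le> x \<and> x \<le> Sup k \<and> interior k = {Inf k<..<Sup k} \<and> (\<forall>y. Inf k \<le> y \<and> y \<le> Sup k \<longrightarrow> y \<in> k) \<and> Inf k \<le> Sup k \<and> a \<le> Inf k \<and> Sup k \<le> b \<and>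
            Inf k \<in> k \<and> Sup k \<in> k \<and> k \<subseteq> \<gamma> x \<and> measure lborel k = Sup k - Inf k"
        if xk: "(x, k) \<in> \<D>" for x k
      proof -
        obtain u v where k: "k = cbox u v" "x \<in> k" "k \<subseteq> cbox a b"
          using tagged_division_ofD(2,3,4)[OF tag xk] by blast
        then have "u \<le> v" by auto
        then show ?thesis using k fine xk by (auto simp: fine_def)
      qed
      have tel: "(\<Sum>(x, k)\<in>\<D>. f (Sup k) - f (Inf k)) = f b - f a"
        using additive_tagged_division_1[OF ab, of \<D> f] tag by simp
      define r where "r = (\<lambda>(x, k). measure lborel k *\<^sub>R g0 x - (f (Sup k) - f (Inf k)))"
      define D1 where "D1 = {p \<in> \<D>. fst p \<notin> N}"
      \<comment> \<open>Degenerate intervals tagged in \<open>N\<close> contribute nothing. Without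
        them the interiors are nonempty and disjoint, so distinct members have distinct end points
        and \<open>\<iota>\<close> is injective.\<close>
      define D2 where "D2 = {p \<in> \<D>. fst p \<in> N \<and> Inf (snd p) < Sup (snd p)}"
      have r1: "\<bar>r (x, k)\<bar> \<le> e1 * measure lborel k" if "(x, k) \<in> D1" for x k
      proof -
        have xk: "(x, k) \<in> \<D>" "x \<notin> N" using that by (auto simp: D1_def)
        note E = el[OF xk(1)]
        have x: "x \<in> {a..b} - N" "Inf k \<le> x" "x \<le> Sup k" using E xk(2) by auto
        have kb: "k \<subseteq> ball x (d x)" using E xk by (auto simp: \<gamma>_def)
        have 1: "\<bar>f (Sup k) - f x - g x * (Sup k - x)\<bar> \<le> e1 * \<bar>Sup k - x\<bar>"
          using E kb by (intro d(2) x) (auto simp: dist_real_def abs_minus_commute subset_iff)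
        have 2: "\<bar>f (Inf k) - f x - g x * (Inf k - x)\<bar> \<le> e1 * \<bar>Inf k - x\<bar>"
          using E kb by (intro d(2) x) (auto simp: dist_real_def abs_minus_commute subset_iff)
        have "r (x, k) = (f (Inf k) - f x - g x * (Inf k - x)) - (f (Sup k) - f x - g x * (Sup k - x))"
        proof -
          have c: "measure lborel k = Sup k - Inf k" using E by simp
          show ?thesis using xk unfolding r_def g0_def prod.case c by (simp add: algebra_simps)
        qed
        also have "\<bar>\<dots>\<bar> \<le> e1 * \<bar>Inf k - x\<bar> + e1 * \<bar>Sup k - x\<bar>"
          using 1 2 by linarith
        also have "\<dots> = e1 * (Sup k - Inf k)" using x by (simp add: algebra_simps)
        also have "\<dots> = e1 * measure lborel k" using E by simp
        finally show ?thesis .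
      qed
      have "(\<Sum>(x, k)\<in>\<D>. measure lborel k *\<^sub>R g0 x) - (f b - f a) = (\<Sum>p\<in>\<D>. r p)"
        unfolding tel[symmetric] r_def by (simp add: sum_subtractf case_prod_unfold)
      also have "\<dots> = (\<Sum>p\<in>D1 \<union> D2. r p)"
      proof (rule sum.mono_neutral_right[OF fin])
        show "D1 \<union> D2 \<subseteq> \<D>" by (auto simp: D1_def D2_def)
        show "\<forall>p\<in>\<D> - (D1 \<union> D2). r p = 0"
        proof
          fix p assume p: "p \<in> \<D> - (D1 \<union> D2)"
          obtain x k where xk: "p = (x, k)" by force
          have "x \<in> N" "\<not> Inf k < Sup k" using p xk by (auto simp: D1_def D2_def)
          then show "r p = 0" using el[of x k] p xk by (auto simp: r_def g0_def)
        qed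
      qed
      also have "\<dots> = (\<Sum>p\<in>D1. r p) + (\<Sum>p\<in>D2. r p)"
        using fin by (intro sum.union_disjoint) (auto simp: D1_def D2_def)
      finally have eq: "(\<Sum>(x, k)\<in>\<D>. measure lborel k *\<^sub>R g0 x) - (f b - f a) = (\<Sum>p\<in>D1. r p) + (\<Sum>p\<in>D2. r p)" .
      have "\<bar>\<Sum>p\<in>D1. r p\<bar> \<le> (\<Sum>p\<in>D1. e1 * measure lborel (snd p))"
        by (intro sum_abs[THEN order_trans] sum_mono) (use r1 in auto)
      also have "\<dots> \<le> (\<Sum>p\<in>\<D>. e1 * measure lborel (snd p))"
        using e1 fin by (intro sum_mono2) (auto simp: D1_def)
      also have "\<dots> = e1 * (b - a)"
        using additive_content_tagged_division[OF tag] ab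
        by (simp add: sum_distrib_left[symmetric] case_prod_unfold)
      also have "\<dots> < e / 2" using e ab by (simp add: e1_def field_simps)
      finally have b1: "\<bar>\<Sum>p\<in>D1. r p\<bar> < e / 2" .
      define \<iota> where "\<iota> = (\<lambda>p::real \<times> real set. (Inf (snd p), Sup (snd p)))"
      have disj: "{Inf (snd p)<..<Sup (snd p)} \<inter> {Inf (snd q)<..<Sup (snd q)} = {}"
        if "p \<in> D2" "q \<in> D2" "p \<noteq> q" for p q
      proof -
        have "interior (snd p) \<inter> interior (snd q) = {}"
          using tagged_division_ofD(5)[OF tag, of "fst p" "snd p" "fst q" "snd q"] that
          by (auto simp: D2_def prod_eq_iff)
        moreover have "interior (snd p) = {Inf (snd p)<..<Sup (snd p)}" "interior (snd q) = {Inf (snd q)<..<Sup (snd q)}"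
          using el[of "fst p" "snd p"] el[of "fst q" "snd q"] that
          by (simp_all add: D2_def)
        ultimately show ?thesis by simp
      qed
      have ne: "{Inf (snd p)<..<Sup (snd p)} \<noteq> {}" if "p \<in> D2" for p
        using that by (auto simp: D2_def)
      have inj: "inj_on \<iota> D2"
      proof (rule inj_onI, rule ccontr)
        fix p q assume pq: "p \<in> D2" "q \<in> D2" "\<iota> p = \<iota> q" "p \<noteq> q"
        then have "Inf (snd p) = Inf (snd q)" "Sup (snd p) = Sup (snd q)" by (auto simp: \<iota>_def)
        then show False using disj[OF pq(1,2,4)] ne[OF pq(1)] by auto
      qed
      have dj: "disjoint_family_on (\<lambda>(l, r). {l<..<r}) (\<iota> ` D2)"
        unfolding disjoint_family_on_def
      proof (intro ballI impI)
        fix m n assume "m \<in> \<iota> ` D2" "n \<in> \<iota> ` D2" "m \<noteq> n"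
        then obtain p q where "p \<in> D2" "q \<in> D2" "m = \<iota> p" "n = \<iota> q" "p \<noteq> q" by auto
        then show "(case m of (l, r) \<Rightarrow> {l<..<r}) \<inter> (case n of (l, r) \<Rightarrow> {l<..<r}) = {}"
          using disj[of p q] by (simp add: \<iota>_def)
      qed
      have fin2: "finite (\<iota> ` D2)" using fin by (simp add: D2_def)
      have P: "\<forall>(l, r)\<in>\<iota> ` D2. a \<le> l \<and> l \<le> r \<and> r \<le> b"
        unfolding \<iota>_def D2_def by (auto dest!: el)
      have X0: "0 \<le> (\<Sum>(l, r)\<in>\<iota> ` D2. r - l)"
        using P by (intro sum_nonneg) auto
      have "ennreal (\<Sum>(l, r)\<in>\<iota> ` D2. r - l) = (\<Sum>(l, r)\<in>\<iota> ` D2. emeasure lborel {l<..<r})"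
        using P by (subst sum_ennreal[symmetric]) (auto simp: case_prod_unfold intro!: sum.cong)
      also have "\<dots> = (\<Sum>p\<in>\<iota> ` D2. emeasure lborel ((\<lambda>(l, r). {l<..<r}) p))"
        by (simp add: case_prod_unfold)
      also have "\<dots> = emeasure lborel (\<Union>p\<in>\<iota> ` D2. (\<lambda>(l, r). {l<..<r}) p)"
        using dj fin2 by (intro sum_emeasure) auto
      also have "\<dots> \<le> emeasure lborel U"
      proof (rule emeasure_mono)
        show "(\<Union>p\<in>\<iota> ` D2. (\<lambda>(l, r). {l<..<r}) p) \<subseteq> U"
          unfolding \<iota>_def D2_def using el \<gamma>_def by fastforce
      qed (use U in auto)
      also note emU
      finally have "(\<Sum>(l, r)\<in>\<iota> ` D2. r - l) < \<delta>"
        by (simp only: ennreal_less_iff[OF X0])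
      then have s: "(\<Sum>(l, r)\<in>\<iota> ` D2. \<bar>f r - f l\<bar>) < e / 2"
        by (intro \<delta>(2) conjI fin2 P dj)
      have "\<bar>\<Sum>p\<in>D2. r p\<bar> \<le> (\<Sum>p\<in>D2. \<bar>r p\<bar>)" by (rule sum_abs)
      also have "\<dots> = (\<Sum>p\<in>D2. (\<lambda>(l, r). \<bar>f r - f l\<bar>) (\<iota> p))"
        by (intro sum.cong) (auto simp: \<iota>_def r_def g0_def D2_def abs_minus_commute)
      also have "\<dots> = (\<Sum>(l, r)\<in>\<iota> ` D2. \<bar>f r - f l\<bar>)"
        using sum.reindex[OF inj, of "\<lambda>(l, r). \<bar>f r - f l\<bar>"] by (simp add: o_def)
      finally have b2: "\<bar>\<Sum>p\<in>D2. r p\<bar> < e / 2" using s by simp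
      show ?thesis unfolding eq using b1 b2 by simp
    qed
    show "\<exists>\<gamma>. gauge \<gamma> \<and> (\<forall>\<D>. \<D> tagged_division_of cbox a b \<and> \<gamma> fine \<D> \<longrightarrow>
        norm ((\<Sum>(x, k)\<in>\<D>. measure lborel k *\<^sub>R g0 x) - (f b - f a)) < e)"
    proof (intro exI[of _ \<gamma>] conjI allI impI gauge)
      fix \<D> assume "\<D> tagged_division_of cbox a b \<and> \<gamma> fine \<D>"
      then show "norm ((\<Sum>(x, k)\<in>\<D>. measure lborel k *\<^sub>R g0 x) - (f b - f a)) < e"
        by (elim conjE) (rule est)
    qed
  qed
  then have "(g0 has_integral f b - f a) {a..b}" by simp
  then show ?thesis
    by (rule has_integral_spike[OF negN, rotated]) (auto simp: g0_def)
qed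

lemma C1_lipschitz:
  fixes G :: "real \<Rightarrow> real"
  assumes G: "\<And>x. x \<in> {c..d} \<Longrightarrow> (G has_real_derivative G' x) (at x within {c..d})" and G': "continuous_on {c..d} G'"
  shows "\<exists>L. \<forall>x\<in>{c..d}. \<forall>y\<in>{c..d}. \<bar>G x - G y\<bar> \<le> L * \<bar>x - y\<bar>"
proof -
  have "bounded (G' ` {c..d})"
    using G' by (intro compact_imp_bounded compact_continuous_image) auto
  then obtain L where L: "\<And>x. x \<in> {c..d} \<Longrightarrow> norm (G' x) \<le> L"
    unfolding bounded_iff by blast
  have "norm (G x - G y) \<le> L * norm (x - y)" if "x \<in> {c..d}" "y \<in> {c..d}" for x y
    by (rule field_differentiable_bound[of "{c..d}"]) (use G L that in auto)
  then show ?thesis by (intro exI[of _ L]) auto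
qed

text \<open>The product \<open>G t * D t\<close> is again absolutely continuous, because
  \<open>G\<close> has a continuous derivative and is therefore Lipschitz on the interval; the
  integrand is its almost everywhere derivative.\<close>

lemma ac_deriv_parts:
  assumes D: "ac_deriv c d D \<delta>" and cd: "c \<le> d"
    and G: "\<And>x. (G has_real_derivative G' x) (at x)" and G': "continuous_on UNIV G'"
  shows "((\<lambda>t. G t * \<delta> t + G' t * D t) has_integral G d * D d - G c * D c) {c..d}"
proof (rule ac_deriv_has_integral[OF _ cd, of "\<lambda>t. G t * D t"])
  obtain L where "\<forall>x\<in>{c..d}. \<forall>y\<in>{c..d}. \<bar>G x - G y\<bar> \<le> L * \<bar>x - y\<bar>"
    using C1_lipschitz[of c d G G'] G G' by (auto intro: has_field_derivative_at_within continuous_on_subset)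
  then have "abs_continuous_on c d G" by (intro lipschitz_imp_abs_continuous[of _ _ _ L]) auto
  moreover have "AE x\<in>{c..d} in lborel. (D has_real_derivative \<delta> x) (at x within {c..d})"
    using D by (simp add: ac_deriv_def)
  then have "AE x\<in>{c..d} in lborel. ((\<lambda>t. G t * D t) has_real_derivative G x * \<delta> x + G' x * D x) (at x within {c..d})"
    by eventually_elim (auto intro!: derivative_eq_intros has_field_derivative_at_within[OF G])
  ultimately show "ac_deriv c d (\<lambda>t. G t * D t) (\<lambda>t. G t * \<delta> t + G' t * D t)"
    using D by (auto simp: ac_deriv_def abs_continuous_mult)
qed

section \<open>Normalised Bernoulli polynomials\<close>

lemma bernpoly_0 [simp]: "bernpoly 0 x = 1"
  by (simp add: bernpoly_def bernoulli.simps)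

lemma bernpoly_1: "bernpoly (Suc 0) x = x - 1 / 2"
  by (simp add: bernpoly_def bernoulli.simps)

text \<open>The Appell property; the factor comes from
  \<open>(n + 1 - k) * (n + 1 choose k) = (n + 1) * (n choose k)\<close>.\<close>

lemma bernpoly_has_derivative:
  "(bernpoly (Suc n) has_real_derivative (real n + 1) * bernpoly n x) (at x)"
proof -
  have "((\<lambda>x. \<Sum>k\<le>Suc n. real (Suc n choose k) * bernoulli k * x ^ (Suc n - k)) has_real_derivative
      (\<Sum>k\<le>Suc n. real (Suc n choose k) * bernoulli k * (real (Suc n - k) * x ^ (Suc n - k - 1)))) (at x)"
    by (rule derivative_eq_intros | simp add: mult_ac)+
  also have "(\<Sum>k\<le>Suc n. real (Suc n choose k) * bernoulli k * (real (Suc n - k) * x ^ (Suc n - k - 1))) =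
      (\<Sum>k\<le>n. real (Suc n choose k) * bernoulli k * (real (Suc n - k) * x ^ (n - k)))"
    by simp
  also have "\<dots> = (\<Sum>k\<le>n. (real n + 1) * (real (n choose k) * bernoulli k * x ^ (n - k)))"
  proof (intro sum.cong refl)
    fix k assume k: "k \<in> {..n}"
    have "(Suc n - k) * (Suc n choose k) = Suc n * (n choose k)"
      using k binomial_absorb_comp[of "Suc n" k] by simp
    then have "real (Suc n - k) * real (Suc n choose k) = (real n + 1) * real (n choose k)"
      by (simp only: of_nat_mult[symmetric] of_nat_Suc[symmetric] add.commute[of _ 1])
    moreover have "real (Suc n choose k) * bernoulli k * (real (Suc n - k) * x ^ (n - k)) =
        (real (Suc n - k) * real (Suc n choose k)) * (bernoulli k * x ^ (n - k))"
      by (simp only: mult_ac)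
    ultimately show "real (Suc n choose k) * bernoulli k * (real (Suc n - k) * x ^ (n - k)) =
        (real n + 1) * (real (n choose k) * bernoulli k * x ^ (n - k))"
      by (simp only: mult.assoc)
  qed
  also have "\<dots> = (real n + 1) * bernpoly n x"
    by (simp add: bernpoly_def sum_distrib_left)
  finally show ?thesis by (simp add: bernpoly_def[abs_def])
qed

text \<open>The recursion for the Bernoulli numbers says exactly that the terms of
  \<open>bernpoly (Suc n) 1\<close> below the constant coefficient cancel, except in degree 1. This
  one jump produces every point evaluation in the proof.\<close>

lemma bernpoly_jump: "bernpoly (Suc n) 1 - bernpoly (Suc n) 0 = (if n = 0 then 1 else 0)"
proof (cases "n = 0")
  case True then show ?thesis by (simp add: bernpoly_1)
next
  case False
  have "bernpoly (Suc n) 0 = (\<Sum>k\<le>Suc n. if k = Suc n then bernoulli (Suc n) else 0)"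
    unfolding bernpoly_def by (intro sum.cong) auto
  then have 0: "bernpoly (Suc n) 0 = bernoulli (Suc n)" by simp
  have "bernpoly (Suc n) 1 = (\<Sum>k<n. real ((n + 1) choose k) * bernoulli k) + (real n + 1) * bernoulli n + bernoulli (Suc n)"
    by (simp add: bernpoly_def lessThan_Suc_atMost[symmetric])
  moreover have "(real n + 1) * bernoulli n = - (\<Sum>k<n. real ((n + 1) choose k) * bernoulli k)"
    using False by (subst bernoulli.simps) (simp add: field_simps)
  ultimately show ?thesis using 0 False by simp
qed

text \<open>Normalised so that differentiation merely lowers \<open>k\<close>. Writing
  \<open>(b - a) ^ k / (b - a)\<close> instead of a truncated exponent gives degree 0 the value
  \<open>1 / (b - a)\<close>, with which the chain of derivatives ends.\<close>

definition nbern :: "real \<Rightarrow> real \<Rightarrow> nat \<Rightarrow> real \<Rightarrow> real" where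
  "nbern a b k x = (b - a) ^ k / (b - a) * bernpoly k ((x - a) / (b - a)) / fact k"

text \<open>The \<open>(b - a)\<close>-periodic extension of \<^const>\<open>nbern\<close>, at \<open>x - t + a\<close>.\<close>

definition pbern :: "real \<Rightarrow> real \<Rightarrow> nat \<Rightarrow> real \<Rightarrow> real \<Rightarrow> real" where
  "pbern a b k x t = nbern a b k (if t \<le> x then x - t + a else x - t + b)"

lemma nbern_scaled: "a < b \<Longrightarrow> k \<ge> 1 \<Longrightarrow> scaled_bernpoly a b k x / fact k = nbern a b k x"
  by (simp add: nbern_def scaled_bernpoly_def power_diff)

lemma nbern_0 [simp]: "nbern a b 0 x = 1 / (b - a)"
  by (simp add: nbern_def)

lemma pbern_0 [simp]: "pbern a b 0 x t = 1 / (b - a)"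
  by (simp add: pbern_def)

lemma nbern_has_derivative:
  assumes "a < b" shows "(nbern a b (Suc k) has_real_derivative nbern a b k x) (at x)"
proof -
  have "((\<lambda>x. bernpoly (Suc k) ((x - a) / (b - a))) has_real_derivative
      (real k + 1) * bernpoly k ((x - a) / (b - a)) * (1 / (b - a))) (at x)"
    by (rule DERIV_chain2[OF bernpoly_has_derivative]) (use assms in \<open>auto intro!: derivative_eq_intros\<close>)
  then have "((\<lambda>x. (b - a) ^ Suc k / (b - a) * bernpoly (Suc k) ((x - a) / (b - a)) / fact (Suc k)) has_real_derivative
      (b - a) ^ Suc k / (b - a) * ((real k + 1) * bernpoly k ((x - a) / (b - a)) * (1 / (b - a))) / fact (Suc k)) (at x)"
    by (intro DERIV_cdivide DERIV_cmult)
  moreover have "(b - a) ^ Suc k / (b - a) * ((real k + 1) * bernpoly k ((x - a) / (b - a)) * (1 / (b - a))) / fact (Suc k)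
      = nbern a b k x"
  proof -
    have "c ^ Suc k / c * ((real k + 1) * B * (1 / c)) / fact (Suc k) = c ^ k / c * B / fact k" if "c \<noteq> 0" for c B :: real
    proof -
      have "c ^ Suc k / c * ((real k + 1) * B * (1 / c)) / fact (Suc k) =
          (c ^ k / c * B) * ((real k + 1) / fact (Suc k))" using that by simp
      also have "(real k + 1) / fact (Suc k) = 1 / fact k" by (simp add: add.commute)
      finally show ?thesis by simp
    qed
    then show ?thesis using assms by (simp only: nbern_def)
  qed
  moreover have "nbern a b (Suc k) = (\<lambda>x. (b - a) ^ Suc k / (b - a) * bernpoly (Suc k) ((x - a) / (b - a)) / fact (Suc k))"
    by (rule ext) (simp only: nbern_def)
  ultimately show ?thesis by (simp only:)
qed

lemma nbern_jump: "a < b \<Longrightarrow> nbern a b (Suc k) b - nbern a b (Suc k) a = (if k = 0 then 1 else 0)"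
  using bernpoly_jump[of k] by (auto simp: nbern_def divide_simps right_diff_distrib[symmetric])

lemma nbern_continuous: "a < b \<Longrightarrow> continuous_on S (nbern a b k)"
proof (cases k)
  case 0
  have "nbern a b 0 = (\<lambda>x. 1 / (b - a))" by (rule ext) simp
  then show ?thesis using 0 by simp
next
  case (Suc m)
  assume "a < b"
  then show ?thesis
    unfolding Suc using nbern_has_derivative by (intro continuous_at_imp_continuous_on ballI DERIV_isCont) auto
qed

lemma nbern_measurable [measurable]: "nbern a b k \<in> borel_measurable borel"
  unfolding nbern_def[abs_def] bernpoly_def by measurable

lemma pbern_measurable [measurable]:
  assumes [measurable]: "f \<in> borel_measurable M" "g \<in> borel_measurable M"
  shows "(\<lambda>z. pbern a b k (f z) (g z)) \<in> borel_measurable M"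
  unfolding pbern_def by measurable

lemma nbern_bounded:
  assumes "a < b"
  shows "\<exists>B>0. \<forall>x\<in>{a..b}. \<bar>nbern a b k x\<bar> \<le> B"
proof -
  have "bounded (nbern a b k ` {a..b})"
    using nbern_continuous[OF assms] by (intro compact_imp_bounded compact_continuous_image) auto
  then obtain B0 where B0: "\<And>x. x \<in> {a..b} \<Longrightarrow> norm (nbern a b k x) \<le> B0"
    unfolding bounded_iff by blast
  have "\<bar>nbern a b k x\<bar> \<le> \<bar>B0\<bar> + 1" if "x \<in> {a..b}" for x
    using B0[OF that] by simp
  then show ?thesis by (intro exI[of _ "\<bar>B0\<bar> + 1"]) auto
qed

lemma pbern_bounded:
  assumes "a < b"
  shows "\<exists>B>0. \<forall>x\<in>{a..b}. \<forall>t\<in>{a..b}. \<bar>pbern a b k x t\<bar> \<le> B"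
proof -
  obtain B where "B > 0" and B: "\<forall>x\<in>{a..b}. \<bar>nbern a b k x\<bar> \<le> B"
    using nbern_bounded[OF assms] by blast
  have "\<bar>pbern a b k x t\<bar> \<le> B" if "x \<in> {a..b}" "t \<in> {a..b}" for x t
    unfolding pbern_def using that by (intro B[rule_format]) auto
  then show ?thesis using \<open>B > 0\<close> by blast
qed

section \<open>Integrals over an interval\<close>

lemma set_integrable_bounded:
  fixes f :: "real \<Rightarrow> 'a::{banach, second_countable_topology}"
  assumes "f \<in> borel_measurable borel" "\<And>x. x \<in> {a..b} \<Longrightarrow> norm (f x) \<le> B"
  shows "set_integrable lborel {a..b} f"
  unfolding set_integrable_def
  using assms by (intro integrableI_bounded_set_indicator[where B=B]) (auto simp: emeasure_lborel_Icc_eq)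

lemma set_integrable_bounded_mult:
  fixes f :: "real \<Rightarrow> real" and g :: "real \<Rightarrow> real"
  assumes "set_integrable lborel {a..b} g" "f \<in> borel_measurable borel" "\<And>x. x \<in> {a..b} \<Longrightarrow> \<bar>f x\<bar> \<le> B"
  shows "set_integrable lborel {a..b} (\<lambda>x. f x * g x)"
  unfolding set_integrable_def
proof (rule Bochner_Integration.integrable_bound)
  have g: "integrable lborel (\<lambda>x. indicat_real {a..b} x *\<^sub>R g x)"
    using assms(1) by (simp add: set_integrable_def)
  then show "integrable lborel (\<lambda>x. B * (indicat_real {a..b} x *\<^sub>R g x))" by simp
  have "(\<lambda>x. f x * (indicat_real {a..b} x *\<^sub>R g x)) \<in> borel_measurable lborel"
    using assms(2) borel_measurable_integrable[OF g] by simp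
  then show "(\<lambda>x. indicat_real {a..b} x *\<^sub>R (f x * g x)) \<in> borel_measurable lborel"
    by (simp add: ac_simps)
  show "AE x in lborel. norm (indicat_real {a..b} x *\<^sub>R (f x * g x)) \<le> norm (B * (indicat_real {a..b} x *\<^sub>R g x))"
  proof (intro AE_I2)
    fix x
    show "norm (indicat_real {a..b} x *\<^sub>R (f x * g x)) \<le> norm (B * (indicat_real {a..b} x *\<^sub>R g x))"
    proof (cases "x \<in> {a..b}")
      case True
      then have "\<bar>f x\<bar> \<le> \<bar>B\<bar>" using assms(3)[OF True] by simp
      then show ?thesis using True by (simp add: abs_mult mult_right_mono)
    qed simp
  qed
qed

lemma LBINT_eq_has_integral:
  fixes f :: "real \<Rightarrow> 'a::euclidean_space"
  assumes "set_integrable lborel S f" "(f has_integral y) S"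
  shows "(LINT x:S|lborel. f x) = y"
  using set_borel_integral_eq_integral[OF assms(1)] assms(2) by (simp add: integral_unique)

text \<open>The interval is split at the break \<open>t\<close>, on both sides of which the
  antiderivative is a shifted \<open>nbern\<close>. The terms at \<open>a\<close> and
  \<open>b\<close> cancel by periodicity of \<open>\<psi>\<close>, and those at \<open>t\<close>
  leave the jump of \<open>nbern\<close>, which is nonzero in degree 1 only.\<close>

lemma pbern_parts_left:
  fixes \<psi> :: "real \<Rightarrow> 'a::euclidean_space"
  assumes ab: "a < b" and \<psi>: "\<And>x. x \<in> {a..b} \<Longrightarrow> (\<psi> has_vector_derivative \<psi>' x) (at x within {a..b})"
    and per: "\<psi> a = \<psi> b" and t: "t \<in> {a..b}"
  shows "((\<lambda>x. pbern a b (Suc m) x t *\<^sub>R \<psi>' x + pbern a b m x t *\<^sub>R \<psi> x) has_integral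
      (if m = 0 then \<psi> t else 0)) {a..b}"
proof -
  have part: "((\<lambda>x. nbern a b (Suc m) (x + c) *\<^sub>R \<psi>' x + nbern a b m (x + c) *\<^sub>R \<psi> x) has_integral
      (nbern a b (Suc m) (v + c) *\<^sub>R \<psi> v - nbern a b (Suc m) (u + c) *\<^sub>R \<psi> u)) {u..v}"
    if "a \<le> u" "u \<le> v" "v \<le> b" for c u v
  proof (rule fundamental_theorem_of_calculus)
    fix x assume x: "x \<in> {u..v}"
    have "((\<lambda>x. nbern a b (Suc m) (x + c)) has_real_derivative nbern a b m (x + c)) (at x within {u..v})"
      using nbern_has_derivative[OF ab, of m "x + c"] by (simp add: DERIV_shift has_field_derivative_at_within)
    moreover have "(\<psi> has_vector_derivative \<psi>' x) (at x within {u..v})"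
      using \<psi>[of x] x that by (auto intro: has_vector_derivative_within_subset[where S="{a..b}"])
    ultimately show "((\<lambda>x. nbern a b (Suc m) (x + c) *\<^sub>R \<psi> x) has_vector_derivative
        nbern a b (Suc m) (x + c) *\<^sub>R \<psi>' x + nbern a b m (x + c) *\<^sub>R \<psi> x) (at x within {u..v})"
      by (rule has_vector_derivative_scaleR)
  qed (use that in auto)
  have 1: "((\<lambda>x. pbern a b (Suc m) x t *\<^sub>R \<psi>' x + pbern a b m x t *\<^sub>R \<psi> x) has_integral
      (nbern a b (Suc m) (t + (b - t)) *\<^sub>R \<psi> t - nbern a b (Suc m) (a + (b - t)) *\<^sub>R \<psi> a)) {a..t}"
    by (rule has_integral_spike_finite[OF _ _ part[of a t "b - t"], of "{t}"])
      (use t in \<open>auto simp: pbern_def algebra_simps\<close>)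
  have 2: "((\<lambda>x. pbern a b (Suc m) x t *\<^sub>R \<psi>' x + pbern a b m x t *\<^sub>R \<psi> x) has_integral
      (nbern a b (Suc m) (b + (a - t)) *\<^sub>R \<psi> b - nbern a b (Suc m) (t + (a - t)) *\<^sub>R \<psi> t)) {t..b}"
    by (rule has_integral_spike_finite[OF _ _ part[of t b "a - t"], of "{}"])
      (use t in \<open>auto simp: pbern_def algebra_simps\<close>)
  have "(nbern a b (Suc m) b *\<^sub>R \<psi> t - nbern a b (Suc m) (a + (b - t)) *\<^sub>R \<psi> a) +
      (nbern a b (Suc m) (b + (a - t)) *\<^sub>R \<psi> b - nbern a b (Suc m) a *\<^sub>R \<psi> t) =
      (nbern a b (Suc m) b - nbern a b (Suc m) a) *\<^sub>R \<psi> t"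
    by (simp add: per algebra_simps)
  also have "\<dots> = (if m = 0 then \<psi> t else 0)"
    unfolding nbern_jump[OF ab] by simp
  finally show ?thesis
    using has_integral_combine[OF _ _ 1 2] t by simp
qed

text \<open>Split at \<open>t = x\<close> as before. Here \<open>D\<close> need not be periodic, so
  the end points leave a term with \<open>D b - D a\<close>; it becomes the polynomial part of the
  representation formula.\<close>

lemma pbern_parts_right:
  assumes ab: "a < b" and D: "ac_deriv a b D \<delta>" and x: "x \<in> {a..b}"
  shows "((\<lambda>t. pbern a b (Suc m) x t * \<delta> t - pbern a b m x t * D t) has_integral
      nbern a b (Suc m) x * (D b - D a) - (if m = 0 then D x else 0)) {a..b}"
proof -
  have part: "((\<lambda>t. nbern a b (Suc m) (c - t) * \<delta> t + (- nbern a b m (c - t)) * D t) has_integral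
      (nbern a b (Suc m) (c - v) * D v - nbern a b (Suc m) (c - u) * D u)) {u..v}"
    if "a \<le> u" "u \<le> v" "v \<le> b" for c u v
  proof (rule ac_deriv_parts[where G="\<lambda>t. nbern a b (Suc m) (c - t)" and G'="\<lambda>t. - nbern a b m (c - t)"])
    show "ac_deriv u v D \<delta>" by (rule ac_deriv_subset[OF D that(1,3)])
    show "((\<lambda>t. nbern a b (Suc m) (c - t)) has_real_derivative - nbern a b m (c - t)) (at t)" for t
    proof -
      have "((\<lambda>t. c - t) has_real_derivative -1) (at t)"
        by (auto intro!: derivative_eq_intros)
      from DERIV_chain2[where f="nbern a b (Suc m)" and g="\<lambda>t. c - t", OF nbern_has_derivative[OF ab] this]
      show ?thesis by simp
    qed
    show "continuous_on UNIV (\<lambda>t. - nbern a b m (c - t))"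
      by (intro continuous_intros continuous_on_compose2[OF nbern_continuous[OF ab, of UNIV]]) auto
  qed (use that in auto)
  have 1: "((\<lambda>t. pbern a b (Suc m) x t * \<delta> t - pbern a b m x t * D t) has_integral
      (nbern a b (Suc m) (x + a - x) * D x - nbern a b (Suc m) (x + a - a) * D a)) {a..x}"
    by (rule has_integral_spike_finite[OF _ _ part[of a x "x + a"], of "{}"])
      (use x in \<open>auto simp: pbern_def algebra_simps\<close>)
  have 2: "((\<lambda>t. pbern a b (Suc m) x t * \<delta> t - pbern a b m x t * D t) has_integral
      (nbern a b (Suc m) (x + b - b) * D b - nbern a b (Suc m) (x + b - x) * D x)) {x..b}"
    by (rule has_integral_spike_finite[OF _ _ part[of x b "x + b"], of "{x}"])
      (use x in \<open>auto simp: pbern_def algebra_simps\<close>)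
  have "(nbern a b (Suc m) a * D x - nbern a b (Suc m) x * D a) +
      (nbern a b (Suc m) x * D b - nbern a b (Suc m) b * D x) =
      nbern a b (Suc m) x * (D b - D a) - (nbern a b (Suc m) b - nbern a b (Suc m) a) * D x"
    by (simp add: algebra_simps)
  also have "\<dots> = nbern a b (Suc m) x * (D b - D a) - (if m = 0 then D x else 0)"
    unfolding nbern_jump[OF ab] by simp
  finally show ?thesis
    using has_integral_combine[OF _ _ 1 2] x by simp
qed

lemma ac_deriv_const: "ac_deriv a b (\<lambda>_. c) (\<lambda>_. 0)"
  unfolding ac_deriv_def by (auto intro!: lipschitz_imp_abs_continuous[of _ _ _ 0])

lemma pbern_integrable:
  assumes "a < b"
  shows "t \<in> {a..b} \<Longrightarrow> set_integrable lborel {a..b} (\<lambda>x. pbern a b k x t)"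
    and "x \<in> {a..b} \<Longrightarrow> set_integrable lborel {a..b} (\<lambda>t. pbern a b k x t)"
proof -
  obtain B where B: "\<And>x t. x \<in> {a..b} \<Longrightarrow> t \<in> {a..b} \<Longrightarrow> \<bar>pbern a b k x t\<bar> \<le> B"
    using pbern_bounded[OF assms] by blast
  show "t \<in> {a..b} \<Longrightarrow> set_integrable lborel {a..b} (\<lambda>x. pbern a b k x t)"
    by (rule set_integrable_bounded[where B=B]) (auto intro: B)
  show "x \<in> {a..b} \<Longrightarrow> set_integrable lborel {a..b} (\<lambda>t. pbern a b k x t)"
    by (rule set_integrable_bounded[where B=B]) (auto intro: B)
qed

text \<open>Integration by parts against the constant 1: its derivative vanishes, and from degree 1
  on the jump is not met.\<close>

lemma pbern_integral_left:
  assumes "a < b" "t \<in> {a..b}" "m \<ge> 1"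
  shows "(LINT x:{a..b}|lborel. pbern a b m x t) = 0"
  using pbern_parts_left[OF assms(1), of "\<lambda>_. 1" "\<lambda>_. 0 :: real" t m] assms pbern_integrable(1)[of a b t m]
  by (intro LBINT_eq_has_integral) auto

lemma pbern_integral_right:
  assumes "a < b" "x \<in> {a..b}" "m \<ge> 1"
  shows "(LINT t:{a..b}|lborel. pbern a b m x t) = 0"
proof (rule LBINT_eq_has_integral[OF pbern_integrable(2)[OF assms(1,2)]])
  show "(pbern a b m x has_integral 0) {a..b}"
    using has_integral_neg[OF pbern_parts_right[OF assms(1) ac_deriv_const[of _ _ 1] assms(2), of m]] assms(3)
    by simp
qed

lemma nbern_integrable: "a < b \<Longrightarrow> set_integrable lborel {a..b} (nbern a b k)"
  using nbern_continuous by (intro borel_integrable_atLeastAtMost') 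

lemma nbern_integral:
  assumes "a < b" shows "(LINT x:{a..b}|lborel. nbern a b m x) = (if m = 0 then 1 else 0)"
proof (rule LBINT_eq_has_integral[OF nbern_integrable[OF assms]])
  have "(nbern a b m has_integral nbern a b (Suc m) b - nbern a b (Suc m) a) {a..b}"
    using assms nbern_has_derivative[OF assms]
    by (intro fundamental_theorem_of_calculus)
      (auto intro: has_field_derivative_at_within simp: has_real_derivative_iff_has_vector_derivative[symmetric])
  then show "(nbern a b m has_integral (if m = 0 then 1 else 0)) {a..b}"
    unfolding nbern_jump[OF assms] .
qed

section \<open>Functions of the one-dimensional Sobolev space\<close>

lemma sob1_jet_ac:
  assumes "sob1_jet \<alpha> a b f D" "k < \<alpha>"
  shows "ac_deriv a b (D k) (D (Suc k))"
proof (cases "Suc k = \<alpha>")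
  case True
  then show ?thesis using assms by (auto simp: sob1_jet_def ac_deriv_def)
next
  case False
  then show ?thesis using assms by (auto simp: sob1_jet_def ac_deriv_def intro!: AE_I2)
qed

lemma set_integrable_of_square:
  fixes f :: "real \<Rightarrow> real"
  assumes "set_borel_measurable lborel {a..b} f" "set_integrable lborel {a..b} (\<lambda>x. (f x)\<^sup>2)"
  shows "set_integrable lborel {a..b} f"
  unfolding set_integrable_def
proof (rule Bochner_Integration.integrable_bound)
  have "set_integrable lborel {a..b} (\<lambda>x. 1 :: real)"
    by (rule set_integrable_bounded[of _ _ _ 1]) auto
  then show "integrable lborel (\<lambda>x. indicat_real {a..b} x *\<^sub>R 1 + indicat_real {a..b} x *\<^sub>R (f x)\<^sup>2)"
    using assms(2) by (auto simp: set_integrable_def)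
  show "(\<lambda>x. indicat_real {a..b} x *\<^sub>R f x) \<in> borel_measurable lborel"
    using assms(1) by (simp add: set_borel_measurable_def)
  have "\<bar>y\<bar> \<le> 1 + y\<^sup>2" for y :: real
    using zero_le_power2[of "\<bar>y\<bar> - 1"] unfolding power2_diff by (simp; linarith)
  then show "AE x in lborel. norm (indicat_real {a..b} x *\<^sub>R f x)
      \<le> norm (indicat_real {a..b} x *\<^sub>R 1 + indicat_real {a..b} x *\<^sub>R (f x)\<^sup>2)"
    by (auto simp: indicator_def)
qed

lemma sob1_jet_integrable:
  assumes "sob1_jet \<alpha> a b f D" "k \<le> \<alpha>"
  shows "set_integrable lborel {a..b} (D k)"
proof (cases "k < \<alpha>")
  case True
  then have "continuous_on {a..b} (D k)"
    using assms by (auto simp: sob1_jet_def intro: abs_continuous_imp_continuous_on)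
  then show ?thesis by (rule borel_integrable_atLeastAtMost')
next
  case False
  then show ?thesis using assms by (auto simp: sob1_jet_def intro: set_integrable_of_square)
qed

text \<open>An Euler-Maclaurin expansion, by induction on \<open>m\<close>: the mean of
  \<open>D m\<close> is split off with the coefficient \<open>nbern a b m x\<close>, and what is
  left is integrated by parts to give the remainder of the next order.\<close>

theorem sob1_representation:
  assumes ab: "a < b" and jet: "sob1_jet \<alpha> a b f D" and x: "x \<in> {a..b}"
    and m: "1 \<le> m" "m \<le> \<alpha>"
  shows "f x = (\<Sum>i<m. nbern a b i x * (LINT t:{a..b}|lborel. D i t)) +
    (LINT t:{a..b}|lborel. (nbern a b m x - pbern a b m x t) * D m t)"
proof -
  have int: "set_integrable lborel {a..b} (\<lambda>t. pbern a b k x t * D l t)" if "l \<le> \<alpha>" for k l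
  proof -
    obtain B where B: "\<And>x t. x \<in> {a..b} \<Longrightarrow> t \<in> {a..b} \<Longrightarrow> \<bar>pbern a b k x t\<bar> \<le> B"
      using pbern_bounded[OF ab] by blast
    show ?thesis
      by (rule set_integrable_bounded_mult[OF sob1_jet_integrable[OF jet that], where B=B]) (auto intro: B x)
  qed
  \<comment> \<open>The boundary term of \<open>pbern_parts_right\<close> is
    \<open>nbern a b (Suc k) x\<close> times the integral of \<open>D (Suc k)\<close>, so it merges
    into the kernel.\<close>
  have step: "(LINT t:{a..b}|lborel. (nbern a b (Suc k) x - pbern a b (Suc k) x t) * D (Suc k) t) =
      (if k = 0 then D 0 x else 0) - (LINT t:{a..b}|lborel. pbern a b k x t * D k t)" if k: "k < \<alpha>" for k
  proof -
    note ac = sob1_jet_ac[OF jet k]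
    have "(LINT t:{a..b}|lborel. pbern a b (Suc k) x t * D (Suc k) t - pbern a b k x t * D k t) =
        nbern a b (Suc k) x * (D k b - D k a) - (if k = 0 then D k x else 0)"
      using k by (intro LBINT_eq_has_integral pbern_parts_right[OF ab ac x] set_integral_diff int) auto
    then have 1: "(LINT t:{a..b}|lborel. pbern a b (Suc k) x t * D (Suc k) t) =
        (LINT t:{a..b}|lborel. pbern a b k x t * D k t) + nbern a b (Suc k) x * (D k b - D k a) - (if k = 0 then D k x else 0)"
      using k by (subst (asm) set_integral_diff) (auto intro: int)
    have 2: "(LINT t:{a..b}|lborel. D (Suc k) t) = D k b - D k a"
      using k ab by (intro LBINT_eq_has_integral ac_deriv_has_integral[OF ac] sob1_jet_integrable[OF jet]) auto
    have "(LINT t:{a..b}|lborel. (nbern a b (Suc k) x - pbern a b (Suc k) x t) * D (Suc k) t) =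
        (LINT t:{a..b}|lborel. nbern a b (Suc k) x * D (Suc k) t - pbern a b (Suc k) x t * D (Suc k) t)"
      by (simp add: left_diff_distrib)
    also have "\<dots> = nbern a b (Suc k) x * (LINT t:{a..b}|lborel. D (Suc k) t) - (LINT t:{a..b}|lborel. pbern a b (Suc k) x t * D (Suc k) t)"
      using k by (subst set_integral_diff) (auto intro!: int sob1_jet_integrable[OF jet])
    finally show ?thesis unfolding 1 2 by auto
  qed
  have D0: "D 0 x = f x" using jet x by (simp add: sob1_jet_def)
  show ?thesis using m
  proof (induction m rule: nat_induct_at_least)
    case base
    then show ?case using step[of 0] D0 by simp
  next
    case (Suc m)
    have "(LINT t:{a..b}|lborel. (nbern a b m x - pbern a b m x t) * D m t) =
        (LINT t:{a..b}|lborel. nbern a b m x * D m t - pbern a b m x t * D m t)"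
      by (simp add: left_diff_distrib)
    also have "\<dots> = nbern a b m x * (LINT t:{a..b}|lborel. D m t) - (LINT t:{a..b}|lborel. pbern a b m x t * D m t)"
      using Suc by (subst set_integral_diff) (auto intro!: int sob1_jet_integrable[OF jet])
    finally show ?case using Suc step[of m] by simp
  qed
qed

section \<open>The measure carrying the data of a Sobolev function\<close>

definition leb :: "real \<Rightarrow> real \<Rightarrow> real measure" where
  "leb a b = density lborel (\<lambda>x. ennreal (indicator {a..b} x))"

lemma sets_leb [simp, measurable_cong]: "sets (leb a b) = sets borel"
  by (simp add: leb_def)

lemma leb_integral:
  fixes f :: "real \<Rightarrow> 'a::{banach, second_countable_topology}"
  assumes "f \<in> borel_measurable borel"
  shows "integrable (leb a b) f \<longleftrightarrow> set_integrable lborel {a..b} f"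
    and "integral\<^sup>L (leb a b) f = (LINT x:{a..b}|lborel. f x)"
  using assms
  by (auto simp: leb_def integrable_density integral_density set_integrable_def set_lebesgue_integral_def)

lemma leb_bounded_integrable:
  fixes f :: "real \<Rightarrow> 'a::{banach, second_countable_topology}"
  assumes "f \<in> borel_measurable borel" "\<And>x. x \<in> {a..b} \<Longrightarrow> norm (f x) \<le> B"
  shows "integrable (leb a b) f"
  using set_integrable_bounded[of f a b B] assms leb_integral(1) by blast

text \<open>
  Lebesgue measure on \<open>[a, b]\<close> plus a unit atom at each \<open>b + 1 + k\<close>, \<open>k < \<alpha>\<close>. A function of the
  one-dimensional space is encoded isometrically by its derivative of order \<open>\<alpha>\<close> on \<open>[a, b]\<close> and by the
  integral of its derivative of order \<open>k\<close> at the atom \<open>b + 1 + k\<close>.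
\<close>

definition data_measure :: "nat \<Rightarrow> real \<Rightarrow> real \<Rightarrow> real measure" where
  "data_measure \<alpha> a b = distr (leb a (b + real \<alpha>)) borel (\<lambda>x. if x \<le> b then x else b + of_int \<lceil>x - b\<rceil>)"

lemma sets_data_measure [simp, measurable_cong]: "sets (data_measure \<alpha> a b) = sets borel"
  by (simp add: data_measure_def)

lemma space_data_measure [simp]: "space (data_measure \<alpha> a b) = UNIV"
  by (simp add: data_measure_def)

text \<open>Each unit interval to the right of \<open>b\<close> is squeezed to its right end point.
  Having length 1 it yields an atom of mass 1, and the data measure is finite as the image of a
  finite measure.\<close>

lemma collapse_const:
  fixes b :: real
  assumes "x \<in> {b + real n<..b + real (Suc n)}"
  shows "(if x \<le> b then x else b + of_int \<lceil>x - b\<rceil>) = b + 1 + real n"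
proof -
  have "\<lceil>x - b\<rceil> = int n + 1" using assms by (intro ceiling_unique) auto
  then show ?thesis using assms by auto
qed

text \<open>Induction on the number of unit intervals appended to \<open>{a..b}\<close>; on each of
  them the collapsed integrand is constant.\<close>

lemma data_measure_nn_integral:
  assumes ab: "a \<le> b" and h[measurable]: "h \<in> borel_measurable borel"
  shows "(\<integral>\<^sup>+t. h t \<partial>data_measure \<alpha> a b) = (\<integral>\<^sup>+t. h t \<partial>leb a b) + (\<Sum>k<\<alpha>. h (b + 1 + real k))"
proof -
  define c where "c x = (if x \<le> b then x else b + of_int \<lceil>x - b\<rceil>)" for x
  have c[measurable]: "c \<in> borel_measurable borel" unfolding c_def by measurable
  have leb: "(\<integral>\<^sup>+x. g x \<partial>leb u v) = (\<integral>\<^sup>+x. indicator {u..v} x * g x \<partial>lborel)"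
    if [measurable]: "g \<in> borel_measurable borel" for g :: "real \<Rightarrow> ennreal" and u v
    unfolding leb_def by (subst nn_integral_density) (auto simp: ennreal_indicator)
  have "(\<integral>\<^sup>+x. indicator {a..b + real n} x * h (c x) \<partial>lborel) =
      (\<integral>\<^sup>+x. indicator {a..b} x * h x \<partial>lborel) + (\<Sum>k<n. h (b + 1 + real k))" for n
  proof (induction n)
    case 0
    show ?case by (auto intro!: nn_integral_cong simp: c_def indicator_def)
  next
    case (Suc n)
    have "(\<integral>\<^sup>+x. indicator {a..b + real (Suc n)} x * h (c x) \<partial>lborel) =
        (\<integral>\<^sup>+x. indicator {a..b + real n} x * h (c x) + indicator {b + real n<..b + real (Suc n)} x * h (b + 1 + real n) \<partial>lborel)"
    proof (intro nn_integral_cong)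
      fix x
      show "indicator {a..b + real (Suc n)} x * h (c x) =
        indicator {a..b + real n} x * h (c x) + indicator {b + real n<..b + real (Suc n)} x * h (b + 1 + real n)"
      proof -
        have "indicator {a..b + real (Suc n)} x = (indicator {a..b + real n} x + indicator {b + real n<..b + real (Suc n)} x :: ennreal)"
          using ab by (auto simp: indicator_def)
        moreover have "indicator {b + real n<..b + real (Suc n)} x * h (c x) = indicator {b + real n<..b + real (Suc n)} x * h (b + 1 + real n)"
        proof (cases "x \<in> {b + real n<..b + real (Suc n)}")
          case True
          then show ?thesis using collapse_const[OF True] by (simp only: c_def)
        qed simp
        ultimately show ?thesis by (simp only: distrib_right)
      qed
    qed
    also have "\<dots> = (\<integral>\<^sup>+x. indicator {a..b + real n} x * h (c x) \<partial>lborel) +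
        (\<integral>\<^sup>+x. indicator {b + real n<..b + real (Suc n)} x * h (b + 1 + real n) \<partial>lborel)"
      by (intro nn_integral_add) auto
    also have "(\<integral>\<^sup>+x. indicator {b + real n<..b + real (Suc n)} x * h (b + 1 + real n) \<partial>lborel) = h (b + 1 + real n)"
      by (simp add: nn_integral_multc)
    finally show ?case using Suc by (simp add: add.assoc)
  qed
  then show ?thesis
    unfolding data_measure_def c_def[symmetric] by (subst nn_integral_distr) (auto simp: leb)
qed

lemma data_measure_integral:
  fixes f :: "real \<Rightarrow> 'a::{banach, second_countable_topology}"
  assumes ab: "a \<le> b" and f[measurable]: "f \<in> borel_measurable borel" and int: "set_integrable lborel {a..b} f"
  shows "integrable (data_measure \<alpha> a b) f"
    and "integral\<^sup>L (data_measure \<alpha> a b) f = (LINT t:{a..b}|lborel. f t) + (\<Sum>k<\<alpha>. f (b + 1 + real k))"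
proof -
  define c where "c x = (if x \<le> b then x else b + of_int \<lceil>x - b\<rceil>)" for x
  have c[measurable]: "c \<in> borel_measurable borel" unfolding c_def by measurable
  have fc: "(\<lambda>x. f (c x)) \<in> borel_measurable borel" by measurable
  have *: "set_integrable lborel {a..b + real n} (\<lambda>x. f (c x)) \<and>
      (LINT x:{a..b + real n}|lborel. f (c x)) = (LINT x:{a..b}|lborel. f x) + (\<Sum>k<n. f (b + 1 + real k))" for n
  proof (induction n)
    case 0
    have "set_integrable lborel {a..b} (\<lambda>x. f (c x)) = set_integrable lborel {a..b} f"
      by (intro set_integrable_cong) (auto simp: c_def)
    moreover have "(LINT x:{a..b}|lborel. f (c x)) = (LINT x:{a..b}|lborel. f x)"
      by (intro set_lebesgue_integral_cong) (auto simp: c_def)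
    ultimately show ?case using int by simp
  next
    case (Suc n)
    let ?I = "{b + real n<..b + real (Suc n)}"
    have eq: "{a..b + real (Suc n)} = {a..b + real n} \<union> ?I" using ab by auto
    have cI: "f (c x) = f (b + 1 + real n)" if "x \<in> ?I" for x
      using collapse_const[OF that] by (simp only: c_def)
    have "set_integrable lborel ?I (\<lambda>x. f (c x)) = set_integrable lborel ?I (\<lambda>x. f (b + 1 + real n))"
      by (intro set_integrable_cong refl cI)
    then have i2: "set_integrable lborel ?I (\<lambda>x. f (c x))"
      by (simp add: set_integrable_def)
    have "(LINT x:?I|lborel. f (c x)) = (LINT x:?I|lborel. f (b + 1 + real n))"
      by (intro set_lebesgue_integral_cong) (use cI in auto)
    also have "\<dots> = f (b + 1 + real n)"
      by (simp add: set_lebesgue_integral_def)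
    finally have v2: "(LINT x:?I|lborel. f (c x)) = f (b + 1 + real n)" .
    show ?case unfolding eq using Suc i2 v2
      by (subst set_integral_Un) (auto intro: set_integrable_Un simp: add.assoc)
  qed
  show "integrable (data_measure \<alpha> a b) f"
    unfolding data_measure_def c_def[symmetric]
    using *[of \<alpha>] leb_integral(1)[OF fc] by (subst integrable_distr_eq) auto
  show "integral\<^sup>L (data_measure \<alpha> a b) f = (LINT t:{a..b}|lborel. f t) + (\<Sum>k<\<alpha>. f (b + 1 + real k))"
    unfolding data_measure_def c_def[symmetric]
    using *[of \<alpha>] leb_integral(2)[OF fc] by (subst integral_distr) auto
qed

definition data_supp :: "nat \<Rightarrow> real \<Rightarrow> real \<Rightarrow> real set" where
  "data_supp \<alpha> a b = {a..b} \<union> (\<lambda>k. b + 1 + real k) ` {..<\<alpha>}"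

lemma data_supp_borel [measurable]: "data_supp \<alpha> a b \<in> sets borel"
  unfolding data_supp_def by (intro sets.Un) (auto intro!: borel_closed finite_imp_closed)

lemma AE_data_supp:
  assumes "a \<le> b" shows "AE t in data_measure \<alpha> a b. t \<in> data_supp \<alpha> a b"
proof (rule AE_I)
  show "{t \<in> space (data_measure \<alpha> a b). t \<notin> data_supp \<alpha> a b} \<subseteq> - data_supp \<alpha> a b" by auto
  have "emeasure (data_measure \<alpha> a b) (- data_supp \<alpha> a b) = (\<integral>\<^sup>+t. indicator (- data_supp \<alpha> a b) t \<partial>data_measure \<alpha> a b)"
    by (subst nn_integral_indicator) auto
  also have "\<dots> = (\<integral>\<^sup>+t. indicator (- data_supp \<alpha> a b) t \<partial>leb a b)"
    by (subst data_measure_nn_integral[OF assms], measurable) (simp add: data_supp_def)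
  also have "\<dots> = (\<integral>\<^sup>+t. ennreal (indicator {a..b} t) * indicator (- data_supp \<alpha> a b) t \<partial>lborel)"
    unfolding leb_def by (subst nn_integral_density) auto
  also have "\<dots> = (\<integral>\<^sup>+t. 0 \<partial>(lborel :: real measure))"
    by (intro nn_integral_cong) (auto simp: data_supp_def indicator_def)
  finally show "emeasure (data_measure \<alpha> a b) (- data_supp \<alpha> a b) = 0" by simp
qed auto

text \<open>No atom lies in \<open>{a..b}\<close>, so the restriction removes them all. Lebesgue
  integrals over a side of the box can thus be written over the data measure, with an
  indicator.\<close>

lemma leb_density_data:
  assumes "a \<le> b" shows "leb a b = density (data_measure \<alpha> a b) (\<lambda>x. ennreal (indicator {a..b} x))"
proof (rule measure_eqI)
  fix A assume "A \<in> sets (leb a b)"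
  then have [measurable]: "A \<in> sets borel" by simp
  have "emeasure (density (data_measure \<alpha> a b) (\<lambda>x. ennreal (indicator {a..b} x))) A =
      (\<integral>\<^sup>+x. ennreal (indicator {a..b} x) * indicator A x \<partial>data_measure \<alpha> a b)"
    by (subst emeasure_density) auto
  also have "\<dots> = (\<integral>\<^sup>+x. ennreal (indicator {a..b} x) * indicator A x \<partial>leb a b)"
    using assms by (subst data_measure_nn_integral) auto
  also have "\<dots> = (\<integral>\<^sup>+x. ennreal (indicator {a..b} x) * (ennreal (indicator {a..b} x) * indicator A x) \<partial>lborel)"
    unfolding leb_def by (subst nn_integral_density) auto
  also have "\<dots> = (\<integral>\<^sup>+x. ennreal (indicator {a..b} x) * indicator A x \<partial>lborel)"
    by (intro nn_integral_cong) (auto simp: indicator_def)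
  also have "\<dots> = emeasure (leb a b) A" unfolding leb_def by (subst emeasure_density) auto
  finally show "emeasure (leb a b) A = emeasure (density (data_measure \<alpha> a b) (\<lambda>x. ennreal (indicator {a..b} x))) A" ..
qed simp

lemma finite_leb: "finite_measure (leb a b)"
proof
  show "emeasure (leb a b) (space (leb a b)) \<noteq> \<infinity>"
    by (cases "a \<le> b") (simp_all add: leb_def emeasure_density ennreal_indicator)
qed

lemma finite_data_measure: "finite_measure (data_measure \<alpha> a b)"
proof -
  interpret finite_measure "leb a (b + real \<alpha>)" by (rule finite_leb)
  show ?thesis unfolding data_measure_def by (rule finite_measure_distr) simp
qed

section \<open>The kernels of the representation and of the projection\<close>

text \<open>The derivative of order \<open>k\<close> in \<open>x\<close> of the kernel in
  \<open>sob1_representation\<close>: the remainder kernel on the interval and, at the atom of order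
  \<open>i\<close>, the polynomial that multiplies the integral of the derivative of order
  \<open>i\<close>. At \<open>k = \<alpha>\<close> it vanishes, since degree 0 cancels on the
  interval and no atom is left.\<close>

definition sob_ker :: "nat \<Rightarrow> real \<Rightarrow> real \<Rightarrow> nat \<Rightarrow> real \<Rightarrow> real \<Rightarrow> real" where
  "sob_ker \<alpha> a b k x t = (if t \<in> {a..b} then nbern a b (\<alpha> - k) x - pbern a b (\<alpha> - k) x t
     else (\<Sum>i\<in>{k..<\<alpha>}. if t = b + 1 + real i then nbern a b (i - k) x else 0))"

text \<open>What remains of \<open>sob_ker \<alpha> a b 0\<close> after the polynomial corrections:
  the mean value at the first atom and the periodic term on the interval.\<close>

definition proj_ker :: "nat \<Rightarrow> real \<Rightarrow> real \<Rightarrow> real \<Rightarrow> real \<Rightarrow> real" where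
  "proj_ker \<alpha> a b x t = (if t \<in> {a..b} then - pbern a b \<alpha> x t else if t = b + 1 then 1 / (b - a) else 0)"

text \<open>Pairing with \<open>data_ind \<alpha> a b k\<close> gives the integral of the derivative of order \<open>k\<close>, also for \<open>k = \<alpha>\<close>.\<close>

definition data_ind :: "nat \<Rightarrow> real \<Rightarrow> real \<Rightarrow> nat \<Rightarrow> real \<Rightarrow> real" where
  "data_ind \<alpha> a b k t = (if k = \<alpha> then indicator {a..b} t else indicator {b + 1 + real k} t)"

lemma sob_ker_interval: "t \<in> {a..b} \<Longrightarrow> sob_ker \<alpha> a b k x t = nbern a b (\<alpha> - k) x - pbern a b (\<alpha> - k) x t"
  by (simp add: sob_ker_def)

lemma sob_ker_atom:
  "i < \<alpha> \<Longrightarrow> sob_ker \<alpha> a b k x (b + 1 + real i) = (if k \<le> i then nbern a b (i - k) x else 0)"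
  by (simp add: sob_ker_def)

lemma sob_ker_measurable [measurable]:
  assumes [measurable]: "f \<in> borel_measurable M" "g \<in> borel_measurable M"
  shows "(\<lambda>z. sob_ker \<alpha> a b k (f z) (g z)) \<in> borel_measurable M"
  unfolding sob_ker_def by measurable

lemma proj_ker_measurable [measurable]:
  assumes [measurable]: "f \<in> borel_measurable M" "g \<in> borel_measurable M"
  shows "(\<lambda>z. proj_ker \<alpha> a b (f z) (g z)) \<in> borel_measurable M"
  unfolding proj_ker_def by measurable

lemma data_ind_measurable [measurable]: "data_ind \<alpha> a b k \<in> borel_measurable borel"
  unfolding data_ind_def[abs_def] by measurable

lemma sob_ker_bounded:
  assumes ab: "a < b"
  shows "\<exists>B>0. \<forall>k\<le>\<alpha>. \<forall>x\<in>{a..b}. \<forall>t. \<bar>sob_ker \<alpha> a b k x t\<bar> \<le> B"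
proof -
  obtain B1 where B1: "\<And>k. B1 k > 0" "\<And>k x. x \<in> {a..b} \<Longrightarrow> \<bar>nbern a b k x\<bar> \<le> B1 k"
    using nbern_bounded[OF ab] by metis
  obtain B2 where B2: "\<And>k. B2 k > 0" "\<And>k x t. x \<in> {a..b} \<Longrightarrow> t \<in> {a..b} \<Longrightarrow> \<bar>pbern a b k x t\<bar> \<le> B2 k"
    using pbern_bounded[OF ab] by metis
  define B where "B = (\<Sum>k\<le>\<alpha>. B1 k + B2 k)"
  have le: "B1 k + B2 k \<le> B" if "k \<le> \<alpha>" for k
    unfolding B_def using that B1(1) B2(1) by (intro member_le_sum) (auto intro: add_nonneg_nonneg less_imp_le)
  have "\<bar>sob_ker \<alpha> a b k x t\<bar> \<le> B" if k: "k \<le> \<alpha>" and x: "x \<in> {a..b}" for k x t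
  proof (cases "t \<in> {a..b}")
    case True
    have "\<bar>nbern a b (\<alpha> - k) x - pbern a b (\<alpha> - k) x t\<bar> \<le> B1 (\<alpha> - k) + B2 (\<alpha> - k)"
      using B1(2)[OF x, of "\<alpha> - k"] B2(2)[OF x True, of "\<alpha> - k"] by linarith
    also have "\<dots> \<le> B" by (rule le) simp
    finally show ?thesis using True by (simp add: sob_ker_interval)
  next
    case False
    show ?thesis
    proof (cases "\<exists>i\<in>{k..<\<alpha>}. t = b + 1 + real i")
      case True
      then obtain i where i: "i \<in> {k..<\<alpha>}" "t = b + 1 + real i" by blast
      then have "\<bar>sob_ker \<alpha> a b k x t\<bar> = \<bar>nbern a b (i - k) x\<bar>" by (simp add: sob_ker_atom)
      also have "\<dots> \<le> B1 (i - k) + B2 (i - k)" using B1(2)[OF x, of "i - k"] B2(1)[of "i - k"] by linarith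
      also have "\<dots> \<le> B" using i by (intro le) auto
      finally show ?thesis .
    next
      case no: False
      have "sob_ker \<alpha> a b k x t = 0"
        using False no by (auto simp: sob_ker_def intro!: sum.neutral)
      moreover have "0 \<le> B" using le[of 0] B1(1)[of 0] B2(1)[of 0] by linarith
      ultimately show ?thesis by simp
    qed
  qed
  moreover have "B > 0" using le[of 0] B1(1)[of 0] B2(1)[of 0] by linarith
  ultimately show ?thesis by blast
qed

text \<open>This is the method in one variable, read on the kernel: the corrections with
  \<open>nbern a b k x\<close> cancel the coefficients at the atoms of order at least 1 and, for
  \<open>k = \<alpha>\<close>, the term \<open>nbern a b \<alpha> x\<close> on the interval.
  Multiplied over the coordinates, the sums expand into the sum over all \<tau>.\<close>

lemma proj_ker_decompose:
  assumes ab: "a < b" and t: "t \<in> data_supp \<alpha> a b" and \<alpha>: "\<alpha> \<ge> 1"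
  shows "proj_ker \<alpha> a b x t = (\<Sum>k\<le>\<alpha>. if k = 0 then sob_ker \<alpha> a b 0 x t else - nbern a b k x * data_ind \<alpha> a b k t)"
proof (cases "t \<in> {a..b}")
  case True
  then have "(\<Sum>k\<le>\<alpha>. if k = 0 then sob_ker \<alpha> a b 0 x t else - nbern a b k x * data_ind \<alpha> a b k t) =
    (\<Sum>k\<le>\<alpha>. (if k = 0 then sob_ker \<alpha> a b 0 x t else 0) + (if k = \<alpha> then - nbern a b \<alpha> x else 0))"
    using \<alpha> by (intro sum.cong) (auto simp: data_ind_def)
  also have "\<dots> = sob_ker \<alpha> a b 0 x t - nbern a b \<alpha> x" by (simp add: sum.distrib)
  finally show ?thesis using True by (simp add: proj_ker_def sob_ker_interval)
next
  case False
  then obtain i where i: "i < \<alpha>" "t = b + 1 + real i" using t by (auto simp: data_supp_def)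
  have "(\<Sum>k\<le>\<alpha>. if k = 0 then sob_ker \<alpha> a b 0 x t else - nbern a b k x * data_ind \<alpha> a b k t) =
    (\<Sum>k\<le>\<alpha>. (if k = 0 then nbern a b i x else 0) + (if k = i then (if i = 0 then 0 else - nbern a b i x) else 0))"
    using \<alpha> i by (intro sum.cong) (auto simp: data_ind_def sob_ker_atom)
  also have "\<dots> = nbern a b i x + (if i = 0 then 0 else - nbern a b i x)" using i by (simp add: sum.distrib)
  finally show ?thesis using False i by (auto simp: proj_ker_def)
qed

text \<open>Bernoulli polynomials and periodic kernels of positive degree have mean zero; only
  degree 0, which occurs at the atom of order \<open>k\<close>, integrates to 1.\<close>

lemma sob_ker_integral:
  assumes ab: "a < b" and t: "t \<in> data_supp \<alpha> a b" and k: "k < \<alpha>"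
  shows "(LINT x:{a..b}|lborel. sob_ker \<alpha> a b k x t) = data_ind \<alpha> a b k t"
proof (cases "t \<in> {a..b}")
  case True
  have "(LINT x:{a..b}|lborel. sob_ker \<alpha> a b k x t) = (LINT x:{a..b}|lborel. nbern a b (\<alpha> - k) x - pbern a b (\<alpha> - k) x t)"
    using True by (simp add: sob_ker_interval)
  also have "\<dots> = 0"
    using True k ab by (subst set_integral_diff) (auto simp: nbern_integral pbern_integral_left intro: nbern_integrable pbern_integrable)
  finally show ?thesis using True k by (auto simp: data_ind_def)
next
  case False
  then obtain i where i: "i < \<alpha>" "t = b + 1 + real i" using t by (auto simp: data_supp_def)
  then have "(LINT x:{a..b}|lborel. sob_ker \<alpha> a b k x t) = (LINT x:{a..b}|lborel. if k \<le> i then nbern a b (i - k) x else 0)"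
    by (simp add: sob_ker_atom)
  also have "\<dots> = (if k = i then 1 else 0)" using nbern_integral[OF ab, of "i - k"] by (cases "k \<le> i") auto
  finally show ?thesis using i k by (auto simp: data_ind_def)
qed

text \<open>Integration by parts with vanishing boundary values lowers the degrees in the kernel by
  one, that is, it raises \<open>k\<close>. When \<open>Suc k = \<alpha>\<close> the periodic term
  has degree 1, and its jump at \<open>t\<close> evaluates \<open>\<psi>\<close> there: this is how
  the data become the weak derivative of order \<alpha>.\<close>

lemma sob_ker_parts_step:
  fixes \<psi> :: "real \<Rightarrow> real"
  assumes ab: "a < b" and t: "t \<in> data_supp \<alpha> a b" and k: "k < \<alpha>"
    and \<psi>: "\<And>x. (\<psi> has_real_derivative \<psi>' x) (at x)" and \<psi>': "continuous_on UNIV \<psi>'"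
    and bd: "\<psi> a = 0" "\<psi> b = 0"
  shows "(LINT s:{a..b}|lborel. sob_ker \<alpha> a b k s t * \<psi>' s) =
    - (if Suc k = \<alpha> then indicator {a..b} t * \<psi> t else (LINT s:{a..b}|lborel. sob_ker \<alpha> a b (Suc k) s t * \<psi> s))"
proof -
  have cont: "continuous_on {a..b} \<psi>" "continuous_on {a..b} \<psi>'"
    by (intro continuous_at_imp_continuous_on ballI DERIV_isCont[OF \<psi>])
      (rule continuous_on_subset[OF \<psi>'], simp)
  have \<psi>v: "(\<psi> has_vector_derivative \<psi>' x) (at x within {a..b})" for x
    using \<psi>[of x] by (auto simp: has_real_derivative_iff_has_vector_derivative intro: has_vector_derivative_at_within)
  obtain B where B: "\<forall>k\<le>\<alpha>. \<forall>x\<in>{a..b}. \<forall>t. \<bar>sob_ker \<alpha> a b k x t\<bar> \<le> B"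
    using sob_ker_bounded[OF ab] by blast
  have int: "set_integrable lborel {a..b} (\<lambda>s. sob_ker \<alpha> a b l s t * g s)" if "l \<le> \<alpha>" "continuous_on {a..b} g" for l g
    using that B by (intro set_integrable_bounded_mult[where B=B] borel_integrable_atLeastAtMost') auto
  have N: "((\<lambda>x. nbern a b (Suc m) x * \<psi>' x + nbern a b m x * \<psi> x) has_integral 0) {a..b}" for m
  proof -
    have "((\<lambda>x. nbern a b (Suc m) x *\<^sub>R \<psi>' x + nbern a b m x *\<^sub>R \<psi> x) has_integral
        nbern a b (Suc m) b *\<^sub>R \<psi> b - nbern a b (Suc m) a *\<^sub>R \<psi> a) {a..b}"
      by (rule fundamental_theorem_of_calculus)
        (use ab in \<open>auto intro!: has_vector_derivative_scaleR has_field_derivative_at_within[OF nbern_has_derivative] \<psi>v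
           simp del: real_scaleR_def\<close>)
    then show ?thesis using bd by simp
  qed
  have N0: "((\<lambda>x. 1 / (b - a) * \<psi>' x) has_integral 0) {a..b}"
  proof -
    have "(\<psi>' has_integral \<psi> b - \<psi> a) {a..b}"
      using ab by (intro fundamental_theorem_of_calculus \<psi>v) auto
    from has_integral_mult_right[OF this, of "1 / (b - a)"] show ?thesis using bd by simp
  qed
  show ?thesis
  proof (cases "t \<in> {a..b}")
    case True
    \<comment> \<open>The kernel then has degree \<open>Suc m\<close>, and \<open>m = 0\<close> is
      exactly the last step, in which the jump appears.\<close>
    define m where "m = \<alpha> - Suc k"
    have \<alpha>k: "\<alpha> - k = Suc m" using k by (simp add: m_def)
    have P: "((\<lambda>x. pbern a b (Suc m) x t * \<psi>' x + pbern a b m x t * \<psi> x) has_integral (if m = 0 then \<psi> t else 0)) {a..b}"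
      using pbern_parts_left[OF ab \<psi>v _ True, of m] bd by simp
    have "((\<lambda>x. sob_ker \<alpha> a b k x t * \<psi>' x + sob_ker \<alpha> a b (Suc k) x t * \<psi> x) has_integral (- (if m = 0 then \<psi> t else 0))) {a..b}"
      using has_integral_diff[OF N[of m] P] True
      by (simp add: sob_ker_interval \<alpha>k m_def[symmetric] algebra_simps)
    then have "(LINT s:{a..b}|lborel. sob_ker \<alpha> a b k s t * \<psi>' s + sob_ker \<alpha> a b (Suc k) s t * \<psi> s) = - (if m = 0 then \<psi> t else 0)"
      using k by (intro LBINT_eq_has_integral set_integral_add int cont) auto
    then have *: "(LINT s:{a..b}|lborel. sob_ker \<alpha> a b k s t * \<psi>' s) + (LINT s:{a..b}|lborel. sob_ker \<alpha> a b (Suc k) s t * \<psi> s) = - (if m = 0 then \<psi> t else 0)"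
      using k by (subst (asm) set_integral_add) (auto intro!: int cont)
    show ?thesis
    proof (cases "m = 0")
      case m0: True
      have "(LINT s:{a..b}|lborel. sob_ker \<alpha> a b (Suc k) s t * \<psi> s) = 0"
        using True m0 by (simp add: sob_ker_interval m_def set_lebesgue_integral_def)
      then show ?thesis using * m0 k True by (auto simp: m_def)
    next
      case False
      then show ?thesis using * k by (auto simp: m_def)
    qed
  next
    case False
    then obtain i where i: "i < \<alpha>" "t = b + 1 + real i" using t by (auto simp: data_supp_def)
    have I: "((\<lambda>x. sob_ker \<alpha> a b k x t * \<psi>' x + sob_ker \<alpha> a b (Suc k) x t * \<psi> x) has_integral 0) {a..b}"
    proof -
      consider "k < i" | "k = i" | "i < k" by linarith
      then show ?thesis
      proof cases
        case 1
        then have "i - k = Suc (i - Suc k)" by simp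
        then show ?thesis using N[of "i - Suc k"] i 1 by (simp add: sob_ker_atom)
      qed (use N0 i in \<open>auto simp: sob_ker_atom\<close>)
    qed
    have "(LINT s:{a..b}|lborel. sob_ker \<alpha> a b k s t * \<psi>' s + sob_ker \<alpha> a b (Suc k) s t * \<psi> s) = 0"
      using k by (intro LBINT_eq_has_integral I set_integral_add int cont) auto
    then have *: "(LINT s:{a..b}|lborel. sob_ker \<alpha> a b k s t * \<psi>' s) + (LINT s:{a..b}|lborel. sob_ker \<alpha> a b (Suc k) s t * \<psi> s) = 0"
      using k by (subst (asm) set_integral_add) (auto intro!: int cont)
    have "(LINT s:{a..b}|lborel. sob_ker \<alpha> a b (Suc k) s t * \<psi> s) = 0" if "Suc k = \<alpha>"
      using that i by (simp add: sob_ker_atom set_lebesgue_integral_def)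
    then show ?thesis using * False by auto
  qed
qed

lemma sob_ker_parts:
  fixes \<Psi> :: "nat \<Rightarrow> real \<Rightarrow> real"
  assumes ab: "a < b" and t: "t \<in> data_supp \<alpha> a b" and k: "k \<le> \<alpha>" "\<alpha> \<ge> 1"
    and \<Psi>: "\<And>n x. (\<Psi> n has_real_derivative \<Psi> (Suc n) x) (at x)"
    and bd: "\<And>n. \<Psi> n a = 0" "\<And>n. \<Psi> n b = 0"
  shows "(LINT s:{a..b}|lborel. sob_ker \<alpha> a b 0 s t * \<Psi> k s) =
    (-1) ^ k * (if k = \<alpha> then indicator {a..b} t * \<Psi> 0 t else (LINT s:{a..b}|lborel. sob_ker \<alpha> a b k s t * \<Psi> 0 s))"
proof -
  have cont: "continuous_on UNIV (\<Psi> n)" for n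
    using \<Psi> by (auto intro!: continuous_at_imp_continuous_on DERIV_isCont)
  \<comment> \<open>The offset \<open>n\<close> is generalised so that the induction hypothesis can
    be used for the derivative of the test function, with \<open>Suc n\<close>.\<close>
  have "(LINT s:{a..b}|lborel. sob_ker \<alpha> a b 0 s t * \<Psi> (k + n) s) =
    (-1) ^ k * (if k = \<alpha> then indicator {a..b} t * \<Psi> n t else (LINT s:{a..b}|lborel. sob_ker \<alpha> a b k s t * \<Psi> n s))" for n
    using k(1)
  proof (induction k arbitrary: n)
    case 0
    then show ?case using k(2) by simp
  next
    case (Suc k)
    have "(LINT s:{a..b}|lborel. sob_ker \<alpha> a b 0 s t * \<Psi> (Suc k + n) s) =
        (-1) ^ k * (LINT s:{a..b}|lborel. sob_ker \<alpha> a b k s t * \<Psi> (Suc n) s)"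
      using Suc.IH[of "Suc n"] Suc.prems by simp
    also have "(LINT s:{a..b}|lborel. sob_ker \<alpha> a b k s t * \<Psi> (Suc n) s) =
        - (if Suc k = \<alpha> then indicator {a..b} t * \<Psi> n t else (LINT s:{a..b}|lborel. sob_ker \<alpha> a b (Suc k) s t * \<Psi> n s))"
      using Suc.prems by (intro sob_ker_parts_step[OF ab t _ \<Psi> cont bd]) auto
    finally show ?case by simp
  qed
  from this[of 0] show ?thesis by simp
qed

section \<open>Data of Sobolev functions\<close>

text \<open>A relation rather than a function: the derivative of order \<alpha>, and with it the
  data on \<open>{a..b}\<close>, is determined only up to a null set.\<close>

definition sob1_data :: "nat \<Rightarrow> real \<Rightarrow> real \<Rightarrow> (real \<Rightarrow> real) \<Rightarrow> (real \<Rightarrow> real) \<Rightarrow> bool" where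
  "sob1_data \<alpha> a b f \<eta> \<longleftrightarrow> (\<exists>D. sob1_jet \<alpha> a b f D \<and>
     \<eta> = (\<lambda>t. if t \<in> {a..b} then D \<alpha> t
              else \<Sum>i<\<alpha>. if t = b + 1 + real i then (LINT x:{a..b}|lborel. D i x) else 0))"

lemma sob1_data_exists: "f \<in> sob1 \<alpha> a b \<Longrightarrow> \<exists>\<eta>. sob1_data \<alpha> a b f \<eta>"
  unfolding sob1_def sob1_data_def by blast

lemma sob1_dataE:
  assumes "sob1_data \<alpha> a b f \<eta>"
  obtains D where "sob1_jet \<alpha> a b f D" "\<And>t. t \<in> {a..b} \<Longrightarrow> \<eta> t = D \<alpha> t"
    "\<And>i. i < \<alpha> \<Longrightarrow> \<eta> (b + 1 + real i) = (LINT x:{a..b}|lborel. D i x)"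
    "\<eta> \<in> borel_measurable borel"
proof -
  obtain D where D: "sob1_jet \<alpha> a b f D" and \<eta>: "\<eta> = (\<lambda>t. if t \<in> {a..b} then D \<alpha> t
              else \<Sum>i<\<alpha>. if t = b + 1 + real i then (LINT x:{a..b}|lborel. D i x) else 0)"
    using assms unfolding sob1_data_def by blast
  have [measurable]: "(\<lambda>t. indicat_real {a..b} t *\<^sub>R D \<alpha> t) \<in> borel_measurable borel"
    using D by (simp add: sob1_jet_def set_borel_measurable_def)
  have "\<eta> = (\<lambda>t. if t \<in> {a..b} then indicat_real {a..b} t *\<^sub>R D \<alpha> t
              else \<Sum>i<\<alpha>. if t = b + 1 + real i then (LINT x:{a..b}|lborel. D i x) else 0)"
    unfolding \<eta> by auto
  also have "\<dots> \<in> borel_measurable borel" by measurable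
  finally have "\<eta> \<in> borel_measurable borel" .
  then show ?thesis using that[OF D] by (simp add: \<eta>)
qed

lemma sob1_data_integrable:
  assumes ab: "a < b" and d: "sob1_data \<alpha> a b f \<eta>"
  shows "\<eta> \<in> borel_measurable borel" "integrable (data_measure \<alpha> a b) \<eta>"
    "integrable (data_measure \<alpha> a b) (\<lambda>t. (\<eta> t)\<^sup>2)"
proof -
  obtain D where D: "sob1_jet \<alpha> a b f D" "\<And>t. t \<in> {a..b} \<Longrightarrow> \<eta> t = D \<alpha> t"
    and [measurable]: "\<eta> \<in> borel_measurable borel" by (rule sob1_dataE[OF d]) blast
  show "\<eta> \<in> borel_measurable borel" by fact
  have "set_integrable lborel {a..b} \<eta> = set_integrable lborel {a..b} (D \<alpha>)"
    by (intro set_integrable_cong refl D(2))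
  then show "integrable (data_measure \<alpha> a b) \<eta>"
    using ab sob1_jet_integrable[OF D(1)] by (intro data_measure_integral(1)) auto
  have "set_integrable lborel {a..b} (\<lambda>t. (\<eta> t)\<^sup>2) = set_integrable lborel {a..b} (\<lambda>t. (D \<alpha> t)\<^sup>2)"
    by (intro set_integrable_cong) (auto simp: D(2))
  then show "integrable (data_measure \<alpha> a b) (\<lambda>t. (\<eta> t)\<^sup>2)"
    using ab D(1) by (intro data_measure_integral(1)) (auto simp: sob1_jet_def)
qed

lemma sob1_data_representation:
  assumes ab: "a < b" and \<alpha>: "\<alpha> \<ge> 1" and d: "sob1_data \<alpha> a b f \<eta>" and x: "x \<in> {a..b}"
  shows "f x = (LINT t|data_measure \<alpha> a b. sob_ker \<alpha> a b 0 x t * \<eta> t)"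
proof -
  obtain D where D: "sob1_jet \<alpha> a b f D" "\<And>t. t \<in> {a..b} \<Longrightarrow> \<eta> t = D \<alpha> t"
      "\<And>i. i < \<alpha> \<Longrightarrow> \<eta> (b + 1 + real i) = (LINT x:{a..b}|lborel. D i x)"
    and [measurable]: "\<eta> \<in> borel_measurable borel" by (rule sob1_dataE[OF d]) blast
  obtain B where B: "\<forall>k\<le>\<alpha>. \<forall>x\<in>{a..b}. \<forall>t. \<bar>sob_ker \<alpha> a b k x t\<bar> \<le> B"
    using sob_ker_bounded[OF ab] by blast
  have "set_integrable lborel {a..b} \<eta> = set_integrable lborel {a..b} (D \<alpha>)"
    by (intro set_integrable_cong refl D(2))
  then have "set_integrable lborel {a..b} (\<lambda>t. sob_ker \<alpha> a b 0 x t * \<eta> t)"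
    using sob1_jet_integrable[OF D(1)] B x by (intro set_integrable_bounded_mult[where B=B]) auto
  then have "(LINT t|data_measure \<alpha> a b. sob_ker \<alpha> a b 0 x t * \<eta> t) =
      (LINT t:{a..b}|lborel. sob_ker \<alpha> a b 0 x t * \<eta> t) + (\<Sum>k<\<alpha>. sob_ker \<alpha> a b 0 x (b + 1 + real k) * \<eta> (b + 1 + real k))"
    using ab by (intro data_measure_integral(2)) auto
  also have "(LINT t:{a..b}|lborel. sob_ker \<alpha> a b 0 x t * \<eta> t) = (LINT t:{a..b}|lborel. (nbern a b \<alpha> x - pbern a b \<alpha> x t) * D \<alpha> t)"
    by (intro set_lebesgue_integral_cong) (auto simp: sob_ker_interval D(2))
  also have "(\<Sum>k<\<alpha>. sob_ker \<alpha> a b 0 x (b + 1 + real k) * \<eta> (b + 1 + real k)) = (\<Sum>k<\<alpha>. nbern a b k x * (LINT t:{a..b}|lborel. D k t))"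
    by (intro sum.cong) (auto simp: sob_ker_atom D(3))
  also have "(LINT t:{a..b}|lborel. (nbern a b \<alpha> x - pbern a b \<alpha> x t) * D \<alpha> t) + (\<Sum>k<\<alpha>. nbern a b k x * (LINT t:{a..b}|lborel. D k t)) = f x"
    using sob1_representation[OF ab D(1) x \<alpha>] by simp
  finally show ?thesis ..
qed

lemma has_real_derivative_unique_Icc:
  fixes f :: "real \<Rightarrow> real"
  assumes "a < b" "x \<in> {a..b}" "(f has_real_derivative d) (at x within {a..b})"
    "(g has_real_derivative e) (at x within {a..b})" "\<And>y. y \<in> {a..b} \<Longrightarrow> f y = g y"
  shows "d = e"
proof -
  have "(f has_real_derivative e) (at x within {a..b})"
    using assms(2,4,5) by (auto intro: has_field_derivative_transform_within[of g e x "{a..b}" 1])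
  then show ?thesis
    using assms(1-3) by (auto simp: has_real_derivative_iff_has_vector_derivative
        intro!: vector_derivative_unique_within[of x "{a..b}" f] simp: trivial_limit_within islimpt_Icc)
qed

text \<open>Derivatives within the interval are unique, which settles the lower orders by induction
  and order \<alpha> almost everywhere. This reconciles the jet that \<open>sob1_inner\<close> picks
  by \<open>SOME\<close> with the one behind the data.\<close>

lemma sob1_jet_unique:
  assumes ab: "a < b" and D: "sob1_jet \<alpha> a b f D" and E: "sob1_jet \<alpha> a b f E"
  shows "k < \<alpha> \<Longrightarrow> x \<in> {a..b} \<Longrightarrow> D k x = E k x"
    and "\<alpha> \<ge> 1 \<Longrightarrow> AE x\<in>{a..b} in lborel. D \<alpha> x = E \<alpha> x"
proof -
  have der: "(F k has_real_derivative F (Suc k) x) (at x within {a..b})"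
    if "sob1_jet \<alpha> a b f F" "Suc k < \<alpha>" "x \<in> {a..b}" for F k x
    using that by (simp add: sob1_jet_def)
  have top: "AE x\<in>{a..b} in lborel. (F (\<alpha> - 1) has_real_derivative F \<alpha> x) (at x within {a..b})"
    if "sob1_jet \<alpha> a b f F" "\<alpha> \<ge> 1" for F
    using sob1_jet_ac[OF that(1), of "\<alpha> - 1"] that(2) by (simp add: ac_deriv_def)
  show *: "D k x = E k x" if "k < \<alpha>" "x \<in> {a..b}" for k x
    using that
  proof (induction k arbitrary: x)
    case 0
    then show ?case using D E by (simp add: sob1_jet_def)
  next
    case (Suc k)
    show ?case
      by (rule has_real_derivative_unique_Icc[OF ab Suc.prems(2) der[OF D Suc.prems] der[OF E Suc.prems] Suc.IH])
        (use Suc.prems(1) in simp_all)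
  qed
  assume \<alpha>: "\<alpha> \<ge> 1"
  have "AE x\<in>{a..b} in lborel. (D (\<alpha> - 1) has_real_derivative D \<alpha> x) (at x within {a..b})"
    "AE x\<in>{a..b} in lborel. (E (\<alpha> - 1) has_real_derivative E \<alpha> x) (at x within {a..b})"
    using top D E \<alpha> by blast+
  then show "AE x\<in>{a..b} in lborel. D \<alpha> x = E \<alpha> x"
  proof eventually_elim
    case (elim x)
    show ?case
    proof
      assume "x \<in> {a..b}"
      then show "D \<alpha> x = E \<alpha> x"
        using elim \<alpha> by (intro has_real_derivative_unique_Icc[OF ab _ elim(1)[rule_format] elim(2)[rule_format]] *) auto
    qed
  qed
qed

lemma sob1_inner_data:
  assumes ab: "a < b" and \<alpha>: "\<alpha> \<ge> 1" and f: "sob1_data \<alpha> a b f \<eta>" and g: "sob1_data \<alpha> a b g \<theta>"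
  shows "sob1_inner \<alpha> a b f g = (LINT t|data_measure \<alpha> a b. \<eta> t * \<theta> t)"
proof -
  obtain D where D: "sob1_jet \<alpha> a b f D" "\<And>t. t \<in> {a..b} \<Longrightarrow> \<eta> t = D \<alpha> t"
      "\<And>i. i < \<alpha> \<Longrightarrow> \<eta> (b + 1 + real i) = (LINT x:{a..b}|lborel. D i x)"
    and [measurable]: "\<eta> \<in> borel_measurable borel" by (rule sob1_dataE[OF f]) blast
  obtain E where E: "sob1_jet \<alpha> a b g E" "\<And>t. t \<in> {a..b} \<Longrightarrow> \<theta> t = E \<alpha> t"
      "\<And>i. i < \<alpha> \<Longrightarrow> \<theta> (b + 1 + real i) = (LINT x:{a..b}|lborel. E i x)"
    and [measurable]: "\<theta> \<in> borel_measurable borel" by (rule sob1_dataE[OF g]) blast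
  define D' E' where "D' = sob1_deriv \<alpha> a b f" and "E' = sob1_deriv \<alpha> a b g"
  have D': "sob1_jet \<alpha> a b f D'" unfolding D'_def sob1_deriv_def by (rule someI[where P="sob1_jet \<alpha> a b f", OF D(1)])
  have E': "sob1_jet \<alpha> a b g E'" unfolding E'_def sob1_deriv_def by (rule someI[where P="sob1_jet \<alpha> a b g", OF E(1)])
  have m: "(\<lambda>x. indicat_real {a..b} x *\<^sub>R D' \<alpha> x) \<in> borel_measurable lborel"
    "(\<lambda>x. indicat_real {a..b} x *\<^sub>R E' \<alpha> x) \<in> borel_measurable lborel"
    using D' E' by (auto simp: sob1_jet_def set_borel_measurable_def)
  have "(\<lambda>x. (indicat_real {a..b} x *\<^sub>R D' \<alpha> x) * (indicat_real {a..b} x *\<^sub>R E' \<alpha> x)) \<in> borel_measurable lborel"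
    using m by (rule borel_measurable_times)
  moreover have "(\<lambda>x. (indicat_real {a..b} x *\<^sub>R D' \<alpha> x) * (indicat_real {a..b} x *\<^sub>R E' \<alpha> x)) =
      (\<lambda>x. indicat_real {a..b} x *\<^sub>R (D' \<alpha> x * E' \<alpha> x))"
    by (auto simp: indicator_def)
  ultimately have mm: "(\<lambda>x. indicat_real {a..b} x *\<^sub>R (D' \<alpha> x * E' \<alpha> x)) \<in> borel_measurable lborel" by simp
  have top: "(LINT x:{a..b}|lborel. D' \<alpha> x * E' \<alpha> x) = (LINT t:{a..b}|lborel. \<eta> t * \<theta> t)"
    unfolding set_lebesgue_integral_def
  proof (rule integral_cong_AE[OF mm])
    show "(\<lambda>t. indicat_real {a..b} t *\<^sub>R (\<eta> t * \<theta> t)) \<in> borel_measurable lborel" by measurable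
    show "AE x in lborel. indicat_real {a..b} x *\<^sub>R (D' \<alpha> x * E' \<alpha> x) = indicat_real {a..b} x *\<^sub>R (\<eta> x * \<theta> x)"
      using sob1_jet_unique(2)[OF ab D' D(1) \<alpha>] sob1_jet_unique(2)[OF ab E' E(1) \<alpha>]
      by eventually_elim (auto simp: D(2) E(2) indicator_def)
  qed
  have sq: "set_integrable lborel {a..b} (\<lambda>t. (\<eta> t)\<^sup>2)" "set_integrable lborel {a..b} (\<lambda>t. (\<theta> t)\<^sup>2)"
  proof -
    have "set_integrable lborel {a..b} (\<lambda>t. (\<eta> t)\<^sup>2) = set_integrable lborel {a..b} (\<lambda>t. (D \<alpha> t)\<^sup>2)"
      by (intro set_integrable_cong) (auto simp: D(2))
    then show "set_integrable lborel {a..b} (\<lambda>t. (\<eta> t)\<^sup>2)" using D(1) by (simp add: sob1_jet_def)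
    have "set_integrable lborel {a..b} (\<lambda>t. (\<theta> t)\<^sup>2) = set_integrable lborel {a..b} (\<lambda>t. (E \<alpha> t)\<^sup>2)"
      by (intro set_integrable_cong) (auto simp: E(2))
    then show "set_integrable lborel {a..b} (\<lambda>t. (\<theta> t)\<^sup>2)" using E(1) by (simp add: sob1_jet_def)
  qed
  have "set_integrable lborel {a..b} (\<lambda>t. \<eta> t * \<theta> t)"
    unfolding set_integrable_def
  proof (rule Bochner_Integration.integrable_bound)
    show "integrable lborel (\<lambda>t. indicat_real {a..b} t *\<^sub>R (\<eta> t)\<^sup>2 + indicat_real {a..b} t *\<^sub>R (\<theta> t)\<^sup>2)"
      using sq by (auto simp: set_integrable_def)
    show "(\<lambda>t. indicat_real {a..b} t *\<^sub>R (\<eta> t * \<theta> t)) \<in> borel_measurable lborel" by measurable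
    have "\<bar>u * v\<bar> \<le> u\<^sup>2 + v\<^sup>2" for u v :: real
    proof -
      have "2 * \<bar>u\<bar> * \<bar>v\<bar> \<le> u\<^sup>2 + v\<^sup>2"
        using sum_squares_bound[of "\<bar>u\<bar>" "\<bar>v\<bar>"] by simp
      moreover have "0 \<le> \<bar>u\<bar> * \<bar>v\<bar>" by simp
      ultimately show ?thesis unfolding abs_mult by linarith
    qed
    then show "AE t in lborel. norm (indicat_real {a..b} t *\<^sub>R (\<eta> t * \<theta> t))
        \<le> norm (indicat_real {a..b} t *\<^sub>R (\<eta> t)\<^sup>2 + indicat_real {a..b} t *\<^sub>R (\<theta> t)\<^sup>2)"
      by (auto simp: indicator_def)
  qed
  then have "(LINT t|data_measure \<alpha> a b. \<eta> t * \<theta> t) =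
      (LINT t:{a..b}|lborel. \<eta> t * \<theta> t) + (\<Sum>k<\<alpha>. \<eta> (b + 1 + real k) * \<theta> (b + 1 + real k))"
    using ab by (intro data_measure_integral(2)) auto
  also have "(\<Sum>k<\<alpha>. \<eta> (b + 1 + real k) * \<theta> (b + 1 + real k)) =
      (\<Sum>k<\<alpha>. (LINT x:{a..b}|lborel. D' k x) * (LINT x:{a..b}|lborel. E' k x))"
  proof (intro sum.cong refl)
    fix k assume k: "k \<in> {..<\<alpha>}"
    have "(LINT x:{a..b}|lborel. D' k x) = (LINT x:{a..b}|lborel. D k x)"
      using k sob1_jet_unique(1)[OF ab D' D(1)] by (intro set_lebesgue_integral_cong) auto
    moreover have "(LINT x:{a..b}|lborel. E' k x) = (LINT x:{a..b}|lborel. E k x)"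
      using k sob1_jet_unique(1)[OF ab E' E(1)] by (intro set_lebesgue_integral_cong) auto
    ultimately show "\<eta> (b + 1 + real k) * \<theta> (b + 1 + real k) =
        (LINT x:{a..b}|lborel. D' k x) * (LINT x:{a..b}|lborel. E' k x)"
      using k D(3) E(3) by simp
  qed
  finally show ?thesis unfolding sob1_inner_def D'_def[symmetric] E'_def[symmetric] top by simp
qed

section \<open>Square-integrable functions\<close>

definition L2 :: "'a measure \<Rightarrow> ('a \<Rightarrow> 'b::{real_normed_field, banach, second_countable_topology}) \<Rightarrow> bool" where
  "L2 M f \<longleftrightarrow> f \<in> borel_measurable M \<and> integrable M (\<lambda>x. (norm (f x))\<^sup>2)"

lemma L2_measurable [measurable_dest]: "L2 M f \<Longrightarrow> f \<in> borel_measurable M"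
  by (simp add: L2_def)

lemma abs_mult_le_sum_squares: "\<bar>u * v\<bar> \<le> u\<^sup>2 + (v :: real)\<^sup>2"
proof -
  have "2 * \<bar>u\<bar> * \<bar>v\<bar> \<le> u\<^sup>2 + v\<^sup>2"
    using sum_squares_bound[of "\<bar>u\<bar>" "\<bar>v\<bar>"] by simp
  moreover have "0 \<le> \<bar>u\<bar> * \<bar>v\<bar>" by simp
  ultimately show ?thesis unfolding abs_mult by linarith
qed

lemma L2_mult_integrable:
  assumes "L2 M f" "L2 M g"
  shows "integrable M (\<lambda>x. f x * g x)"
proof (rule Bochner_Integration.integrable_bound)
  show "integrable M (\<lambda>x. (norm (f x))\<^sup>2 + (norm (g x))\<^sup>2)" using assms by (auto simp: L2_def)
  show "(\<lambda>x. f x * g x) \<in> borel_measurable M" using assms by (auto simp: L2_def)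
  show "AE x in M. norm (f x * g x) \<le> norm ((norm (f x))\<^sup>2 + (norm (g x))\<^sup>2)"
  proof (intro AE_I2)
    fix x
    show "norm (f x * g x) \<le> norm ((norm (f x))\<^sup>2 + (norm (g x))\<^sup>2)"
      using abs_mult_le_sum_squares[of "norm (f x)" "norm (g x)"] by (simp add: norm_mult)
  qed
qed

lemma L2_cmult: "L2 M f \<Longrightarrow> L2 M (\<lambda>x. c * f x)"
  by (auto simp: L2_def norm_mult power_mult_distrib)

lemma L2_add:
  assumes "L2 M f" "L2 M g" shows "L2 M (\<lambda>x. f x + g x)"
  unfolding L2_def
proof (intro conjI)
  show "(\<lambda>x. f x + g x) \<in> borel_measurable M" using assms by (auto simp: L2_def)
  show "integrable M (\<lambda>x. (norm (f x + g x))\<^sup>2)"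
  proof (rule Bochner_Integration.integrable_bound)
    show "integrable M (\<lambda>x. 2 * (norm (f x))\<^sup>2 + 2 * (norm (g x))\<^sup>2)" using assms by (auto simp: L2_def)
    show "(\<lambda>x. (norm (f x + g x))\<^sup>2) \<in> borel_measurable M" using assms by (auto simp: L2_def)
    show "AE x in M. norm ((norm (f x + g x))\<^sup>2) \<le> norm (2 * (norm (f x))\<^sup>2 + 2 * (norm (g x))\<^sup>2)"
    proof (intro AE_I2)
      fix x
      have "(norm (f x + g x))\<^sup>2 \<le> (norm (f x) + norm (g x))\<^sup>2"
        by (intro power_mono norm_triangle_ineq) auto
      also have "\<dots> \<le> 2 * (norm (f x))\<^sup>2 + 2 * (norm (g x))\<^sup>2"
        using sum_squares_bound[of "norm (f x)" "norm (g x)"] by (simp add: power2_sum)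
      finally show "norm ((norm (f x + g x))\<^sup>2) \<le> norm (2 * (norm (f x))\<^sup>2 + 2 * (norm (g x))\<^sup>2)" by simp
    qed
  qed
qed

lemma L2_zero: "L2 M (\<lambda>x. 0)"
  by (simp add: L2_def)

lemma L2_diff: "L2 M f \<Longrightarrow> L2 M g \<Longrightarrow> L2 M (\<lambda>x. f x - g x)"
  using L2_add[of M f "\<lambda>x. (-1) * g x"] L2_cmult[of M g "-1"] by simp

lemma L2_sum: "(\<And>i. i \<in> I \<Longrightarrow> L2 M (f i)) \<Longrightarrow> L2 M (\<lambda>x. \<Sum>i\<in>I. f i x)"
  by (induction I rule: infinite_finite_induct) (auto intro: L2_add L2_zero)

lemma cnj_measurable [measurable]: "cnj \<in> borel_measurable borel"
  by (intro borel_measurable_continuous_onI continuous_intros)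

lemma L2_cnj: "L2 M f \<Longrightarrow> L2 M (\<lambda>x. cnj (f x))"
  unfolding L2_def by (auto intro: measurable_compose[OF _ cnj_measurable])

lemma L2_of_real: "L2 M f \<Longrightarrow> L2 M (\<lambda>x. complex_of_real (f x))"
  by (auto simp: L2_def)

lemma L2_bounded:
  assumes "finite_measure M" "f \<in> borel_measurable M" "AE x in M. norm (f x) \<le> B"
  shows "L2 M f"
  unfolding L2_def
proof (intro conjI assms(2))
  interpret finite_measure M by fact
  show "integrable M (\<lambda>x. (norm (f x))\<^sup>2)"
    by (rule integrable_const_bound[where B="B\<^sup>2"])
      (use assms(2,3) in \<open>auto elim!: eventually_mono intro!: power_mono\<close>)
qed

lemma L2_integrable:
  assumes "finite_measure M" "L2 M f" shows "integrable M f"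
proof -
  have "L2 M (\<lambda>x. 1)" using assms(1) by (rule L2_bounded[of _ _ 1]) auto
  from L2_mult_integrable[OF assms(2) this] show ?thesis by simp
qed

lemma L2_Cauchy_Schwarz:
  assumes f: "L2 M f" and g: "L2 M g"
  shows "(norm (LINT x|M. f x * g x))\<^sup>2 \<le> (LINT x|M. (norm (f x))\<^sup>2) * (LINT x|M. (norm (g x))\<^sup>2)"
proof -
  define A B C where "A = (LINT x|M. (norm (f x))\<^sup>2)" and "B = (LINT x|M. (norm (g x))\<^sup>2)"
    and "C = (LINT x|M. norm (f x) * norm (g x))"
  have i: "integrable M (\<lambda>x. (norm (f x))\<^sup>2)" "integrable M (\<lambda>x. (norm (g x))\<^sup>2)"
      "integrable M (\<lambda>x. norm (f x) * norm (g x))"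
    using f g integrable_norm[OF L2_mult_integrable[OF f g]] by (auto simp: L2_def norm_mult)
  have q: "0 \<le> s\<^sup>2 * A - 2 * s * C + B" for s
  proof -
    have "0 \<le> (LINT x|M. (s * norm (f x) - norm (g x))\<^sup>2)" by simp
    also have "(\<lambda>x. (s * norm (f x) - norm (g x))\<^sup>2) =
        (\<lambda>x. s\<^sup>2 * (norm (f x))\<^sup>2 - 2 * s * (norm (f x) * norm (g x)) + (norm (g x))\<^sup>2)"
      by (auto simp: power2_diff power_mult_distrib)
    also have "(LINT x|M. s\<^sup>2 * (norm (f x))\<^sup>2 - 2 * s * (norm (f x) * norm (g x)) + (norm (g x))\<^sup>2) =
        s\<^sup>2 * A - 2 * s * C + B"
      using i by (simp add: A_def B_def C_def)
    finally show ?thesis .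
  qed
  have A0: "0 \<le> A" and C0: "0 \<le> C" by (simp_all add: A_def C_def)
  have "C\<^sup>2 \<le> A * B"
  proof (cases "A = 0")
    case True
    have "C = 0"
    proof (rule ccontr)
      assume "C \<noteq> 0"
      then have "C > 0" using C0 by simp
      \<comment> \<open>With \<open>A = 0\<close> the quadratic is affine in \<open>s\<close>, and
        at this \<open>s\<close> it would equal -1.\<close>
      then show False using q[of "(B + 1) / (2 * C)"] True by (simp add: field_simps)
    qed
    then show ?thesis using True by simp
  next
    case False
    then have "A > 0" using A0 by simp
    have "0 \<le> (C / A)\<^sup>2 * A - 2 * (C / A) * C + B" by (rule q)
    also have "(C / A)\<^sup>2 * A - 2 * (C / A) * C + B = B - C\<^sup>2 / A"
      using \<open>A > 0\<close> by (simp add: field_simps power2_eq_square)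
    finally show ?thesis using \<open>A > 0\<close> by (simp add: field_simps)
  qed
  moreover have "norm (LINT x|M. f x * g x) \<le> C"
    unfolding C_def using integral_norm_bound[of M "\<lambda>x. f x * g x"] by (simp add: norm_mult)
  then have "(norm (LINT x|M. f x * g x))\<^sup>2 \<le> C\<^sup>2" by (intro power_mono) auto
  ultimately show ?thesis unfolding A_def B_def by linarith
qed

lemma L2_tendsto_pairing:
  assumes f: "\<And>n. L2 M (f n)" "L2 M f0" and g: "L2 M g"
    and lim: "(\<lambda>n. LINT x|M. (norm (f n x - f0 x))\<^sup>2) \<longlonglongrightarrow> 0"
  shows "(\<lambda>n. LINT x|M. f n x * g x) \<longlonglongrightarrow> (LINT x|M. f0 x * g x)"
proof -
  have "(\<lambda>n. sqrt ((LINT x|M. (norm (f n x - f0 x))\<^sup>2) * (LINT x|M. (norm (g x))\<^sup>2))) \<longlonglongrightarrow> sqrt (0 * (LINT x|M. (norm (g x))\<^sup>2))"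
    by (intro tendsto_intros lim)
  then have z: "(\<lambda>n. sqrt ((LINT x|M. (norm (f n x - f0 x))\<^sup>2) * (LINT x|M. (norm (g x))\<^sup>2))) \<longlonglongrightarrow> 0" by simp
  have "(\<lambda>n. (LINT x|M. f n x * g x) - (LINT x|M. f0 x * g x)) \<longlonglongrightarrow> 0"
  proof (rule Lim_null_comparison[OF _ z], intro always_eventually allI)
    fix n
    have "(LINT x|M. f n x * g x) - (LINT x|M. f0 x * g x) = (LINT x|M. (f n x - f0 x) * g x)"
      using f g by (simp add: left_diff_distrib L2_mult_integrable)
    then show "norm ((LINT x|M. f n x * g x) - (LINT x|M. f0 x * g x)) \<le>
        sqrt ((LINT x|M. (norm (f n x - f0 x))\<^sup>2) * (LINT x|M. (norm (g x))\<^sup>2))"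
      using L2_Cauchy_Schwarz[OF L2_diff[OF f(1)[of n] f(2)] g] by (simp add: real_le_rsqrt)
  qed
  then show ?thesis by (simp add: LIM_zero_iff)
qed

text \<open>On a finite measure space a Cauchy sequence in L2 is Cauchy in L1, so a subsequence
  converges almost everywhere; Fatou's lemma transfers the Cauchy estimate to the limit.\<close>

theorem L2_complete:
  fixes s :: "nat \<Rightarrow> 'a \<Rightarrow> real"
  assumes fin: "finite_measure M" and s: "\<And>n. L2 M (s n)"
    and cauchy: "\<And>e. e > 0 \<Longrightarrow> \<exists>N. \<forall>m\<ge>N. \<forall>n\<ge>N. (LINT x|M. (s m x - s n x)\<^sup>2) < e"
  shows "\<exists>f. L2 M f \<and> (\<lambda>n. LINT x|M. (s n x - f x)\<^sup>2) \<longlonglongrightarrow> 0"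
proof -
  interpret finite_measure M by fact
  have sm[measurable]: "s n \<in> borel_measurable M" for n using s by (simp add: L2_def)
  have L1: "(LINT x|M. norm (s m x - s n x))\<^sup>2 \<le> (LINT x|M. (s m x - s n x)\<^sup>2) * measure M (space M)" for m n
  proof -
    have "L2 M (\<lambda>x. \<bar>s m x - s n x\<bar>)" using L2_diff[OF s[of m] s[of n]] by (simp add: L2_def)
    moreover have "L2 M (\<lambda>x. 1 :: real)" by (rule L2_bounded[OF fin, of _ 1]) auto
    ultimately show ?thesis using L2_Cauchy_Schwarz[of M "\<lambda>x. \<bar>s m x - s n x\<bar>" "\<lambda>x. 1"] by simp
  qed
  obtain r where r: "strict_mono r" "AE x in M. Cauchy (\<lambda>i. s (r i) x)"
  proof (rule cauchy_L1_AE_cauchy_subseq[of M s])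
    show "integrable M (s n)" for n by (rule L2_integrable[OF fin s])
    fix e :: real assume e: "e > 0"
    let ?K = "measure M (space M) + 1"
    have K: "?K > 0" using measure_nonneg[of M "space M"] by linarith
    then obtain N where N: "\<forall>m\<ge>N. \<forall>n\<ge>N. (LINT x|M. (s m x - s n x)\<^sup>2) < e\<^sup>2 / ?K"
      using cauchy[of "e\<^sup>2 / ?K"] e by auto
    have "LINT x|M. norm (s m x - s n x) < e" if "m \<ge> N" "n \<ge> N" for m n
    proof -
      have "(LINT x|M. norm (s m x - s n x))\<^sup>2 \<le> (LINT x|M. (s m x - s n x)\<^sup>2) * measure M (space M)" by (rule L1)
      also have "\<dots> \<le> (LINT x|M. (s m x - s n x)\<^sup>2) * ?K" by (intro mult_left_mono) auto
      also have "\<dots> < e\<^sup>2" using N that K by (simp add: pos_less_divide_eq)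
      finally show ?thesis using e by (simp add: power2_less_imp_less)
    qed
    then show "\<exists>N. \<forall>i\<ge>N. \<forall>j\<ge>N. LINT x|M. norm (s i x - s j x) < e" by blast
  qed blast
  define f where "f x = lim (\<lambda>i. s (r i) x)" for x
  have [measurable]: "f \<in> borel_measurable M"
    unfolding f_def by (rule borel_measurable_lim_metric) simp
  have lim: "AE x in M. (\<lambda>i. s (r i) x) \<longlonglongrightarrow> f x"
    using r(2) by eventually_elim (simp add: f_def Cauchy_convergent_iff convergent_LIMSEQ_iff)
  have bound: "(\<integral>\<^sup>+x. ennreal ((s n x - f x)\<^sup>2) \<partial>M) \<le> ennreal e"
    if e: "e > 0" and N: "\<forall>m\<ge>N. \<forall>n\<ge>N. (LINT x|M. (s m x - s n x)\<^sup>2) < e" and n: "n \<ge> N" for e N n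
  proof -
    have "(\<integral>\<^sup>+x. ennreal ((s n x - f x)\<^sup>2) \<partial>M) = (\<integral>\<^sup>+x. liminf (\<lambda>i. ennreal ((s n x - s (r i) x)\<^sup>2)) \<partial>M)"
    proof (rule nn_integral_cong_AE)
      show "AE x in M. ennreal ((s n x - f x)\<^sup>2) = liminf (\<lambda>i. ennreal ((s n x - s (r i) x)\<^sup>2))"
        using lim
      proof eventually_elim
        case (elim x)
        have "(\<lambda>i. ennreal ((s n x - s (r i) x)\<^sup>2)) \<longlonglongrightarrow> ennreal ((s n x - f x)\<^sup>2)"
          by (intro tendsto_ennrealI tendsto_intros elim)
        then show ?case by (rule lim_imp_Liminf[OF sequentially_bot, symmetric])
      qed
    qed
    also have "\<dots> \<le> liminf (\<lambda>i. \<integral>\<^sup>+x. ennreal ((s n x - s (r i) x)\<^sup>2) \<partial>M)"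
      by (intro nn_integral_liminf) simp
    also have "\<dots> \<le> ennreal e"
    proof (rule Liminf_le)
      show "\<forall>\<^sub>F i in sequentially. (\<integral>\<^sup>+x. ennreal ((s n x - s (r i) x)\<^sup>2) \<partial>M) \<le> ennreal e"
        using eventually_ge_at_top[of N]
      proof eventually_elim
        case (elim i)
        then have "r i \<ge> N" using strict_mono_imp_increasing[OF r(1), of i] by simp
        then have "(LINT x|M. (s n x - s (r i) x)\<^sup>2) < e" using N n by blast
        moreover have "integrable M (\<lambda>x. (s n x - s (r i) x)\<^sup>2)"
          using L2_diff[OF s[of n] s[of "r i"]] by (simp add: L2_def)
        ultimately show ?case
          by (subst nn_integral_eq_integral) (auto intro!: ennreal_leI)
      qed
    qed simp
    finally show ?thesis .
  qed
  have intD: "integrable M (\<lambda>x. (s n x - f x)\<^sup>2)" and valD: "(LINT x|M. (s n x - f x)\<^sup>2) \<le> e"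
    if e: "e > 0" and N: "\<forall>m\<ge>N. \<forall>n\<ge>N. (LINT x|M. (s m x - s n x)\<^sup>2) < e" and n: "n \<ge> N" for e N n
  proof -
    have b: "(\<integral>\<^sup>+x. ennreal ((s n x - f x)\<^sup>2) \<partial>M) \<le> ennreal e" by (rule bound[OF e N n])
    show i: "integrable M (\<lambda>x. (s n x - f x)\<^sup>2)"
      by (rule integrableI_bounded) (use le_less_trans[OF b ennreal_less_top] in simp_all)
    have "ennreal (LINT x|M. (s n x - f x)\<^sup>2) \<le> ennreal e"
      using b nn_integral_eq_integral[OF i] by simp
    then show "(LINT x|M. (s n x - f x)\<^sup>2) \<le> e" using e by simp
  qed
  obtain N1 where N1: "\<forall>m\<ge>N1. \<forall>n\<ge>N1. (LINT x|M. (s m x - s n x)\<^sup>2) < 1" using cauchy[of 1] by auto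
  have "L2 M (\<lambda>x. s N1 x - f x)"
    using intD[OF _ N1, of N1] by (simp add: L2_def)
  then have "L2 M (\<lambda>x. s N1 x - (s N1 x - f x))" using s L2_diff by blast
  then have "L2 M f" by simp
  moreover have "(\<lambda>n. LINT x|M. (s n x - f x)\<^sup>2) \<longlonglongrightarrow> 0"
  proof (rule LIMSEQ_I)
    fix e :: real assume e: "e > 0"
    then obtain N where N: "\<forall>m\<ge>N. \<forall>n\<ge>N. (LINT x|M. (s m x - s n x)\<^sup>2) < e / 2" using cauchy[of "e / 2"] by auto
    have "norm ((LINT x|M. (s n x - f x)\<^sup>2) - 0) < e" if "n \<ge> N" for n
    proof -
      have "(LINT x|M. (s n x - f x)\<^sup>2) \<le> e / 2" using e by (intro valD[OF _ N that]) simp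
      moreover have "0 \<le> (LINT x|M. (s n x - f x)\<^sup>2)" by simp
      ultimately show ?thesis using e by simp
    qed
    then show "\<exists>N. \<forall>n\<ge>N. norm ((LINT x|M. (s n x - f x)\<^sup>2) - 0) < e" by blast
  qed
  ultimately show ?thesis by blast
qed

text \<open>Pythagoras for a finite orthonormal family. It is read in two ways below: a nonnegative
  left side is Bessel's inequality, and convergence of the coefficient sums to the squared norm is
  convergence of the expansion in L2.\<close>

lemma bessel_identity:
  fixes f :: "'a \<Rightarrow> complex" and e :: "'i \<Rightarrow> 'a \<Rightarrow> complex"
  assumes I: "finite I" and f: "L2 M f" and e: "\<And>i. i \<in> I \<Longrightarrow> L2 M (e i)"
    and on: "\<And>i j. i \<in> I \<Longrightarrow> j \<in> I \<Longrightarrow> (LINT x|M. e i x * cnj (e j x)) = (if i = j then 1 else 0)"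
    and c: "\<And>i. i \<in> I \<Longrightarrow> (LINT x|M. f x * cnj (e i x)) = c i"
  shows "(LINT x|M. (cmod (f x - (\<Sum>i\<in>I. c i * e i x)))\<^sup>2) = (LINT x|M. (cmod (f x))\<^sup>2) - (\<Sum>i\<in>I. (cmod (c i))\<^sup>2)"
proof -
  define g where "g x = (\<Sum>i\<in>I. c i * e i x)" for x
  have g: "L2 M g" unfolding g_def by (intro L2_sum L2_cmult e)
  have int: "integrable M (\<lambda>x. u x * cnj (v x))" if "L2 M u" "L2 M v" for u v :: "'a \<Rightarrow> complex"
    using L2_mult_integrable[OF that(1) L2_cnj[OF that(2)]] .
  have fg: "(LINT x|M. f x * cnj (g x)) = (\<Sum>i\<in>I. c i * cnj (c i))"
  proof -
    have "(LINT x|M. f x * cnj (g x)) = (LINT x|M. (\<Sum>i\<in>I. cnj (c i) * (f x * cnj (e i x))))"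
      by (simp add: g_def sum_distrib_left mult_ac)
    also have "\<dots> = (\<Sum>i\<in>I. cnj (c i) * (LINT x|M. f x * cnj (e i x)))"
      using f e by (subst Bochner_Integration.integral_sum) (auto intro!: integrable_mult_right int)
    also have "\<dots> = (\<Sum>i\<in>I. c i * cnj (c i))" by (intro sum.cong) (auto simp: c)
    finally show ?thesis .
  qed
  have eg: "(LINT x|M. e i x * cnj (g x)) = cnj (c i)" if i: "i \<in> I" for i
  proof -
    have "(LINT x|M. e i x * cnj (g x)) = (LINT x|M. (\<Sum>j\<in>I. cnj (c j) * (e i x * cnj (e j x))))"
      by (simp add: g_def sum_distrib_left mult_ac)
    also have "\<dots> = (\<Sum>j\<in>I. cnj (c j) * (LINT x|M. e i x * cnj (e j x)))"
      using i e by (subst Bochner_Integration.integral_sum) (auto intro!: integrable_mult_right int)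
    also have "\<dots> = (\<Sum>j\<in>I. if i = j then cnj (c i) else 0)" using i by (intro sum.cong) (auto simp: on)
    finally show ?thesis using I i by simp
  qed
  have gg: "(LINT x|M. g x * cnj (g x)) = (\<Sum>i\<in>I. c i * cnj (c i))"
  proof -
    have "g x * cnj (g x) = (\<Sum>i\<in>I. c i * (e i x * cnj (g x)))" for x
    proof -
      have "g x * cnj (g x) = (\<Sum>i\<in>I. c i * e i x) * cnj (g x)" by (simp only: g_def)
      then show ?thesis by (simp only: sum_distrib_right mult.assoc)
    qed
    then have "(LINT x|M. g x * cnj (g x)) = (LINT x|M. (\<Sum>i\<in>I. c i * (e i x * cnj (g x))))"
      by (simp only:)
    also have "\<dots> = (\<Sum>i\<in>I. c i * (LINT x|M. e i x * cnj (g x)))"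
      using g e by (subst Bochner_Integration.integral_sum) (auto intro!: integrable_mult_right int)
    also have "\<dots> = (\<Sum>i\<in>I. c i * cnj (c i))" by (intro sum.cong) (auto simp: eg)
    finally show ?thesis .
  qed
  have gf: "(LINT x|M. g x * cnj (f x)) = (\<Sum>i\<in>I. c i * cnj (c i))"
  proof -
    have "(LINT x|M. g x * cnj (f x)) = (LINT x|M. cnj (f x * cnj (g x)))" by (simp add: mult_ac)
    also have "\<dots> = cnj (LINT x|M. f x * cnj (g x))" by (rule integral_bounded_linear[OF bounded_linear_cnj int[OF f g]])
    also have "\<dots> = (\<Sum>i\<in>I. c i * cnj (c i))" unfolding fg by (simp add: mult_ac)
    finally show ?thesis .
  qed
  have sq: "of_real (LINT x|M. (cmod (u x))\<^sup>2) = (LINT x|M. u x * cnj (u x))" for u :: "'a \<Rightarrow> complex"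
    by (simp add: complex_norm_square[symmetric] flip: integral_complex_of_real)
  have "complex_of_real (LINT x|M. (cmod (f x - g x))\<^sup>2) = (LINT x|M. (f x - g x) * cnj (f x - g x))"
    by (rule sq)
  also have "\<dots> = (LINT x|M. (f x * cnj (f x) - f x * cnj (g x)) - (g x * cnj (f x) - g x * cnj (g x)))"
    by (simp add: algebra_simps)
  also have "\<dots> = ((LINT x|M. f x * cnj (f x)) - (LINT x|M. f x * cnj (g x))) - ((LINT x|M. g x * cnj (f x)) - (LINT x|M. g x * cnj (g x)))"
    using f g by (simp add: int)
  also have "\<dots> = of_real (LINT x|M. (cmod (f x))\<^sup>2) - (\<Sum>i\<in>I. c i * cnj (c i))"
    unfolding fg gf gg sq by simp
  also have "\<dots> = of_real ((LINT x|M. (cmod (f x))\<^sup>2) - (\<Sum>i\<in>I. (cmod (c i))\<^sup>2))"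
    by (simp only: of_real_diff of_real_sum complex_norm_square)
  finally show ?thesis unfolding g_def of_real_eq_iff .
qed

section \<open>One-dimensional Fourier analysis of the kernels\<close>

definition fexp :: "real \<Rightarrow> real \<Rightarrow> int \<Rightarrow> real \<Rightarrow> complex" where
  "fexp a b h x = exp (\<i> * of_real (2 * pi * of_int h * (x - a) / (b - a))) / of_real (sqrt (b - a))"

definition freq :: "real \<Rightarrow> real \<Rightarrow> int \<Rightarrow> real" where
  "freq a b h = 2 * pi * of_int h / (b - a)"

lemma freq_eq_0_iff: "a < b \<Longrightarrow> freq a b h = 0 \<longleftrightarrow> h = 0"
  by (simp add: freq_def)

lemma freq_uminus [simp]: "freq a b (- h) = - freq a b h"
  by (simp add: freq_def)

lemma kor_weight1_freq: "a < b \<Longrightarrow> h \<noteq> 0 \<Longrightarrow> kor_weight1 \<alpha> a b h = \<bar>freq a b h\<bar> ^ \<alpha>"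
  by (simp add: kor_weight1_def freq_def power_divide abs_divide)

lemma kor_weight1_pos: "a < b \<Longrightarrow> kor_weight1 \<alpha> a b h > 0"
  by (simp add: kor_weight1_def)

lemma cmod_fexp: "a < b \<Longrightarrow> cmod (fexp a b h x) = 1 / sqrt (b - a)"
  by (simp add: fexp_def norm_divide)

lemma cnj_fexp: "cnj (fexp a b h x) = fexp a b (- h) x"
  by (simp add: fexp_def exp_cnj)

lemma fexp_0: "fexp a b 0 x = of_real (1 / sqrt (b - a))"
  by (simp add: fexp_def)

lemma fexp_mult: "fexp a b h x * fexp a b k x = fexp a b (h + k) x / of_real (sqrt (b - a))"
proof -
  have r: "2 * pi * of_int (h + k) * (x - a) / (b - a) =
      2 * pi * of_int h * (x - a) / (b - a) + 2 * pi * of_int k * (x - a) / (b - a)"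
    by (simp add: add_divide_distrib[symmetric] ring_distribs)
  show ?thesis unfolding fexp_def r of_real_add distrib_left exp_add by simp
qed

lemma fexp_has_vector_derivative:
  "(fexp a b h has_vector_derivative (\<i> * of_real (freq a b h)) * fexp a b h x) (at x within S)"
proof (cases "b = a")
  case True
  then have "fexp a b h = (\<lambda>_. 0)" by (auto simp: fexp_def)
  then show ?thesis by simp
next
  case False
  then have "((\<lambda>z. exp (\<i> * (of_real (2 * pi * of_int h) * (z - of_real a) / of_real (b - a))) / of_real (sqrt (b - a)))
     has_field_derivative (\<i> * of_real (freq a b h)) * fexp a b h x) (at (of_real x))"
    by (auto intro!: derivative_eq_intros simp: fexp_def freq_def)
  from has_vector_derivative_real_field[OF this]
  show ?thesis by (simp add: fexp_def[abs_def])
qed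

lemma fexp_continuous: "continuous_on S (fexp a b h)"
  using fexp_has_vector_derivative by (auto intro!: continuous_on_vector_derivative)

lemma fexp_measurable [measurable]: "fexp a b h \<in> borel_measurable borel"
  by (intro borel_measurable_continuous_onI fexp_continuous)

lemma fexp_periodic: "a < b \<Longrightarrow> fexp a b h a = fexp a b h b"
proof -
  assume "a < b"
  then have r: "2 * pi * of_int h * (b - a) / (b - a) = 2 * pi * of_int h" by simp
  have "exp (\<i> * of_real (2 * pi * of_int h)) = 1"
    by (auto simp: exp_eq_1 intro!: exI[of _ h])
  then show ?thesis unfolding fexp_def r by simp
qed

lemma fexp_integrable: "set_integrable lborel {a..b} (fexp a b h)"
  by (rule borel_integrable_atLeastAtMost'[OF fexp_continuous])

lemma fexp_integral:
  assumes ab: "a < b"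
  shows "(LINT x:{a..b}|lborel. fexp a b h x) = (if h = 0 then of_real (sqrt (b - a)) else 0)"
proof (cases "h = 0")
  case True
  have "(LINT x:{a..b}|lborel. fexp a b h x) = of_real ((b - a) / sqrt (b - a))"
    using ab True by (simp add: fexp_0 set_lebesgue_integral_def scaleR_conv_of_real)
  then show ?thesis using True ab by (simp add: real_div_sqrt)
next
  case False
  let ?w = "\<i> * of_real (freq a b h)"
  have w: "?w \<noteq> 0" using False ab by (simp add: freq_eq_0_iff)
  have "((\<lambda>x. ?w * fexp a b h x) has_integral fexp a b h b - fexp a b h a) {a..b}"
    using ab by (intro fundamental_theorem_of_calculus fexp_has_vector_derivative) auto
  then have "((\<lambda>x. inverse ?w * (?w * fexp a b h x)) has_integral inverse ?w * 0) {a..b}"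
    unfolding fexp_periodic[OF ab] by (intro has_integral_mult_right) simp
  moreover have "inverse v * (v * z) = z" if "v \<noteq> 0" for v z :: complex
    using that by (simp add: mult.assoc[symmetric])
  note this[OF w]
  ultimately have "(fexp a b h has_integral 0) {a..b}" by (simp only: mult_zero_right)
  then show ?thesis using False by (simp add: LBINT_eq_has_integral[OF fexp_integrable])
qed

lemma fexp_orthonormal:
  assumes ab: "a < b"
  shows "(LINT x:{a..b}|lborel. fexp a b h x * cnj (fexp a b k x)) = (if h = k then 1 else 0)"
proof -
  have "(LINT x:{a..b}|lborel. fexp a b h x * cnj (fexp a b k x)) = (LINT x:{a..b}|lborel. fexp a b (h - k) x) / of_real (sqrt (b - a))"
    unfolding cnj_fexp fexp_mult by simp
  also have "\<dots> = (if h = k then 1 else 0)" using ab by (simp add: fexp_integral)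
  finally show ?thesis .
qed

lemma set_integrable_scaleR_bounded:
  fixes f :: "real \<Rightarrow> real" and g :: "real \<Rightarrow> complex"
  assumes "f \<in> borel_measurable borel" "\<And>x. x \<in> {a..b} \<Longrightarrow> \<bar>f x\<bar> \<le> B" "continuous_on UNIV g"
  shows "set_integrable lborel {a..b} (\<lambda>x. f x *\<^sub>R g x)"
proof -
  have "bounded (g ` {a..b})"
    using assms(3) by (intro compact_imp_bounded compact_continuous_image) (auto intro: continuous_on_subset)
  then obtain C where C: "\<And>x. x \<in> {a..b} \<Longrightarrow> norm (g x) \<le> C" unfolding bounded_iff by blast
  have [measurable]: "g \<in> borel_measurable borel" using assms(3) by (rule borel_measurable_continuous_onI)
  show ?thesis
  proof (rule set_integrable_bounded[where B="\<bar>B\<bar> * \<bar>C\<bar>"])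
    fix x assume x: "x \<in> {a..b}"
    have "\<bar>f x\<bar> \<le> \<bar>B\<bar>" "norm (g x) \<le> \<bar>C\<bar>" using assms(2)[OF x] C[OF x] by linarith+
    then show "norm (f x *\<^sub>R g x) \<le> \<bar>B\<bar> * \<bar>C\<bar>" by (simp add: mult_mono)
  qed (use assms(1) in measurable)
qed

text \<open>By \<open>pbern_parts_left\<close> the integrals satisfy
  \<open>I (Suc k) = ((if k = 0 then fexp a b h t else 0) - I k) / w\<close> with
  \<open>I 0 = 0\<close>, as \<open>fexp\<close> has mean zero for \<open>h \<noteq> 0\<close>. The
  alternating signs are collected in the power of \<open>- w\<close>.\<close>

lemma pbern_fourier_left:
  assumes ab: "a < b" and t: "t \<in> {a..b}" and h: "h \<noteq> 0" and m: "m \<ge> 1"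
  shows "(LINT x:{a..b}|lborel. pbern a b m x t *\<^sub>R fexp a b h x) = - fexp a b h t / (- (\<i> * of_real (freq a b h))) ^ m"
proof -
  define w where "w = \<i> * complex_of_real (freq a b h)"
  have w: "w \<noteq> 0" using h ab by (simp add: w_def freq_eq_0_iff)
  have d: "(fexp a b h has_vector_derivative w * fexp a b h x) (at x within S)" for x S
    unfolding w_def by (rule fexp_has_vector_derivative)
  have int: "set_integrable lborel {a..b} (\<lambda>x. pbern a b k x t *\<^sub>R fexp a b h x)" for k
  proof -
    obtain B where "\<forall>x\<in>{a..b}. \<forall>t\<in>{a..b}. \<bar>pbern a b k x t\<bar> \<le> B" using pbern_bounded[OF ab] by blast
    then show ?thesis using t by (intro set_integrable_scaleR_bounded[where B=B] fexp_continuous) auto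
  qed
  have step: "(LINT x:{a..b}|lborel. pbern a b (Suc k) x t *\<^sub>R fexp a b h x) =
      ((if k = 0 then fexp a b h t else 0) - (LINT x:{a..b}|lborel. pbern a b k x t *\<^sub>R fexp a b h x)) / w" for k
  proof -
    have eq: "pbern a b (Suc k) x t *\<^sub>R (w * fexp a b h x) = w * (pbern a b (Suc k) x t *\<^sub>R fexp a b h x)" for x
      by simp
    have "(LINT x:{a..b}|lborel. w * (pbern a b (Suc k) x t *\<^sub>R fexp a b h x) + pbern a b k x t *\<^sub>R fexp a b h x) =
        (if k = 0 then fexp a b h t else 0)"
    proof (rule LBINT_eq_has_integral)
      show "set_integrable lborel {a..b} (\<lambda>x. w * (pbern a b (Suc k) x t *\<^sub>R fexp a b h x) + pbern a b k x t *\<^sub>R fexp a b h x)"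
        by (intro set_integral_add set_integrable_mult_right int)
      show "((\<lambda>x. w * (pbern a b (Suc k) x t *\<^sub>R fexp a b h x) + pbern a b k x t *\<^sub>R fexp a b h x) has_integral
          (if k = 0 then fexp a b h t else 0)) {a..b}"
        using pbern_parts_left[where m=k and \<psi>="fexp a b h" and \<psi>'="\<lambda>x. w * fexp a b h x", OF ab d fexp_periodic[OF ab] t] unfolding eq .
    qed
    then have "w * (LINT x:{a..b}|lborel. pbern a b (Suc k) x t *\<^sub>R fexp a b h x) + (LINT x:{a..b}|lborel. pbern a b k x t *\<^sub>R fexp a b h x) =
        (if k = 0 then fexp a b h t else 0)"
      unfolding set_integral_add(2)[OF set_integrable_mult_right[OF int] int] set_integral_mult_right .
    then have "w * (LINT x:{a..b}|lborel. pbern a b (Suc k) x t *\<^sub>R fexp a b h x) =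
        (if k = 0 then fexp a b h t else 0) - (LINT x:{a..b}|lborel. pbern a b k x t *\<^sub>R fexp a b h x)"
      by (simp only: eq_diff_eq)
    then show ?thesis using w by (simp add: nonzero_eq_divide_eq mult.commute)
  qed
  show ?thesis unfolding w_def[symmetric] using m
  proof (induction m rule: nat_induct_at_least)
    case base
    have "(LINT x:{a..b}|lborel. pbern a b 0 x t *\<^sub>R fexp a b h x) = of_real (1 / (b - a)) * (LINT x:{a..b}|lborel. fexp a b h x)"
      by (simp add: scaleR_conv_of_real)
    then have "(LINT x:{a..b}|lborel. pbern a b 0 x t *\<^sub>R fexp a b h x) = 0"
      using h by (simp add: fexp_integral[OF ab])
    then show ?case using step[of 0] by simp
  next
    case (Suc m)
    then have "m \<noteq> 0" by simp
    then show ?case using step[of m] w by (simp add: Suc.IH field_simps)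
  qed
qed

text \<open>The Sobolev spaces consist of real functions, so exponentials enter through
  \<open>Re\<close> and \<open>Im\<close>; \<open>L\<close> stands for either of them.\<close>

lemma Re_Im_jet:
  assumes ab: "a < b" and \<alpha>: "\<alpha> \<ge> 1" and L: "L = Re \<or> L = Im"
  shows "sob1_jet \<alpha> a b (\<lambda>x. L (fexp a b h x)) (\<lambda>k x. L ((\<i> * of_real (freq a b h)) ^ k * fexp a b h x))"
proof -
  let ?w = "\<i> * of_real (freq a b h)"
  have bl: "bounded_linear L" using L bounded_linear_Re bounded_linear_Im by auto
  have d: "((\<lambda>x. L (?w ^ k * fexp a b h x)) has_real_derivative L (?w ^ Suc k * fexp a b h x)) (at x within S)" for k x S
  proof -
    have "((\<lambda>x. ?w ^ k * fexp a b h x) has_vector_derivative ?w ^ k * (?w * fexp a b h x)) (at x within S)"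
      by (rule has_vector_derivative_mult_right[OF fexp_has_vector_derivative])
    from bounded_linear.has_vector_derivative[OF bl this]
    show ?thesis by (simp add: has_real_derivative_iff_has_vector_derivative mult_ac)
  qed
  have c: "continuous_on S (\<lambda>x. L (?w ^ k * fexp a b h x))" for k S
    by (intro bounded_linear.continuous_on[OF bl] continuous_intros fexp_continuous)
  have ac: "abs_continuous_on a b (\<lambda>x. L (?w ^ k * fexp a b h x))" for k
  proof -
    obtain K where "\<forall>x\<in>{a..b}. \<forall>y\<in>{a..b}. \<bar>L (?w ^ k * fexp a b h x) - L (?w ^ k * fexp a b h y)\<bar> \<le> K * \<bar>x - y\<bar>"
      using C1_lipschitz[of a b "\<lambda>x. L (?w ^ k * fexp a b h x)" "\<lambda>x. L (?w ^ Suc k * fexp a b h x)", OF d c] by blast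
    then show ?thesis by (intro lipschitz_imp_abs_continuous[of _ _ _ K]) auto
  qed
  have cm: "continuous_on UNIV (\<lambda>x. L (?w ^ \<alpha> * fexp a b h x))" by (rule c)
  have m: "set_borel_measurable lborel {a..b} (\<lambda>x. L (?w ^ \<alpha> * fexp a b h x))"
    using borel_measurable_continuous_onI[OF cm] unfolding set_borel_measurable_def by simp
  have i: "set_integrable lborel {a..b} (\<lambda>x. (L (?w ^ \<alpha> * fexp a b h x))\<^sup>2)"
    by (intro borel_integrable_atLeastAtMost' continuous_intros c)
  show ?thesis unfolding sob1_jet_def using ac d m i by (auto intro!: AE_I2)
qed

text \<open>In the representation formula for the real and imaginary parts of \<open>fexp\<close>
  all mean values vanish. What is left is the integral of \<open>pbern\<close> against the
  derivative of order \<open>m\<close>, which is \<open>fexp\<close> times a constant.\<close>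

lemma pbern_fourier_right:
  assumes ab: "a < b" and x: "x \<in> {a..b}" and h: "h \<noteq> 0" and m: "m \<ge> 1"
  shows "(LINT t:{a..b}|lborel. pbern a b m x t *\<^sub>R fexp a b h t) = - fexp a b h x / (\<i> * of_real (freq a b h)) ^ m"
proof -
  let ?w = "\<i> * of_real (freq a b h)"
  have w: "?w \<noteq> 0" using h ab by (simp add: freq_eq_0_iff)
  obtain B where B: "\<forall>x\<in>{a..b}. \<forall>t\<in>{a..b}. \<bar>pbern a b m x t\<bar> \<le> B" using pbern_bounded[OF ab] by blast
  have int: "set_integrable lborel {a..b} (\<lambda>t. pbern a b m x t *\<^sub>R (?w ^ m * fexp a b h t))"
    using B x by (intro set_integrable_scaleR_bounded[where B=B] continuous_intros fexp_continuous) auto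
  have cint: "set_integrable lborel {a..b} (\<lambda>t. ?w ^ k * fexp a b h t)" for k
    by (intro set_integrable_mult_right fexp_integrable)
  have z: "(LINT t:{a..b}|lborel. ?w ^ k * fexp a b h t) = 0" for k
    using h by (simp add: fexp_integral[OF ab])
  have LI: "(LINT t:{a..b}|lborel. L (g t)) = L (LINT t:{a..b}|lborel. g t)"
    if "L = Re \<or> L = Im" "set_integrable lborel {a..b} g" for L g
  proof -
    have bl: "bounded_linear L" using that(1) bounded_linear_Re bounded_linear_Im by auto
    have "indicat_real {a..b} x *\<^sub>R L (g x) = L (indicat_real {a..b} x *\<^sub>R g x)" for x
      using that(1) by auto
    then show ?thesis
      using integral_bounded_linear[OF bl that(2)[unfolded set_integrable_def]]
      unfolding set_lebesgue_integral_def by (simp only:)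
  qed
  have "L (fexp a b h x) = L (- (LINT t:{a..b}|lborel. pbern a b m x t *\<^sub>R (?w ^ m * fexp a b h t)))"
    if L: "L = Re \<or> L = Im" for L
  proof -
    have add: "L (u - v) = L u - L v" "L (r *\<^sub>R u) = r * L u" "L (- u) = - L u" "L 0 = 0" for u v r using L by auto
    have i2: "set_integrable lborel {a..b} (\<lambda>t. nbern a b m x *\<^sub>R (?w ^ m * fexp a b h t))"
      using cint[of m] by (simp add: set_integrable_scaleR_right)
    have zz: "(LINT t:{a..b}|lborel. L (?w ^ k * fexp a b h t)) = 0" for k
      unfolding LI[OF L cint] z add ..
    have "L (fexp a b h x) = (\<Sum>i<m. nbern a b i x * (LINT t:{a..b}|lborel. L (?w ^ i * fexp a b h t))) +
        (LINT t:{a..b}|lborel. (nbern a b m x - pbern a b m x t) * L (?w ^ m * fexp a b h t))"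
      by (rule sob1_representation[OF ab Re_Im_jet[OF ab m L] x m]) simp
    also have "\<dots> = (LINT t:{a..b}|lborel. L (nbern a b m x *\<^sub>R (?w ^ m * fexp a b h t) - pbern a b m x t *\<^sub>R (?w ^ m * fexp a b h t)))"
      unfolding zz add by (simp add: left_diff_distrib)
    also have "\<dots> = L (LINT t:{a..b}|lborel. nbern a b m x *\<^sub>R (?w ^ m * fexp a b h t) - pbern a b m x t *\<^sub>R (?w ^ m * fexp a b h t))"
      by (rule LI[OF L set_integral_diff(1)[OF i2 int]])
    also have "\<dots> = L (- (LINT t:{a..b}|lborel. pbern a b m x t *\<^sub>R (?w ^ m * fexp a b h t)))"
      unfolding set_integral_diff(2)[OF i2 int] set_integral_scaleR_right z by simp
    finally show ?thesis .
  qed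
  then have "fexp a b h x = - (LINT t:{a..b}|lborel. pbern a b m x t *\<^sub>R (?w ^ m * fexp a b h t))"
    by (intro complex_eqI) blast+
  also have "(\<lambda>t. pbern a b m x t *\<^sub>R (?w ^ m * fexp a b h t)) = (\<lambda>t. ?w ^ m * (pbern a b m x t *\<^sub>R fexp a b h t))"
    by simp
  also have "(LINT t:{a..b}|lborel. ?w ^ m * (pbern a b m x t *\<^sub>R fexp a b h t)) = ?w ^ m * (LINT t:{a..b}|lborel. pbern a b m x t *\<^sub>R fexp a b h t)"
    by (rule set_integral_mult_right)
  finally show ?thesis using w by (simp add: field_simps)
qed

text \<open>From degree 2 on, the two branches of \<open>pbern\<close> agree at the break
  \<open>t = x\<close>, so the function of \<open>t\<close> is Lipschitz across it; the derivative
  may fail to exist at this single point only.\<close>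

lemma pbern_ac:
  assumes ab: "a < b" and x: "x \<in> {a..b}" and n: "n \<ge> 1"
  shows "ac_deriv a b (\<lambda>t. pbern a b (Suc n) x t) (\<lambda>t. - pbern a b n x t)"
  unfolding ac_deriv_def
proof (intro conjI)
  have d: "((\<lambda>t. nbern a b (Suc n) (c - t)) has_real_derivative - nbern a b n (c - t)) (at t)" for c t
  proof -
    have "((\<lambda>t. c - t) has_real_derivative -1) (at t)" by (auto intro!: derivative_eq_intros)
    from DERIV_chain2[where f="nbern a b (Suc n)" and g="\<lambda>t. c - t", OF nbern_has_derivative[OF ab] this]
    show ?thesis by simp
  qed
  obtain L where L: "\<forall>u\<in>{a..b}. \<forall>v\<in>{a..b}. \<bar>nbern a b (Suc n) u - nbern a b (Suc n) v\<bar> \<le> L * \<bar>u - v\<bar>"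
    using C1_lipschitz[of a b "nbern a b (Suc n)" "nbern a b n", OF has_field_derivative_at_within[OF nbern_has_derivative[OF ab]] nbern_continuous[OF ab]]
    by blast
  have jump: "nbern a b (Suc n) b = nbern a b (Suc n) a" using nbern_jump[OF ab, of n] n by simp
  have mixed: "\<bar>pbern a b (Suc n) x t - pbern a b (Suc n) x u\<bar> \<le> L * (u - t)"
    if "a \<le> t" "t \<le> u" "u \<le> b" for t u
  proof -
    consider "u \<le> x" | "x < t" | "t \<le> x" "x < u" by linarith
    then show ?thesis
    proof cases
      case 1
      then show ?thesis using that x L[rule_format, of "x - t + a" "x - u + a"] by (simp add: pbern_def)
    next
      case 2
      then show ?thesis using that x L[rule_format, of "x - t + b" "x - u + b"] by (simp add: pbern_def)
    next
      case 3
      have "\<bar>nbern a b (Suc n) (x - t + a) - nbern a b (Suc n) a\<bar> \<le> L * (x - t)"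
        using that x 3 ab L[rule_format, of "x - t + a" a] by simp
      moreover have "\<bar>nbern a b (Suc n) b - nbern a b (Suc n) (x - u + b)\<bar> \<le> L * (u - x)"
        using that x 3 ab L[rule_format, of b "x - u + b"] by simp
      moreover have "L * (u - t) = L * (x - t) + L * (u - x)" by (simp add: algebra_simps)
      ultimately show ?thesis using 3 jump by (simp add: pbern_def)
    qed
  qed
  show "abs_continuous_on a b (pbern a b (Suc n) x)"
  proof (rule lipschitz_imp_abs_continuous[of _ _ _ L])
    fix t u assume "t \<in> {a..b}" "u \<in> {a..b}"
    then show "\<bar>pbern a b (Suc n) x t - pbern a b (Suc n) x u\<bar> \<le> L * \<bar>t - u\<bar>"
      using mixed[of t u] mixed[of u t] by (cases "t \<le> u") (auto simp: abs_minus_commute)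
  qed
  have "AE t in lborel. t \<noteq> x" by (rule AE_lborel_singleton)
  then show "AE t\<in>{a..b} in lborel. (pbern a b (Suc n) x has_real_derivative - pbern a b n x t) (at t within {a..b})"
  proof eventually_elim
    case (elim t)
    have "(pbern a b (Suc n) x has_real_derivative - pbern a b n x t) (at t)"
    proof (cases "t < x")
      case True
      have "(pbern a b (Suc n) x has_real_derivative - nbern a b n (x + a - t)) (at t)"
      proof (rule has_field_derivative_transform_within_open[OF d open_lessThan])
        show "t \<in> {..<x}" using True by simp
        fix s assume s: "s \<in> {..<x}"
        have e: "x + a - s = x - s + a" by simp
        show "nbern a b (Suc n) (x + a - s) = pbern a b (Suc n) x s" unfolding e using s by (simp add: pbern_def)
      qed
      moreover have "pbern a b n x t = nbern a b n (x - t + a)" using True by (simp add: pbern_def)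
      moreover have "x - t + a = x + a - t" by simp
      ultimately show ?thesis by (simp only:)
    next
      case False
      have "(pbern a b (Suc n) x has_real_derivative - nbern a b n (x + b - t)) (at t)"
      proof (rule has_field_derivative_transform_within_open[OF d open_greaterThan])
        show "t \<in> {x<..}" using False elim by simp
        fix s assume s: "s \<in> {x<..}"
        have e: "x + b - s = x - s + b" by simp
        show "nbern a b (Suc n) (x + b - s) = pbern a b (Suc n) x s" unfolding e using s by (simp add: pbern_def)
      qed
      moreover have "pbern a b n x t = nbern a b n (x - t + b)" using False elim by (simp add: pbern_def)
      moreover have "x - t + b = x + b - t" by simp
      ultimately show ?thesis by (simp only:)
    qed
    then show ?case using has_field_derivative_at_within by blast
  qed
qed

section \<open>Convolutions of periodic Bernoulli kernels and the even power sums\<close>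

lemma pbern_mult_integrable:
  assumes ab: "a < b" and x: "x \<in> {a..b}" and y: "y \<in> {a..b}"
  shows "set_integrable lborel {a..b} (\<lambda>t. pbern a b k y t * pbern a b n x t)"
proof -
  obtain B where "\<forall>x\<in>{a..b}. \<forall>t\<in>{a..b}. \<bar>pbern a b k x t\<bar> \<le> B" using pbern_bounded[OF ab] by blast
  then show ?thesis using x y
    by (intro set_integrable_bounded_mult[where B=B] pbern_integrable(2)[OF ab]) auto
qed

text \<open>Each integration by parts moves one degree from the first factor to the second, changes
  the sign, and has no boundary term because the second factor is periodic. At degree 1 the jump of
  the first factor evaluates the second at \<open>y\<close>, whose integral against the constant of
  degree 0 is zero.\<close>

lemma pbern_convolution:
  assumes ab: "a < b" and x: "x \<in> {a..b}" and y: "y \<in> {a..b}" and n: "n \<ge> 1"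
  shows "(LINT t:{a..b}|lborel. pbern a b (Suc k) y t * pbern a b n x t) = (-1) ^ k * pbern a b (n + Suc k) x y"
  using n
proof (induction k arbitrary: n)
  case (0 n)
  note int = pbern_mult_integrable[OF ab x y]
  have per: "pbern a b (Suc n) x b = pbern a b (Suc n) x a"
    using nbern_jump[OF ab, of n] 0 x by (auto simp: pbern_def)
  have i1: "set_integrable lborel {a..b} (\<lambda>t. - (pbern a b 1 y t * pbern a b n x t))"
    using int[of 1 n] by (simp add: set_integrable_def)
  have i2: "set_integrable lborel {a..b} (\<lambda>t. (1 / (b - a)) * pbern a b (Suc n) x t)"
    by (intro set_integrable_mult_right pbern_integrable(2)[OF ab x])
  have "((\<lambda>t. - (pbern a b 1 y t * pbern a b n x t) - (1 / (b - a)) * pbern a b (Suc n) x t) has_integral - pbern a b (Suc n) x y) {a..b}"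
    using pbern_parts_right[OF ab pbern_ac[OF ab x 0] y, of 0] per by (simp add: mult_ac)
  then have "(LINT t:{a..b}|lborel. - (pbern a b 1 y t * pbern a b n x t) - (1 / (b - a)) * pbern a b (Suc n) x t) = - pbern a b (Suc n) x y"
    by (rule LBINT_eq_has_integral[OF set_integral_diff(1)[OF i1 i2]])
  moreover have "(LINT t:{a..b}|lborel. - (pbern a b 1 y t * pbern a b n x t) - (1 / (b - a)) * pbern a b (Suc n) x t) =
      - (LINT t:{a..b}|lborel. pbern a b 1 y t * pbern a b n x t) - (1 / (b - a)) * (LINT t:{a..b}|lborel. pbern a b (Suc n) x t)"
    unfolding set_integral_diff(2)[OF i1 i2] by (simp add: set_lebesgue_integral_def)
  ultimately show ?case using pbern_integral_right[OF ab x, of "Suc n"] by simp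
next
  case (Suc k n)
  note int = pbern_mult_integrable[OF ab x y]
  have "pbern a b (Suc n) x b = pbern a b (Suc n) x a"
    using nbern_jump[OF ab, of n] Suc.prems x by (auto simp: pbern_def)
  then have "((\<lambda>t. - (pbern a b (Suc (Suc k)) y t * pbern a b n x t) - pbern a b (Suc k) y t * pbern a b (Suc n) x t) has_integral 0) {a..b}"
    using pbern_parts_right[OF ab pbern_ac[OF ab x Suc.prems] y, of "Suc k"] by simp
  from has_integral_neg[OF this]
  have "((\<lambda>t. pbern a b (Suc (Suc k)) y t * pbern a b n x t + pbern a b (Suc k) y t * pbern a b (Suc n) x t) has_integral 0) {a..b}"
    by (simp add: add.commute)
  then have "(LINT t:{a..b}|lborel. pbern a b (Suc (Suc k)) y t * pbern a b n x t + pbern a b (Suc k) y t * pbern a b (Suc n) x t) = 0"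
    by (intro LBINT_eq_has_integral set_integral_add int)
  then have "(LINT t:{a..b}|lborel. pbern a b (Suc (Suc k)) y t * pbern a b n x t) + (LINT t:{a..b}|lborel. pbern a b (Suc k) y t * pbern a b (Suc n) x t) = 0"
    unfolding set_integral_add(2)[OF int int] .
  then show ?case using Suc.IH[of "Suc n"] by simp
qed

lemma pbern_square_integral:
  assumes ab: "a < b" and x: "x \<in> {a..b}" and m: "m \<ge> 1"
  shows "(LINT t:{a..b}|lborel. (pbern a b m x t)\<^sup>2) = (-1) ^ (m + 1) * nbern a b (2 * m) a"
proof -
  obtain k where k: "m = Suc k" using m by (cases m) auto
  have "(LINT t:{a..b}|lborel. pbern a b (Suc k) x t * pbern a b m x t) = (-1) ^ k * pbern a b (m + Suc k) x x"
    by (rule pbern_convolution[OF ab x x m])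
  then show ?thesis by (simp add: k power2_eq_square pbern_def mult_2)
qed

definition nzset :: "nat \<Rightarrow> int set" where
  "nzset N = {- int N..int N} - {0}"

lemma sum_interval_nzset: "(\<Sum>h\<in>{- int N..int N}. f h) = f 0 + (\<Sum>h\<in>nzset N. f h)"
  unfolding nzset_def by (subst sum.remove[of _ 0]) auto

lemma sum_nzset_even:
  fixes f :: "int \<Rightarrow> real"
  assumes "\<And>h. f (- h) = f h"
  shows "(\<Sum>h\<in>nzset N. f h) = 2 * (\<Sum>n<N. f (int n + 1))"
proof (induction N)
  case 0
  show ?case by (simp add: nzset_def)
next
  case (Suc N)
  have "nzset (Suc N) = insert (int N + 1) (insert (- (int N + 1)) (nzset N))"
    by (auto simp: nzset_def)
  then show ?case using Suc assms[of "int N + 1"] by (simp add: nzset_def)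
qed

text \<open>The limit is the squared L2 norm of \<open>pbern a b 1 x\<close> on the interval (by
  \<open>pbern_square_integral\<close> and \<open>nbern_2\<close>), so this is Parseval's equality
  for the kernel of degree 1, obtained here from the Basel sum.\<close>

lemma basel_freq:
  assumes ab: "a < b"
  shows "(\<lambda>N. \<Sum>h\<in>nzset N. 1 / ((b - a) * (freq a b h)\<^sup>2)) \<longlonglongrightarrow> (b - a) / 12"
proof -
  have "(\<Sum>h\<in>nzset N. 1 / ((b - a) * (freq a b h)\<^sup>2)) = (b - a) / (2 * pi\<^sup>2) * (\<Sum>n<N. 1 / (real n + 1)\<^sup>2)" for N
  proof -
    have "(\<Sum>h\<in>nzset N. 1 / ((b - a) * (freq a b h)\<^sup>2)) = 2 * (\<Sum>n<N. 1 / ((b - a) * (freq a b (int n + 1))\<^sup>2))"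
      by (rule sum_nzset_even) simp
    also have "\<dots> = (\<Sum>n<N. (b - a) / (2 * pi\<^sup>2) * (1 / (real n + 1)\<^sup>2))"
      unfolding sum_distrib_left
    proof (intro sum.cong refl)
      fix n
      have "2 * (1 / (c * (2 * pi * r / c)\<^sup>2)) = c / (2 * pi\<^sup>2) * (1 / r\<^sup>2)" if "c \<noteq> 0" "r \<noteq> 0" for c r :: real
        using that by (simp add: field_simps power2_eq_square)
      from this[of "b - a" "real n + 1"] show "2 * (1 / ((b - a) * (freq a b (int n + 1))\<^sup>2)) = (b - a) / (2 * pi\<^sup>2) * (1 / (real n + 1)\<^sup>2)"
        using ab by (simp add: freq_def)
    qed
    finally show ?thesis by (simp add: sum_distrib_left)
  qed
  moreover have "(\<lambda>N. (b - a) / (2 * pi\<^sup>2) * (\<Sum>n<N. 1 / (real n + 1)\<^sup>2)) \<longlonglongrightarrow> (b - a) / (2 * pi\<^sup>2) * (pi\<^sup>2 / 6)"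
    using inverse_squares_sums unfolding sums_def by (intro tendsto_intros) (simp add: add.commute)
  moreover have "(b - a) / (2 * pi\<^sup>2) * (pi\<^sup>2 / 6) = (b - a) / 12" by simp
  ultimately show ?thesis by (simp only:)
qed

lemma nbern_2: "a < b \<Longrightarrow> nbern a b 2 a = (b - a) / 12"
proof -
  assume ab: "a < b"
  have "bernoulli 2 = 1 / 6"
    by (simp add: bernoulli.simps numeral_2_eq_2 lessThan_Suc)
  then have "bernpoly 2 0 = 1 / 6"
    by (simp add: bernpoly_def numeral_2_eq_2 atMost_Suc)
  then show ?thesis using ab by (simp add: nbern_def power2_eq_square)
qed

lemma leb_L2_bounded:
  assumes "f \<in> borel_measurable borel" "\<And>x. x \<in> {a..b} \<Longrightarrow> norm (f x) \<le> B"
  shows "L2 (leb a b) f"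
proof (rule L2_bounded[OF finite_leb])
  show "f \<in> borel_measurable (leb a b)" using assms(1) by simp
  show "AE x in leb a b. norm (f x) \<le> B"
    unfolding leb_def by (subst AE_density) (auto simp: indicator_def assms(2))
qed

text \<open>Euler's evaluation of the even zeta values, for all \<open>m\<close> at once: the
  Fourier sums of the degree 1 kernel converge to it in L2, and pairing with the kernel of degree
  \<open>2 * m - 1\<close> gives the power sums on one side and a convolution on the other.\<close>

lemma freq_power_sums:
  assumes ab: "a < b" and m: "m \<ge> 1"
  shows "(\<lambda>N. \<Sum>h\<in>nzset N. 1 / ((b - a) * freq a b h ^ (2 * m))) \<longlonglongrightarrow> (-1) ^ (m + 1) * nbern a b (2 * m) a"
proof -
  define f where "f t = complex_of_real (pbern a b 1 a t)" for t
  define g where "g t = complex_of_real (pbern a b (2 * m - 1) a t)" for t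
  define c where "c h = - fexp a b (- h) a / (\<i> * of_real (freq a b (- h)))" for h
  have a: "a \<in> {a..b}" using ab by simp
  have [measurable]: "f \<in> borel_measurable borel" "g \<in> borel_measurable borel" unfolding f_def[abs_def] g_def[abs_def] by measurable
  obtain B1 where B1: "\<forall>x\<in>{a..b}. \<forall>t\<in>{a..b}. \<bar>pbern a b 1 x t\<bar> \<le> B1" using pbern_bounded[OF ab] by blast
  obtain B2 where B2: "\<forall>x\<in>{a..b}. \<forall>t\<in>{a..b}. \<bar>pbern a b (2 * m - 1) x t\<bar> \<le> B2" using pbern_bounded[OF ab] by blast
  have L2f: "L2 (leb a b) f" using B1 a by (intro leb_L2_bounded[where B=B1]) (auto simp: f_def)
  have L2g: "L2 (leb a b) g" using B2 a by (intro leb_L2_bounded[where B=B2]) (auto simp: g_def)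
  have L2e: "L2 (leb a b) (fexp a b h)" for h
    by (rule leb_L2_bounded[where B="1 / sqrt (b - a)"]) (auto simp: cmod_fexp[OF ab])
  have on: "(LINT x|leb a b. fexp a b h x * cnj (fexp a b k x)) = (if h = k then 1 else 0)" for h k
    by (subst leb_integral(2)) (simp_all add: fexp_orthonormal[OF ab])
  have cf: "(LINT x|leb a b. f x * cnj (fexp a b h x)) = c h" if "h \<noteq> 0" for h
    using pbern_fourier_right[OF ab a, of "- h" 1] that
    by (subst leb_integral(2)) (simp_all add: f_def c_def cnj_fexp scaleR_conv_of_real)
  have cg: "(LINT x|leb a b. fexp a b h x * g x) = - fexp a b h a / (\<i> * of_real (freq a b h)) ^ (2 * m - 1)" if "h \<noteq> 0" for h
    using pbern_fourier_right[OF ab a, of "h" "2 * m - 1"] that m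
    by (subst leb_integral(2)) (simp_all add: g_def scaleR_conv_of_real mult.commute)
  have cc: "(cmod (c h))\<^sup>2 = 1 / ((b - a) * (freq a b h)\<^sup>2)" for h
    using ab by (simp add: c_def norm_divide norm_mult cmod_fexp power_divide power_mult_distrib)
  have ff: "(LINT x|leb a b. (cmod (f x))\<^sup>2) = (b - a) / 12"
    using pbern_square_integral[OF ab a, of 1] nbern_2[OF ab]
    by (subst leb_integral(2)) (simp_all add: f_def numeral_2_eq_2)
  define s where "s N t = (\<Sum>h\<in>nzset N. c h * fexp a b h t)" for N t
  have L2s: "L2 (leb a b) (s N)" for N unfolding s_def[abs_def] by (intro L2_sum L2_cmult L2e)
  \<comment> \<open>Bessel's identity turns the Basel sum into convergence of the partial sums to
    \<open>f\<close> in L2.\<close>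
  have "(LINT t|leb a b. (cmod (s N t - f t))\<^sup>2) = (b - a) / 12 - (\<Sum>h\<in>nzset N. 1 / ((b - a) * (freq a b h)\<^sup>2))" for N
  proof -
    have "(LINT t|leb a b. (cmod (f t - s N t))\<^sup>2) = (LINT t|leb a b. (cmod (f t))\<^sup>2) - (\<Sum>h\<in>nzset N. (cmod (c h))\<^sup>2)"
      unfolding s_def by (rule bessel_identity) (auto simp: nzset_def L2f L2e on cf)
    then show ?thesis by (simp add: ff cc norm_minus_commute)
  qed
  moreover have "(\<lambda>N. (b - a) / 12 - (\<Sum>h\<in>nzset N. 1 / ((b - a) * (freq a b h)\<^sup>2))) \<longlonglongrightarrow> (b - a) / 12 - (b - a) / 12"
    by (intro tendsto_intros basel_freq[OF ab])
  ultimately have "(\<lambda>N. LINT t|leb a b. (cmod (s N t - f t))\<^sup>2) \<longlonglongrightarrow> 0" by simp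
  then have lim: "(\<lambda>N. LINT t|leb a b. s N t * g t) \<longlonglongrightarrow> (LINT t|leb a b. f t * g t)"
    by (intro L2_tendsto_pairing L2s L2f L2g)
  have fg: "(LINT t|leb a b. f t * g t) = of_real (nbern a b (2 * m) a)"
  proof -
    have "(LINT t:{a..b}|lborel. pbern a b 1 a t * pbern a b (2 * m - 1) a t) = nbern a b (2 * m) a"
      using pbern_convolution[OF ab a a, of "2 * m - 1" 0] m by (simp add: pbern_def)
    moreover have "(LINT t|leb a b. f t * g t) = of_real (LINT t:{a..b}|lborel. pbern a b 1 a t * pbern a b (2 * m - 1) a t)"
      by (subst leb_integral(2)) (simp_all add: f_def g_def set_lebesgue_integral_def scaleR_conv_of_real flip: of_real_mult)
    ultimately show ?thesis by simp
  qed
  have sg: "(LINT t|leb a b. s N t * g t) = of_real ((-1) ^ (m + 1) * (\<Sum>h\<in>nzset N. 1 / ((b - a) * freq a b h ^ (2 * m))))" for N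
  proof -
    have "s N t * g t = (\<Sum>h\<in>nzset N. c h * (fexp a b h t * g t))" for t
      by (simp only: s_def sum_distrib_right mult.assoc)
    then have "(LINT t|leb a b. s N t * g t) = (LINT t|leb a b. (\<Sum>h\<in>nzset N. c h * (fexp a b h t * g t)))"
      by (simp only:)
    also have "\<dots> = (\<Sum>h\<in>nzset N. c h * (LINT t|leb a b. fexp a b h t * g t))"
      by (subst Bochner_Integration.integral_sum) (auto intro!: integrable_mult_right L2_mult_integrable[OF L2e L2g])
    also have "\<dots> = (\<Sum>h\<in>nzset N. of_real ((-1) ^ (m + 1) * (1 / ((b - a) * freq a b h ^ (2 * m)))))"
    proof (intro sum.cong refl)
      fix h assume "h \<in> nzset N"
      then have h: "h \<noteq> 0" by (simp add: nzset_def)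
      define r where "r = freq a b h"
      have r: "r \<noteq> 0" using h ab by (simp add: r_def freq_eq_0_iff)
      have ee: "fexp a b (- h) a * fexp a b h a = of_real (1 / (b - a))"
      proof -
        have "fexp a b k a = of_real (1 / sqrt (b - a))" for k by (simp add: fexp_def)
        then show ?thesis using ab by (simp only: of_real_mult[symmetric]) simp
      qed
      have pw: "(\<i> * complex_of_real r) * (\<i> * complex_of_real r) ^ (2 * m - 1) = of_real ((-1) ^ m * r ^ (2 * m))"
      proof -
        have "(\<i> * complex_of_real r) * (\<i> * complex_of_real r) ^ (2 * m - 1) = (\<i> * complex_of_real r) ^ (2 * m)"
          using m by (simp add: power_eq_if[of _ "2 * m"])
        also have "\<dots> = of_real ((-1) ^ m * r ^ (2 * m))" by (simp add: power_mult power_mult_distrib power_minus[of "(complex_of_real r)\<^sup>2"])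
        finally show ?thesis .
      qed
      have "c h * (LINT t|leb a b. fexp a b h t * g t) =
          - (fexp a b (- h) a * fexp a b h a) / ((\<i> * of_real r) * (\<i> * of_real r) ^ (2 * m - 1))"
        unfolding cg[OF h] by (simp add: c_def r_def)
      also have "\<dots> = of_real ((-1) ^ (m + 1) * (1 / ((b - a) * r ^ (2 * m))))"
        unfolding ee pw using r ab by (cases "even m") simp_all
      finally show "c h * (LINT t|leb a b. fexp a b h t * g t) = of_real ((-1) ^ (m + 1) * (1 / ((b - a) * freq a b h ^ (2 * m))))"
        by (simp add: r_def)
    qed
    finally show ?thesis by (simp add: sum_distrib_left)
  qed
  have "(\<lambda>N. (-1) ^ (m + 1) * (\<Sum>h\<in>nzset N. 1 / ((b - a) * freq a b h ^ (2 * m)))) \<longlonglongrightarrow> nbern a b (2 * m) a"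
    using lim unfolding fg sg tendsto_of_real_iff .
  then have "(\<lambda>N. (-1) ^ (m + 1) * ((-1) ^ (m + 1) * (\<Sum>h\<in>nzset N. 1 / ((b - a) * freq a b h ^ (2 * m))))) \<longlonglongrightarrow> (-1) ^ (m + 1) * nbern a b (2 * m) a"
    by (intro tendsto_intros)
  moreover have "(-1) ^ (m + 1) * ((-1) ^ (m + 1) * x) = x" for x :: real
    by (cases "even m") simp_all
  ultimately show ?thesis by (simp only:)
qed

text \<open>The data of \<open>fexp a b h\<close>, normalised.\<close>

definition psi :: "nat \<Rightarrow> real \<Rightarrow> real \<Rightarrow> int \<Rightarrow> real \<Rightarrow> complex" where
  "psi \<alpha> a b h t = (if h = 0 then indicator {b + 1} t
     else if t \<in> {a..b} then ((\<i> * of_real (freq a b h)) ^ \<alpha> / of_real (\<bar>freq a b h\<bar> ^ \<alpha>)) * fexp a b h t else 0)"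

lemma psi_measurable [measurable]: "psi \<alpha> a b h \<in> borel_measurable borel"
  unfolding psi_def[abs_def] by measurable

lemma cmod_phase: "a < b \<Longrightarrow> h \<noteq> 0 \<Longrightarrow> cmod ((\<i> * of_real (freq a b h)) ^ \<alpha> / of_real (\<bar>freq a b h\<bar> ^ \<alpha>)) = 1"
  by (simp add: norm_divide norm_power norm_mult freq_eq_0_iff)

lemma psi_bounded: "a < b \<Longrightarrow> cmod (psi \<alpha> a b h t) \<le> 1 + 1 / sqrt (b - a)"
proof -
  assume ab: "a < b"
  show ?thesis
  proof (cases "h = 0")
    case True
    then show ?thesis using ab by (auto simp: psi_def indicator_def)
  next
    case False
    have "cmod (((\<i> * of_real (freq a b h)) ^ \<alpha> / of_real (\<bar>freq a b h\<bar> ^ \<alpha>)) * fexp a b h t) = 1 / sqrt (b - a)"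
      unfolding norm_mult cmod_phase[OF ab False] cmod_fexp[OF ab] by simp
    then show ?thesis using ab False by (auto simp: psi_def)
  qed
qed

lemma cnj_psi: "cnj (psi \<alpha> a b h t) = psi \<alpha> a b (- h) t"
proof -
  have "cnj (indicator A t) = indicator A t" for A by (simp add: indicator_def)
  then show ?thesis by (simp add: psi_def cnj_fexp)
qed

section \<open>The normalised data of the exponentials and the coefficients of the projection
  kernel\<close>

lemma data_measure_bounded_integral:
  fixes f :: "real \<Rightarrow> 'a::{banach, second_countable_topology}"
  assumes "a < b" "f \<in> borel_measurable borel" "\<And>t. t \<in> {a..b} \<Longrightarrow> norm (f t) \<le> B"
  shows "integrable (data_measure \<alpha> a b) f"
    and "integral\<^sup>L (data_measure \<alpha> a b) f = (LINT t:{a..b}|lborel. f t) + (\<Sum>k<\<alpha>. f (b + 1 + real k))"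
  using data_measure_integral[of a b f \<alpha>] set_integrable_bounded[OF assms(2,3)] assms(1,2) by auto

text \<open>Frequency 0 lives on the atom \<open>b + 1\<close> only and all other frequencies on the
  interval only, where the phases are unimodular and cancel for \<open>h = k\<close>.\<close>

lemma psi_orthonormal:
  assumes ab: "a < b" and \<alpha>: "\<alpha> \<ge> 1"
  shows "(LINT t|data_measure \<alpha> a b. psi \<alpha> a b h t * cnj (psi \<alpha> a b k t)) = (if h = k then 1 else 0)"
proof -
  let ?K = "1 + 1 / sqrt (b - a)"
  have "(LINT t|data_measure \<alpha> a b. psi \<alpha> a b h t * cnj (psi \<alpha> a b k t)) =
      (LINT t:{a..b}|lborel. psi \<alpha> a b h t * cnj (psi \<alpha> a b k t)) + (\<Sum>i<\<alpha>. psi \<alpha> a b h (b + 1 + real i) * cnj (psi \<alpha> a b k (b + 1 + real i)))"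
  proof (rule data_measure_bounded_integral(2)[OF ab, where B="?K * ?K"])
    show "norm (psi \<alpha> a b h t * cnj (psi \<alpha> a b k t)) \<le> ?K * ?K" for t
      unfolding norm_mult complex_mod_cnj using ab by (intro mult_mono psi_bounded[OF ab]) auto
  qed measurable
  also have "(\<Sum>i<\<alpha>. psi \<alpha> a b h (b + 1 + real i) * cnj (psi \<alpha> a b k (b + 1 + real i))) =
      (\<Sum>i<\<alpha>. if i = 0 then if h = 0 \<and> k = 0 then 1 else 0 else 0)"
    by (intro sum.cong) (auto simp: psi_def indicator_def)
  also have "\<dots> = (if h = 0 \<and> k = 0 then 1 else 0)" using \<alpha> by simp
  also have "(LINT t:{a..b}|lborel. psi \<alpha> a b h t * cnj (psi \<alpha> a b k t)) = (if h = k \<and> h \<noteq> 0 then 1 else 0)"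
  proof (cases "h = 0 \<or> k = 0")
    case True
    have "(LINT t:{a..b}|lborel. psi \<alpha> a b h t * cnj (psi \<alpha> a b k t)) = (LINT t:{a..b}|lborel. 0)"
      using True by (intro set_lebesgue_integral_cong) (auto simp: psi_def indicator_def)
    then show ?thesis using True by (auto simp: set_lebesgue_integral_def)
  next
    case False
    define u where "u h = (\<i> * of_real (freq a b h)) ^ \<alpha> / complex_of_real (\<bar>freq a b h\<bar> ^ \<alpha>)" for h
    have "(LINT t:{a..b}|lborel. psi \<alpha> a b h t * cnj (psi \<alpha> a b k t)) =
        (LINT t:{a..b}|lborel. (u h * cnj (u k)) * (fexp a b h t * cnj (fexp a b k t)))"
      using False by (intro set_lebesgue_integral_cong) (auto simp: psi_def u_def)
    also have "\<dots> = (u h * cnj (u k)) * (if h = k then 1 else 0)"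
      unfolding set_integral_mult_right fexp_orthonormal[OF ab] ..
    also have "\<dots> = (if h = k then 1 else 0)"
    proof -
      have "u h * cnj (u h) = 1"
        using False unfolding complex_norm_square[symmetric] u_def by (subst cmod_phase[OF ab]) auto
      then show ?thesis by (cases "h = k") simp_all
    qed
    finally show ?thesis using False by auto
  qed
  finally show ?thesis by auto
qed

lemma proj_ker_bounded:
  assumes ab: "a < b"
  shows "\<exists>B>0. \<forall>x\<in>{a..b}. \<forall>t. \<bar>proj_ker \<alpha> a b x t\<bar> \<le> B"
proof -
  obtain B where B: "B > 0" "\<forall>x\<in>{a..b}. \<forall>t\<in>{a..b}. \<bar>pbern a b \<alpha> x t\<bar> \<le> B" using pbern_bounded[OF ab] by blast
  have "\<bar>proj_ker \<alpha> a b x t\<bar> \<le> B + 1 / (b - a)" if "x \<in> {a..b}" for x t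
    using B(2)[rule_format, OF that, of t] B(1) ab by (auto simp: proj_ker_def intro: add_increasing2)
  moreover have "B + 1 / (b - a) > 0" using B(1) ab by (simp add: add_pos_pos)
  ultimately show ?thesis by blast
qed

text \<open>The factor \<open>(\<i> * freq a b h) ^ \<alpha>\<close> in \<open>psi\<close> cancels
  the denominator from \<open>pbern_fourier_right\<close> and leaves the absolute value, which is
  the weight; frequency 0 is read off at the atom.\<close>

lemma proj_ker_psi:
  assumes ab: "a < b" and \<alpha>: "\<alpha> \<ge> 1" and x: "x \<in> {a..b}"
  shows "(LINT t|data_measure \<alpha> a b. of_real (proj_ker \<alpha> a b x t) * psi \<alpha> a b h t) = fexp a b h x / of_real (kor_weight1 \<alpha> a b h)"
proof -
  obtain B where B: "B > 0" "\<forall>x\<in>{a..b}. \<forall>t. \<bar>proj_ker \<alpha> a b x t\<bar> \<le> B" using proj_ker_bounded[OF ab] by blast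
  have "(LINT t|data_measure \<alpha> a b. of_real (proj_ker \<alpha> a b x t) * psi \<alpha> a b h t) =
      (LINT t:{a..b}|lborel. of_real (proj_ker \<alpha> a b x t) * psi \<alpha> a b h t) + (\<Sum>i<\<alpha>. of_real (proj_ker \<alpha> a b x (b + 1 + real i)) * psi \<alpha> a b h (b + 1 + real i))"
  proof (rule data_measure_bounded_integral(2)[OF ab, where B="B * (1 + 1 / sqrt (b - a))"])
    show "norm (of_real (proj_ker \<alpha> a b x t) * psi \<alpha> a b h t) \<le> B * (1 + 1 / sqrt (b - a))" for t
      unfolding norm_mult using ab B x by (intro mult_mono psi_bounded[OF ab]) auto
  qed measurable
  also have "(\<Sum>i<\<alpha>. of_real (proj_ker \<alpha> a b x (b + 1 + real i)) * psi \<alpha> a b h (b + 1 + real i)) =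
      (\<Sum>i<\<alpha>. if i = 0 then if h = 0 then of_real (1 / (b - a)) else 0 else 0)"
    using ab by (intro sum.cong) (auto simp: psi_def proj_ker_def indicator_def)
  also have "\<dots> = (if h = 0 then of_real (1 / (b - a)) else 0)" using \<alpha> by simp
  also have "(LINT t:{a..b}|lborel. of_real (proj_ker \<alpha> a b x t) * psi \<alpha> a b h t) =
      (if h = 0 then 0 else fexp a b h x / of_real (kor_weight1 \<alpha> a b h))"
  proof (cases "h = 0")
    case True
    have "(LINT t:{a..b}|lborel. of_real (proj_ker \<alpha> a b x t) * psi \<alpha> a b h t) = (LINT t:{a..b}|lborel. 0)"
      using True by (intro set_lebesgue_integral_cong) (auto simp: psi_def indicator_def)
    then show ?thesis using True by (auto simp: set_lebesgue_integral_def)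
  next
    case False
    define w r where "w = (\<i> * complex_of_real (freq a b h)) ^ \<alpha>" and "r = complex_of_real (\<bar>freq a b h\<bar> ^ \<alpha>)"
    have w: "w \<noteq> 0" using False ab by (simp add: w_def freq_eq_0_iff)
    have "(LINT t:{a..b}|lborel. of_real (proj_ker \<alpha> a b x t) * psi \<alpha> a b h t) =
        (LINT t:{a..b}|lborel. (- w / r) * (pbern a b \<alpha> x t *\<^sub>R fexp a b h t))"
      using False by (intro set_lebesgue_integral_cong) (auto simp: psi_def proj_ker_def w_def r_def scaleR_conv_of_real)
    also have "\<dots> = (- w / r) * (- fexp a b h x / w)"
      unfolding set_integral_mult_right w_def using pbern_fourier_right[OF ab x False \<alpha>] by simp
    also have "\<dots> = fexp a b h x / r" using w by simp
    finally show ?thesis using False ab by (simp add: r_def kor_weight1_freq)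
  qed
  finally show ?thesis using ab by (auto simp: fexp_0 kor_weight1_def simp flip: of_real_divide)
qed

text \<open>The companion of \<open>proj_ker_psi\<close> in the other variable, by
  \<open>pbern_fourier_left\<close>; it yields the Fourier coefficients of the image of the
  method.\<close>

lemma proj_ker_fourier:
  assumes ab: "a < b" and \<alpha>: "\<alpha> \<ge> 1"
  shows "(LINT x:{a..b}|lborel. of_real (proj_ker \<alpha> a b x t) * cnj (fexp a b h x)) = cnj (psi \<alpha> a b h t) / of_real (kor_weight1 \<alpha> a b h)"
proof (cases "t \<in> {a..b}")
  case t: True
  then have 1: "(LINT x:{a..b}|lborel. of_real (proj_ker \<alpha> a b x t) * cnj (fexp a b h x)) =
      - (LINT x:{a..b}|lborel. pbern a b \<alpha> x t *\<^sub>R fexp a b (- h) x)"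
    by (simp add: proj_ker_def cnj_fexp scaleR_conv_of_real set_lebesgue_integral_def)
  show ?thesis
  proof (cases "h = 0")
    case True
    have "(LINT x:{a..b}|lborel. pbern a b \<alpha> x t *\<^sub>R fexp a b (- h) x) = of_real (1 / sqrt (b - a)) * of_real (LINT x:{a..b}|lborel. pbern a b \<alpha> x t)"
      using True by (simp add: fexp_0 set_lebesgue_integral_def scaleR_conv_of_real flip: of_real_mult)
    then show ?thesis using 1 True t pbern_integral_left[OF ab t \<alpha>] by (simp add: psi_def)
  next
    case False
    define w where "w = \<i> * complex_of_real (freq a b h)"
    have w: "w \<noteq> 0" using False ab by (simp add: w_def freq_eq_0_iff)
    \<comment> \<open>Division by \<open>w ^ \<alpha>\<close> becomes multiplication by its
      conjugate; divided once by the weight this is the phase in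
      \<open>cnj (psi \<alpha> a b h t)\<close>, and one more division by the weight
      remains.\<close>
    have sq: "of_real (\<bar>freq a b h\<bar> ^ \<alpha>) * of_real (\<bar>freq a b h\<bar> ^ \<alpha>) = w ^ \<alpha> * cnj (w ^ \<alpha>)"
    proof -
      have "w ^ \<alpha> * cnj (w ^ \<alpha>) = of_real ((cmod (w ^ \<alpha>))\<^sup>2)" by (rule complex_norm_square[symmetric])
      also have "cmod (w ^ \<alpha>) = \<bar>freq a b h\<bar> ^ \<alpha>" by (simp add: w_def norm_power norm_mult)
      finally show ?thesis by (simp add: power2_eq_square)
    qed
    have "(LINT x:{a..b}|lborel. of_real (proj_ker \<alpha> a b x t) * cnj (fexp a b h x)) = cnj (fexp a b h t) / w ^ \<alpha>"
      unfolding 1 using pbern_fourier_left[OF ab t _ \<alpha>, of "- h"] False by (simp add: w_def cnj_fexp)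
    also have "\<dots> = cnj (w ^ \<alpha>) * cnj (fexp a b h t) / (w ^ \<alpha> * cnj (w ^ \<alpha>))"
      using w by simp
    also have "\<dots> = cnj (w ^ \<alpha> / of_real (\<bar>freq a b h\<bar> ^ \<alpha>) * fexp a b h t) / of_real (\<bar>freq a b h\<bar> ^ \<alpha>)"
      unfolding sq[symmetric] by simp
    finally show ?thesis using False t ab by (simp add: psi_def w_def kor_weight1_freq)
  qed
next
  case t: False
  show ?thesis
  proof (cases "h = 0 \<and> t = b + 1")
    case True
    have "(LINT x:{a..b}|lborel. of_real (proj_ker \<alpha> a b x t) * cnj (fexp a b h x)) = of_real (1 / (b - a)) * (LINT x:{a..b}|lborel. fexp a b 0 x)"
      using True by (simp add: proj_ker_def cnj_fexp)
    also have "\<dots> = of_real (sqrt (b - a) / (b - a))" by (simp add: fexp_integral[OF ab])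
    also have "sqrt (b - a) / (b - a) = 1 / sqrt (b - a)" using ab by (simp add: field_simps)
    finally show ?thesis using True by (simp add: psi_def kor_weight1_def)
  next
    case False
    show ?thesis
    proof (cases "t = b + 1")
      case True
      then have "(LINT x:{a..b}|lborel. of_real (proj_ker \<alpha> a b x t) * cnj (fexp a b h x)) = of_real (1 / (b - a)) * (LINT x:{a..b}|lborel. fexp a b (- h) x)"
        by (simp add: proj_ker_def cnj_fexp)
      then show ?thesis using False True t by (simp add: fexp_integral[OF ab] psi_def)
    next
      case no: False
      then show ?thesis using t False by (auto simp: proj_ker_def psi_def set_lebesgue_integral_def)
    qed
  qed
qed

text \<open>Both sides are explicit: the norm by \<open>pbern_square_integral\<close>, the sum by
  \<open>freq_power_sums\<close>, with \<open>1 / (b - a)\<^sup>2\<close> added by the atom and by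
  frequency 0 respectively. Equality puts \<open>proj_ker\<close> into the closed span of the
  functions \<open>psi\<close>.\<close>

lemma proj_ker_parseval:
  assumes ab: "a < b" and \<alpha>: "\<alpha> \<ge> 1" and x: "x \<in> {a..b}"
  shows "(\<lambda>N. \<Sum>h\<in>{- int N..int N}. 1 / ((b - a) * (kor_weight1 \<alpha> a b h)\<^sup>2)) \<longlonglongrightarrow> (LINT t|data_measure \<alpha> a b. (proj_ker \<alpha> a b x t)\<^sup>2)"
proof -
  obtain B where B: "B > 0" "\<forall>x\<in>{a..b}. \<forall>t. \<bar>proj_ker \<alpha> a b x t\<bar> \<le> B" using proj_ker_bounded[OF ab] by blast
  have "(LINT t|data_measure \<alpha> a b. (proj_ker \<alpha> a b x t)\<^sup>2) =
      (LINT t:{a..b}|lborel. (proj_ker \<alpha> a b x t)\<^sup>2) + (\<Sum>i<\<alpha>. (proj_ker \<alpha> a b x (b + 1 + real i))\<^sup>2)"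
  proof (rule data_measure_bounded_integral(2)[OF ab, where B="B\<^sup>2"])
    show "norm ((proj_ker \<alpha> a b x t)\<^sup>2) \<le> B\<^sup>2" for t
      using B x by (simp add: abs_le_square_iff[symmetric])
  qed measurable
  also have "(\<Sum>i<\<alpha>. (proj_ker \<alpha> a b x (b + 1 + real i))\<^sup>2) = (\<Sum>i<\<alpha>. if i = 0 then 1 / (b - a)\<^sup>2 else 0)"
    using ab by (intro sum.cong) (auto simp: proj_ker_def power_divide)
  also have "\<dots> = 1 / (b - a)\<^sup>2" using \<alpha> by simp
  also have "(LINT t:{a..b}|lborel. (proj_ker \<alpha> a b x t)\<^sup>2) = (LINT t:{a..b}|lborel. (pbern a b \<alpha> x t)\<^sup>2)"
    by (intro set_lebesgue_integral_cong) (auto simp: proj_ker_def)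
  also have "\<dots> = (-1) ^ (\<alpha> + 1) * nbern a b (2 * \<alpha>) a" by (rule pbern_square_integral[OF ab x \<alpha>])
  finally have P: "(LINT t|data_measure \<alpha> a b. (proj_ker \<alpha> a b x t)\<^sup>2) = (-1) ^ (\<alpha> + 1) * nbern a b (2 * \<alpha>) a + 1 / (b - a)\<^sup>2" .
  have "(\<Sum>h\<in>{- int N..int N}. 1 / ((b - a) * (kor_weight1 \<alpha> a b h)\<^sup>2)) =
      (\<Sum>h\<in>nzset N. 1 / ((b - a) * freq a b h ^ (2 * \<alpha>))) + 1 / (b - a)\<^sup>2" for N
  proof -
    have "(\<Sum>h\<in>nzset N. 1 / ((b - a) * (kor_weight1 \<alpha> a b h)\<^sup>2)) = (\<Sum>h\<in>nzset N. 1 / ((b - a) * freq a b h ^ (2 * \<alpha>)))"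
    proof (intro sum.cong refl)
      fix h assume "h \<in> nzset N"
      then have "kor_weight1 \<alpha> a b h = \<bar>freq a b h\<bar> ^ \<alpha>" using ab by (intro kor_weight1_freq) (auto simp: nzset_def)
      then have "(kor_weight1 \<alpha> a b h)\<^sup>2 = freq a b h ^ (2 * \<alpha>)"
        by (simp add: power_mult[symmetric] mult.commute[of 2] power_even_abs)
      then show "1 / ((b - a) * (kor_weight1 \<alpha> a b h)\<^sup>2) = 1 / ((b - a) * freq a b h ^ (2 * \<alpha>))" by simp
    qed
    then show ?thesis unfolding sum_interval_nzset using ab by (simp add: kor_weight1_def power2_eq_square)
  qed
  then show ?thesis unfolding P using tendsto_add[OF freq_power_sums[OF ab \<alpha>] tendsto_const[of "1 / (b - a)\<^sup>2"]] by (simp only:)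
qed

text \<open>The shift by \<open>frac\<close> follows the two branches of \<open>pbern\<close> except
  for \<open>y - x = b - a\<close>, where \<open>frac\<close> is 0 and the argument is
  \<open>a\<close> instead of \<open>b\<close>; from degree 2 on both arguments give the same
  value.\<close>

lemma periodic_bernpoly_pbern:
  assumes ab: "a < b" and x: "x \<in> {a..b}" and y: "y \<in> {a..b}" and n: "n \<ge> 2"
  shows "periodic_bernpoly a b n (y - x + a) / fact n = pbern a b n y x"
proof -
  have "a + (b - a) * frac ((y - x + a - a) / (b - a)) = (if x \<le> y then if y - x = b - a then a else y - x + a else y - x + b)"
  proof -
    consider "x \<le> y" "y - x = b - a" | "x \<le> y" "y - x \<noteq> b - a" | "y < x" by linarith
    then show ?thesis
    proof cases
      case 1
      then show ?thesis using ab by simp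
    next
      case 2
      then have "0 \<le> (y - x) / (b - a)" "(y - x) / (b - a) < 1" using ab x y by auto
      then have "frac ((y - x) / (b - a)) = (y - x) / (b - a)" by (simp add: frac_eq)
      then show ?thesis using ab 2 by simp
    next
      case 3
      have "-1 \<le> (y - x) / (b - a)" "(y - x) / (b - a) < 0" using ab x y 3 by (auto simp: field_simps)
      then have "\<lfloor>(y - x) / (b - a)\<rfloor> = -1" by (intro floor_unique) auto
      then have "frac ((y - x) / (b - a)) = (y - x) / (b - a) + 1" by (simp add: frac_def)
      then show ?thesis using ab 3 by (simp add: field_simps)
    qed
  qed
  then have "periodic_bernpoly a b n (y - x + a) / fact n = nbern a b n (if x \<le> y then if y - x = b - a then a else y - x + a else y - x + b)"
    unfolding periodic_bernpoly_def using nbern_scaled[OF ab] n by simp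
  moreover obtain k where "n = Suc k" "k \<noteq> 0" using n by (cases n) auto
  then have "nbern a b n a = nbern a b n b" using nbern_jump[OF ab, of k] by simp
  ultimately show ?thesis by (auto simp: pbern_def)
qed

text \<open>On the interval the polynomial part of \<open>sob_ker\<close> meets a function of mean
  zero, and what remains is the convolution of two kernels of degree \<alpha>; the atom gives the
  constant. Hence \<open>proj_ker \<alpha> a b x\<close> is the data function of the Korobov kernel
  with second argument \<open>x\<close>.\<close>

lemma sob_ker_proj_ker:
  assumes ab: "a < b" and \<alpha>: "\<alpha> \<ge> 1" and x: "x \<in> {a..b}" and y: "y \<in> {a..b}"
  shows "(LINT t|data_measure \<alpha> a b. sob_ker \<alpha> a b 0 y t * proj_ker \<alpha> a b x t) =
    1 / (b - a)\<^sup>2 + (-1) ^ (\<alpha> + 1) * periodic_bernpoly a b (2 * \<alpha>) (y - x + a) / fact (2 * \<alpha>)"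
proof -
  obtain B where B: "B > 0" "\<forall>x\<in>{a..b}. \<forall>t. \<bar>proj_ker \<alpha> a b x t\<bar> \<le> B" using proj_ker_bounded[OF ab] by blast
  obtain C where C: "C > 0" "\<forall>k\<le>\<alpha>. \<forall>x\<in>{a..b}. \<forall>t. \<bar>sob_ker \<alpha> a b k x t\<bar> \<le> C" using sob_ker_bounded[OF ab] by blast
  have "(LINT t|data_measure \<alpha> a b. sob_ker \<alpha> a b 0 y t * proj_ker \<alpha> a b x t) =
      (LINT t:{a..b}|lborel. sob_ker \<alpha> a b 0 y t * proj_ker \<alpha> a b x t) + (\<Sum>i<\<alpha>. sob_ker \<alpha> a b 0 y (b + 1 + real i) * proj_ker \<alpha> a b x (b + 1 + real i))"
  proof (rule data_measure_bounded_integral(2)[OF ab, where B="C * B"])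
    show "norm (sob_ker \<alpha> a b 0 y t * proj_ker \<alpha> a b x t) \<le> C * B" for t
      unfolding norm_mult using B C x y by (intro mult_mono) auto
  qed measurable
  also have "(\<Sum>i<\<alpha>. sob_ker \<alpha> a b 0 y (b + 1 + real i) * proj_ker \<alpha> a b x (b + 1 + real i)) = (\<Sum>i<\<alpha>. if i = 0 then 1 / (b - a)\<^sup>2 else 0)"
    using ab by (intro sum.cong) (auto simp: proj_ker_def sob_ker_atom power2_eq_square)
  also have "\<dots> = 1 / (b - a)\<^sup>2" using \<alpha> by simp
  also have "(LINT t:{a..b}|lborel. sob_ker \<alpha> a b 0 y t * proj_ker \<alpha> a b x t) =
      (LINT t:{a..b}|lborel. pbern a b \<alpha> x t * pbern a b \<alpha> y t - nbern a b \<alpha> y * pbern a b \<alpha> x t)"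
    by (intro set_lebesgue_integral_cong) (auto simp: proj_ker_def sob_ker_interval algebra_simps)
  also have "\<dots> = (LINT t:{a..b}|lborel. pbern a b \<alpha> x t * pbern a b \<alpha> y t) - nbern a b \<alpha> y * (LINT t:{a..b}|lborel. pbern a b \<alpha> x t)"
    by (subst set_integral_diff) (auto intro!: pbern_mult_integrable pbern_integrable ab x y simp del: atLeastAtMost_iff)
  also have "\<dots> = (-1) ^ (\<alpha> + 1) * pbern a b (2 * \<alpha>) y x"
  proof -
    obtain k where k: "\<alpha> = Suc k" using \<alpha> by (cases \<alpha>) auto
    have "(LINT t:{a..b}|lborel. pbern a b (Suc k) x t * pbern a b \<alpha> y t) = (-1) ^ k * pbern a b (\<alpha> + Suc k) y x"
      by (rule pbern_convolution[OF ab y x \<alpha>])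
    then show ?thesis using pbern_integral_right[OF ab x \<alpha>] by (simp add: k mult_2)
  qed
  also have "pbern a b (2 * \<alpha>) y x = periodic_bernpoly a b (2 * \<alpha>) (y - x + a) / fact (2 * \<alpha>)"
    using \<alpha> by (intro periodic_bernpoly_pbern[symmetric] ab x y) simp
  finally show ?thesis by simp
qed

text \<open>For \<open>h \<noteq> 0\<close> all means vanish, and the derivative of order \<alpha>
  carries the factor \<open>\<bar>freq a b h\<bar> ^ \<alpha>\<close> in modulus; for
  \<open>h = 0\<close> only the mean \<open>sqrt (b - a)\<close> survives. Here the Korobov weight
  shows itself as a Sobolev norm.\<close>

lemma fexp_sob1_data:
  assumes ab: "a < b" and \<alpha>: "\<alpha> \<ge> 1" and L: "L = Re \<or> L = Im"
  shows "sob1_data \<alpha> a b (\<lambda>x. L (fexp a b h x)) (\<lambda>t. L (of_real (kor_weight1 \<alpha> a b h) * psi \<alpha> a b h t))"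
  unfolding sob1_data_def
proof (intro exI conjI)
  let ?w = "\<i> * complex_of_real (freq a b h)"
  show "sob1_jet \<alpha> a b (\<lambda>x. L (fexp a b h x)) (\<lambda>k x. L (?w ^ k * fexp a b h x))"
    by (rule Re_Im_jet[OF ab \<alpha> L])
  have bl: "bounded_linear L" using L bounded_linear_Re bounded_linear_Im by auto
  have i: "(LINT x:{a..b}|lborel. L (?w ^ k * fexp a b h x)) = L (?w ^ k * (if h = 0 then of_real (sqrt (b - a)) else 0))" for k
  proof -
    have "set_integrable lborel {a..b} (\<lambda>x. ?w ^ k * fexp a b h x)"
      by (intro set_integrable_mult_right fexp_integrable)
    note * = integral_bounded_linear[OF bl this[unfolded set_integrable_def]]
    have "indicat_real {a..b} x *\<^sub>R L z = L (indicat_real {a..b} x *\<^sub>R z)" for x z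
      using L by auto
    then have "(LINT x:{a..b}|lborel. L (?w ^ k * fexp a b h x)) = L (LINT x:{a..b}|lborel. ?w ^ k * fexp a b h x)"
      using * unfolding set_lebesgue_integral_def by (simp only:)
    then show ?thesis unfolding set_integral_mult_right fexp_integral[OF ab] .
  qed
  show "(\<lambda>t. L (of_real (kor_weight1 \<alpha> a b h) * psi \<alpha> a b h t)) =
    (\<lambda>t. if t \<in> {a..b} then L (?w ^ \<alpha> * fexp a b h t)
         else \<Sum>i<\<alpha>. if t = b + 1 + real i then LINT x:{a..b}|lborel. L (?w ^ i * fexp a b h x) else 0)"
  proof (cases "h = 0")
    case True
    have L0: "L 0 = 0" using L by auto
    show ?thesis
    proof
      fix t
      have "(\<Sum>i<\<alpha>. if t = b + 1 + real i then LINT x:{a..b}|lborel. L (?w ^ i * fexp a b h x) else 0) =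
        (\<Sum>i<\<alpha>. if i = 0 then if t = b + 1 then L (of_real (sqrt (b - a))) else 0 else 0)"
        unfolding i using True L0 by (intro sum.cong) (auto simp: freq_def power_0_left)
      also have "\<dots> = (if t = b + 1 then L (of_real (sqrt (b - a))) else 0)" using \<alpha> by simp
      finally show "L (of_real (kor_weight1 \<alpha> a b h) * psi \<alpha> a b h t) = (if t \<in> {a..b} then L (?w ^ \<alpha> * fexp a b h t)
         else \<Sum>i<\<alpha>. if t = b + 1 + real i then LINT x:{a..b}|lborel. L (?w ^ i * fexp a b h x) else 0)"
        using True \<alpha> L0 by (auto simp: kor_weight1_def psi_def freq_def power_0_left)
    qed
  next
    case False
    then have r: "complex_of_real (\<bar>freq a b h\<bar> ^ \<alpha>) \<noteq> 0" using ab by (simp add: freq_eq_0_iff)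
    have L0: "L 0 = 0" using L by auto
    have z: "(\<Sum>i<\<alpha>. if t = b + 1 + real i then LINT x:{a..b}|lborel. L (?w ^ i * fexp a b h x) else 0) = 0" for t
      unfolding i using False L0 by (intro sum.neutral) auto
    have "of_real (kor_weight1 \<alpha> a b h) * psi \<alpha> a b h t = (if t \<in> {a..b} then ?w ^ \<alpha> * fexp a b h t else 0)" for t
      using False r unfolding psi_def kor_weight1_freq[OF ab False] by (simp del: of_real_power)
    then show ?thesis unfolding z using L0 by (auto split: if_splits)
  qed
qed

section \<open>Product measures\<close>

text \<open>The counterpart of \<open>replace_coords\<close> for plain functions. Only the values of
  \<open>y\<close> on \<open>w\<close> enter, so a point of the product over \<open>w\<close> can be
  inserted directly.\<close>

definition mix :: "'n set \<Rightarrow> ('n \<Rightarrow> 'a) \<Rightarrow> ('n \<Rightarrow> 'a) \<Rightarrow> 'n \<Rightarrow> 'a" where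
  "mix w x y = (\<lambda>j. if j \<in> w then y j else x j)"

lemma mix_in [simp]: "j \<in> w \<Longrightarrow> mix w x y j = y j"
  and mix_notin [simp]: "j \<notin> w \<Longrightarrow> mix w x y j = x j"
  by (simp_all add: mix_def)

lemma mix_UNIV [simp]: "mix UNIV x y = y" and mix_empty [simp]: "mix {} x y = x"
  by (auto simp: mix_def)

lemma vec_nth_replace_coords: "vec_nth (replace_coords w y x) = mix w (vec_nth x) y"
  by (auto simp: replace_coords_def mix_def)

lemma borel_measurable_vec_lambda:
  assumes "\<And>j. (\<lambda>z. f z j) \<in> borel_measurable N"
  shows "(\<lambda>z. vec_lambda (f z) :: real ^ 'n::finite) \<in> borel_measurable N"
proof (subst borel_measurable_euclidean_space, intro ballI)
  fix i :: "real ^ 'n" assume "i \<in> Basis"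
  then obtain j where "i = axis j 1" by (auto simp: Basis_vec_def)
  then show "(\<lambda>z. vec_lambda (f z) \<bullet> i) \<in> borel_measurable N"
    using assms[of j] by (simp add: inner_axis)
qed

lemma vec_nth_measurable [measurable]: "(\<lambda>x::real ^ 'n::finite. x $ j) \<in> borel_measurable borel"
  by (intro borel_measurable_continuous_onI continuous_intros)

lemma measurable_to_PiM_borel:
  fixes f :: "'z \<Rightarrow> 'n \<Rightarrow> real"
  assumes "\<And>j. (\<lambda>z. f z j) \<in> borel_measurable N"
  shows "f \<in> measurable N (PiM UNIV (\<lambda>_. borel))"
  by (rule measurable_PiM_single') (use assms in auto)

lemma component_measurable:
  assumes "f \<in> measurable N (PiM UNIV (\<lambda>_. borel))"
  shows "(\<lambda>z. f z j :: real) \<in> borel_measurable N"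
  using measurable_compose[OF assms measurable_component_singleton[of j UNIV]] by simp

lemma PiM_component_measurable:
  assumes "j \<in> w" shows "(\<lambda>y. y j :: real) \<in> borel_measurable (PiM w (\<lambda>_. borel))"
  using measurable_component_singleton[of j w "\<lambda>_. borel"] assms by simp

lemma mix_measurable:
  assumes f: "f \<in> measurable N (PiM UNIV (\<lambda>_. borel))" and g: "g \<in> measurable N (PiM w (\<lambda>_. borel))"
  shows "(\<lambda>z. mix w (f z) (g z)) \<in> measurable N (PiM UNIV (\<lambda>_. borel :: real measure))"
proof (rule measurable_to_PiM_borel)
  fix j
  show "(\<lambda>z. mix w (f z) (g z) j) \<in> borel_measurable N"
  proof (cases "j \<in> w")
    case True
    then show ?thesis using measurable_compose[OF g PiM_component_measurable[OF True]] by simp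
  next
    case False
    then show ?thesis using component_measurable[OF f] by simp
  qed
qed

lemma mix_measurable_UNIV:
  assumes f: "f \<in> measurable N (PiM UNIV (\<lambda>_. borel))" and g: "g \<in> measurable N (PiM UNIV (\<lambda>_. borel))"
  shows "(\<lambda>z. mix w (f z) (g z)) \<in> measurable N (PiM UNIV (\<lambda>_. borel :: real measure))"
proof (rule measurable_to_PiM_borel)
  fix j
  show "(\<lambda>z. mix w (f z) (g z) j) \<in> borel_measurable N"
    using component_measurable[OF f] component_measurable[OF g] by (cases "j \<in> w") auto
qed

text \<open>Instantiated twice on the same coordinates: with Lebesgue measure on the sides of the
  box and with the data measures. The base point \<open>x\<close> in the lemmas supplies the
  coordinates that are not integrated.\<close>

locale finite_borel_product =
  fixes N :: "'n::finite \<Rightarrow> real measure"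
  assumes fin_N: "\<And>j. finite_measure (N j)" and sets_N: "\<And>j. sets (N j) = sets borel"
begin

sublocale P: product_sigma_finite N
proof (rule product_sigma_finite.intro)
  fix j interpret finite_measure "N j" by (rule fin_N)
  show "sigma_finite_measure (N j)" by (rule sigma_finite_measure_axioms)
qed

lemma space_N: "space (N j) = UNIV"
  using sets_eq_imp_space_eq[OF sets_N] by simp

lemma sets_P: "sets (PiM w N) = sets (PiM w (\<lambda>_. borel))"
  by (rule sets_PiM_cong) (auto simp: sets_N)

lemma measurable_P: "f \<in> measurable (PiM w N) K \<longleftrightarrow> f \<in> measurable (PiM w (\<lambda>_. borel)) K"
  using measurable_cong_sets[OF sets_P refl] by blast

lemma finite_P: "finite_measure (PiM w N)"
proof
  have "emeasure (PiM w N) (PiE w (\<lambda>j. space (N j))) = (\<Prod>j\<in>w. emeasure (N j) (space (N j)))"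
    by (rule P.emeasure_PiM) auto
  also have "\<dots> < top"
    using finite_measure.emeasure_finite[OF fin_N] by (simp add: less_top[symmetric] ennreal_prod_eq_top)
  finally show "emeasure (PiM w N) (space (PiM w N)) \<noteq> \<infinity>" by (simp add: space_PiM)
qed

lemma pair_sf: "pair_sigma_finite (PiM u N) (PiM v N)"
proof -
  interpret finite_measure "PiM u N" by (rule finite_P)
  interpret B: finite_measure "PiM v N" by (rule finite_P)
  show ?thesis ..
qed

lemma fold_nn:
  assumes "u \<inter> v = {}" and h: "h \<in> borel_measurable (PiM UNIV (\<lambda>_. borel))"
  shows "(\<integral>\<^sup>+y. h (mix (u \<union> v) x y) \<partial>PiM (u \<union> v) N) = (\<integral>\<^sup>+y. (\<integral>\<^sup>+z. h (mix v (mix u x y) z) \<partial>PiM v N) \<partial>PiM u N)"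
proof -
  have "(\<lambda>y. h (mix (u \<union> v) x y)) \<in> borel_measurable (PiM (u \<union> v) N)"
    unfolding measurable_P
    by (rule measurable_compose[OF mix_measurable h]) (auto simp: space_PiM)
  then have "(\<integral>\<^sup>+y. h (mix (u \<union> v) x y) \<partial>PiM (u \<union> v) N) =
      (\<integral>\<^sup>+y. (\<integral>\<^sup>+z. h (mix (u \<union> v) x (merge u v (y, z))) \<partial>PiM v N) \<partial>PiM u N)"
    using assms(1) by (intro P.product_nn_integral_fold) auto
  moreover have "mix (u \<union> v) x (merge u v (y, z)) = mix v (mix u x y) z" for y z
    using assms(1) by (auto simp: mix_def merge_def fun_eq_iff)
  ultimately show ?thesis by simp
qed

lemma fold_integral:
  fixes h :: "('n \<Rightarrow> real) \<Rightarrow> 'b::{banach, second_countable_topology}"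
  assumes "u \<inter> v = {}" and h: "integrable (PiM (u \<union> v) N) (\<lambda>y. h (mix (u \<union> v) x y))"
  shows "(LINT y|PiM (u \<union> v) N. h (mix (u \<union> v) x y)) = (LINT y|PiM u N. LINT z|PiM v N. h (mix v (mix u x y) z))"
proof -
  have "(LINT y|PiM (u \<union> v) N. h (mix (u \<union> v) x y)) =
      (LINT y|PiM u N. LINT z|PiM v N. h (mix (u \<union> v) x (merge u v (y, z))))"
    using assms by (intro P.product_integral_fold) auto
  moreover have "mix (u \<union> v) x (merge u v (y, z)) = mix v (mix u x y) z" for y z
    using assms(1) by (auto simp: mix_def merge_def fun_eq_iff)
  ultimately show ?thesis by simp
qed

lemma fold_pair_integrable:
  fixes h :: "('n \<Rightarrow> real) \<Rightarrow> 'b::{banach, second_countable_topology}"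
  assumes "u \<inter> v = {}" and h: "integrable (PiM (u \<union> v) N) (\<lambda>y. h (mix (u \<union> v) x y))"
  shows "integrable (PiM u N \<Otimes>\<^sub>M PiM v N) (\<lambda>(y, z). h (mix v (mix u x y) z))"
proof -
  have "integrable (PiM u N \<Otimes>\<^sub>M PiM v N) (\<lambda>p. h (mix (u \<union> v) x (merge u v p)))"
    by (rule integrable_distr[OF measurable_merge]) (use P.distr_merge[OF assms(1)] h in simp)
  moreover have "mix (u \<union> v) x (merge u v (y, z)) = mix v (mix u x y) z" for y z
    using assms(1) by (auto simp: mix_def merge_def fun_eq_iff)
  then have "(\<lambda>p. h (mix (u \<union> v) x (merge u v p))) = (\<lambda>(y, z). h (mix v (mix u x y) z))" by auto
  ultimately show ?thesis by simp
qed

lemma PI_measurable2: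
  fixes h :: "'k \<Rightarrow> ('n \<Rightarrow> real) \<Rightarrow> 'b::{banach, second_countable_topology}"
  assumes f: "f \<in> measurable K (PiM UNIV (\<lambda>_. borel))"
    and h: "(\<lambda>p. h (fst p) (snd p)) \<in> borel_measurable (K \<Otimes>\<^sub>M PiM UNIV (\<lambda>_. borel))"
  shows "(\<lambda>x. LINT y|PiM w N. h x (mix w (f x) y)) \<in> borel_measurable K"
proof -
  interpret finite_measure "PiM w N" by (rule finite_P)
  have s: "snd \<in> measurable (K \<Otimes>\<^sub>M PiM w N) (PiM w (\<lambda>_. borel))"
    using measurable_snd[of K "PiM w N"] measurable_cong_sets[OF refl sets_P] by blast
  have "(\<lambda>p. (fst p, mix w (f (fst p)) (snd p))) \<in> measurable (K \<Otimes>\<^sub>M PiM w N) (K \<Otimes>\<^sub>M PiM UNIV (\<lambda>_. borel))"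
    by (intro measurable_Pair measurable_fst mix_measurable[OF measurable_compose[OF measurable_fst f] s])
  from measurable_compose[OF this h]
  have "(\<lambda>(x, y). h x (mix w (f x) y)) \<in> borel_measurable (K \<Otimes>\<^sub>M PiM w N)"
    by (simp add: case_prod_unfold)
  then show ?thesis by (rule borel_measurable_lebesgue_integral)
qed

lemma PI_measurable:
  fixes h :: "('n \<Rightarrow> real) \<Rightarrow> 'b::{banach, second_countable_topology}"
  assumes f: "f \<in> measurable K (PiM UNIV (\<lambda>_. borel))" and h: "h \<in> borel_measurable (PiM UNIV (\<lambda>_. borel))"
  shows "(\<lambda>x. LINT y|PiM w N. h (mix w (f x) y)) \<in> borel_measurable K"
  by (rule PI_measurable2[OF f, of "\<lambda>_. h"]) (rule measurable_compose[OF measurable_snd h])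

lemma bounded_integrable:
  fixes h :: "('n \<Rightarrow> real) \<Rightarrow> 'b::{banach, second_countable_topology}"
  assumes h: "h \<in> borel_measurable (PiM UNIV (\<lambda>_. borel))" and B: "\<And>y. norm (h (mix w x y)) \<le> B"
  shows "integrable (PiM w N) (\<lambda>y. h (mix w x y))"
proof -
  interpret finite_measure "PiM w N" by (rule finite_P)
  have "(\<lambda>y. h (mix w x y)) \<in> borel_measurable (PiM w N)"
    unfolding measurable_P by (rule measurable_compose[OF mix_measurable h]) (auto simp: space_PiM)
  then show ?thesis using B by (intro integrable_const_bound[where B=B]) auto
qed

text \<open>The first form puts coordinate \<open>j\<close> innermost, the second outermost;
  chaining them moves one integration past all the others.\<close>

lemma insert_integral:
  fixes h :: "('n \<Rightarrow> real) \<Rightarrow> 'b::{banach, second_countable_topology}"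
  assumes j: "j \<notin> v" and hm: "h \<in> borel_measurable (PiM UNIV (\<lambda>_. borel))"
    and h: "integrable (PiM (insert j v) N) (\<lambda>y. h (mix (insert j v) x y))"
  shows "(LINT y|PiM (insert j v) N. h (mix (insert j v) x y)) = (LINT y|PiM v N. LINT s|N j. h ((mix v x y)(j := s)))"
    and "(LINT y|PiM (insert j v) N. h (mix (insert j v) x y)) = (LINT s|N j. LINT y|PiM v N. h (mix v (x(j := s)) y))"
proof -
  have e: "mix (insert j v) x (y(j := s)) = (mix v x y)(j := s)" for y s
    using j by (auto simp: mix_def)
  show "(LINT y|PiM (insert j v) N. h (mix (insert j v) x y)) = (LINT y|PiM v N. LINT s|N j. h ((mix v x y)(j := s)))"
    using P.product_integral_insert[OF _ j h] by (simp add: e)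
  have "(LINT y|PiM ({j} \<union> v) N. h (mix ({j} \<union> v) x y)) = (LINT y|PiM {j} N. LINT z|PiM v N. h (mix v (mix {j} x y) z))"
    using j h by (intro fold_integral) auto
  also have "\<dots> = (LINT y|PiM {j} N. (\<lambda>s. LINT z|PiM v N. h (mix v (x(j := s)) z)) (y j))"
  proof -
    have "mix {j} x y = x(j := y j)" for y by (auto simp: mix_def)
    then show ?thesis by simp
  qed
  also have "\<dots> = (LINT s|N j. LINT y|PiM v N. h (mix v (x(j := s)) y))"
  proof (rule P.product_integral_singleton)
    have "(\<lambda>s. x(j := s)) \<in> measurable borel (PiM UNIV (\<lambda>_. borel))"
      by (rule measurable_to_PiM_borel) auto
    from PI_measurable[OF this hm] show "(\<lambda>s. LINT z|PiM v N. h (mix v (x(j := s)) z)) \<in> borel_measurable (N j)"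
      using measurable_cong_sets[OF sets_N refl] by blast
  qed
  finally show "(LINT y|PiM (insert j v) N. h (mix (insert j v) x y)) = (LINT s|N j. LINT y|PiM v N. h (mix v (x(j := s)) y))"
    by simp
qed

lemma AE_component:
  assumes j: "j \<in> w" and S: "S \<in> sets borel" and AE: "AE s in N j. s \<in> S"
  shows "AE y in PiM w N. y j \<in> S"
proof (rule AE_I)
  let ?A = "PiE w (\<lambda>i. if i = j then - S else UNIV)"
  have "emeasure (N j) (- S) = 0"
  proof -
    have "- S \<in> sets (N j)" using S by (simp add: sets_N)
    then have "AE s in N j. s \<notin> - S \<longleftrightarrow> True" "- S \<in> null_sets (N j) \<longleftrightarrow> (AE s in N j. s \<notin> - S)"
      using AE by (auto simp: AE_iff_null_sets)
    then show ?thesis using AE by (simp add: null_sets_def)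
  qed
  moreover have A: "emeasure (PiM w N) ?A = (\<Prod>i\<in>w. emeasure (N i) (if i = j then - S else UNIV))"
    using S by (intro P.emeasure_PiM) (auto simp: sets_N)
  ultimately show "emeasure (PiM w N) ?A = 0"
    using j by (auto intro!: prod_zero)
  show "{y \<in> space (PiM w N). y j \<notin> S} \<subseteq> ?A"
    by (auto simp: space_PiM space_N PiE_iff intro: extensional_arb)
  show "?A \<in> sets (PiM w N)"
    using S by (intro sets_PiM_I_finite) (auto simp: sets_N)
qed

lemma AE_components:
  assumes "\<And>j. j \<in> w \<Longrightarrow> S j \<in> sets borel" "\<And>j. j \<in> w \<Longrightarrow> AE s in N j. s \<in> S j"
  shows "AE y in PiM w N. \<forall>j\<in>w. y j \<in> S j"
  using assms by (subst AE_finite_all) (auto intro: AE_component)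

end

lemma PiM_density:
  fixes N :: "'n::finite \<Rightarrow> real measure"
  assumes N: "finite_borel_product N" and f: "\<And>j. f j \<in> borel_measurable borel"
    and D: "finite_borel_product (\<lambda>j. density (N j) (f j))"
  shows "PiM w (\<lambda>j. density (N j) (f j)) = density (PiM w N) (\<lambda>y. \<Prod>j\<in>w. f j (y j))"
proof -
  interpret N: finite_borel_product N by fact
  interpret D: finite_borel_product "\<lambda>j. density (N j) (f j)" by fact
  have fm: "f j \<in> borel_measurable (N j)" for j
    using f measurable_cong_sets[OF N.sets_N refl] by blast
  have gm: "(\<lambda>y. \<Prod>j\<in>w. f j (y j)) \<in> borel_measurable (PiM w N)"
  proof (intro borel_measurable_prod_ennreal)
    fix j assume "j \<in> w"
    from measurable_compose[OF measurable_component_singleton[OF this] fm]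
    show "(\<lambda>y. f j (y j)) \<in> borel_measurable (PiM w N)" .
  qed
  show ?thesis
  proof (rule D.P.PiM_eqI[symmetric])
    show "sets (density (PiM w N) (\<lambda>y. \<Prod>j\<in>w. f j (y j))) = sets (PiM w (\<lambda>j. density (N j) (f j)))"
      by (simp add: N.sets_P D.sets_P)
    fix A assume "\<And>j. j \<in> w \<Longrightarrow> A j \<in> sets (density (N j) (f j))"
    then have A: "\<And>j. j \<in> w \<Longrightarrow> A j \<in> sets (N j)" by simp
    have "emeasure (density (PiM w N) (\<lambda>y. \<Prod>j\<in>w. f j (y j))) (PiE w A) =
        (\<integral>\<^sup>+y. (\<Prod>j\<in>w. f j (y j)) * indicator (PiE w A) y \<partial>PiM w N)"
      using gm A by (intro emeasure_density sets_PiM_I_finite) auto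
    also have "\<dots> = (\<integral>\<^sup>+y. (\<Prod>j\<in>w. f j (y j) * indicator (A j) (y j)) \<partial>PiM w N)"
    proof (intro nn_integral_cong)
      fix y assume "y \<in> space (PiM w N)"
      then have "indicator (PiE w A) y = (\<Prod>j\<in>w. indicator (A j) (y j) :: ennreal)"
        by (auto simp: indicator_def space_PiM PiE_iff intro!: prod.neutral[symmetric] prod_zero)
      then show "(\<Prod>j\<in>w. f j (y j)) * indicator (PiE w A) y = (\<Prod>j\<in>w. f j (y j) * indicator (A j) (y j))"
        by (simp add: prod.distrib)
    qed
    also have "\<dots> = (\<Prod>j\<in>w. \<integral>\<^sup>+s. f j s * indicator (A j) s \<partial>N j)"
      using fm A by (intro N.P.product_nn_integral_prod) auto
    also have "\<dots> = (\<Prod>j\<in>w. emeasure (density (N j) (f j)) (A j))"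
      using fm A by (intro prod.cong refl emeasure_density[symmetric]) auto
    finally show "emeasure (density (PiM w N) (\<lambda>y. \<Prod>j\<in>w. f j (y j))) (PiE w A) = (\<Prod>j\<in>w. emeasure (density (N j) (f j)) (A j))" .
  qed simp
qed

section \<open>The box\<close>

locale sobolev_box =
  fixes \<alpha> :: nat and a b :: "real ^ 'n::finite"
  assumes \<alpha>1: "\<alpha> \<ge> 1" and ab: "a $ j < b $ j"
begin

abbreviation BP :: "('n \<Rightarrow> real) measure" where "BP \<equiv> PiM UNIV (\<lambda>_. borel)"

definition Lm :: "'n \<Rightarrow> real measure" where "Lm j = leb (a $ j) (b $ j)"
definition Mm :: "'n \<Rightarrow> real measure" where "Mm j = data_measure \<alpha> (a $ j) (b $ j)"

abbreviation LL :: "'n set \<Rightarrow> ('n \<Rightarrow> real) measure" where "LL w \<equiv> PiM w Lm"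
abbreviation MM :: "'n set \<Rightarrow> ('n \<Rightarrow> real) measure" where "MM w \<equiv> PiM w Mm"

definition bx :: "('n \<Rightarrow> real) set" where "bx = {z. \<forall>j. z j \<in> {a $ j..b $ j}}"

lemma bx_cbox: "vec_nth x \<in> bx \<longleftrightarrow> x \<in> cbox a b"
  by (auto simp: bx_def mem_box_cart)

lemma bx_measurable [measurable]: "bx \<in> sets BP"
proof -
  have "bx = {z \<in> space BP. \<forall>j\<in>UNIV. z j \<in> {a $ j..b $ j}}" by (auto simp: bx_def space_PiM)
  also have "\<dots> \<in> sets BP" by measurable
  finally show ?thesis .
qed

sublocale L: finite_borel_product Lm
  by (rule finite_borel_product.intro) (simp_all only: Lm_def finite_leb sets_leb)

sublocale M: finite_borel_product Mm
  by (rule finite_borel_product.intro) (simp_all only: Mm_def finite_data_measure sets_data_measure)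

section \<open>Lebesgue measure on the box, the data measures, and partial integrals\<close>

lemma ind_prod: "(\<Prod>j\<in>w. ennreal (indicator {a $ j..b $ j} (y j))) = ennreal (\<Prod>j\<in>w. indicat_real {a $ j..b $ j} (y j))"
  by (rule prod_ennreal) simp

lemma LL_density_MM: "LL w = density (MM w) (\<lambda>y. ennreal (\<Prod>j\<in>w. indicat_real {a $ j..b $ j} (y j)))"
proof -
  have e: "Lm = (\<lambda>j. density (Mm j) (\<lambda>x. ennreal (indicator {a $ j..b $ j} x)))"
    unfolding Lm_def[abs_def] Mm_def by (rule ext) (rule leb_density_data[OF less_imp_le[OF ab]])
  have "PiM w (\<lambda>j. density (Mm j) (\<lambda>x. ennreal (indicator {a $ j..b $ j} x))) =
      density (MM w) (\<lambda>y. \<Prod>j\<in>w. ennreal (indicator {a $ j..b $ j} (y j)))"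
  proof (rule PiM_density[OF M.finite_borel_product_axioms])
    show "finite_borel_product (\<lambda>j. density (Mm j) (\<lambda>x. ennreal (indicator {a $ j..b $ j} x)))"
      using L.finite_borel_product_axioms by (subst (asm) e)
  qed measurable
  then show ?thesis by (simp only: ind_prod e[symmetric])
qed

lemma LL_density_lborel: "LL w = density (PiM w (\<lambda>_. lborel)) (\<lambda>y. ennreal (indicator (PiE w (\<lambda>j. {a $ j..b $ j})) y))"
proof (rule L.P.PiM_eqI[symmetric])
  interpret B: product_sigma_finite "\<lambda>_::'n. lborel :: real measure"
    by (rule product_sigma_finite.intro) (rule sigma_finite_lborel)
  have sB: "sets (PiM w (\<lambda>_. lborel)) = sets (PiM w (\<lambda>_. borel))" by (rule sets_PiM_cong) auto
  show "sets (density (PiM w (\<lambda>_. lborel)) (\<lambda>y. ennreal (indicator (PiE w (\<lambda>j. {a $ j..b $ j})) y))) = sets (LL w)"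
    by (simp only: sets_density L.sets_P sB)
  fix A assume "\<And>j. j \<in> w \<Longrightarrow> A j \<in> sets (Lm j)"
  then have A: "\<And>j. j \<in> w \<Longrightarrow> A j \<in> sets borel" by (simp add: L.sets_N)
  have bm: "PiE w (\<lambda>j. {a $ j..b $ j}) \<in> sets (PiM w (\<lambda>_. lborel))" by (intro sets_PiM_I_finite) auto
  have Am: "PiE w A \<in> sets (PiM w (\<lambda>_. lborel))" using A by (intro sets_PiM_I_finite) auto
  have "emeasure (density (PiM w (\<lambda>_. lborel)) (\<lambda>y. ennreal (indicator (PiE w (\<lambda>j. {a $ j..b $ j})) y))) (PiE w A) =
      (\<integral>\<^sup>+y. ennreal (indicator (PiE w (\<lambda>j. {a $ j..b $ j})) y) * indicator (PiE w A) y \<partial>PiM w (\<lambda>_. lborel))"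
    using bm Am by (intro emeasure_density) auto
  also have "\<dots> = (\<integral>\<^sup>+y. indicator (PiE w (\<lambda>j. {a $ j..b $ j} \<inter> A j)) y \<partial>PiM w (\<lambda>_. lborel))"
    by (intro nn_integral_cong) (auto simp: indicator_def PiE_iff)
  also have "\<dots> = emeasure (PiM w (\<lambda>_. lborel)) (PiE w (\<lambda>j. {a $ j..b $ j} \<inter> A j))"
    using A by (intro nn_integral_indicator sets_PiM_I_finite) auto
  also have "\<dots> = (\<Prod>j\<in>w. emeasure lborel ({a $ j..b $ j} \<inter> A j))"
    using A by (intro B.emeasure_PiM) auto
  also have "\<dots> = (\<Prod>j\<in>w. emeasure (Lm j) (A j))"
  proof (intro prod.cong refl)
    fix j assume "j \<in> w"
    then have [measurable]: "A j \<in> sets borel" by (rule A)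
    have "emeasure (Lm j) (A j) = (\<integral>\<^sup>+x. ennreal (indicator {a $ j..b $ j} x) * indicator (A j) x \<partial>lborel)"
      unfolding Lm_def leb_def by (intro emeasure_density) auto
    also have "\<dots> = (\<integral>\<^sup>+x. indicator ({a $ j..b $ j} \<inter> A j) x \<partial>lborel)"
      by (intro nn_integral_cong) (auto simp: indicator_def)
    finally show "emeasure lborel ({a $ j..b $ j} \<inter> A j) = emeasure (Lm j) (A j)" by simp
  qed
  finally show "emeasure (density (PiM w (\<lambda>_. lborel)) (\<lambda>y. ennreal (indicator (PiE w (\<lambda>j. {a $ j..b $ j})) y))) (PiE w A) =
      (\<Prod>j\<in>w. emeasure (Lm j) (A j))" .
qed simp

text \<open>Only values of \<open>h\<close> at points whose coordinates in \<open>w\<close> lie in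
  the box are integrated, so any measurable \<open>F\<close> that agrees there computes the partial
  integral.\<close>

lemma partial_integral_LL:
  assumes F: "F \<in> borel_measurable (LL w)"
    and eq: "\<And>y. y \<in> PiE w (\<lambda>j. {a $ j..b $ j}) \<Longrightarrow> h (replace_coords w y x) = F y"
  shows "partial_integral w a b h x = (LINT y|LL w. F y)"
    and "partial_integrable w a b h x \<longleftrightarrow> integrable (LL w) F"
proof -
  have bm: "PiE w (\<lambda>j. {a $ j..b $ j}) \<in> sets (PiM w (\<lambda>_. lborel))" by (intro sets_PiM_I_finite) auto
  have Fm: "F \<in> borel_measurable (PiM w (\<lambda>_. lborel))"
  proof -
    have sB: "sets (PiM w (\<lambda>_. lborel)) = sets (LL w)" unfolding L.sets_P by (rule sets_PiM_cong) auto
    show ?thesis using F unfolding measurable_cong_sets[OF sB refl] .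
  qed
  have e: "(\<lambda>y. indicat_real (PiE w (\<lambda>j. {a $ j..b $ j})) y *\<^sub>R h (replace_coords w y x)) =
      (\<lambda>y. indicat_real (PiE w (\<lambda>j. {a $ j..b $ j})) y *\<^sub>R F y)"
    using eq by (auto simp: indicator_def)
  show "partial_integral w a b h x = (LINT y|LL w. F y)"
    unfolding partial_integral_def set_lebesgue_integral_def e LL_density_lborel
    using Fm bm by (intro integral_density[symmetric]) auto
  show "partial_integrable w a b h x \<longleftrightarrow> integrable (LL w) F"
    unfolding partial_integrable_def set_integrable_def e LL_density_lborel
    using Fm bm by (intro integrable_density[symmetric]) auto
qed

lemma AE_LL: "AE y in LL w. \<forall>j\<in>w. y j \<in> {a $ j..b $ j}"
proof (rule L.AE_components)
  show "AE s in Lm j. s \<in> {a $ j..b $ j}" for j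
    unfolding Lm_def leb_def by (subst AE_density) (auto simp: indicator_def)
qed auto

lemma AE_MM: "AE y in MM w. \<forall>j\<in>w. y j \<in> data_supp \<alpha> (a $ j) (b $ j)"
proof (rule M.AE_components)
  show "AE s in Mm j. s \<in> data_supp \<alpha> (a $ j) (b $ j)" for j
    unfolding Mm_def using ab[of j] by (intro AE_data_supp) simp
qed auto

lemma ind_prod_measurable: "(\<lambda>y. \<Prod>j\<in>w. indicat_real {a $ j..b $ j} (y j)) \<in> borel_measurable (PiM w (\<lambda>_. borel))"
  by (intro borel_measurable_prod measurable_compose[OF PiM_component_measurable]) auto

lemma ind_prod_measurable_MM: "(\<lambda>y. \<Prod>j\<in>w. indicat_real {a $ j..b $ j} (y j)) \<in> borel_measurable (MM w)"
  unfolding M.measurable_P by (rule ind_prod_measurable)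

lemma LL_integral_MM:
  fixes h :: "('n \<Rightarrow> real) \<Rightarrow> 'b::{banach, second_countable_topology}"
  assumes "h \<in> borel_measurable (PiM w (\<lambda>_. borel))"
  shows "(LINT y|LL w. h y) = (LINT y|MM w. (\<Prod>j\<in>w. indicat_real {a $ j..b $ j} (y j)) *\<^sub>R h y)"
proof -
  have h: "h \<in> borel_measurable (MM w)" using assms unfolding M.measurable_P .
  show ?thesis unfolding LL_density_MM
    by (rule integral_density[OF h ind_prod_measurable_MM]) (auto intro!: prod_nonneg)
qed

lemma LL_nn_integral_le_MM:
  assumes "h \<in> borel_measurable (PiM w (\<lambda>_. borel))"
  shows "(\<integral>\<^sup>+y. h y \<partial>LL w) \<le> (\<integral>\<^sup>+y. h y \<partial>MM w)"
proof -
  have "(\<integral>\<^sup>+y. h y \<partial>LL w) = (\<integral>\<^sup>+y. ennreal (\<Prod>j\<in>w. indicat_real {a $ j..b $ j} (y j)) * h y \<partial>MM w)"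
  proof -
    have h: "h \<in> borel_measurable (MM w)" using assms unfolding M.measurable_P .
    show ?thesis unfolding LL_density_MM
      by (rule nn_integral_density[OF measurable_compose[OF ind_prod_measurable_MM measurable_ennreal] h])
  qed
  also have "\<dots> \<le> (\<integral>\<^sup>+y. 1 * h y \<partial>MM w)"
  proof (intro nn_integral_mono mult_right_mono)
    fix y
    have "(\<Prod>j\<in>w. indicat_real {a $ j..b $ j} (y j)) \<le> 1" by (intro prod_le_1) auto
    then show "ennreal (\<Prod>j\<in>w. indicat_real {a $ j..b $ j} (y j)) \<le> 1" by simp
  qed simp
  finally show ?thesis by simp
qed

text \<open>Fubini gives the first claim. The second follows because \<open>LL w\<close> has a
  density with respect to \<open>MM w\<close>, so null sets are inherited.\<close>

lemma fiber_integrable: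
  fixes H :: "('n \<Rightarrow> real) \<Rightarrow> real"
  assumes H: "integrable (MM UNIV) H"
  shows "AE s in MM w. integrable (MM (- w)) (\<lambda>t. H (mix (- w) (mix w x s) t))"
    and "AE s in LL w. integrable (MM (- w)) (\<lambda>t. H (mix (- w) (mix w x s) t))"
proof -
  interpret pair_sigma_finite "MM w" "MM (- w)" by (rule M.pair_sf)
  have "integrable (MM (w \<union> - w)) (\<lambda>y. H (mix (w \<union> - w) x y))"
    using H by simp
  from M.fold_pair_integrable[OF _ this] have "integrable (MM w \<Otimes>\<^sub>M MM (- w)) (\<lambda>(s, t). H (mix (- w) (mix w x s) t))"
    by simp
  from AE_integrable_fst[OF this] show 1: "AE s in MM w. integrable (MM (- w)) (\<lambda>t. H (mix (- w) (mix w x s) t))" .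
  show "AE s in LL w. integrable (MM (- w)) (\<lambda>t. H (mix (- w) (mix w x s) t))"
    unfolding LL_density_MM
    using 1 by (subst AE_density[OF measurable_compose[OF ind_prod_measurable_MM measurable_ennreal]]) auto
qed

lemma const_mix_measurable:
  assumes "h \<in> measurable BP K"
  shows "(\<lambda>y. h (mix w x y)) \<in> measurable (PiM w (\<lambda>_. borel)) K"
  by (rule measurable_compose[OF mix_measurable assms]) (auto simp: space_PiM)

lemma section_measurable:
  assumes "(\<lambda>p. A (fst p) (snd p)) \<in> measurable (BP \<Otimes>\<^sub>M BP) K"
  shows "(\<lambda>z. A z T) \<in> measurable BP K"
  using measurable_compose[OF measurable_Pair2'[of T BP BP] assms] by (simp add: space_PiM)

lemma norm_integral_le_nn_integral:
  fixes f :: "'z \<Rightarrow> 'b::{banach, second_countable_topology}"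
  shows "ennreal (norm (integral\<^sup>L M f)) \<le> (\<integral>\<^sup>+x. ennreal (norm (f x)) \<partial>M)"
  by (cases "integrable M f") (auto intro: integral_norm_bound_ennreal simp: not_integrable_integral_eq)

text \<open>The Fubini argument behind the weak derivatives and the Fourier coefficients. A
  coordinate in \<open>w\<close> is at once a coordinate of the point and an argument of
  \<open>H\<close>, so its Lebesgue integral becomes a data integral with an indicator. A coordinate
  in \<open>u - w\<close> occurs only in the bounded kernel \<open>A\<close> and can be integrated
  first.\<close>

theorem swap_fibers:
  fixes A :: "('n \<Rightarrow> real) \<Rightarrow> ('n \<Rightarrow> real) \<Rightarrow> 'c::{banach, second_countable_topology}" and H :: "('n \<Rightarrow> real) \<Rightarrow> real"
  assumes wu: "w \<subseteq> u" and Am: "(\<lambda>p. A (fst p) (snd p)) \<in> borel_measurable (BP \<Otimes>\<^sub>M BP)"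
    and Ab: "\<And>x T. norm (A x T) \<le> C" and Hm: "H \<in> borel_measurable BP" and Hi: "integrable (MM UNIV) H"
  defines "F \<equiv> \<lambda>z. LINT t|MM (- w). H (mix (- w) z t) *\<^sub>R A z (mix (- w) z t)"
  shows "F \<in> borel_measurable BP"
    and "integrable (LL u) (\<lambda>y. F (mix u x y))"
    and "(LINT y|LL u. F (mix u x y)) = (LINT T|MM UNIV. (\<Prod>j\<in>w. indicat_real {a $ j..b $ j} (T j)) *\<^sub>R
       (H T *\<^sub>R (LINT y|LL (u - w). A (mix (u - w) (mix w x T) y) T)))"
proof -
  have C0: "0 \<le> C" using Ab norm_ge_zero order_trans by blast
  have HAm: "(\<lambda>p. H (snd p) *\<^sub>R A (fst p) (snd p)) \<in> borel_measurable (BP \<Otimes>\<^sub>M BP)"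
    by (intro borel_measurable_scaleR Am measurable_compose[OF measurable_snd Hm])
  show Fm: "F \<in> borel_measurable BP"
    unfolding F_def by (rule M.PI_measurable2[OF measurable_ident HAm, simplified])
  \<comment> \<open>The L1 norm of \<open>H\<close> on a fibre dominates \<open>F\<close> up to the
    constant \<open>C\<close> and ignores the coordinates outside \<open>w\<close>; the integral
    over \<open>u - w\<close> therefore only multiplies by a finite volume.\<close>
  define Q where "Q z = (\<integral>\<^sup>+t. ennreal \<bar>H (mix (- w) z t)\<bar> \<partial>MM (- w))" for z
  have Qmix: "Q (mix (u - w) z y) = Q z" for z y
  proof -
    have "mix (- w) (mix (u - w) z y) t = mix (- w) z t" for t by (auto simp: mix_def)
    then show ?thesis by (simp add: Q_def)
  qed
  have Qm: "Q \<in> borel_measurable BP"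
  proof -
    interpret finite_measure "MM (- w)" by (rule M.finite_P)
    have s: "snd \<in> measurable (BP \<Otimes>\<^sub>M MM (- w)) (PiM (- w) (\<lambda>_. borel))"
      using measurable_snd[of BP "MM (- w)"] measurable_cong_sets[OF refl M.sets_P] by blast
    have "(\<lambda>p. ennreal \<bar>H (mix (- w) (fst p) (snd p))\<bar>) \<in> borel_measurable (BP \<Otimes>\<^sub>M MM (- w))"
      by (intro measurable_compose[OF _ measurable_ennreal] borel_measurable_abs measurable_compose[OF mix_measurable Hm] measurable_fst s)
    then show ?thesis unfolding Q_def by (intro borel_measurable_nn_integral) (simp add: case_prod_unfold)
  qed
  have FQ: "ennreal (norm (F z)) \<le> ennreal C * Q z" for z
  proof -
    have "ennreal (norm (F z)) \<le> (\<integral>\<^sup>+t. ennreal (norm (H (mix (- w) z t) *\<^sub>R A z (mix (- w) z t))) \<partial>MM (- w))"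
      unfolding F_def by (rule norm_integral_le_nn_integral)
    also have "\<dots> \<le> (\<integral>\<^sup>+t. ennreal C * ennreal \<bar>H (mix (- w) z t)\<bar> \<partial>MM (- w))"
      by (intro nn_integral_mono) (auto simp: ennreal_mult[symmetric] C0 Ab mult.commute[of C] intro!: ennreal_leI mult_left_mono)
    also have "\<dots> = ennreal C * Q z"
    proof -
      have "(\<lambda>t. H (mix (- w) z t)) \<in> borel_measurable (MM (- w))"
        unfolding M.measurable_P by (rule const_mix_measurable[OF Hm])
      then show ?thesis unfolding Q_def by (intro nn_integral_cmult) simp
    qed
    finally show ?thesis .
  qed
  have u: "u = w \<union> (u - w)" using wu by auto
  have Uw: "UNIV = w \<union> - w" by auto
  interpret LF: finite_measure "LL (u - w)" by (rule L.finite_P)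
  have Kfin: "emeasure (LL (u - w)) (space (LL (u - w))) < top"
    using LF.emeasure_finite[of "space (LL (u - w))"] by (simp add: less_top[symmetric])
  have Qfin: "(\<integral>\<^sup>+s. Q (mix w x s) \<partial>LL w) < \<infinity>"
  proof -
    have "(\<integral>\<^sup>+s. Q (mix w x s) \<partial>LL w) \<le> (\<integral>\<^sup>+s. Q (mix w x s) \<partial>MM w)"
      by (rule LL_nn_integral_le_MM[OF const_mix_measurable[OF Qm]])
    also have "\<dots> = (\<integral>\<^sup>+t. ennreal \<bar>H (mix (w \<union> - w) x t)\<bar> \<partial>MM (w \<union> - w))"
      unfolding Q_def
      by (rule M.fold_nn[symmetric]) (auto intro!: measurable_compose[OF _ measurable_ennreal] borel_measurable_abs Hm)
    also have "\<dots> < \<infinity>" using Hi by (simp add: integrable_iff_bounded)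
    finally show ?thesis .
  qed
  have Fim: "(\<lambda>y. F (mix u x y)) \<in> borel_measurable (LL u)"
    using const_mix_measurable[OF Fm] L.measurable_P by blast
  have CQm: "(\<lambda>z. ennreal C * Q z) \<in> borel_measurable BP" using Qm by simp
  have bnd: "(\<integral>\<^sup>+y. ennreal (norm (F (mix u x y))) \<partial>LL u) < \<infinity>"
  proof -
    have "(\<integral>\<^sup>+y. ennreal (norm (F (mix u x y))) \<partial>LL u) \<le> (\<integral>\<^sup>+y. ennreal C * Q (mix u x y) \<partial>LL u)"
      by (intro nn_integral_mono FQ)
    also have "\<dots> = (\<integral>\<^sup>+y. ennreal C * Q (mix (w \<union> (u - w)) x y) \<partial>LL (w \<union> (u - w)))"
      using u by simp
    also have "\<dots> = (\<integral>\<^sup>+s. (\<integral>\<^sup>+y. ennreal C * Q (mix (u - w) (mix w x s) y) \<partial>LL (u - w)) \<partial>LL w)"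
      by (rule L.fold_nn[OF _ CQm]) auto
    also have "\<dots> = (\<integral>\<^sup>+s. (ennreal C * emeasure (LL (u - w)) (space (LL (u - w)))) * Q (mix w x s) \<partial>LL w)"
      unfolding Qmix by (simp add: mult_ac)
    also have "\<dots> = (ennreal C * emeasure (LL (u - w)) (space (LL (u - w)))) * (\<integral>\<^sup>+s. Q (mix w x s) \<partial>LL w)"
    proof (rule nn_integral_cmult)
      show "(\<lambda>s. Q (mix w x s)) \<in> borel_measurable (LL w)"
        unfolding L.measurable_P by (rule const_mix_measurable[OF Qm])
    qed
    also have "\<dots> < \<infinity>"
      using Qfin Kfin by (simp add: ennreal_mult_less_top)
    finally show ?thesis .
  qed
  show Fi: "integrable (LL u) (\<lambda>y. F (mix u x y))"
    using Fim bnd by (rule integrableI_bounded)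
  define R where "R T = H T *\<^sub>R (LINT y|LL (u - w). A (mix (u - w) (mix w x T) y) T)" for T
  have Rm: "R \<in> borel_measurable BP"
  proof -
    have "(\<lambda>T. LINT y|LL (u - w). A (mix (u - w) (mix w x T) y) T) \<in> borel_measurable BP"
    proof (rule L.PI_measurable2[where h="\<lambda>T z. A z T" and f="\<lambda>T. mix w x T"])
      have "x \<in> space BP" by (simp add: space_PiM)
      then show "(\<lambda>T. mix w x T) \<in> measurable BP BP"
        by (intro mix_measurable_UNIV measurable_const measurable_ident_sets refl)
      show "(\<lambda>p. A (snd p) (fst p)) \<in> borel_measurable (BP \<Otimes>\<^sub>M BP)"
        using measurable_compose[OF measurable_Pair[OF measurable_snd measurable_fst] Am] by simp
    qed
    then show ?thesis unfolding R_def by (intro borel_measurable_scaleR Hm)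
  qed
  have Rb: "norm (R T) \<le> C * measure (LL (u - w)) (space (LL (u - w))) * \<bar>H T\<bar>" for T
  proof -
    have "norm (LINT y|LL (u - w). A (mix (u - w) (mix w x T) y) T) \<le> (LINT y|LL (u - w). C)"
    proof -
      have "(\<lambda>z. A z T) \<in> borel_measurable BP"
        by (rule section_measurable[OF Am])
      then have i: "integrable (LL (u - w)) (\<lambda>y. A (mix (u - w) (mix w x T) y) T)"
        by (rule L.bounded_integrable[where B=C]) (rule Ab)
      have "norm (LINT y|LL (u - w). A (mix (u - w) (mix w x T) y) T) \<le> (LINT y|LL (u - w). norm (A (mix (u - w) (mix w x T) y) T))"
        by (rule integral_norm_bound)
      also have "\<dots> \<le> (LINT y|LL (u - w). C)"
        by (rule integral_mono[OF integrable_norm[OF i]]) (auto simp: Ab)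
      finally show ?thesis .
    qed
    then have "\<bar>H T\<bar> * norm (LINT y|LL (u - w). A (mix (u - w) (mix w x T) y) T) \<le> \<bar>H T\<bar> * (C * measure (LL (u - w)) (space (LL (u - w))))"
      by (intro mult_left_mono) (auto simp: mult.commute)
    then show ?thesis by (simp add: R_def mult_ac)
  qed
  \<comment> \<open>The indicator turns Lebesgue measure in the coordinates in \<open>w\<close> into
    the data measure, after which both groups of coordinates combine into
    \<open>MM UNIV\<close>.\<close>
  define R' where "R' T = (\<Prod>j\<in>w. indicat_real {a $ j..b $ j} (T j)) *\<^sub>R R T" for T
  have indm: "(\<lambda>T. \<Prod>j\<in>w. indicat_real {a $ j..b $ j} (T j)) \<in> borel_measurable BP"
    by (intro borel_measurable_prod measurable_compose[OF PiM_component_measurable]) auto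
  have R'm: "R' \<in> borel_measurable BP" unfolding R'_def by (intro borel_measurable_scaleR indm Rm)
  have R'i: "integrable (MM UNIV) R'"
  proof (rule Bochner_Integration.integrable_bound)
    show "integrable (MM UNIV) (\<lambda>T. C * measure (LL (u - w)) (space (LL (u - w))) * \<bar>H T\<bar>)"
      using Hi by simp
    show "R' \<in> borel_measurable (MM UNIV)" using R'm M.measurable_P by blast
    show "AE T in MM UNIV. norm (R' T) \<le> norm (C * measure (LL (u - w)) (space (LL (u - w))) * \<bar>H T\<bar>)"
    proof (intro AE_I2)
      fix T
      have "\<bar>\<Prod>j\<in>w. indicat_real {a $ j..b $ j} (T j)\<bar> \<le> 1"
        unfolding abs_prod by (intro prod_le_1) auto
      then have "norm (R' T) \<le> 1 * norm (R T)"
        unfolding R'_def norm_scaleR by (intro mult_right_mono) auto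
      then show "norm (R' T) \<le> norm (C * measure (LL (u - w)) (space (LL (u - w))) * \<bar>H T\<bar>)"
        using Rb[of T] by simp
    qed
  qed
  \<comment> \<open>The exchange is made on almost every fibre: those on which \<open>H\<close>, as
    a function of the coordinates outside \<open>w\<close>, is integrable.\<close>
  have inner: "AE s in LL w. (LINT y|LL (u - w). F (mix (u - w) (mix w x s) y)) = (LINT t|MM (- w). R (mix (- w) (mix w x s) t))"
    using fiber_integrable(2)[OF Hi, of w x]
  proof eventually_elim
    case (elim s)
    interpret LM: pair_sigma_finite "LL (u - w)" "MM (- w)"
    proof -
      interpret a: finite_measure "LL (u - w)" by (rule L.finite_P)
      interpret b: finite_measure "MM (- w)" by (rule M.finite_P)
      show "pair_sigma_finite (LL (u - w)) (MM (- w))" ..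
    qed
    let ?z = "mix w x s"
    have e1: "mix (- w) (mix (u - w) ?z y) t = mix (- w) ?z t" for y t by (auto simp: mix_def)
    have e2: "mix w x (mix (- w) ?z t) = ?z" for t by (auto simp: mix_def)
    have fs: "fst \<in> measurable (LL (u - w) \<Otimes>\<^sub>M MM (- w)) (PiM (u - w) (\<lambda>_. borel))"
      using measurable_fst[of "LL (u - w)" "MM (- w)"] measurable_cong_sets[OF refl L.sets_P] by blast
    have sn: "snd \<in> measurable (LL (u - w) \<Otimes>\<^sub>M MM (- w)) (PiM (- w) (\<lambda>_. borel))"
      using measurable_snd[of "LL (u - w)" "MM (- w)"] measurable_cong_sets[OF refl M.sets_P] by blast
    have m1: "(\<lambda>p. mix (u - w) ?z (fst p)) \<in> measurable (LL (u - w) \<Otimes>\<^sub>M MM (- w)) BP"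
      by (rule mix_measurable[OF _ fs]) (auto simp: space_PiM)
    have m2: "(\<lambda>p. mix (- w) ?z (snd p)) \<in> measurable (LL (u - w) \<Otimes>\<^sub>M MM (- w)) BP"
      by (rule mix_measurable[OF _ sn]) (auto simp: space_PiM)
    have Zm: "(\<lambda>p. H (mix (- w) ?z (snd p)) *\<^sub>R A (mix (u - w) ?z (fst p)) (mix (- w) ?z (snd p))) \<in> borel_measurable (LL (u - w) \<Otimes>\<^sub>M MM (- w))"
      using measurable_compose[OF measurable_Pair[OF m1 m2] HAm] by simp
    have "integrable (LL (u - w) \<Otimes>\<^sub>M MM (- w)) (\<lambda>(y, t). H (mix (- w) ?z t) *\<^sub>R A (mix (u - w) ?z y) (mix (- w) ?z t))"
    proof (rule Bochner_Integration.integrable_bound)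
      have "integrable (LL (u - w) \<Otimes>\<^sub>M MM (- w)) (\<lambda>p. (\<lambda>_. 1 :: real) (fst p) * H (mix (- w) ?z (snd p)))"
      proof (rule integrableI_bounded)
        show "(\<lambda>p. (\<lambda>_. 1 :: real) (fst p) * H (mix (- w) ?z (snd p))) \<in> borel_measurable (LL (u - w) \<Otimes>\<^sub>M MM (- w))"
          using measurable_compose[OF m2 Hm] by simp
        have nm: "(\<lambda>p. ennreal (norm (H (mix (- w) ?z (snd p))))) \<in> borel_measurable (LL (u - w) \<Otimes>\<^sub>M MM (- w))"
          by (rule measurable_compose[OF measurable_compose[OF measurable_compose[OF m2 Hm] borel_measurable_norm] measurable_ennreal])
        have "(\<integral>\<^sup>+p. ennreal (norm (H (mix (- w) ?z (snd p)))) \<partial>(LL (u - w) \<Otimes>\<^sub>M MM (- w))) =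
            (\<integral>\<^sup>+y. (\<integral>\<^sup>+t. ennreal (norm (H (mix (- w) ?z t))) \<partial>MM (- w)) \<partial>LL (u - w))"
          using LM.M2.nn_integral_fst[OF nm] by simp
        also have "\<dots> < \<infinity>"
          using elim Kfin by (simp add: integrable_iff_bounded ennreal_mult_less_top)
        finally show "(\<integral>\<^sup>+p. ennreal (norm ((\<lambda>_. 1 :: real) (fst p) * H (mix (- w) ?z (snd p)))) \<partial>(LL (u - w) \<Otimes>\<^sub>M MM (- w))) < \<infinity>" by simp
      qed
      then show "integrable (LL (u - w) \<Otimes>\<^sub>M MM (- w)) (\<lambda>p. C * H (mix (- w) ?z (snd p)))" by simp
      show "(\<lambda>(y, t). H (mix (- w) ?z t) *\<^sub>R A (mix (u - w) ?z y) (mix (- w) ?z t)) \<in> borel_measurable (LL (u - w) \<Otimes>\<^sub>M MM (- w))"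
        using Zm by (simp add: case_prod_unfold)
      show "AE p in LL (u - w) \<Otimes>\<^sub>M MM (- w). norm (case p of (y, t) \<Rightarrow> H (mix (- w) ?z t) *\<^sub>R A (mix (u - w) ?z y) (mix (- w) ?z t)) \<le> norm (C * H (mix (- w) ?z (snd p)))"
        by (intro AE_I2) (auto simp: abs_mult C0 mult.commute[of C] intro!: mult_left_mono Ab)
    qed
    note LM.Fubini_integral[OF this]
    then have "(LINT y|LL (u - w). LINT t|MM (- w). H (mix (- w) ?z t) *\<^sub>R A (mix (u - w) ?z y) (mix (- w) ?z t)) =
        (LINT t|MM (- w). LINT y|LL (u - w). H (mix (- w) ?z t) *\<^sub>R A (mix (u - w) ?z y) (mix (- w) ?z t))"
      by (rule sym)
    then show ?case unfolding F_def R_def e1 e2 by simp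
  qed
  have "(LINT y|LL u. F (mix u x y)) = (LINT y|LL (w \<union> (u - w)). F (mix (w \<union> (u - w)) x y))"
    using u by simp
  also have "\<dots> = (LINT s|LL w. LINT y|LL (u - w). F (mix (u - w) (mix w x s) y))"
    by (rule L.fold_integral) (use Fi u in auto)
  also have "\<dots> = (LINT s|LL w. LINT t|MM (- w). R (mix (- w) (mix w x s) t))"
  proof (rule integral_cong_AE[OF _ _ inner])
    have c: "(\<lambda>s. mix w x s) \<in> measurable (PiM w (\<lambda>_. borel)) BP"
      by (rule mix_measurable) (auto simp: space_PiM)
    show "(\<lambda>s. LINT y|LL (u - w). F (mix (u - w) (mix w x s) y)) \<in> borel_measurable (LL w)"
      unfolding L.measurable_P by (rule L.PI_measurable[OF c Fm])
    show "(\<lambda>s. LINT t|MM (- w). R (mix (- w) (mix w x s) t)) \<in> borel_measurable (LL w)"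
      unfolding L.measurable_P by (rule M.PI_measurable[OF c Rm])
  qed
  also have "\<dots> = (LINT s|MM w. (\<Prod>j\<in>w. indicat_real {a $ j..b $ j} (s j)) *\<^sub>R (LINT t|MM (- w). R (mix (- w) (mix w x s) t)))"
  proof (rule LL_integral_MM)
    have c: "(\<lambda>s. mix w x s) \<in> measurable (PiM w (\<lambda>_. borel)) BP"
      by (rule mix_measurable) (auto simp: space_PiM)
    show "(\<lambda>s. LINT t|MM (- w). R (mix (- w) (mix w x s) t)) \<in> borel_measurable (PiM w (\<lambda>_. borel))"
      by (rule M.PI_measurable[OF c Rm])
  qed
  also have "\<dots> = (LINT s|MM w. LINT t|MM (- w). R' (mix (- w) (mix w x s) t))"
  proof (intro Bochner_Integration.integral_cong refl)
    fix s
    have "(\<Prod>j\<in>w. indicat_real {a $ j..b $ j} (mix (- w) (mix w x s) t j)) = (\<Prod>j\<in>w. indicat_real {a $ j..b $ j} (s j))" for t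
      by (intro prod.cong) (auto simp: mix_def)
    then show "(\<Prod>j\<in>w. indicat_real {a $ j..b $ j} (s j)) *\<^sub>R (LINT t|MM (- w). R (mix (- w) (mix w x s) t)) =
        (LINT t|MM (- w). R' (mix (- w) (mix w x s) t))"
      unfolding R'_def by simp
  qed
  also have "\<dots> = (LINT T|MM (w \<union> - w). R' (mix (w \<union> - w) x T))"
    by (rule M.fold_integral[symmetric]) (use R'i in auto)
  finally show "(LINT y|LL u. F (mix u x y)) = (LINT T|MM UNIV. (\<Prod>j\<in>w. indicat_real {a $ j..b $ j} (T j)) *\<^sub>R
       (H T *\<^sub>R (LINT y|LL (u - w). A (mix (u - w) (mix w x T) y) T)))"
    by (simp add: R'_def R_def)
qed

section \<open>The mixed derivatives of a represented function\<close>

text \<open>The cut-off makes the kernel bounded for all real arguments, so Fubini applies without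
  confining points to the box.\<close>

definition Kc :: "'n \<Rightarrow> nat \<Rightarrow> real \<Rightarrow> real \<Rightarrow> real" where
  "Kc j k x t = indicator {a $ j..b $ j} x * sob_ker \<alpha> (a $ j) (b $ j) k x t"

definition Kp :: "('n \<Rightarrow> nat) \<Rightarrow> 'n set \<Rightarrow> ('n \<Rightarrow> real) \<Rightarrow> ('n \<Rightarrow> real) \<Rightarrow> real" where
  "Kp \<tau> v x T = (\<Prod>j\<in>v. Kc j (\<tau> j) (x j) (T j))"

definition top_set :: "('n \<Rightarrow> nat) \<Rightarrow> 'n set" where "top_set \<tau> = {j. \<tau> j = \<alpha>}"

text \<open>In the coordinates in which the order is \<open>\<alpha>\<close> the derivative is the data function itself; in the others the data are
  integrated against the kernel of the derivative.\<close>

definition gder :: "(('n \<Rightarrow> real) \<Rightarrow> real) \<Rightarrow> ('n \<Rightarrow> nat) \<Rightarrow> ('n \<Rightarrow> real) \<Rightarrow> real" where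
  "gder H \<tau> z = (LINT t|MM (- top_set \<tau>). H (mix (- top_set \<tau>) z t) * Kp \<tau> (- top_set \<tau>) z (mix (- top_set \<tau>) z t))"

lemma Kc_measurable [measurable]: "(\<lambda>p. Kc j k (f p) (g p)) \<in> borel_measurable N"
  if "f \<in> borel_measurable N" "g \<in> borel_measurable N"
proof -
  note [measurable] = that
  show ?thesis unfolding Kc_def by measurable
qed

lemma Kp_measurable: "(\<lambda>p. Kp \<tau> v (fst p) (snd p)) \<in> borel_measurable (BP \<Otimes>\<^sub>M BP)"
  unfolding Kp_def
  by (intro borel_measurable_prod Kc_measurable component_measurable measurable_fst measurable_snd)

lemma Kc_bounded: "\<exists>C\<ge>1. \<forall>j. \<forall>k\<le>\<alpha>. \<forall>x t. \<bar>Kc j k x t\<bar> \<le> C"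
proof -
  have "\<forall>j. \<exists>B>0. \<forall>k\<le>\<alpha>. \<forall>x\<in>{a $ j..b $ j}. \<forall>t. \<bar>sob_ker \<alpha> (a $ j) (b $ j) k x t\<bar> \<le> B"
    using sob_ker_bounded[OF ab] by blast
  then obtain B where B: "\<And>j. B j > 0" "\<And>j k x t. k \<le> \<alpha> \<Longrightarrow> x \<in> {a $ j..b $ j} \<Longrightarrow> \<bar>sob_ker \<alpha> (a $ j) (b $ j) k x t\<bar> \<le> B j"
    by metis
  have le: "B j \<le> 1 + (\<Sum>j\<in>UNIV. B j)" for j
  proof -
    have "B j \<le> (\<Sum>j\<in>UNIV. B j)"
      by (rule member_le_sum) (use B(1) less_imp_le in auto)
    then show ?thesis by simp
  qed
  have "\<bar>Kc j k x t\<bar> \<le> 1 + (\<Sum>j\<in>UNIV. B j)" if "k \<le> \<alpha>" for j k x t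
  proof (cases "x \<in> {a $ j..b $ j}")
    case True
    then show ?thesis using B(2)[OF that True, of t] le[of j] by (simp add: Kc_def)
  next
    case False
    then show ?thesis using B(1)[of j] le[of j] by (simp add: Kc_def)
  qed
  moreover have "1 \<le> 1 + (\<Sum>j\<in>UNIV. B j)" using B(1) by (simp add: sum_nonneg less_imp_le)
  ultimately show ?thesis by blast
qed

text \<open>The constant is at least 1, so its power with exponent \<open>CARD('n)\<close> bounds
  the products over every subset of coordinates.\<close>

definition KB :: real where
  "KB = (SOME C. C \<ge> 1 \<and> (\<forall>j. \<forall>k\<le>\<alpha>. \<forall>x t. \<bar>Kc j k x t\<bar> \<le> C)) ^ CARD('n)"

lemma Kp_bounded:
  assumes "\<tau> \<in> multi_le \<alpha>" shows "\<bar>Kp \<tau> v x T\<bar> \<le> KB" and "KB \<ge> 1"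
proof -
  define C where "C = (SOME C. C \<ge> 1 \<and> (\<forall>j. \<forall>k\<le>\<alpha>. \<forall>x t. \<bar>Kc j k x t\<bar> \<le> C))"
  have C: "C \<ge> 1" "\<And>j k x t. k \<le> \<alpha> \<Longrightarrow> \<bar>Kc j k x t\<bar> \<le> C"
    using someI_ex[OF Kc_bounded] unfolding C_def by blast+
  have "\<bar>Kp \<tau> v x T\<bar> = (\<Prod>j\<in>v. \<bar>Kc j (\<tau> j) (x j) (T j)\<bar>)" by (simp add: Kp_def abs_prod)
  also have "\<dots> \<le> (\<Prod>j\<in>v. C)" using assms by (intro prod_mono) (auto simp: multi_le_def C)
  also have "\<dots> = C ^ card v" by simp
  also have "\<dots> \<le> C ^ CARD('n)" using C(1) by (intro power_increasing card_mono) auto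
  finally show "\<bar>Kp \<tau> v x T\<bar> \<le> KB" by (simp add: KB_def C_def)
  show "KB \<ge> 1" using C(1) unfolding KB_def C_def[symmetric] by (rule one_le_power)
qed

lemma Kp_outside: "j \<in> v \<Longrightarrow> z j \<notin> {a $ j..b $ j} \<Longrightarrow> Kp \<tau> v z T = 0"
  unfolding Kp_def by (intro prod_zero bexI[of _ j]) (auto simp: Kc_def)

lemma Kp_cong: "(\<And>j. j \<in> v \<Longrightarrow> \<tau> j = \<tau>' j \<and> x j = x' j \<and> T j = T' j) \<Longrightarrow> Kp \<tau> v x T = Kp \<tau>' v x' T'"
  unfolding Kp_def by (intro prod.cong) auto

lemma Kp_insert: "j \<notin> v \<Longrightarrow> Kp \<tau> (insert j v) z T = Kc j (\<tau> j) (z j) (T j) * Kp \<tau> v z T"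
  by (simp add: Kp_def)

lemma mix_upd: "j \<notin> v \<Longrightarrow> (mix v z y)(j := s) = mix v (z(j := s)) y"
  by (auto simp: mix_def)

lemma mix_upd_insert: "j \<notin> v \<Longrightarrow> mix (insert j v) z T = mix v (z(j := T j)) T"
  by (auto simp: mix_def)

lemma bx_upd: "z \<in> bx \<Longrightarrow> s \<in> {a $ j..b $ j} \<Longrightarrow> z(j := s) \<in> bx"
  by (auto simp: bx_def)

text \<open>Induction on the coordinates in \<open>v\<close>, each treated by
  \<open>sob_ker_parts\<close>. A coordinate of order \<alpha> loses its integral: the point is
  frozen at the data value \<open>T j\<close>, with an indicator. A coordinate of lower order keeps
  its integral, now with the kernel of order \<open>\<tau> j\<close>. The base point
  \<open>z\<close> varies in the induction because freezing changes it.\<close>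

lemma parts_on_fibers:
  fixes \<phi> :: "('n \<Rightarrow> nat) \<Rightarrow> ('n \<Rightarrow> real) \<Rightarrow> real"
  assumes \<tau>: "\<tau> \<in> multi_le \<alpha>" and T: "\<And>j. T j \<in> data_supp \<alpha> (a $ j) (b $ j)"
    and \<phi>m: "\<And>\<sigma>. \<phi> \<sigma> \<in> borel_measurable BP" and \<phi>b: "\<And>\<sigma>. \<exists>B. \<forall>z\<in>bx. \<bar>\<phi> \<sigma> z\<bar> \<le> B"
    and \<phi>d: "\<And>\<sigma> z j s. ((\<lambda>s. \<phi> \<sigma> (z(j := s))) has_real_derivative \<phi> (\<sigma>(j := Suc (\<sigma> j))) (z(j := s))) (at s)"
    and \<phi>0: "\<And>\<sigma> z j. j \<in> v \<Longrightarrow> z j = a $ j \<or> z j = b $ j \<Longrightarrow> \<phi> \<sigma> z = 0"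
  shows "z \<in> bx \<Longrightarrow> (LINT y|LL v. Kp (\<lambda>_. 0) v (mix v z y) T * \<phi> (\<lambda>j. if j \<in> v then \<sigma> j + \<tau> j else \<sigma> j) (mix v z y)) =
    (-1) ^ (\<Sum>j\<in>v. \<tau> j) * (\<Prod>j\<in>v \<inter> top_set \<tau>. indicat_real {a $ j..b $ j} (T j)) *
    (LINT y|LL (v - top_set \<tau>). Kp \<tau> (v - top_set \<tau>) (mix (v - top_set \<tau>) (mix (v \<inter> top_set \<tau>) z T) y) T *
       \<phi> \<sigma> (mix (v - top_set \<tau>) (mix (v \<inter> top_set \<tau>) z T) y))"
  using finite[of v] \<phi>0
proof (induction v arbitrary: z \<sigma> rule: finite_induct)
  case empty
  show ?case by (simp add: Kp_def)
next
  case (insert j v)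
  let ?w = "top_set \<tau>"
  have z: "z \<in> bx" by fact
  have zero: "(\<lambda>_. 0) \<in> multi_le \<alpha>" by (simp add: multi_le_def)
  have hm: "(\<lambda>z. Kp \<tau>' v' z T * \<phi> \<sigma>' z) \<in> borel_measurable BP" for \<tau>' v' \<sigma>'
  proof -
    have "(\<lambda>z. Kp \<tau>' v' z T) \<in> borel_measurable BP"
      by (rule section_measurable[OF Kp_measurable])
    then show ?thesis by (intro borel_measurable_times \<phi>m)
  qed
  have hi: "integrable (LL v') (\<lambda>y. Kp \<tau>' v' (mix v' z' y) T * \<phi> \<sigma>' (mix v' z' y))"
    if \<tau>': "\<tau>' \<in> multi_le \<alpha>" and z': "z' \<in> bx" for \<tau>' v' \<sigma>' z'
  proof -
    obtain B where B: "\<forall>z\<in>bx. \<bar>\<phi> \<sigma>' z\<bar> \<le> B" using \<phi>b by blast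
    show ?thesis
    proof (rule L.bounded_integrable[where B="KB * \<bar>B\<bar>", OF hm])
      fix y
      show "norm (Kp \<tau>' v' (mix v' z' y) T * \<phi> \<sigma>' (mix v' z' y)) \<le> KB * \<bar>B\<bar>"
      proof (cases "mix v' z' y \<in> bx")
        case True
        then have "\<bar>\<phi> \<sigma>' (mix v' z' y)\<bar> \<le> \<bar>B\<bar>" using B by fastforce
        then show ?thesis unfolding real_norm_def abs_mult
          using Kp_bounded[OF \<tau>'] by (intro mult_mono) (auto intro: order_trans[OF zero_le_one])
      next
        case False
        then obtain i where "mix v' z' y i \<notin> {a $ i..b $ i}" by (auto simp: bx_def)
        moreover from this have "i \<in> v'" using z' by (cases "i \<in> v'") (auto simp: bx_def)
        ultimately have "Kp \<tau>' v' (mix v' z' y) T = 0" by (intro Kp_outside)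
        then show ?thesis using Kp_bounded(2)[OF \<tau>'] by simp
      qed
    qed
  qed
  define \<sigma>2 where "\<sigma>2 = (\<lambda>i. if i \<in> v then \<sigma> i + \<tau> i else \<sigma> i)"
  have \<sigma>1: "(\<lambda>i. if i \<in> insert j v then \<sigma> i + \<tau> i else \<sigma> i) = \<sigma>2(j := \<sigma>2 j + \<tau> j)"
    using insert.hyps by (auto simp: \<sigma>2_def)
  \<comment> \<open>The stage at which only coordinate \<open>j\<close> has been integrated by
    parts, written as a single \<open>Kp\<close> so that the two forms of
    \<open>L.insert_integral\<close> apply to it.\<close>
  define \<tau>0 where "\<tau>0 = (\<lambda>i. if i = j then \<tau> j else 0)"
  have \<tau>0: "\<tau>0 \<in> multi_le \<alpha>" using \<tau> by (simp add: \<tau>0_def multi_le_def)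
  have \<tau>j: "\<tau> j \<le> \<alpha>" using \<tau> by (simp add: multi_le_def)
  have Kp0: "Kp \<tau>0 v q T = Kp (\<lambda>_. 0) v q T" for q
    using insert.hyps by (intro Kp_cong) (auto simp: \<tau>0_def)
  have Kpu: "Kp \<tau>' v (q(j := s)) T = Kp \<tau>' v q T" for \<tau>' q s
    using insert.hyps by (intro Kp_cong) auto
  have one: "(LINT s|Lm j. Kp (\<lambda>_. 0) (insert j v) (q(j := s)) T * \<phi> (\<sigma>2(j := \<sigma>2 j + \<tau> j)) (q(j := s))) =
      (-1) ^ \<tau> j * (Kp (\<lambda>_. 0) v q T * (if \<tau> j = \<alpha> then indicator {a $ j..b $ j} (T j) * \<phi> \<sigma>2 (q(j := T j))
        else (LINT s|Lm j. Kc j (\<tau> j) s (T j) * \<phi> \<sigma>2 (q(j := s)))))" for q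
  proof -
    have qm: "(\<lambda>s. q(j := s)) \<in> measurable borel BP" by (rule measurable_to_PiM_borel) auto
    have ms: "(\<lambda>s. Kc j k s (T j) * \<phi> \<sigma>' (q(j := s))) \<in> borel_measurable borel" for k \<sigma>'
      by (intro borel_measurable_times measurable_compose[OF qm \<phi>m] Kc_measurable) auto
    have L: "(LINT s|Lm j. Kc j k s (T j) * \<phi> \<sigma>' (q(j := s))) =
        (LINT s:{a $ j..b $ j}|lborel. sob_ker \<alpha> (a $ j) (b $ j) k s (T j) * \<phi> \<sigma>' (q(j := s)))" for k \<sigma>'
      unfolding Lm_def leb_integral(2)[OF ms]
      by (intro set_lebesgue_integral_cong) (auto simp: Kc_def)
    have "(LINT s|Lm j. Kp (\<lambda>_. 0) (insert j v) (q(j := s)) T * \<phi> (\<sigma>2(j := \<sigma>2 j + \<tau> j)) (q(j := s))) =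
        (LINT s|Lm j. Kp (\<lambda>_. 0) v q T * (Kc j 0 s (T j) * \<phi> (\<sigma>2(j := \<sigma>2 j + \<tau> j)) (q(j := s))))"
      using insert.hyps by (simp add: Kp_insert Kpu mult_ac)
    also have "\<dots> = Kp (\<lambda>_. 0) v q T * (LINT s:{a $ j..b $ j}|lborel. sob_ker \<alpha> (a $ j) (b $ j) 0 s (T j) * \<phi> (\<sigma>2(j := \<sigma>2 j + \<tau> j)) (q(j := s)))"
      by (simp add: L)
    also have "(LINT s:{a $ j..b $ j}|lborel. sob_ker \<alpha> (a $ j) (b $ j) 0 s (T j) * \<phi> (\<sigma>2(j := \<sigma>2 j + \<tau> j)) (q(j := s))) =
        (-1) ^ \<tau> j * (if \<tau> j = \<alpha> then indicator {a $ j..b $ j} (T j) * \<phi> (\<sigma>2(j := \<sigma>2 j + 0)) (q(j := T j))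
        else (LINT s:{a $ j..b $ j}|lborel. sob_ker \<alpha> (a $ j) (b $ j) (\<tau> j) s (T j) * \<phi> (\<sigma>2(j := \<sigma>2 j + 0)) (q(j := s))))"
    proof (rule sob_ker_parts[OF ab T \<tau>j \<alpha>1, where \<Psi>="\<lambda>n s. \<phi> (\<sigma>2(j := \<sigma>2 j + n)) (q(j := s))"])
      fix n s
      show "((\<lambda>s. \<phi> (\<sigma>2(j := \<sigma>2 j + n)) (q(j := s))) has_real_derivative \<phi> (\<sigma>2(j := \<sigma>2 j + Suc n)) (q(j := s))) (at s)"
        using \<phi>d[of "\<sigma>2(j := \<sigma>2 j + n)" q j s] by simp
    qed (use insert.prems(2)[of j] in auto)
    finally show ?thesis unfolding L add_0_right fun_upd_triv by (rule trans[OF _ mult.left_commute])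
  qed
  have LHS: "(LINT y|LL (insert j v). Kp (\<lambda>_. 0) (insert j v) (mix (insert j v) z y) T * \<phi> (\<lambda>i. if i \<in> insert j v then \<sigma> i + \<tau> i else \<sigma> i) (mix (insert j v) z y)) =
      (-1) ^ \<tau> j * (LINT y|LL v. Kp (\<lambda>_. 0) v (mix v z y) T * (if \<tau> j = \<alpha> then indicator {a $ j..b $ j} (T j) * \<phi> \<sigma>2 ((mix v z y)(j := T j))
        else (LINT s|Lm j. Kc j (\<tau> j) s (T j) * \<phi> \<sigma>2 ((mix v z y)(j := s)))))"
    unfolding \<sigma>1 L.insert_integral(1)[OF insert.hyps(2) hm hi[OF zero z]] one by simp
  have IH: "(LINT y|LL v. Kp (\<lambda>_. 0) v (mix v z' y) T * \<phi> \<sigma>2 (mix v z' y)) =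
    (-1) ^ (\<Sum>j\<in>v. \<tau> j) * (\<Prod>j\<in>v \<inter> ?w. indicat_real {a $ j..b $ j} (T j)) *
    (LINT y|LL (v - ?w). Kp \<tau> (v - ?w) (mix (v - ?w) (mix (v \<inter> ?w) z' T) y) T * \<phi> \<sigma> (mix (v - ?w) (mix (v \<inter> ?w) z' T) y))"
    if "z' \<in> bx" for z'
    unfolding \<sigma>2_def by (rule insert.IH[OF that]) (use insert.prems(2) in auto)
  show ?case
  proof (cases "\<tau> j = \<alpha>")
    case True
    have w: "insert j v \<inter> ?w = insert j (v \<inter> ?w)" "insert j v - ?w = v - ?w" "j \<notin> v \<inter> ?w"
      using True insert.hyps by (auto simp: top_set_def)
    have "(LINT y|LL v. Kp (\<lambda>_. 0) v (mix v z y) T * (indicator {a $ j..b $ j} (T j) * \<phi> \<sigma>2 ((mix v z y)(j := T j)))) =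
        indicator {a $ j..b $ j} (T j) * (LINT y|LL v. Kp (\<lambda>_. 0) v (mix v (z(j := T j)) y) T * \<phi> \<sigma>2 (mix v (z(j := T j)) y))"
      unfolding mix_upd[OF insert.hyps(2), symmetric] Kpu by (simp add: mult.left_commute)
    also have "\<dots> = indicator {a $ j..b $ j} (T j) * ((-1) ^ (\<Sum>j\<in>v. \<tau> j) * (\<Prod>j\<in>v \<inter> ?w. indicat_real {a $ j..b $ j} (T j)) *
      (LINT y|LL (v - ?w). Kp \<tau> (v - ?w) (mix (v - ?w) (mix (v \<inter> ?w) (z(j := T j)) T) y) T * \<phi> \<sigma> (mix (v - ?w) (mix (v \<inter> ?w) (z(j := T j)) T) y)))"
      \<comment> \<open>The updated base point is in the box only if \<open>T j\<close> lies in the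
        interval; otherwise the indicator makes both sides 0.\<close>
      using IH[OF bx_upd[OF z, of "T j" j]] by (cases "T j \<in> {a $ j..b $ j}") auto
    finally show ?thesis
      unfolding LHS w mix_upd_insert[OF w(3)] using True insert.hyps w(3) by (simp add: power_add)
  next
    case False
    then have jw: "j \<notin> ?w" by (simp add: top_set_def)
    have w: "insert j v \<inter> ?w = v \<inter> ?w" "insert j v - ?w = insert j (v - ?w)" "j \<notin> v - ?w"
      using jw insert.hyps by auto
    let ?E = "\<Prod>j\<in>v \<inter> ?w. indicat_real {a $ j..b $ j} (T j)"
    have "(LINT y|LL v. Kp (\<lambda>_. 0) v (mix v z y) T * (LINT s|Lm j. Kc j (\<tau> j) s (T j) * \<phi> \<sigma>2 ((mix v z y)(j := s)))) =
        (LINT y|LL v. LINT s|Lm j. Kp \<tau>0 (insert j v) ((mix v z y)(j := s)) T * \<phi> \<sigma>2 ((mix v z y)(j := s)))"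
      using insert.hyps by (simp add: Kp_insert Kpu Kp0 mult_ac \<tau>0_def[THEN fun_cong, of j] flip: integral_mult_right_zero)
    also have "\<dots> = (LINT s|Lm j. LINT y|LL v. Kp \<tau>0 (insert j v) (mix v (z(j := s)) y) T * \<phi> \<sigma>2 (mix v (z(j := s)) y))"
      by (rule trans[OF L.insert_integral(1)[OF insert.hyps(2) hm hi[OF \<tau>0 z], symmetric] L.insert_integral(2)[OF insert.hyps(2) hm hi[OF \<tau>0 z]]])
    also have "\<dots> = (LINT s|Lm j. Kc j (\<tau> j) s (T j) * (LINT y|LL v. Kp (\<lambda>_. 0) v (mix v (z(j := s)) y) T * \<phi> \<sigma>2 (mix v (z(j := s)) y)))"
      using insert.hyps by (simp add: Kp_insert Kp0 \<tau>0_def[THEN fun_cong, of j] mult.assoc)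
    also have "\<dots> = (LINT s|Lm j. (-1) ^ (\<Sum>j\<in>v. \<tau> j) * ?E * (Kc j (\<tau> j) s (T j) *
        (LINT y|LL (v - ?w). Kp \<tau> (v - ?w) (mix (v - ?w) (mix (v \<inter> ?w) (z(j := s)) T) y) T * \<phi> \<sigma> (mix (v - ?w) (mix (v \<inter> ?w) (z(j := s)) T) y))))"
    proof (intro Bochner_Integration.integral_cong refl)
      fix s
      show "Kc j (\<tau> j) s (T j) * (LINT y|LL v. Kp (\<lambda>_. 0) v (mix v (z(j := s)) y) T * \<phi> \<sigma>2 (mix v (z(j := s)) y)) =
        (-1) ^ (\<Sum>j\<in>v. \<tau> j) * ?E * (Kc j (\<tau> j) s (T j) *
        (LINT y|LL (v - ?w). Kp \<tau> (v - ?w) (mix (v - ?w) (mix (v \<inter> ?w) (z(j := s)) T) y) T * \<phi> \<sigma> (mix (v - ?w) (mix (v \<inter> ?w) (z(j := s)) T) y)))"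
      proof (cases "s \<in> {a $ j..b $ j}")
        case True
        show ?thesis unfolding IH[OF bx_upd[OF z True]] by (simp only: mult_ac)
      next
        case False
        then have "Kc j (\<tau> j) s (T j) = 0" by (simp add: Kc_def)
        then show ?thesis by simp
      qed
    qed
    also have "\<dots> = (-1) ^ (\<Sum>j\<in>v. \<tau> j) * ?E * (LINT s|Lm j. Kc j (\<tau> j) s (T j) *
        (LINT y|LL (v - ?w). Kp \<tau> (v - ?w) (mix (v - ?w) (mix (v \<inter> ?w) (z(j := s)) T) y) T * \<phi> \<sigma> (mix (v - ?w) (mix (v \<inter> ?w) (z(j := s)) T) y)))"
      by simp
    also have "\<dots> = (-1) ^ (\<Sum>j\<in>v. \<tau> j) * ?E * (LINT y|LL (insert j (v - ?w)). Kp \<tau> (insert j (v - ?w)) (mix (insert j (v - ?w)) (mix (v \<inter> ?w) z T) y) T * \<phi> \<sigma> (mix (insert j (v - ?w)) (mix (v \<inter> ?w) z T) y))"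
    \<comment> \<open>If a frozen coordinate of \<open>T\<close> leaves the box, the product of
      indicators annihilates both sides; otherwise the new base point lies in \<open>bx\<close> and
      Fubini applies.\<close>
    proof (cases "\<forall>i\<in>v \<inter> ?w. T i \<in> {a $ i..b $ i}")
      case True
      then have z2: "mix (v \<inter> ?w) z T \<in> bx" using z by (auto simp: bx_def mix_def)
      have e: "(mix (v \<inter> ?w) z T)(j := s) = mix (v \<inter> ?w) (z(j := s)) T" for s
        using insert.hyps by (intro mix_upd) auto
      have "(LINT y|LL (insert j (v - ?w)). Kp \<tau> (insert j (v - ?w)) (mix (insert j (v - ?w)) (mix (v \<inter> ?w) z T) y) T * \<phi> \<sigma> (mix (insert j (v - ?w)) (mix (v \<inter> ?w) z T) y)) =
          (LINT s|Lm j. LINT y|LL (v - ?w). Kp \<tau> (insert j (v - ?w)) (mix (v - ?w) (mix (v \<inter> ?w) (z(j := s)) T) y) T * \<phi> \<sigma> (mix (v - ?w) (mix (v \<inter> ?w) (z(j := s)) T) y))"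
        unfolding L.insert_integral(2)[OF w(3) hm hi[OF \<tau> z2]] e ..
      also have "\<dots> = (LINT s|Lm j. Kc j (\<tau> j) s (T j) *
        (LINT y|LL (v - ?w). Kp \<tau> (v - ?w) (mix (v - ?w) (mix (v \<inter> ?w) (z(j := s)) T) y) T * \<phi> \<sigma> (mix (v - ?w) (mix (v \<inter> ?w) (z(j := s)) T) y)))"
        using insert.hyps w(3) jw by (simp add: Kp_insert mult.assoc)
      finally show ?thesis by simp
    next
      case False
      then obtain i where i: "i \<in> v \<inter> ?w" "T i \<notin> {a $ i..b $ i}" by blast
      then have "?E = 0" by (intro prod_zero bexI[of _ i]) (simp_all add: indicator_def)
      then show ?thesis by simp
    qed
    finally show ?thesis
      unfolding LHS w using False insert.hyps by (simp add: power_add mult.assoc)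
  qed
qed

section \<open>Pairing the mixed derivatives with bounded functions on fibres\<close>

lemma zero_multi_le: "(\<lambda>_. 0) \<in> multi_le \<alpha>" by (simp add: multi_le_def)

lemma top_set_zero [simp]: "top_set (\<lambda>_. 0) = {}" using \<alpha>1 by (auto simp: top_set_def)

lemma top_set_subset_supp: "top_set \<tau> \<subseteq> multi_supp \<tau>" using \<alpha>1 by (auto simp: top_set_def multi_supp_def)

lemma Kp_union: "v \<inter> v' = {} \<Longrightarrow> Kp \<tau> (v \<union> v') z T = Kp \<tau> v z T * Kp \<tau> v' z T"
  unfolding Kp_def by (intro prod.union_disjoint) auto

lemma AE_LL_bx:
  assumes "z \<in> bx" shows "AE y in LL u. mix u z y \<in> bx"
  using AE_LL[of u] by eventually_elim (use assms in \<open>auto simp: bx_def mix_def\<close>)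

text \<open>Test functions are bounded on the box, whereas \<open>swap_fibers\<close> asks for a
  kernel bounded everywhere.\<close>

definition cut :: "(('n \<Rightarrow> real) \<Rightarrow> real) \<Rightarrow> ('n \<Rightarrow> real) \<Rightarrow> real" where
  "cut \<phi> x = (if x \<in> bx then \<phi> x else 0)"

lemma cut_measurable: "\<phi> \<in> borel_measurable BP \<Longrightarrow> cut \<phi> \<in> borel_measurable BP"
  unfolding cut_def[abs_def] by (intro measurable_If_set) (auto simp: space_PiM)

lemma gder_measurable:
  assumes "H \<in> borel_measurable BP"
  shows "gder H \<tau> \<in> borel_measurable BP"
proof -
  have "(\<lambda>p. H (snd p) * Kp \<tau> (- top_set \<tau>) (fst p) (snd p)) \<in> borel_measurable (BP \<Otimes>\<^sub>M BP)"
    by (intro borel_measurable_times Kp_measurable measurable_compose[OF measurable_snd assms])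
  from M.PI_measurable2[OF measurable_ident this, of "- top_set \<tau>"] show ?thesis
    by (simp add: gder_def[abs_def])
qed

text \<open>\<open>swap_fibers\<close> for the kernel multiplied by the cut-off of
  \<open>\<phi>\<close>. The kernel factors for coordinates outside \<open>u\<close> do not depend
  on \<open>y\<close> and are pulled out.\<close>

lemma gder_pairing:
  assumes Hm: "H \<in> borel_measurable BP" and Hi: "integrable (MM UNIV) H"
    and \<tau>: "\<tau> \<in> multi_le \<alpha>" and wu: "top_set \<tau> \<subseteq> u" and z: "z \<in> bx"
    and \<phi>m: "\<phi> \<in> borel_measurable BP" and \<phi>b: "\<forall>z\<in>bx. \<bar>\<phi> z\<bar> \<le> B"
  shows "integrable (LL u) (\<lambda>y. gder H \<tau> (mix u z y) * \<phi> (mix u z y))"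
    and "(LINT y|LL u. gder H \<tau> (mix u z y) * \<phi> (mix u z y)) =
      (LINT T|MM UNIV. (\<Prod>j\<in>top_set \<tau>. indicat_real {a $ j..b $ j} (T j)) * (H T * (Kp \<tau> (- u) z T *
        (LINT y|LL (u - top_set \<tau>). Kp \<tau> (u - top_set \<tau>) (mix (u - top_set \<tau>) (mix (top_set \<tau>) z T) y) T *
           \<phi> (mix (u - top_set \<tau>) (mix (top_set \<tau>) z T) y)))))"
proof -
  let ?w = "top_set \<tau>"
  define A where "A x T = Kp \<tau> (- ?w) x T * cut \<phi> x" for x T
  have Am: "(\<lambda>p. A (fst p) (snd p)) \<in> borel_measurable (BP \<Otimes>\<^sub>M BP)"
    unfolding A_def by (intro borel_measurable_times Kp_measurable measurable_compose[OF measurable_fst cut_measurable[OF \<phi>m]])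
  have Ab: "norm (A x T) \<le> KB * \<bar>B\<bar>" for x T
  proof -
    have "\<bar>cut \<phi> x\<bar> \<le> \<bar>B\<bar>" using \<phi>b by (fastforce simp: cut_def)
    then show ?thesis using Kp_bounded[OF \<tau>] unfolding A_def real_norm_def abs_mult
      by (intro mult_mono) (auto intro: order_trans[OF zero_le_one])
  qed
  have F: "(LINT t|MM (- ?w). H (mix (- ?w) x t) *\<^sub>R A x (mix (- ?w) x t)) = gder H \<tau> x * cut \<phi> x" for x
    unfolding A_def gder_def by (simp add: mult.assoc[symmetric])
  have gm: "(\<lambda>y. gder H \<tau> (mix u z y) * \<phi> (mix u z y)) \<in> borel_measurable (LL u)"
    unfolding L.measurable_P
    by (intro borel_measurable_times const_mix_measurable gder_measurable Hm \<phi>m)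
  have gm': "(\<lambda>y. gder H \<tau> (mix u z y) * cut \<phi> (mix u z y)) \<in> borel_measurable (LL u)"
    unfolding L.measurable_P
    by (intro borel_measurable_times const_mix_measurable gder_measurable Hm cut_measurable \<phi>m)
  have ae: "AE y in LL u. gder H \<tau> (mix u z y) * cut \<phi> (mix u z y) = gder H \<tau> (mix u z y) * \<phi> (mix u z y)"
    using AE_LL_bx[OF z, of u] by eventually_elim (simp add: cut_def)
  note sw = swap_fibers(2,3)[OF wu Am Ab Hm Hi, unfolded F]
  show "integrable (LL u) (\<lambda>y. gder H \<tau> (mix u z y) * \<phi> (mix u z y))"
    using sw(1)[of z] integrable_cong_AE[OF gm' gm ae] by simp
  have "(LINT y|LL u. gder H \<tau> (mix u z y) * \<phi> (mix u z y)) = (LINT y|LL u. gder H \<tau> (mix u z y) * cut \<phi> (mix u z y))"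
    by (rule integral_cong_AE[OF gm' gm ae, symmetric])
  also have "\<dots> = (LINT T|MM UNIV. (\<Prod>j\<in>?w. indicat_real {a $ j..b $ j} (T j)) *\<^sub>R
       (H T *\<^sub>R (LINT y|LL (u - ?w). A (mix (u - ?w) (mix ?w z T) y) T)))"
    by (rule sw(2))
  also have "\<dots> = (LINT T|MM UNIV. (\<Prod>j\<in>?w. indicat_real {a $ j..b $ j} (T j)) * (H T * (Kp \<tau> (- u) z T *
        (LINT y|LL (u - ?w). Kp \<tau> (u - ?w) (mix (u - ?w) (mix ?w z T) y) T * \<phi> (mix (u - ?w) (mix ?w z T) y)))))"
  proof (intro Bochner_Integration.integral_cong refl)
    fix T
    show "(\<Prod>j\<in>?w. indicat_real {a $ j..b $ j} (T j)) *\<^sub>R (H T *\<^sub>R (LINT y|LL (u - ?w). A (mix (u - ?w) (mix ?w z T) y) T)) =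
      (\<Prod>j\<in>?w. indicat_real {a $ j..b $ j} (T j)) * (H T * (Kp \<tau> (- u) z T *
        (LINT y|LL (u - ?w). Kp \<tau> (u - ?w) (mix (u - ?w) (mix ?w z T) y) T * \<phi> (mix (u - ?w) (mix ?w z T) y))))"
    proof (cases "\<forall>j\<in>?w. T j \<in> {a $ j..b $ j}")
      case True
      have "A (mix (u - ?w) (mix ?w z T) y) T = Kp \<tau> (- u) z T *
          (Kp \<tau> (u - ?w) (mix (u - ?w) (mix ?w z T) y) T * \<phi> (mix (u - ?w) (mix ?w z T) y))" for y
      proof -
        let ?x = "mix (u - ?w) (mix ?w z T) y"
        have "- ?w = - u \<union> (u - ?w)" using wu by auto
        then have "Kp \<tau> (- ?w) ?x T = Kp \<tau> (- u \<union> (u - ?w)) ?x T" by simp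
        also have "\<dots> = Kp \<tau> (- u) ?x T * Kp \<tau> (u - ?w) ?x T" by (rule Kp_union) auto
        also have "Kp \<tau> (- u) ?x T = Kp \<tau> (- u) z T"
          using wu by (intro Kp_cong) (auto simp: mix_def)
        finally have K: "Kp \<tau> (- ?w) ?x T = Kp \<tau> (- u) z T * Kp \<tau> (u - ?w) ?x T" .
        \<comment> \<open>The cut-off is invisible: a coordinate that leaves the box must belong to
          \<open>u - top_set \<tau>\<close>, and there the kernel itself is 0.\<close>
        have "Kp \<tau> (u - ?w) ?x T * cut \<phi> ?x = Kp \<tau> (u - ?w) ?x T * \<phi> ?x"
        proof (cases "?x \<in> bx")
          case False
          then obtain i where i: "?x i \<notin> {a $ i..b $ i}" by (auto simp: bx_def)
          have "i \<in> u - ?w"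
          proof (rule ccontr)
            assume "i \<notin> u - ?w"
            then show False using i True z by (cases "i \<in> ?w") (auto simp: bx_def)
          qed
          then show ?thesis using Kp_outside[where z="?x" and j=i] i by simp
        qed (simp add: cut_def)
        then show ?thesis unfolding A_def K by (simp only: mult.assoc)
      qed
      then show ?thesis by simp
    next
      case False
      then obtain i where i: "i \<in> ?w" "T i \<notin> {a $ i..b $ i}" by blast
      then have "(\<Prod>j\<in>?w. indicat_real {a $ j..b $ j} (T j)) = 0" by (intro prod_zero bexI[of _ i]) (simp_all add: indicator_def)
      then show ?thesis by simp
    qed
  qed
  finally show "(LINT y|LL u. gder H \<tau> (mix u z y) * \<phi> (mix u z y)) = \<dots>" .
qed

section \<open>Test functions and the weak derivative identity\<close>

lemma vec_lambda_measurable: "vec_lambda \<in> measurable BP (borel :: (real ^ 'n) measure)"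
  using borel_measurable_vec_lambda[of "\<lambda>z. z" BP] component_measurable[OF measurable_ident_sets[OF refl]] by simp

lemma vec_nth_measurable_BP: "vec_nth \<in> measurable (borel :: (real ^ 'n) measure) BP"
  by (rule measurable_to_PiM_borel) (rule vec_nth_measurable)

lemma vec_update: "vec_lambda (z(j := s)) = vec_lambda (z(j := r)) + (s - r) *\<^sub>R axis j (1::real)"
  by (simp add: vec_eq_iff axis_def)

text \<open>\<open>test_jet\<close> restricts the support of the function of order 0 alone. The
  derivatives inherit it, by induction on the total order, since a function that is 0 on an open set
  has derivative 0 there. The support keeps away from the faces, so every derivative is 0 on them
  and no boundary terms arise.\<close>

lemma test_jet_functions:
  assumes jet: "test_jet u a b \<Phi>"
  defines "\<phi> \<equiv> \<lambda>\<sigma> z. \<Phi> \<sigma> (vec_lambda z)"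
  shows "\<phi> \<sigma> \<in> borel_measurable BP"
    and "\<exists>B. \<forall>z\<in>bx. \<bar>\<phi> \<sigma> z\<bar> \<le> B"
    and "((\<lambda>s. \<phi> \<sigma> (z(j := s))) has_real_derivative \<phi> (\<sigma>(j := Suc (\<sigma> j))) (z(j := s))) (at s)"
    and "j \<in> u \<Longrightarrow> z j = a $ j \<or> z j = b $ j \<Longrightarrow> \<phi> \<sigma> z = 0"
proof -
  have cont: "continuous_on UNIV (\<Phi> \<sigma>)" for \<sigma> using jet by (simp add: test_jet_def)
  have der: "((\<lambda>t. \<Phi> \<sigma> (x + t *\<^sub>R axis j 1)) has_real_derivative \<Phi> (\<sigma>(j := Suc (\<sigma> j))) x) (at 0)" for \<sigma> j x
    using jet by (simp add: test_jet_def)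
  obtain c d where cd: "\<And>j. j \<in> u \<Longrightarrow> a $ j < c $ j \<and> d $ j < b $ j"
    "\<And>x j. \<Phi> (\<lambda>_. 0) x \<noteq> 0 \<Longrightarrow> j \<in> u \<Longrightarrow> c $ j \<le> x $ j \<and> x $ j \<le> d $ j"
    using jet unfolding test_jet_def by blast
  show "\<phi> \<sigma> \<in> borel_measurable BP"
    unfolding \<phi>_def using measurable_compose[OF vec_lambda_measurable borel_measurable_continuous_onI[OF cont]] .
  have "bounded (\<Phi> \<sigma> ` cbox a b)"
    by (intro compact_imp_bounded compact_continuous_image continuous_on_subset[OF cont]) auto
  then obtain B where B: "\<And>x. x \<in> cbox a b \<Longrightarrow> norm (\<Phi> \<sigma> x) \<le> B" unfolding bounded_iff by blast
  have "vec_lambda z \<in> cbox a b" if "z \<in> bx" for z using that bx_cbox[of "vec_lambda z"] by (simp add: vec_lambda_inverse)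
  then show "\<exists>B. \<forall>z\<in>bx. \<bar>\<phi> \<sigma> z\<bar> \<le> B" using B unfolding \<phi>_def by fastforce
  show "((\<lambda>s. \<phi> \<sigma> (z(j := s))) has_real_derivative \<phi> (\<sigma>(j := Suc (\<sigma> j))) (z(j := s))) (at s)" for \<sigma> z j s
  proof -
    have "((\<lambda>t. \<Phi> \<sigma> (vec_lambda (z(j := s)) + t *\<^sub>R axis j 1)) has_real_derivative \<Phi> (\<sigma>(j := Suc (\<sigma> j))) (vec_lambda (z(j := s)))) (at (s + - s))"
      using der by simp
    then have "((\<lambda>r. \<Phi> \<sigma> (vec_lambda (z(j := s)) + (r + - s) *\<^sub>R axis j 1)) has_real_derivative \<Phi> (\<sigma>(j := Suc (\<sigma> j))) (vec_lambda (z(j := s)))) (at s)"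
      by (rule iffD1[OF DERIV_shift[where f="\<lambda>t. \<Phi> \<sigma> (vec_lambda (z(j := s)) + t *\<^sub>R axis j 1)"]])
    moreover have "vec_lambda (z(j := s)) + (r + - s) *\<^sub>R axis j 1 = vec_lambda (z(j := r))" for r
      using vec_update[of z j r s] by simp
    ultimately show ?thesis unfolding \<phi>_def by (simp only:)
  qed
  have zero: "\<Phi> \<sigma> x = 0" if j: "j \<in> u" and x: "x $ j < c $ j \<or> x $ j > d $ j" for \<sigma> j x
  proof -
    have "\<forall>\<sigma>. (\<Sum>i\<in>UNIV. \<sigma> i) = m \<longrightarrow> (\<forall>x. x $ j < c $ j \<or> x $ j > d $ j \<longrightarrow> \<Phi> \<sigma> x = 0)" for m
    proof (induction m)
      case 0
      show ?case
      proof (intro allI impI)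
        fix \<sigma> :: "'n \<Rightarrow> nat" and x :: "real ^ 'n" assume "(\<Sum>i\<in>UNIV. \<sigma> i) = 0" "x $ j < c $ j \<or> x $ j > d $ j"
        then have "\<sigma> = (\<lambda>_. 0)" by (auto simp: fun_eq_iff)
        then show "\<Phi> \<sigma> x = 0" using cd(2)[of x j] j \<open>x $ j < c $ j \<or> x $ j > d $ j\<close> by force
      qed
    next
      case (Suc m)
      show ?case
      proof (intro allI impI)
        fix \<sigma> :: "'n \<Rightarrow> nat" and x :: "real ^ 'n" assume s: "(\<Sum>i\<in>UNIV. \<sigma> i) = Suc m" and x: "x $ j < c $ j \<or> x $ j > d $ j"
        obtain i where i: "\<sigma> i \<noteq> 0"
        proof (rule ccontr)
          assume "\<not> thesis"
          then have "\<forall>i. \<sigma> i = 0" using that by blast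
          then show False using s by simp
        qed
        define \<sigma>' where "\<sigma>' = \<sigma>(i := \<sigma> i - 1)"
        have \<sigma>: "\<sigma> = \<sigma>'(i := Suc (\<sigma>' i))" using i by (auto simp: \<sigma>'_def)
        have "(\<Sum>k\<in>UNIV. \<sigma> k) = \<sigma> i + (\<Sum>k\<in>UNIV - {i}. \<sigma> k)" by (simp add: sum.remove)
        moreover have "(\<Sum>k\<in>UNIV. \<sigma>' k) = \<sigma>' i + (\<Sum>k\<in>UNIV - {i}. \<sigma>' k)" by (simp add: sum.remove)
        moreover have "(\<Sum>k\<in>UNIV - {i}. \<sigma>' k) = (\<Sum>k\<in>UNIV - {i}. \<sigma> k)" by (intro sum.cong) (auto simp: \<sigma>'_def)
        ultimately have sm: "(\<Sum>k\<in>UNIV. \<sigma>' k) = m" using s i by (simp add: \<sigma>'_def)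
        let ?X = "\<lambda>t::real. x + t *\<^sub>R axis i 1"
        let ?S = "(\<lambda>t. ?X t $ j) -` ({..<c $ j} \<union> {d $ j<..})"
        have "open ?S" by (intro open_vimage) (auto intro!: continuous_intros)
        moreover have "0 \<in> ?S" using x by auto
        moreover have "0 = \<Phi> \<sigma>' (?X t)" if "t \<in> ?S" for t
          using Suc.IH[rule_format, OF sm, of "?X t"] that by auto
        ultimately have "((\<lambda>t. \<Phi> \<sigma>' (?X t)) has_real_derivative 0) (at 0)"
          by (intro has_field_derivative_transform_within_open[OF DERIV_const]) 
        from DERIV_unique[OF this der] show "\<Phi> \<sigma> x = 0" using \<sigma> by simp
      qed
    qed
    then show ?thesis using x by blast
  qed
  show "j \<in> u \<Longrightarrow> z j = a $ j \<or> z j = b $ j \<Longrightarrow> \<phi> \<sigma> z = 0" for j z \<sigma>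
    unfolding \<phi>_def using cd(1)[of j] by (intro zero[of j]) auto
qed

text \<open>\<open>gder_pairing\<close> turns both sides into integrals of \<open>H\<close> against
  kernels, and these kernels agree by \<open>parts_on_fibers\<close> for almost every
  \<open>T\<close>; factors outside \<open>multi_supp \<tau>\<close> have order 0 on both sides. The
  exceptional set of \<open>T\<close> does not depend on \<open>x\<close>, so the identity holds at
  every point of the box.\<close>

theorem gder_is_mixed_deriv:
  assumes Hm: "H \<in> borel_measurable BP" and Hi: "integrable (MM UNIV) H"
    and f: "\<And>x. x \<in> cbox a b \<Longrightarrow> f x = gder H (\<lambda>_. 0) (vec_nth x)" and \<tau>: "\<tau> \<in> multi_le \<alpha>"
  shows "is_mixed_deriv a b \<tau> f (\<lambda>x. gder H \<tau> (vec_nth x))"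
  unfolding is_mixed_deriv_def
proof (intro conjI ballI allI impI)
  have gb: "(\<lambda>x. gder H \<tau> (vec_nth x)) \<in> borel_measurable borel"
    by (rule measurable_compose[OF vec_nth_measurable_BP gder_measurable[OF Hm]])
  then show "set_borel_measurable lborel (cbox a b) (\<lambda>x. gder H \<tau> (vec_nth x))"
    unfolding set_borel_measurable_def by measurable
  let ?u = "multi_supp \<tau>"
  let ?w = "top_set \<tau>"
  fix x assume x: "x \<in> cbox a b"
  then have z: "vec_nth x \<in> bx" by (simp add: bx_cbox)
  have box: "replace_coords ?u y x \<in> cbox a b" if "y \<in> PiE ?u (\<lambda>j. {a $ j..b $ j})" for y
    unfolding bx_cbox[symmetric] vec_nth_replace_coords using that z by (auto simp: bx_def mix_def PiE_iff)
  have one: "\<forall>z\<in>bx. \<bar>1::real\<bar> \<le> 1" by simp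
  have mg: "(\<lambda>y. gder H \<tau>' (mix ?u (vec_nth x) y)) \<in> borel_measurable (LL ?u)" for \<tau>'
    unfolding L.measurable_P by (rule const_mix_measurable[OF gder_measurable[OF Hm]])
  show "partial_integrable ?u a b f x"
  proof (subst partial_integral_LL(2)[OF mg[of "\<lambda>_. 0"]])
    show "f (replace_coords ?u y x) = gder H (\<lambda>_. 0) (mix ?u (vec_nth x) y)" if "y \<in> PiE ?u (\<lambda>j. {a $ j..b $ j})" for y
      using f[OF box[OF that]] by (simp add: vec_nth_replace_coords)
    show "integrable (LL ?u) (\<lambda>y. gder H (\<lambda>_. 0) (mix ?u (vec_nth x) y))"
      using gder_pairing(1)[where \<phi>="\<lambda>_. 1" and B=1, OF Hm Hi zero_multi_le _ z _ one] by simp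
  qed
  show "partial_integrable ?u a b (\<lambda>x. gder H \<tau> (vec_nth x)) x"
  proof (subst partial_integral_LL(2)[OF mg[of \<tau>]])
    show "integrable (LL ?u) (\<lambda>y. gder H \<tau> (mix ?u (vec_nth x) y))"
      using gder_pairing(1)[where \<phi>="\<lambda>_. 1" and B=1, OF Hm Hi \<tau> top_set_subset_supp z _ one] by simp
  qed (simp add: vec_nth_replace_coords)
  fix \<Phi> assume jet: "test_jet ?u a b \<Phi>"
  define \<phi> where "\<phi> \<sigma> z = \<Phi> \<sigma> (vec_lambda z)" for \<sigma> z
  note \<phi> = test_jet_functions[OF jet, folded \<phi>_def]
  have \<Phi>: "\<Phi> \<sigma> y = \<phi> \<sigma> (vec_nth y)" for \<sigma> y by (simp add: \<phi>_def vec_nth_inverse)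
  obtain B1 where B1: "\<forall>z\<in>bx. \<bar>\<phi> \<tau> z\<bar> \<le> B1" using \<phi>(2) by blast
  obtain B2 where B2: "\<forall>z\<in>bx. \<bar>\<phi> (\<lambda>_. 0) z\<bar> \<le> B2" using \<phi>(2) by blast
  let ?z = "vec_nth x"
  have fib: "(\<lambda>T. LINT y|LL v. Kp \<tau>' v (mix v (mix w ?z T) y) T * \<phi> \<sigma> (mix v (mix w ?z T) y)) \<in> borel_measurable BP" for \<tau>' v w \<sigma>
  proof (rule L.PI_measurable2[where h="\<lambda>T z. Kp \<tau>' v z T * \<phi> \<sigma> z" and f="\<lambda>T. mix w ?z T"])
    have "?z \<in> space BP" by (simp add: space_PiM)
    then show "(\<lambda>T. mix w ?z T) \<in> measurable BP BP"
      by (intro mix_measurable_UNIV measurable_const measurable_ident_sets refl)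
    show "(\<lambda>p. Kp \<tau>' v (snd p) (fst p) * \<phi> \<sigma> (snd p)) \<in> borel_measurable (BP \<Otimes>\<^sub>M BP)"
      using measurable_compose[OF measurable_Pair[OF measurable_snd measurable_fst] Kp_measurable] measurable_compose[OF measurable_snd \<phi>(1)]
      by (intro borel_measurable_times) auto
  qed
  have secm: "(\<lambda>T. Kp \<tau>' v ?z T) \<in> borel_measurable BP" for \<tau>' v
  proof -
    have "?z \<in> space BP" by (simp add: space_PiM)
    from measurable_compose[OF measurable_Pair1'[OF this] Kp_measurable] show ?thesis by simp
  qed
  have indm: "(\<lambda>T. \<Prod>j\<in>?w. indicat_real {a $ j..b $ j} (T j)) \<in> borel_measurable BP"
    by (intro borel_measurable_prod measurable_compose[OF PiM_component_measurable]) auto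
  have "partial_integral ?u a b (\<lambda>y. f y * \<Phi> \<tau> y) x = (LINT y|LL ?u. gder H (\<lambda>_. 0) (mix ?u ?z y) * \<phi> \<tau> (mix ?u ?z y))"
  proof (rule partial_integral_LL(1))
    show "(\<lambda>y. gder H (\<lambda>_. 0) (mix ?u ?z y) * \<phi> \<tau> (mix ?u ?z y)) \<in> borel_measurable (LL ?u)"
      unfolding L.measurable_P by (intro borel_measurable_times const_mix_measurable gder_measurable Hm \<phi>(1))
    show "f (replace_coords ?u y x) * \<Phi> \<tau> (replace_coords ?u y x) = gder H (\<lambda>_. 0) (mix ?u ?z y) * \<phi> \<tau> (mix ?u ?z y)"
      if "y \<in> PiE ?u (\<lambda>j. {a $ j..b $ j})" for y
      using f[OF box[OF that]] by (simp add: \<Phi> vec_nth_replace_coords)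
  qed
  also have "\<dots> = (LINT T|MM UNIV. H T * (Kp (\<lambda>_. 0) (- ?u) ?z T * (LINT y|LL ?u. Kp (\<lambda>_. 0) ?u (mix ?u ?z y) T * \<phi> \<tau> (mix ?u ?z y))))"
    using gder_pairing(2)[OF Hm Hi zero_multi_le _ z \<phi>(1) B1, of ?u] by simp
  also have "\<dots> = (LINT T|MM UNIV. (-1) ^ (\<Sum>j\<in>UNIV. \<tau> j) * ((\<Prod>j\<in>?w. indicat_real {a $ j..b $ j} (T j)) * (H T * (Kp \<tau> (- ?u) ?z T *
        (LINT y|LL (?u - ?w). Kp \<tau> (?u - ?w) (mix (?u - ?w) (mix ?w ?z T) y) T * \<phi> (\<lambda>_. 0) (mix (?u - ?w) (mix ?w ?z T) y))))))"
  proof (rule integral_cong_AE)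
    show "(\<lambda>T. H T * (Kp (\<lambda>_. 0) (- ?u) ?z T * (LINT y|LL ?u. Kp (\<lambda>_. 0) ?u (mix ?u ?z y) T * \<phi> \<tau> (mix ?u ?z y)))) \<in> borel_measurable (MM UNIV)"
      unfolding M.measurable_P using fib[where \<tau>'="\<lambda>_. 0" and v="?u" and w="{}" and \<sigma>=\<tau>] by (intro borel_measurable_times Hm secm) simp
    show "(\<lambda>T. (-1) ^ (\<Sum>j\<in>UNIV. \<tau> j) * ((\<Prod>j\<in>?w. indicat_real {a $ j..b $ j} (T j)) * (H T * (Kp \<tau> (- ?u) ?z T *
        (LINT y|LL (?u - ?w). Kp \<tau> (?u - ?w) (mix (?u - ?w) (mix ?w ?z T) y) T * \<phi> (\<lambda>_. 0) (mix (?u - ?w) (mix ?w ?z T) y)))))) \<in> borel_measurable (MM UNIV)"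
      unfolding M.measurable_P by (intro borel_measurable_times Hm secm indm fib borel_measurable_const)
    show "AE T in MM UNIV. H T * (Kp (\<lambda>_. 0) (- ?u) ?z T * (LINT y|LL ?u. Kp (\<lambda>_. 0) ?u (mix ?u ?z y) T * \<phi> \<tau> (mix ?u ?z y))) =
      (-1) ^ (\<Sum>j\<in>UNIV. \<tau> j) * ((\<Prod>j\<in>?w. indicat_real {a $ j..b $ j} (T j)) * (H T * (Kp \<tau> (- ?u) ?z T *
        (LINT y|LL (?u - ?w). Kp \<tau> (?u - ?w) (mix (?u - ?w) (mix ?w ?z T) y) T * \<phi> (\<lambda>_. 0) (mix (?u - ?w) (mix ?w ?z T) y)))))"
      using AE_MM[of UNIV]
    proof eventually_elim
      case (elim T)
      have uw: "?u \<inter> ?w = ?w" using top_set_subset_supp by auto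
      have s: "(\<Sum>j\<in>?u. \<tau> j) = (\<Sum>j\<in>UNIV. \<tau> j)" by (intro sum.mono_neutral_left) (auto simp: multi_supp_def)
      have t: "(\<lambda>j. if j \<in> ?u then 0 + \<tau> j else 0) = \<tau>" by (auto simp: multi_supp_def)
      have "(LINT y|LL ?u. Kp (\<lambda>_. 0) ?u (mix ?u ?z y) T * \<phi> \<tau> (mix ?u ?z y)) =
        (-1) ^ (\<Sum>j\<in>UNIV. \<tau> j) * (\<Prod>j\<in>?w. indicat_real {a $ j..b $ j} (T j)) *
        (LINT y|LL (?u - ?w). Kp \<tau> (?u - ?w) (mix (?u - ?w) (mix ?w ?z T) y) T * \<phi> (\<lambda>_. 0) (mix (?u - ?w) (mix ?w ?z T) y))"
        using parts_on_fibers[OF \<tau>, of T \<phi> ?u ?z "\<lambda>_. 0", unfolded uw s t] elim \<phi> z by simp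
      moreover have "Kp (\<lambda>_. 0) (- ?u) ?z T = Kp \<tau> (- ?u) ?z T"
        by (intro Kp_cong) (auto simp: multi_supp_def)
      ultimately show ?case by (simp add: mult_ac)
    qed
  qed
  also have "\<dots> = (-1) ^ (\<Sum>j\<in>UNIV. \<tau> j) * (LINT y|LL ?u. gder H \<tau> (mix ?u ?z y) * \<phi> (\<lambda>_. 0) (mix ?u ?z y))"
    unfolding gder_pairing(2)[OF Hm Hi \<tau> top_set_subset_supp z \<phi>(1) B2] by simp
  also have "(LINT y|LL ?u. gder H \<tau> (mix ?u ?z y) * \<phi> (\<lambda>_. 0) (mix ?u ?z y)) =
      partial_integral ?u a b (\<lambda>y. gder H \<tau> (vec_nth y) * \<Phi> (\<lambda>_. 0) y) x"
  proof (rule partial_integral_LL(1)[symmetric])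
    show "(\<lambda>y. gder H \<tau> (mix ?u ?z y) * \<phi> (\<lambda>_. 0) (mix ?u ?z y)) \<in> borel_measurable (LL ?u)"
      unfolding L.measurable_P by (intro borel_measurable_times const_mix_measurable gder_measurable Hm \<phi>(1))
  qed (simp add: \<Phi> vec_nth_replace_coords)
  finally show "partial_integral ?u a b (\<lambda>y. f y * \<Phi> \<tau> y) x =
      (-1) ^ (\<Sum>j\<in>UNIV. \<tau> j) * partial_integral ?u a b (\<lambda>y. gder H \<tau> (vec_nth y) * \<Phi> (\<lambda>_. 0) y) x" .
qed

end

section \<open>Test functions\<close>

text \<open>With \<open>y = 1 / x\<close>, differentiating \<open>P y * exp (- y)\<close> in
  \<open>x\<close> gives \<open>y\<^sup>2 * (P y - P' y) * exp (- y)\<close>; the factor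
  \<open>monom 1 2\<close> is \<open>y\<^sup>2\<close>.\<close>

fun flatP :: "nat \<Rightarrow> real poly" where
  "flatP 0 = 1"
| "flatP (Suc n) = monom 1 2 * (flatP n - pderiv (flatP n))"

text \<open>\<open>flat n\<close> is the derivative of order \<open>n\<close> of the function \<open>exp (- 1 / x)\<close>, extended by \<open>0\<close> to \<open>x \<le> 0\<close>.\<close>

definition flat :: "nat \<Rightarrow> real \<Rightarrow> real" where
  "flat n x = (if x > 0 then poly (flatP n) (1 / x) * exp (- (1 / x)) else 0)"

text \<open>The case \<open>k = 1\<close> is the difference quotient of \<open>flat n\<close> at 0,
  written in the variable \<open>1 / h\<close>; other exponents occur in the induction over the
  coefficients, where \<open>pCons\<close> raises \<open>k\<close>.\<close>

lemma poly_exp_tendsto_0: "((\<lambda>y. y ^ k * poly p y / exp y) \<longlongrightarrow> (0::real)) at_top"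
proof (induction p arbitrary: k)
  case 0
  show ?case by simp
next
  case (pCons c p)
  have "((\<lambda>y. c * (y ^ k / exp y) + y ^ Suc k * poly p y / exp y) \<longlongrightarrow> c * 0 + 0) at_top"
    by (intro tendsto_intros tendsto_power_div_exp_0 pCons.IH)
  moreover have "(\<lambda>y. c * (y ^ k / exp y) + y ^ Suc k * poly p y / exp y) = (\<lambda>y. y ^ k * poly (pCons c p) y / exp y)"
    by (auto simp: algebra_simps add_divide_distrib)
  ultimately show ?case by simp
qed

lemma flat_has_derivative: "(flat n has_real_derivative flat (Suc n) x) (at x)"
proof -
  consider "x > 0" | "x < 0" | "x = 0" by linarith
  then show ?thesis
  proof cases
    case 1
    have "((\<lambda>x. poly (flatP n) (1 / x) * exp (- (1 / x))) has_real_derivative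
        poly (pderiv (flatP n)) (1 / x) * (- (1 / x\<^sup>2)) * exp (- (1 / x)) + exp (- (1 / x)) * (1 / x\<^sup>2) * poly (flatP n) (1 / x)) (at x)"
    proof -
      have i: "((\<lambda>x. 1 / x) has_real_derivative - (1 / x\<^sup>2)) (at x)"
        using 1 by (auto intro!: derivative_eq_intros simp: power2_eq_square)
      have p: "((\<lambda>x. poly (flatP n) (1 / x)) has_real_derivative poly (pderiv (flatP n)) (1 / x) * (- (1 / x\<^sup>2))) (at x)"
        by (rule DERIV_chain2[where f="poly (flatP n)" and g="\<lambda>x. 1 / x", OF poly_DERIV i])
      have e: "((\<lambda>x. exp (- (1 / x))) has_real_derivative exp (- (1 / x)) * (1 / x\<^sup>2)) (at x)"
        by (rule DERIV_cong[OF DERIV_chain2[where f=exp and g="\<lambda>x. - (1 / x)", OF DERIV_exp DERIV_minus[OF i]]]) simp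
      show ?thesis by (rule DERIV_cong[OF DERIV_mult[OF p e]]) (simp add: mult_ac)
    qed
    moreover have "poly (pderiv (flatP n)) (1 / x) * (- (1 / x\<^sup>2)) * exp (- (1 / x)) + exp (- (1 / x)) * (1 / x\<^sup>2) * poly (flatP n) (1 / x) = flat (Suc n) x"
      using 1 by (simp add: flat_def poly_monom power_one_over algebra_simps)
    ultimately have "((\<lambda>x. poly (flatP n) (1 / x) * exp (- (1 / x))) has_real_derivative flat (Suc n) x) (at x)" by simp
    then show ?thesis
      by (rule has_field_derivative_transform_within_open[of _ _ _ "{0<..}"]) (use 1 in \<open>auto simp: flat_def\<close>)
  next
    case 2
    have "((\<lambda>_. 0) has_real_derivative flat (Suc n) x) (at x)" using 2 by (simp add: flat_def)
    then show ?thesis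
      by (rule has_field_derivative_transform_within_open[of _ _ _ "{..<0}"]) (use 2 in \<open>auto simp: flat_def\<close>)
  next
    case 3
    have r: "((\<lambda>h. (flat n h - flat n 0) / h) \<longlongrightarrow> 0) (at_right 0)"
    proof -
      have "((\<lambda>h. (inverse h) ^ 1 * poly (flatP n) (inverse h) / exp (inverse h)) \<longlongrightarrow> 0) (at_right (0::real))"
        by (rule filterlim_compose[OF poly_exp_tendsto_0 filterlim_inverse_at_top_right])
      moreover have "\<forall>\<^sub>F h in at_right 0. (inverse h) ^ 1 * poly (flatP n) (inverse h) / exp (inverse h) = (flat n h - flat n 0) / h"
        using eventually_at_right_less[of 0]
        by eventually_elim (simp add: flat_def exp_minus field_simps)
      ultimately show ?thesis by (rule Lim_transform_eventually)
    qed
    have l: "((\<lambda>h. (flat n h - flat n 0) / h) \<longlongrightarrow> 0) (at_left 0)"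
    proof -
      have "\<forall>\<^sub>F h in at_left 0. (flat n h - flat n 0) / h = 0"
        by (simp add: eventually_at_left_field flat_def) (auto intro: exI[of _ "-1"])
      then show ?thesis by (simp add: tendsto_eventually)
    qed
    have "((\<lambda>h. (flat n h - flat n 0) / h) \<longlongrightarrow> 0) (at 0)"
      using filterlim_split_at[OF l r] by simp
    then show ?thesis using 3 by (simp add: DERIV_def flat_def[of "Suc n"])
  qed
qed

lemma leibniz_derivative:
  fixes u v :: "nat \<Rightarrow> real \<Rightarrow> real"
  assumes u: "\<And>n x. (u n has_real_derivative u (Suc n) x) (at x)" and v: "\<And>n x. (v n has_real_derivative v (Suc n) x) (at x)"
  shows "((\<lambda>x. \<Sum>i\<le>n. real (n choose i) * (u i x * v (n - i) x)) has_real_derivative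
    (\<Sum>i\<le>Suc n. real (Suc n choose i) * (u i x * v (Suc n - i) x))) (at x)"
proof -
  have "((\<lambda>x. \<Sum>i\<le>n. real (n choose i) * (u i x * v (n - i) x)) has_real_derivative
      (\<Sum>i\<le>n. real (n choose i) * (u (Suc i) x * v (n - i) x + v (Suc (n - i)) x * u i x))) (at x)"
    by (intro DERIV_sum DERIV_cmult DERIV_mult u v)
  moreover have "(\<Sum>i\<le>Suc n. real (Suc n choose i) * (u i x * v (Suc n - i) x)) =
      (\<Sum>i\<le>n. real (n choose i) * (u (Suc i) x * v (n - i) x + v (Suc (n - i)) x * u i x))"
  proof -
    have "(\<Sum>i\<le>Suc n. real (Suc n choose i) * (u i x * v (Suc n - i) x)) =
        u 0 x * v (Suc n) x + (\<Sum>i\<le>n. real (Suc n choose Suc i) * (u (Suc i) x * v (n - i) x))"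
      by (subst sum.atMost_Suc_shift) simp
    also have "(\<Sum>i\<le>n. real (Suc n choose Suc i) * (u (Suc i) x * v (n - i) x)) =
        (\<Sum>i\<le>n. real (n choose i) * (u (Suc i) x * v (n - i) x)) + (\<Sum>i\<le>n. real (n choose Suc i) * (u (Suc i) x * v (n - i) x))"
      by (simp add: sum.distrib[symmetric] distrib_right)
    also have "u 0 x * v (Suc n) x + ((\<Sum>i\<le>n. real (n choose i) * (u (Suc i) x * v (n - i) x)) + (\<Sum>i\<le>n. real (n choose Suc i) * (u (Suc i) x * v (n - i) x))) =
        (\<Sum>i\<le>n. real (n choose i) * (u (Suc i) x * v (n - i) x)) + (\<Sum>i\<le>Suc n. real (n choose i) * (u i x * v (Suc n - i) x))"
    proof -
      have "(\<Sum>i\<le>Suc n. real (n choose i) * (u i x * v (Suc n - i) x)) =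
          u 0 x * v (Suc n) x + (\<Sum>i\<le>n. real (n choose Suc i) * (u (Suc i) x * v (n - i) x))"
        by (subst sum.atMost_Suc_shift) simp
      then show ?thesis by simp
    qed
    also have "(\<Sum>i\<le>Suc n. real (n choose i) * (u i x * v (Suc n - i) x)) = (\<Sum>i\<le>n. real (n choose i) * (v (Suc (n - i)) x * u i x))"
      by (simp add: Suc_diff_le mult.commute)
    finally show ?thesis by (simp add: sum.distrib distrib_left)
  qed
  ultimately show ?thesis by simp
qed

text \<open>Order 0 is a product of two flat profiles supported in \<open>{c..d}\<close>; the higher
  orders are its derivatives, written out by Leibniz' rule. Scaling by \<open>N\<close> drives the
  profiles to 1 inside the interval.\<close>

definition bump :: "nat \<Rightarrow> real \<Rightarrow> real \<Rightarrow> nat \<Rightarrow> real \<Rightarrow> real" where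
  "bump N c d n x = (\<Sum>i\<le>n. real (n choose i) *
     ((real N ^ i * flat i (real N * (x - c))) * ((- real N) ^ (n - i) * flat (n - i) (real N * (d - x)))))"

lemma bump_has_derivative: "(bump N c d n has_real_derivative bump N c d (Suc n) x) (at x)"
proof -
  have lin: "((\<lambda>x. r ^ n * flat n (r * x + q)) has_real_derivative r ^ Suc n * flat (Suc n) (r * x + q)) (at x)" for r q n x
  proof -
    have "((\<lambda>x. r * x + q) has_real_derivative r) (at x)" by (auto intro!: derivative_eq_intros)
    from DERIV_chain2[where f="flat n" and g="\<lambda>x. r * x + q", OF flat_has_derivative this]
    have "((\<lambda>x. r ^ n * flat n (r * x + q)) has_real_derivative r ^ n * (flat (Suc n) (r * x + q) * r)) (at x)"
      by (rule DERIV_cmult)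
    then show ?thesis by (simp add: mult_ac)
  qed
  have 1: "((\<lambda>x. real N ^ n * flat n (real N * (x - c))) has_real_derivative real N ^ Suc n * flat (Suc n) (real N * (x - c))) (at x)" for n x
    using lin[of "real N" n "- real N * c" x] by (simp add: right_diff_distrib)
  have 2: "((\<lambda>x. (- real N) ^ n * flat n (real N * (d - x))) has_real_derivative (- real N) ^ Suc n * flat (Suc n) (real N * (d - x))) (at x)" for n x
    using lin[of "- real N" n "real N * d" x] by (simp add: right_diff_distrib)
  show ?thesis
    using leibniz_derivative[of "\<lambda>n x. real N ^ n * flat n (real N * (x - c))" "\<lambda>n x. (- real N) ^ n * flat n (real N * (d - x))", OF 1 2]
    unfolding bump_def[abs_def] .
qed

lemma bump_continuous: "continuous_on S (bump N c d n)"
  by (intro continuous_at_imp_continuous_on ballI DERIV_isCont[OF bump_has_derivative])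

lemma bump_0: "bump N c d 0 x = flat 0 (real N * (x - c)) * flat 0 (real N * (d - x))"
  by (simp add: bump_def)

lemma flat_0_bounds: "0 \<le> flat 0 x" "flat 0 x \<le> 1"
  by (auto simp: flat_def)

lemma bump_0_bound: "\<bar>bump N c d 0 x\<bar> \<le> 1"
  using flat_0_bounds by (simp add: bump_0 abs_mult mult_le_one)

lemma bump_0_support: "bump N c d 0 x \<noteq> 0 \<Longrightarrow> c \<le> x \<and> x \<le> d"
  by (auto simp: bump_0 flat_def zero_less_mult_iff split: if_splits)

text \<open>The margins keep the support in a compact part of the open interval, as
  \<open>test_jet\<close> demands. They tend to 0, so for \<open>x\<close> inside the scaled
  arguments still tend to infinity, where \<open>flat 0\<close> approaches 1.\<close>

lemma bump_0_tendsto: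
  "(\<lambda>N. bump N (c + 1 / (real N + 1)) (d - 1 / (real N + 1)) 0 x) \<longlonglongrightarrow> indicator {c<..<d} x"
proof (cases "x \<in> {c<..<d}")
  case True
  have flat1: "(flat 0 \<longlongrightarrow> 1) at_top"
  proof -
    have "((\<lambda>y::real. exp (- (1 / y))) \<longlongrightarrow> exp (- 0)) at_top"
      by (intro tendsto_intros tendsto_divide_0[OF tendsto_const] filterlim_at_top_imp_at_infinity filterlim_ident)
    moreover have "\<forall>\<^sub>F y in at_top. exp (- (1 / y)) = flat 0 y"
      using eventually_gt_at_top[of 0] by eventually_elim (simp add: flat_def)
    ultimately show ?thesis by (simp add: tendsto_cong)
  qed
  have inf: "filterlim (\<lambda>N. real N * (r - 1 / (real N + 1))) at_top sequentially" if "r > 0" for r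
  proof -
    have z: "(\<lambda>N. 1 / (real N + 1)) \<longlonglongrightarrow> 0"
      using LIMSEQ_inverse_real_of_nat by (simp add: inverse_eq_divide add.commute)
    have "(\<lambda>N. r - 1 / (real N + 1)) \<longlonglongrightarrow> r - 0" by (intro tendsto_intros z)
    then have "filterlim (\<lambda>N. (r - 1 / (real N + 1)) * real N) at_top sequentially"
      using that by (intro filterlim_tendsto_pos_mult_at_top[of _ r] filterlim_real_sequentially) auto
    then show ?thesis by (simp add: mult.commute)
  qed
  have "(\<lambda>N. flat 0 (real N * ((x - c) - 1 / (real N + 1))) * flat 0 (real N * ((d - x) - 1 / (real N + 1)))) \<longlonglongrightarrow> 1 * 1"
    using True by (intro tendsto_mult filterlim_compose[OF flat1] inf) auto
  then show ?thesis using True by (simp add: bump_0 algebra_simps)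
next
  case False
  have "bump N (c + 1 / (real N + 1)) (d - 1 / (real N + 1)) 0 x = 0" for N
  proof (rule ccontr)
    assume "bump N (c + 1 / (real N + 1)) (d - 1 / (real N + 1)) 0 x \<noteq> 0"
    from bump_0_support[OF this] have "c + 1 / (real N + 1) \<le> x" "x \<le> d - 1 / (real N + 1)" by auto
    moreover have "0 < 1 / (real N + 1)" by simp
    ultimately have "c < x" "x < d" by linarith+
    then show False using False by simp
  qed
  then show ?thesis using False by simp
qed

section \<open>Uniqueness of mixed derivatives\<close>

context sobolev_box
begin

text \<open>A product over \<open>u\<close> is constant in all other coordinates, so a multi-index
  with a positive entry outside \<open>u\<close> has to give 0; this is the case
  distinction.\<close>

lemma product_test_jet:
  assumes r: "\<And>j n x. (r j n has_real_derivative r j (Suc n) x) (at x)"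
    and supp: "\<And>j x. j \<in> u \<Longrightarrow> r j 0 x \<noteq> 0 \<Longrightarrow> c j \<le> x \<and> x \<le> d j" and cd: "\<And>j. j \<in> u \<Longrightarrow> a $ j < c j \<and> d j < b $ j"
  shows "test_jet u a b (\<lambda>\<sigma> x. if \<forall>j\<in>- u. \<sigma> j = 0 then \<Prod>j\<in>u. r j (\<sigma> j) (x $ j) else 0)"
  unfolding test_jet_def
proof (intro conjI allI)
  have cont: "continuous_on S (r j n)" for S j n
    by (intro continuous_at_imp_continuous_on ballI DERIV_isCont[OF r])
  fix \<sigma> :: "'n \<Rightarrow> nat"
  have "continuous_on UNIV (\<lambda>x::real^'n. \<Prod>j\<in>u. r j (\<sigma> j) (x $ j))"
    by (intro continuous_on_prod continuous_on_compose2[OF cont[of UNIV]] continuous_intros) auto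
  then have "continuous_on UNIV (\<lambda>x::real^'n. if P then \<Prod>j\<in>u. r j (\<sigma> j) (x $ j) else 0)" for P
    by (cases P) simp_all
  then show "continuous_on UNIV (\<lambda>x::real^'n. if \<forall>j\<in>- u. \<sigma> j = 0 then \<Prod>j\<in>u. r j (\<sigma> j) (x $ j) else 0)" .
  fix j and x :: "real ^ 'n"
  show "((\<lambda>t. if \<forall>j\<in>- u. \<sigma> j = 0 then \<Prod>i\<in>u. r i (\<sigma> i) ((x + t *\<^sub>R axis j 1) $ i) else 0) has_real_derivative
      (if \<forall>i\<in>- u. (\<sigma>(j := Suc (\<sigma> j))) i = 0 then \<Prod>i\<in>u. r i ((\<sigma>(j := Suc (\<sigma> j))) i) (x $ i) else 0)) (at 0)"
  proof (cases "j \<in> u")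
    case True
    have split: "(\<Prod>i\<in>u. r i (\<sigma>' i) (y i)) = r j (\<sigma>' j) (y j) * (\<Prod>i\<in>u - {j}. r i (\<sigma>' i) (y i))" for \<sigma>' y
      using True by (simp add: prod.remove)
    have "((\<lambda>t. r j (\<sigma> j) (x $ j + t)) has_real_derivative r j (Suc (\<sigma> j)) (x $ j)) (at 0)"
      using r[of j "\<sigma> j" "x $ j"] DERIV_shift[where f="r j (\<sigma> j)" and x=0 and z="x $ j"] by (simp add: add.commute)
    then have d: "((\<lambda>t. r j (\<sigma> j) (x $ j + t) * (\<Prod>i\<in>u - {j}. r i (\<sigma> i) (x $ i))) has_real_derivative
        r j (Suc (\<sigma> j)) (x $ j) * (\<Prod>i\<in>u - {j}. r i (\<sigma> i) (x $ i))) (at 0)"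
      by (rule DERIV_cmult_right)
    have e1: "(\<Prod>i\<in>u. r i (\<sigma> i) ((x + t *\<^sub>R axis j 1) $ i)) = r j (\<sigma> j) (x $ j + t) * (\<Prod>i\<in>u - {j}. r i (\<sigma> i) (x $ i))" for t
      unfolding split by (auto simp: axis_def intro!: arg_cong2[where f="(*)"] prod.cong)
    have e2: "(\<Prod>i\<in>u. r i ((\<sigma>(j := Suc (\<sigma> j))) i) (x $ i)) = r j (Suc (\<sigma> j)) (x $ j) * (\<Prod>i\<in>u - {j}. r i (\<sigma> i) (x $ i))"
      unfolding split by (auto intro!: arg_cong2[where f="(*)"] prod.cong)
    have e3: "(\<forall>i\<in>- u. (\<sigma>(j := Suc (\<sigma> j))) i = 0) \<longleftrightarrow> (\<forall>j\<in>- u. \<sigma> j = 0)" using True by auto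
    have "((\<lambda>t. if P then r j (\<sigma> j) (x $ j + t) * (\<Prod>i\<in>u - {j}. r i (\<sigma> i) (x $ i)) else 0) has_real_derivative
        (if P then r j (Suc (\<sigma> j)) (x $ j) * (\<Prod>i\<in>u - {j}. r i (\<sigma> i) (x $ i)) else 0)) (at 0)" for P
      using d by (cases P) simp_all
    then show ?thesis unfolding e1 e2 e3 .
  next
    case False
    have "(\<Prod>i\<in>u. r i (\<sigma> i) ((x + t *\<^sub>R axis j 1) $ i)) = (\<Prod>i\<in>u. r i (\<sigma> i) (x $ i))" for t
      using False by (intro prod.cong) (auto simp: axis_def)
    moreover have "\<not> (\<forall>i\<in>- u. (\<sigma>(j := Suc (\<sigma> j))) i = 0)" using False by auto
    ultimately show ?thesis by (simp only: if_False DERIV_const)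
  qed
next
  show "\<exists>c d. (\<forall>j\<in>u. a $ j < c $ j \<and> d $ j < b $ j) \<and>
     (\<forall>x. (if \<forall>j\<in>- u. (0::nat) = 0 then \<Prod>j\<in>u. r j 0 (x $ j) else 0) \<noteq> 0 \<longrightarrow> (\<forall>j\<in>u. c $ j \<le> x $ j \<and> x $ j \<le> d $ j))"
  proof (rule exI[of _ "vec_lambda c"], rule exI[of _ "vec_lambda d"], intro conjI allI impI ballI)
    fix x :: "real ^ 'n" and j assume "(if \<forall>j\<in>- u. (0::nat) = 0 then \<Prod>j\<in>u. r j 0 (x $ j) else 0) \<noteq> 0" and j: "j \<in> u"
    then have "r j 0 (x $ j) \<noteq> 0" by auto
    from supp[OF j this] show "vec_lambda c $ j \<le> x $ j" "x $ j \<le> vec_lambda d $ j" by auto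
  qed (use cd in auto)
qed

text \<open>The fundamental lemma of the calculus of variations on a single fibre. Products of bumps
  tend boundedly to indicators of open rectangles, and these form an intersection-stable generator
  of the product sigma-algebra; hence all integrals over measurable sets vanish. The faces of the
  box are null.\<close>

lemma test_functions_separate:
  assumes x: "x \<in> cbox a b" and ki: "integrable (LL u) k"
    and orth: "\<And>\<Phi>. test_jet u a b \<Phi> \<Longrightarrow> (LINT y|LL u. k y * \<Phi> (\<lambda>_. 0) (replace_coords u y x)) = 0"
  shows "AE y in LL u. k y = 0"
proof -
  have km: "k \<in> borel_measurable (LL u)" using ki by simp
  have comp: "(\<lambda>y. y j) \<in> borel_measurable (LL u)" if "j \<in> u" for j
    unfolding L.measurable_P using PiM_component_measurable[OF that] .
  \<comment> \<open>\<open>max\<close> and \<open>min\<close> intersect the rectangle with the open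
    box; an empty intersection is allowed, and the bumps are then 0.\<close>
  have rect: "(LINT y|LL u. k y * (\<Prod>j\<in>u. indicator {max (a $ j) (c j)<..<min (b $ j) (d j)} (y j))) = 0" for c d
  proof -
    define r where "r N j = bump N (max (a $ j) (c j) + 1 / (real N + 1)) (min (b $ j) (d j) - 1 / (real N + 1))" for N j
    have rb: "\<bar>r N j 0 s\<bar> \<le> 1" for N j s unfolding r_def by (rule bump_0_bound)
    have rm: "r N j 0 \<in> borel_measurable borel" for N j
      unfolding r_def by (rule borel_measurable_continuous_onI[OF bump_continuous])
    have pm: "(\<lambda>y. \<Prod>j\<in>u. r N j 0 (y j)) \<in> borel_measurable (LL u)" for N
      by (intro borel_measurable_prod measurable_compose[OF comp rm])
    have z: "(LINT y|LL u. k y * (\<Prod>j\<in>u. r N j 0 (y j))) = 0" for N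
    proof -
      have "test_jet u a b (\<lambda>\<sigma> x. if \<forall>j\<in>- u. \<sigma> j = 0 then \<Prod>j\<in>u. r N j (\<sigma> j) (x $ j) else 0)"
      proof (rule product_test_jet)
        show "(r N j n has_real_derivative r N j (Suc n) s) (at s)" for j n s unfolding r_def by (rule bump_has_derivative)
        show "max (a $ j) (c j) + 1 / (real N + 1) \<le> s \<and> s \<le> min (b $ j) (d j) - 1 / (real N + 1)" if "r N j 0 s \<noteq> 0" for j s
          using that unfolding r_def by (rule bump_0_support)
        have "0 < 1 / (real N + 1)" by simp
        then show "a $ j < max (a $ j) (c j) + 1 / (real N + 1) \<and> min (b $ j) (d j) - 1 / (real N + 1) < b $ j" for j
          using max.cobounded1[of "a $ j" "c j"] min.cobounded1[of "b $ j" "d j"] by linarith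
      qed
      from orth[OF this] have "(LINT y|LL u. k y * (\<Prod>j\<in>u. r N j 0 (replace_coords u y x $ j))) = 0" by simp
      moreover have "(\<Prod>j\<in>u. r N j 0 (replace_coords u y x $ j)) = (\<Prod>j\<in>u. r N j 0 (y j))" for y
        by (intro prod.cong) (auto simp: replace_coords_def)
      ultimately show ?thesis by simp
    qed
    have "(\<lambda>N. LINT y|LL u. k y * (\<Prod>j\<in>u. r N j 0 (y j))) \<longlonglongrightarrow>
        (LINT y|LL u. k y * (\<Prod>j\<in>u. indicator {max (a $ j) (c j)<..<min (b $ j) (d j)} (y j)))"
    proof (rule integral_dominated_convergence[where w="\<lambda>y. \<bar>k y\<bar>"])
      show "(\<lambda>y. k y * (\<Prod>j\<in>u. indicator {max (a $ j) (c j)<..<min (b $ j) (d j)} (y j))) \<in> borel_measurable (LL u)"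
        by (intro borel_measurable_times km borel_measurable_prod measurable_compose[OF comp]) auto
      show "(\<lambda>y. k y * (\<Prod>j\<in>u. r N j 0 (y j))) \<in> borel_measurable (LL u)" for N
        by (intro borel_measurable_times km pm)
      show "integrable (LL u) (\<lambda>y. \<bar>k y\<bar>)" using ki by simp
      show "AE y in LL u. (\<lambda>N. k y * (\<Prod>j\<in>u. r N j 0 (y j))) \<longlonglongrightarrow> k y * (\<Prod>j\<in>u. indicator {max (a $ j) (c j)<..<min (b $ j) (d j)} (y j))"
        unfolding r_def by (intro AE_I2 tendsto_mult tendsto_const tendsto_prod bump_0_tendsto)
      show "AE y in LL u. norm (k y * (\<Prod>j\<in>u. r N j 0 (y j))) \<le> \<bar>k y\<bar>" for N
      proof (intro AE_I2)
        fix y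
        have "\<bar>\<Prod>j\<in>u. r N j 0 (y j)\<bar> \<le> 1" unfolding abs_prod by (intro prod_le_1) (auto simp: rb)
        then show "norm (k y * (\<Prod>j\<in>u. r N j 0 (y j))) \<le> \<bar>k y\<bar>"
          unfolding real_norm_def abs_mult by (intro mult_left_le) auto
      qed
    qed
    then show ?thesis unfolding z by (simp add: LIMSEQ_const_iff)
  qed
  \<comment> \<open>Cutting down to the open box makes the integral of \<open>k'\<close> over an
    arbitrary open rectangle an instance of \<open>rect\<close>.\<close>
  define k' where "k' y = k y * (\<Prod>j\<in>u. indicator {a $ j<..<b $ j} (y j))" for y
  have k'm: "k' \<in> borel_measurable (LL u)"
    unfolding k'_def by (intro borel_measurable_times km borel_measurable_prod measurable_compose[OF comp]) auto
  have k'i: "integrable (LL u) k'"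
  proof (rule Bochner_Integration.integrable_bound[OF ki k'm], intro AE_I2)
    fix y
    have "\<bar>\<Prod>j\<in>u. indicat_real {a $ j<..<b $ j} (y j)\<bar> \<le> 1" unfolding abs_prod by (intro prod_le_1) auto
    then show "norm (k' y) \<le> norm (k y)" unfolding k'_def real_norm_def abs_mult by (intro mult_left_le) auto
  qed
  define G where "G = {{f \<in> PiE u (\<lambda>_. UNIV). \<forall>i\<in>u. f i \<in> A i} | A. A \<in> Pi u (\<lambda>_. range (\<lambda>(c, d). {c<..<d::real}))}"
  have base: "(LINT y:A|LL u. k' y) = 0" if AG: "A \<in> G" for A
  proof -
    obtain A0 where A0: "A = {f \<in> PiE u (\<lambda>_. UNIV). \<forall>i\<in>u. f i \<in> A0 i}" "A0 \<in> Pi u (\<lambda>_. range (\<lambda>(c, d). {c<..<d::real}))"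
      using AG by (auto simp: G_def)
    then have "\<forall>i\<in>u. \<exists>c d. A0 i = {c<..<d}" by (fastforce simp: Pi_def)
    then obtain c d where cd: "\<And>i. i \<in> u \<Longrightarrow> A0 i = {c i<..<d i}" by metis
    have "(LINT y:A|LL u. k' y) = (LINT y|LL u. k y * (\<Prod>j\<in>u. indicator {max (a $ j) (c j)<..<min (b $ j) (d j)} (y j)))"
      unfolding set_lebesgue_integral_def
    proof (intro Bochner_Integration.integral_cong refl)
      fix y assume "y \<in> space (LL u)"
      then have y: "y \<in> PiE u (\<lambda>_. UNIV)" by (simp add: space_PiM L.space_N)
      have "indicat_real A y = (\<Prod>j\<in>u. indicator {c j<..<d j} (y j))"
      proof (cases "y \<in> A")
        case True
        then have "(\<Prod>j\<in>u. indicat_real {c j<..<d j} (y j)) = 1" using A0 cd by (intro prod.neutral) (auto simp: indicator_def)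
        then show ?thesis using True by simp
      next
        case False
        then obtain i where "i \<in> u" "y i \<notin> {c i<..<d i}" using A0 cd y by auto
        then have "(\<Prod>j\<in>u. indicat_real {c j<..<d j} (y j)) = 0" by (intro prod_zero bexI[of _ i]) (simp_all add: indicator_def)
        then show ?thesis using False by simp
      qed
      then have "indicat_real A y * (\<Prod>j\<in>u. indicator {a $ j<..<b $ j} (y j)) = (\<Prod>j\<in>u. indicator {c j<..<d j} (y j) * indicator {a $ j<..<b $ j} (y j))"
        by (simp add: prod.distrib)
      also have "\<dots> = (\<Prod>j\<in>u. indicator {max (a $ j) (c j)<..<min (b $ j) (d j)} (y j))"
        by (intro prod.cong) (auto simp: indicator_def)
      finally show "indicat_real A y *\<^sub>R k' y = k y * (\<Prod>j\<in>u. indicator {max (a $ j) (c j)<..<min (b $ j) (d j)} (y j))"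
        by (simp add: k'_def mult_ac)
    qed
    then show ?thesis by (simp add: rect)
  qed
  have setsG: "sets (LL u) = sigma_sets (PiE u (\<lambda>_. UNIV)) G"
  proof -
    have "sets (PiM u (\<lambda>_. sigma UNIV (range (\<lambda>(c, d). {c<..<d::real})))) = sets (sigma (PiE u (\<lambda>_. UNIV))
        {{f \<in> PiE u (\<lambda>_. UNIV). \<forall>i\<in>j. f i \<in> A i} | A j. j \<in> {u} \<and> A \<in> Pi j (\<lambda>_. range (\<lambda>(c, d). {c<..<d::real}))})"
    proof (rule sets_PiM_sigma)
      show "\<exists>S\<subseteq>range (\<lambda>(c, d). {c<..<d::real}). countable S \<and> UNIV = \<Union>S" for i :: 'n
      proof (intro exI[of _ "range (\<lambda>n::nat. {- real n<..<real n})"] conjI)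
        show "UNIV = \<Union> (range (\<lambda>n::nat. {- real n<..<real n}))"
        proof (intro equalityI subsetI)
          fix t :: real
          obtain n where "\<bar>t\<bar> < real n" using reals_Archimedean2 by blast
          then have "t \<in> {- real n<..<real n}" by auto
          then show "t \<in> \<Union> (range (\<lambda>n::nat. {- real n<..<real n}))" by blast
        qed simp
      qed auto
    qed auto
    moreover have "(\<lambda>_::'n. sigma UNIV (range (\<lambda>(c, d). {c<..<d::real}))) = (\<lambda>_. borel)"
      using borel_eq_box[where 'a=real] by (simp add: box_real(1))
    ultimately have "sets (PiM u (\<lambda>_. borel :: real measure)) = sets (sigma (PiE u (\<lambda>_. UNIV))
        {{f \<in> PiE u (\<lambda>_. UNIV). \<forall>i\<in>j. f i \<in> A i} | A j. j \<in> {u} \<and> A \<in> Pi j (\<lambda>_. range (\<lambda>(c, d). {c<..<d::real}))})"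
      by simp
    also have "\<dots> = sigma_sets (PiE u (\<lambda>_. UNIV)) G"
      unfolding G_def by (subst sets_measure_of) auto
    finally show ?thesis unfolding L.sets_P .
  qed
  have Int: "Int_stable G"
  proof (rule Int_stableI)
    fix A B assume "A \<in> G" "B \<in> G"
    then obtain A0 B0 where A: "A = {f \<in> PiE u (\<lambda>_. UNIV). \<forall>i\<in>u. f i \<in> A0 i}" "A0 \<in> Pi u (\<lambda>_. range (\<lambda>(c, d). {c<..<d::real}))"
      and B: "B = {f \<in> PiE u (\<lambda>_. UNIV). \<forall>i\<in>u. f i \<in> B0 i}" "B0 \<in> Pi u (\<lambda>_. range (\<lambda>(c, d). {c<..<d::real}))"
      unfolding G_def by blast
    have "A \<inter> B = {f \<in> PiE u (\<lambda>_. UNIV). \<forall>i\<in>u. f i \<in> A0 i \<inter> B0 i}" unfolding A B by auto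
    moreover have "(\<lambda>i. A0 i \<inter> B0 i) \<in> Pi u (\<lambda>_. range (\<lambda>(c, d). {c<..<d::real}))"
    proof
      fix i assume i: "i \<in> u"
      obtain p q where pq: "A0 i = {fst p<..<snd p}" "B0 i = {fst q<..<snd q}"
        using A(2) B(2) i by (fastforce simp: Pi_def)
      have "A0 i \<inter> B0 i = (\<lambda>(c, d). {c<..<d}) (max (fst p) (fst q), min (snd p) (snd q))" unfolding pq by auto
      then show "A0 i \<inter> B0 i \<in> range (\<lambda>(c, d). {c<..<d::real})" by blast
    qed
    ultimately show "A \<inter> B \<in> G" unfolding G_def by (intro CollectI exI[of _ "\<lambda>i. A0 i \<inter> B0 i"]) auto
  qed
  have sub: "G \<subseteq> Pow (PiE u (\<lambda>_. UNIV))" by (auto simp: G_def)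
  have total: "(LINT y|LL u. k' y) = 0"
    using rect[of "\<lambda>j. a $ j" "\<lambda>j. b $ j"] by (simp add: k'_def)
  have all: "(LINT y:A|LL u. k' y) = 0" if "A \<in> sets (LL u)" for A
    using Int sub that[unfolded setsG]
  proof (induction A rule: sigma_sets_induct_disjoint)
    case (basic A)
    then show ?case by (rule base)
  next
    case empty
    then show ?case by (simp add: set_lebesgue_integral_def)
  next
    case (compl A)
    have Am: "A \<in> sets (LL u)" using compl setsG by simp
    have "PiE u (\<lambda>_. UNIV) = space (LL u)" by (simp add: space_PiM L.space_N)
    then have "(LINT y:PiE u (\<lambda>_. UNIV) - A|LL u. k' y) = (LINT y|LL u. k' y) - (LINT y:A|LL u. k' y)"
    proof -
      have "(LINT y:PiE u (\<lambda>_. UNIV) - A|LL u. k' y) = (LINT y|LL u. k' y - indicat_real A y *\<^sub>R k' y)"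
        unfolding set_lebesgue_integral_def
        by (intro Bochner_Integration.integral_cong refl) (auto simp: indicator_def space_PiM L.space_N)
      also have "\<dots> = (LINT y|LL u. k' y) - (LINT y:A|LL u. k' y)"
        unfolding set_lebesgue_integral_def using k'i integrable_mult_indicator[OF Am k'i] by simp
      finally show ?thesis .
    qed
    then show ?case using compl(2) total by simp
  next
    case (union A)
    have Am: "A i \<in> sets (LL u)" for i using union setsG by auto
    have "set_integrable (LL u) (\<Union>i. A i) k'"
      unfolding set_integrable_def using Am by (intro integrable_mult_indicator k'i) auto
    then have "(LINT y:(\<Union>i. A i)|LL u. k' y) = (\<Sum>i. (LINT y:(A i)|LL u. k' y))"
      using union Am by (intro lebesgue_integral_countable_add) (auto simp: disjoint_family_on_def)
    then show ?case using union by simp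
  qed
  have "AE y in LL u. k' y = 0"
    by (rule density_unique_real[OF k'i]) (use all in \<open>auto simp: set_lebesgue_integral_def\<close>)
  moreover have "AE y in LL u. \<forall>j\<in>u. y j \<in> {a $ j<..<b $ j}"
  proof (rule L.AE_components)
    show "AE s in Lm j. s \<in> {a $ j<..<b $ j}" for j
    proof -
      have "AE s in lborel. s \<noteq> a $ j" "AE s in lborel. s \<noteq> b $ j" by (rule AE_lborel_singleton)+
      then have "AE s in lborel. 0 < ennreal (indicator {a $ j..b $ j} s) \<longrightarrow> s \<in> {a $ j<..<b $ j}"
        by eventually_elim (auto simp: indicator_def split: if_splits)
      then show ?thesis unfolding Lm_def leb_def by (subst AE_density) auto
    qed
  qed auto
  ultimately show ?thesis
  proof eventually_elim
    case (elim y)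
    then have "(\<Prod>j\<in>u. indicat_real {a $ j<..<b $ j} (y j)) = 1" by (intro prod.neutral) auto
    then show ?case using elim by (simp add: k'_def)
  qed
qed

text \<open>\<open>is_mixed_deriv\<close> grants measurability on the box only; the extension by 0
  is Borel on the whole space and can be composed with \<open>replace_coords\<close>.\<close>

definition restr :: "(real ^ 'n \<Rightarrow> real) \<Rightarrow> real ^ 'n \<Rightarrow> real" where
  "restr g x = indicator (cbox a b) x * g x"

lemma replace_coords_measurable:
  fixes x :: "real ^ 'n"
  shows "(\<lambda>y. replace_coords w y x) \<in> borel_measurable (PiM w (\<lambda>_. borel))"
proof -
  have "(\<lambda>y. mix w (vec_nth x) y) \<in> measurable (PiM w (\<lambda>_. borel)) BP"
    by (rule mix_measurable) (auto simp: space_PiM)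
  from measurable_compose[OF this vec_lambda_measurable] show ?thesis
    by (simp add: replace_coords_def mix_def)
qed

lemma replace_coords_cbox:
  assumes "x \<in> cbox a b" "y \<in> PiE u (\<lambda>j. {a $ j..b $ j})" shows "replace_coords u y x \<in> cbox a b"
  unfolding bx_cbox[symmetric] vec_nth_replace_coords
  using assms by (auto simp: bx_cbox[symmetric] bx_def mix_def PiE_iff)

text \<open>A mixed derivative is unique up to null sets on \<^emph>\<open>every\<close> fibre, which is why the integrals in the Bernoulli
  polynomial method do not depend on the choice made by \<^const>\<open>mixed_deriv\<close>.\<close>

theorem mixed_deriv_unique:
  assumes g: "is_mixed_deriv a b \<tau> f g" and g': "is_mixed_deriv a b \<tau> f g'" and x: "x \<in> cbox a b"
  shows "AE y in LL (multi_supp \<tau>). restr g (replace_coords (multi_supp \<tau>) y x) = restr g' (replace_coords (multi_supp \<tau>) y x)"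
proof -
  let ?u = "multi_supp \<tau>"
  have m: "(\<lambda>y. restr h (replace_coords ?u y x)) \<in> borel_measurable (LL ?u)" if "is_mixed_deriv a b \<tau> f h" for h
  proof -
    have "restr h \<in> borel_measurable borel"
      using that by (simp add: is_mixed_deriv_def set_borel_measurable_def restr_def[abs_def])
    then show ?thesis unfolding L.measurable_P by (rule measurable_compose[OF replace_coords_measurable])
  qed
  have eq: "restr h (replace_coords ?u y x) = h (replace_coords ?u y x)" if "y \<in> PiE ?u (\<lambda>j. {a $ j..b $ j})" for h y
    using replace_coords_cbox[OF x that] by (simp add: restr_def)
  have i: "integrable (LL ?u) (\<lambda>y. restr h (replace_coords ?u y x))" if h: "is_mixed_deriv a b \<tau> f h" for h
    using h x partial_integral_LL(2)[OF m[OF h], of h x] eq by (simp add: is_mixed_deriv_def)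
  have p: "partial_integral ?u a b (\<lambda>y. h y * \<Phi> (\<lambda>_. 0) y) x = (LINT y|LL ?u. restr h (replace_coords ?u y x) * \<Phi> (\<lambda>_. 0) (replace_coords ?u y x))"
    if h: "is_mixed_deriv a b \<tau> f h" and jet: "test_jet ?u a b \<Phi>" for h \<Phi>
  proof (rule partial_integral_LL(1))
    have "\<Phi> (\<lambda>_. 0) \<in> borel_measurable borel" using jet by (intro borel_measurable_continuous_onI) (simp add: test_jet_def)
    then have "(\<lambda>y. \<Phi> (\<lambda>_. 0) (replace_coords ?u y x)) \<in> borel_measurable (LL ?u)"
      unfolding L.measurable_P by (rule measurable_compose[OF replace_coords_measurable])
    then show "(\<lambda>y. restr h (replace_coords ?u y x) * \<Phi> (\<lambda>_. 0) (replace_coords ?u y x)) \<in> borel_measurable (LL ?u)"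
      by (intro borel_measurable_times m[OF h])
  qed (simp add: eq)
  have pb: "integrable (LL ?u) (\<lambda>y. restr h (replace_coords ?u y x) * \<Phi> (\<lambda>_. 0) (replace_coords ?u y x))"
    if h: "is_mixed_deriv a b \<tau> f h" and jet: "test_jet ?u a b \<Phi>" for h \<Phi>
  proof -
    have c: "continuous_on UNIV (\<Phi> (\<lambda>_. 0))" using jet by (simp add: test_jet_def)
    then have "bounded (\<Phi> (\<lambda>_. 0) ` cbox a b)"
      by (intro compact_imp_bounded compact_continuous_image continuous_on_subset[OF c]) auto
    then obtain B where B: "\<And>x. x \<in> cbox a b \<Longrightarrow> norm (\<Phi> (\<lambda>_. 0) x) \<le> B" unfolding bounded_iff by blast
    have "\<Phi> (\<lambda>_. 0) \<in> borel_measurable borel" using c by (rule borel_measurable_continuous_onI)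
    then have pm: "(\<lambda>y. \<Phi> (\<lambda>_. 0) (replace_coords ?u y x)) \<in> borel_measurable (LL ?u)"
      unfolding L.measurable_P by (rule measurable_compose[OF replace_coords_measurable])
    show ?thesis
    proof (rule Bochner_Integration.integrable_bound)
      show "integrable (LL ?u) (\<lambda>y. B * restr h (replace_coords ?u y x))" using i[OF h] by simp
      show "(\<lambda>y. restr h (replace_coords ?u y x) * \<Phi> (\<lambda>_. 0) (replace_coords ?u y x)) \<in> borel_measurable (LL ?u)"
        by (intro borel_measurable_times m[OF h] pm)
      show "AE y in LL ?u. norm (restr h (replace_coords ?u y x) * \<Phi> (\<lambda>_. 0) (replace_coords ?u y x)) \<le> norm (B * restr h (replace_coords ?u y x))"
      proof (intro AE_I2)
        fix y
        show "norm (restr h (replace_coords ?u y x) * \<Phi> (\<lambda>_. 0) (replace_coords ?u y x)) \<le> norm (B * restr h (replace_coords ?u y x))"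
        proof (cases "replace_coords ?u y x \<in> cbox a b")
          case True
          then have "norm (\<Phi> (\<lambda>_. 0) (replace_coords ?u y x)) \<le> \<bar>B\<bar>" using B[OF True] by simp
          then show ?thesis by (simp add: norm_mult abs_mult mult.commute[of B] mult_left_mono)
        qed (simp add: restr_def)
      qed
    qed
  qed
  have weak: "partial_integral ?u a b (\<lambda>y. f y * \<Phi> \<tau> y) x = (-1) ^ (\<Sum>j\<in>UNIV. \<tau> j) * partial_integral ?u a b (\<lambda>y. h y * \<Phi> (\<lambda>_. 0) y) x"
    if h: "is_mixed_deriv a b \<tau> f h" and jet: "test_jet ?u a b \<Phi>" for h \<Phi>
    by (rule mp[OF spec[OF conjunct2[OF conjunct2[OF bspec[OF conjunct2[OF h[unfolded is_mixed_deriv_def]] x]]]] jet])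
  have "AE y in LL ?u. restr g (replace_coords ?u y x) - restr g' (replace_coords ?u y x) = 0"
  proof (rule test_functions_separate[OF x])
    show "integrable (LL ?u) (\<lambda>y. restr g (replace_coords ?u y x) - restr g' (replace_coords ?u y x))"
      using i[OF g] i[OF g'] by simp
    fix \<Phi> assume jet: "test_jet ?u a b \<Phi>"
    have "(-1) ^ (\<Sum>j\<in>UNIV. \<tau> j) * partial_integral ?u a b (\<lambda>y. g y * \<Phi> (\<lambda>_. 0) y) x =
        (-1) ^ (\<Sum>j\<in>UNIV. \<tau> j) * partial_integral ?u a b (\<lambda>y. g' y * \<Phi> (\<lambda>_. 0) y) x"
      unfolding weak[OF g jet, symmetric] weak[OF g' jet, symmetric] ..
    then have "partial_integral ?u a b (\<lambda>y. g y * \<Phi> (\<lambda>_. 0) y) x = partial_integral ?u a b (\<lambda>y. g' y * \<Phi> (\<lambda>_. 0) y) x" by simp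
    then show "(LINT y|LL ?u. (restr g (replace_coords ?u y x) - restr g' (replace_coords ?u y x)) * \<Phi> (\<lambda>_. 0) (replace_coords ?u y x)) = 0"
      unfolding p[OF g jet] p[OF g' jet] using pb[OF g jet] pb[OF g' jet] by (simp add: left_diff_distrib)
  qed
  then show ?thesis by eventually_elim simp
qed

section \<open>The Bernoulli polynomial method and the inner product in terms of the data\<close>

abbreviation dind :: "'n \<Rightarrow> nat \<Rightarrow> real \<Rightarrow> real" where "dind j \<equiv> data_ind \<alpha> (a $ j) (b $ j)"

text \<open>\<open>H\<close> collects, on the product of the one-dimensional data spaces, the quantities whose squares make up the
  Sobolev norm of \<open>f\<close>.\<close>

definition has_data :: "(real ^ 'n \<Rightarrow> real) \<Rightarrow> (('n \<Rightarrow> real) \<Rightarrow> real) \<Rightarrow> bool" where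
  "has_data f H \<longleftrightarrow> L2 (MM UNIV) H \<and> (\<forall>x\<in>cbox a b. f x = gder H (\<lambda>_. 0) (vec_nth x))"

lemma has_data_facts:
  assumes "has_data f H"
  shows "H \<in> borel_measurable BP" "integrable (MM UNIV) H" "L2 (MM UNIV) H"
    "\<And>x. x \<in> cbox a b \<Longrightarrow> f x = gder H (\<lambda>_. 0) (vec_nth x)"
  using assms L2_measurable[of "MM UNIV" H] L2_integrable[OF M.finite_P, of UNIV H] M.measurable_P[of H UNIV borel]
  by (auto simp: has_data_def)

definition md :: "(real ^ 'n \<Rightarrow> real) \<Rightarrow> ('n \<Rightarrow> nat) \<Rightarrow> ('n \<Rightarrow> real) \<Rightarrow> real" where
  "md f \<tau> z = restr (mixed_deriv a b \<tau> f) (vec_lambda z)"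

lemma vec_nth_vec_lambda: "vec_nth (vec_lambda z) = z"
  by (rule ext) simp

text \<open>\<open>gder H \<tau>\<close> witnesses that a mixed derivative exists, so
  \<open>SOME\<close> in \<open>mixed_deriv\<close> picks a genuine one, and uniqueness on fibres
  compares the two.\<close>

lemma md_facts:
  assumes f: "has_data f H" and \<tau>: "\<tau> \<in> multi_le \<alpha>"
  shows "md f \<tau> \<in> borel_measurable BP"
    and "z \<in> bx \<Longrightarrow> AE y in LL (multi_supp \<tau>). md f \<tau> (mix (multi_supp \<tau>) z y) = gder H \<tau> (mix (multi_supp \<tau>) z y)"
proof -
  have g: "is_mixed_deriv a b \<tau> f (\<lambda>x. gder H \<tau> (vec_nth x))"
    by (rule gder_is_mixed_deriv[OF has_data_facts(1,2,4)[OF f] \<tau>])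
  then have d: "is_mixed_deriv a b \<tau> f (mixed_deriv a b \<tau> f)" unfolding mixed_deriv_def by (rule someI[where P="is_mixed_deriv a b \<tau> f"])
  have "restr (mixed_deriv a b \<tau> f) \<in> borel_measurable borel"
    using d by (simp add: is_mixed_deriv_def set_borel_measurable_def restr_def[abs_def])
  then show "md f \<tau> \<in> borel_measurable BP"
    unfolding md_def[abs_def] by (rule measurable_compose[OF vec_lambda_measurable])
  assume z: "z \<in> bx"
  let ?u = "multi_supp \<tau>"
  have rc: "replace_coords ?u y (vec_lambda z) = vec_lambda (mix ?u z y)" for y
    by (simp add: replace_coords_def mix_def vec_eq_iff)
  have "vec_lambda z \<in> cbox a b" using z by (simp add: bx_cbox[symmetric] vec_nth_vec_lambda)
  from mixed_deriv_unique[OF d g this] AE_LL_bx[OF z, of ?u]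
  show "AE y in LL ?u. md f \<tau> (mix ?u z y) = gder H \<tau> (mix ?u z y)"
  proof eventually_elim
    case (elim y)
    then have "vec_lambda (mix ?u z y) \<in> cbox a b" by (simp add: bx_cbox[symmetric] vec_nth_vec_lambda)
    then show ?case using elim(1) unfolding rc by (simp add: md_def restr_def vec_nth_vec_lambda)
  qed
qed

lemma partial_integral_md:
  assumes f: "has_data f H" and \<tau>: "\<tau> \<in> multi_le \<alpha>" and x: "x \<in> cbox a b"
  shows "partial_integral u a b (mixed_deriv a b \<tau> f) x = (LINT y|LL u. md f \<tau> (mix u (vec_nth x) y))"
proof (rule partial_integral_LL(1))
  show "(\<lambda>y. md f \<tau> (mix u (vec_nth x) y)) \<in> borel_measurable (LL u)"
    unfolding L.measurable_P by (rule const_mix_measurable[OF md_facts(1)[OF f \<tau>]])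
  fix y assume "y \<in> PiE u (\<lambda>j. {a $ j..b $ j})"
  from replace_coords_cbox[OF x this]
  show "mixed_deriv a b \<tau> f (replace_coords u y x) = md f \<tau> (mix u (vec_nth x) y)"
    by (simp add: md_def restr_def vec_nth_replace_coords[symmetric])
qed

lemma Kc_integral:
  assumes "t \<in> data_supp \<alpha> (a $ j) (b $ j)" "k < \<alpha>"
  shows "(LINT y|Lm j. Kc j k y t) = dind j k t"
proof -
  have "(LINT y|Lm j. Kc j k y t) = (LINT y:{a $ j..b $ j}|lborel. Kc j k y t)"
    unfolding Lm_def by (rule leb_integral(2)) measurable
  also have "\<dots> = (LINT y:{a $ j..b $ j}|lborel. sob_ker \<alpha> (a $ j) (b $ j) k y t)"
    by (rule set_lebesgue_integral_cong) (auto simp: Kc_def)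
  finally show ?thesis using sob_ker_integral[OF ab assms] by simp
qed

lemma Kc_integrable: "k \<le> \<alpha> \<Longrightarrow> integrable (Lm j) (\<lambda>y. Kc j k y t)"
proof -
  assume k: "k \<le> \<alpha>"
  obtain C where C: "\<forall>j. \<forall>k\<le>\<alpha>. \<forall>x t. \<bar>Kc j k x t\<bar> \<le> C" using Kc_bounded by blast
  show ?thesis unfolding Lm_def
    by (rule leb_bounded_integrable[where B=C]) (use C k in auto)
qed

lemma Kc_prod_integral:
  assumes T: "\<forall>j\<in>v. T j \<in> data_supp \<alpha> (a $ j) (b $ j)" and \<tau>: "\<And>j. j \<in> v \<Longrightarrow> \<tau> j < \<alpha>"
  shows "(LINT y|LL v. (\<Prod>j\<in>v. Kc j (\<tau> j) (y j) (T j))) = (\<Prod>j\<in>v. dind j (\<tau> j) (T j))"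
proof -
  have "(LINT y|LL v. (\<Prod>j\<in>v. Kc j (\<tau> j) (y j) (T j))) = (\<Prod>j\<in>v. LINT y|Lm j. Kc j (\<tau> j) y (T j))"
    by (rule L.P.product_integral_prod) (use \<tau> in \<open>auto intro!: Kc_integrable simp: less_imp_le\<close>)
  also have "\<dots> = (\<Prod>j\<in>v. dind j (\<tau> j) (T j))"
    by (rule prod.cong[OF refl]) (use T \<tau> in \<open>auto intro!: Kc_integral\<close>)
  finally show ?thesis .
qed

lemma L2_prod:
  fixes q :: "'n \<Rightarrow> real \<Rightarrow> 'b::{real_normed_field, banach, second_countable_topology}"
  assumes "\<And>j. L2 (Mm j) (q j)" shows "L2 (MM UNIV) (\<lambda>T. \<Prod>j\<in>UNIV. q j (T j))"
proof -
  have m: "(\<lambda>T. \<Prod>j\<in>UNIV. q j (T j)) \<in> borel_measurable (MM UNIV)"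
    by (intro borel_measurable_prod measurable_compose[OF measurable_component_singleton]) (use assms in \<open>auto intro: L2_measurable\<close>)
  have "integrable (MM UNIV) (\<lambda>T. \<Prod>j\<in>UNIV. (norm (q j (T j)))\<^sup>2)"
    by (rule M.P.product_integrable_prod) (use assms in \<open>auto simp: L2_def\<close>)
  then show ?thesis using m by (simp add: L2_def prod_norm[symmetric] prod_power_distrib)
qed

lemma L2_Mm_bounded:
  fixes q :: "real \<Rightarrow> 'b::{real_normed_field, banach, second_countable_topology}"
  assumes "q \<in> borel_measurable borel" "\<And>t. norm (q t) \<le> B" shows "L2 (Mm j) q"
  by (rule L2_bounded[where B=B]) (use assms M.fin_N[of j] M.sets_N[of j] measurable_cong_sets[OF M.sets_N[of j] refl] in auto)

lemma dind_L2: "L2 (Mm j) (dind j k)"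
  by (rule L2_Mm_bounded[where B=1]) (auto simp: data_ind_def indicator_def)

lemma Kc_L2: "k \<le> \<alpha> \<Longrightarrow> L2 (Mm j) (Kc j k x)"
proof -
  assume k: "k \<le> \<alpha>"
  obtain C where C: "\<forall>j. \<forall>k\<le>\<alpha>. \<forall>x t. \<bar>Kc j k x t\<bar> \<le> C" using Kc_bounded by blast
  show ?thesis by (rule L2_Mm_bounded[where B=C]) (use C k in auto)
qed

lemma Kc_inside: "x \<in> {a $ j..b $ j} \<Longrightarrow> Kc j k x t = sob_ker \<alpha> (a $ j) (b $ j) k x t"
  by (simp add: Kc_def)

lemma multi_le_PiE: "multi_le \<alpha> = PiE UNIV (\<lambda>_::'n. {..\<alpha>})"
  by (auto simp: multi_le_def)

lemma finite_multi_le: "finite (multi_le \<alpha> :: ('n \<Rightarrow> nat) set)"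
  unfolding multi_le_PiE by (rule finite_PiE) auto

text \<open>Three kinds of coordinates: outside the support the evaluation kernel is untouched, at
  order \<alpha> the indicator of the interval is \<open>dind\<close>, and at the orders in between
  the kernel integrates to \<open>dind\<close> by \<open>Kc_integral\<close>.\<close>

lemma partial_integral_gder:
  assumes Hm: "H \<in> borel_measurable BP" and Hi: "integrable (MM UNIV) H" and \<tau>: "\<tau> \<in> multi_le \<alpha>" and z: "z \<in> bx"
  shows "(LINT y|LL (multi_supp \<tau>). gder H \<tau> (mix (multi_supp \<tau>) z y)) =
    (LINT T|MM UNIV. H T * (\<Prod>j\<in>UNIV. if \<tau> j = 0 then Kc j 0 (z j) (T j) else dind j (\<tau> j) (T j)))"
proof -
  let ?u = "multi_supp \<tau>" and ?w = "top_set \<tau>"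
  have "(LINT y|LL ?u. gder H \<tau> (mix ?u z y) * 1) = (LINT T|MM UNIV. (\<Prod>j\<in>?w. indicat_real {a $ j..b $ j} (T j)) * (H T * (Kp \<tau> (- ?u) z T *
        (LINT y|LL (?u - ?w). Kp \<tau> (?u - ?w) (mix (?u - ?w) (mix ?w z T) y) T * 1))))"
    by (rule gder_pairing(2)[OF Hm Hi \<tau> top_set_subset_supp z, where B=1]) auto
  also have "\<dots> = (LINT T|MM UNIV. H T * (\<Prod>j\<in>UNIV. if \<tau> j = 0 then Kc j 0 (z j) (T j) else dind j (\<tau> j) (T j)))"
  proof (rule integral_cong_AE)
    have Tm: "(\<lambda>T. T j) \<in> borel_measurable (MM UNIV)" for j
      unfolding M.measurable_P by (rule PiM_component_measurable) simp
    have Hm': "H \<in> borel_measurable (MM UNIV)" using Hi by simp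
    have "(\<lambda>T. LINT y|LL (?u - ?w). Kp \<tau> (?u - ?w) (mix (?u - ?w) (mix ?w z T) y) T) \<in> borel_measurable BP"
    proof (rule L.PI_measurable2[where h="\<lambda>T z. Kp \<tau> (?u - ?w) z T" and f="\<lambda>T. mix ?w z T"])
      have "z \<in> space BP" by (simp add: space_PiM)
      then show "(\<lambda>T. mix ?w z T) \<in> measurable BP BP"
        by (intro mix_measurable_UNIV measurable_const measurable_ident_sets refl)
      show "(\<lambda>p. Kp \<tau> (?u - ?w) (snd p) (fst p)) \<in> borel_measurable (BP \<Otimes>\<^sub>M BP)"
        using measurable_compose[OF measurable_Pair[OF measurable_snd measurable_fst] Kp_measurable] by simp
    qed
    moreover have "(\<lambda>T. Kp \<tau> (- ?u) z T) \<in> borel_measurable (MM UNIV)"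
      unfolding Kp_def by (intro borel_measurable_prod Kc_measurable Tm borel_measurable_const)
    moreover have "(\<lambda>T. indicat_real {a $ j..b $ j} (T j)) \<in> borel_measurable (MM UNIV)" for j
      by (rule measurable_compose[OF Tm]) auto
    ultimately show "(\<lambda>T. (\<Prod>j\<in>?w. indicat_real {a $ j..b $ j} (T j)) * (H T * (Kp \<tau> (- ?u) z T *
        (LINT y|LL (?u - ?w). Kp \<tau> (?u - ?w) (mix (?u - ?w) (mix ?w z T) y) T * 1)))) \<in> borel_measurable (MM UNIV)"
      unfolding mult_1_right using M.measurable_P by (intro borel_measurable_times borel_measurable_prod Hm') blast+
    have "(\<lambda>T. if \<tau> j = 0 then Kc j 0 (z j) (T j) else dind j (\<tau> j) (T j)) \<in> borel_measurable (MM UNIV)" for j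
      using measurable_compose[OF Tm data_ind_measurable] by (cases "\<tau> j = 0") (auto intro: Kc_measurable Tm)
    then show "(\<lambda>T. H T * (\<Prod>j\<in>UNIV. if \<tau> j = 0 then Kc j 0 (z j) (T j) else dind j (\<tau> j) (T j))) \<in> borel_measurable (MM UNIV)"
      by (intro borel_measurable_times borel_measurable_prod Hm')
    show "AE T in MM UNIV. (\<Prod>j\<in>?w. indicat_real {a $ j..b $ j} (T j)) * (H T * (Kp \<tau> (- ?u) z T *
        (LINT y|LL (?u - ?w). Kp \<tau> (?u - ?w) (mix (?u - ?w) (mix ?w z T) y) T * 1))) =
       H T * (\<Prod>j\<in>UNIV. if \<tau> j = 0 then Kc j 0 (z j) (T j) else dind j (\<tau> j) (T j))"
      using AE_MM[of UNIV]
    proof eventually_elim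
      case (elim T)
      have "(LINT y|LL (?u - ?w). Kp \<tau> (?u - ?w) (mix (?u - ?w) (mix ?w z T) y) T * 1) =
          (LINT y|LL (?u - ?w). (\<Prod>j\<in>?u - ?w. Kc j (\<tau> j) (y j) (T j)))"
        unfolding Kp_def mult_1_right by (intro Bochner_Integration.integral_cong prod.cong refl) simp
      also have "\<dots> = (\<Prod>j\<in>?u - ?w. dind j (\<tau> j) (T j))"
      proof (rule Kc_prod_integral)
        show "\<tau> j < \<alpha>" if "j \<in> ?u - ?w" for j
          using that \<tau> by (auto simp: top_set_def multi_le_def order.strict_iff_order)
      qed (use elim in auto)
      finally have 1: "(LINT y|LL (?u - ?w). Kp \<tau> (?u - ?w) (mix (?u - ?w) (mix ?w z T) y) T * 1) = (\<Prod>j\<in>?u - ?w. dind j (\<tau> j) (T j))" .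
      have 2: "(\<Prod>j\<in>?w. indicat_real {a $ j..b $ j} (T j)) = (\<Prod>j\<in>?w. dind j (\<tau> j) (T j))"
        by (rule prod.cong) (auto simp: data_ind_def top_set_def)
      have 3: "Kp \<tau> (- ?u) z T = (\<Prod>j\<in>- ?u. if \<tau> j = 0 then Kc j 0 (z j) (T j) else dind j (\<tau> j) (T j))"
        unfolding Kp_def by (rule prod.cong) (auto simp: multi_supp_def)
      have "(\<Prod>j\<in>?w. dind j (\<tau> j) (T j)) * (\<Prod>j\<in>?u - ?w. dind j (\<tau> j) (T j)) = (\<Prod>j\<in>?u. dind j (\<tau> j) (T j))"
        using prod.subset_diff[OF top_set_subset_supp[of \<tau>], of "\<lambda>j. dind j (\<tau> j) (T j)"] by (simp add: mult.commute)
      also have "\<dots> = (\<Prod>j\<in>?u. if \<tau> j = 0 then Kc j 0 (z j) (T j) else dind j (\<tau> j) (T j))"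
        by (rule prod.cong) (auto simp: multi_supp_def)
      finally have 4: "(\<Prod>j\<in>?w. dind j (\<tau> j) (T j)) * (\<Prod>j\<in>?u - ?w. dind j (\<tau> j) (T j)) = \<dots>" .
      have 5: "(\<Prod>j\<in>UNIV. if \<tau> j = 0 then Kc j 0 (z j) (T j) else dind j (\<tau> j) (T j)) =
          (\<Prod>j\<in>- ?u. if \<tau> j = 0 then Kc j 0 (z j) (T j) else dind j (\<tau> j) (T j)) * (\<Prod>j\<in>?u. if \<tau> j = 0 then Kc j 0 (z j) (T j) else dind j (\<tau> j) (T j))"
        using prod.subset_diff[of ?u UNIV "\<lambda>j. if \<tau> j = 0 then Kc j 0 (z j) (T j) else dind j (\<tau> j) (T j)"] by (simp add: Compl_eq_Diff_UNIV)
      have r: "p * (h * (k * l)) = h * (k * (p * l))" for p h k l :: real by simp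
      show ?case unfolding 1 2 3 5 4[symmetric] by (rule r)
    qed
  qed
  finally show ?thesis by simp
qed

lemma gder_0:
  assumes "H \<in> borel_measurable BP" "integrable (MM UNIV) H" "z \<in> bx"
  shows "gder H (\<lambda>_. 0) z = (LINT T|MM UNIV. H T * (\<Prod>j\<in>UNIV. Kc j 0 (z j) (T j)))"
  unfolding gder_def Kp_def by (simp add: top_set_zero)

text \<open>Every term of the method, including \<open>f\<close> itself as the term of order 0,
  pairs \<open>H\<close> with a product of one factor per coordinate, and the factor depends on
  \<open>\<tau> j\<close> alone. Summing over all \<tau> therefore gives a product of sums over
  \<open>k \<le> \<alpha>\<close>, which \<open>proj_ker_decompose\<close> evaluates for almost
  every \<open>T\<close>.\<close>

theorem bernoulli_method_data:
  assumes f: "has_data f H" and x: "x \<in> cbox a b"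
  shows "bernoulli_method \<alpha> a b f x = (LINT T|MM UNIV. H T * (\<Prod>j\<in>UNIV. proj_ker \<alpha> (a $ j) (b $ j) (x $ j) (T j)))"
proof -
  \<comment> \<open>The sign \<open>(-1) ^ card u\<close> is distributed over the coordinates in the
    support.\<close>
  let ?e = "\<lambda>j k t. if k = 0 then Kc j 0 (x $ j) t else - nbern (a $ j) (b $ j) k (x $ j) * dind j k t"
  note H = has_data_facts[OF f]
  have z: "vec_nth x \<in> bx" using x by (simp add: bx_cbox)
  have xj: "x $ j \<in> {a $ j..b $ j}" for j using z by (simp add: bx_def)
  have summand: "(let u = multi_supp \<tau> in
       (-1) ^ card u * (\<Prod>j\<in>u. scaled_bernpoly (a $ j) (b $ j) (\<tau> j) (x $ j) / fact (\<tau> j)) * partial_integral u a b (mixed_deriv a b \<tau> f) x) =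
      (LINT T|MM UNIV. H T * (\<Prod>j\<in>UNIV. ?e j (\<tau> j) (T j)))" if \<tau>: "\<tau> \<in> multi_le \<alpha>" for \<tau>
  proof -
    let ?u = "multi_supp \<tau>"
    have mm: "(\<lambda>y. h (mix ?u (vec_nth x) y)) \<in> borel_measurable (LL ?u)" if "h \<in> borel_measurable BP" for h :: "_ \<Rightarrow> real"
      unfolding L.measurable_P by (rule const_mix_measurable[OF that])
    have "partial_integral ?u a b (mixed_deriv a b \<tau> f) x = (LINT y|LL ?u. gder H \<tau> (mix ?u (vec_nth x) y))"
      unfolding partial_integral_md[OF f \<tau> x]
      by (intro integral_cong_AE mm md_facts[OF f \<tau>] gder_measurable H z)
    also have "\<dots> = (LINT T|MM UNIV. H T * (\<Prod>j\<in>UNIV. if \<tau> j = 0 then Kc j 0 (x $ j) (T j) else dind j (\<tau> j) (T j)))"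
      by (rule partial_integral_gder[OF H(1,2) \<tau> z])
    finally have 1: "partial_integral ?u a b (mixed_deriv a b \<tau> f) x = \<dots>" .
    have "(-1) ^ card ?u * (\<Prod>j\<in>?u. scaled_bernpoly (a $ j) (b $ j) (\<tau> j) (x $ j) / fact (\<tau> j)) = (\<Prod>j\<in>?u. - nbern (a $ j) (b $ j) (\<tau> j) (x $ j))"
      unfolding prod_constant[symmetric] prod.distrib[symmetric]
      by (rule prod.cong) (auto simp: multi_supp_def nbern_scaled[OF ab, symmetric])
    also have "\<dots> = (\<Prod>j\<in>UNIV. if \<tau> j = 0 then 1 else - nbern (a $ j) (b $ j) (\<tau> j) (x $ j))"
      by (rule prod.mono_neutral_cong_left) (auto simp: multi_supp_def)
    finally have 2: "(-1) ^ card ?u * (\<Prod>j\<in>?u. scaled_bernpoly (a $ j) (b $ j) (\<tau> j) (x $ j) / fact (\<tau> j)) = \<dots>" .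
    have 3: "(\<Prod>j\<in>UNIV. ?e j (\<tau> j) (T j)) = (\<Prod>j\<in>UNIV. if \<tau> j = 0 then 1 else - nbern (a $ j) (b $ j) (\<tau> j) (x $ j)) *
        (\<Prod>j\<in>UNIV. if \<tau> j = 0 then Kc j 0 (x $ j) (T j) else dind j (\<tau> j) (T j))" for T
      unfolding prod.distrib[symmetric] by (rule prod.cong) auto
    show ?thesis unfolding Let_def 1 2 3 mult.left_commute[of "H _"] by (rule integral_mult_right_zero[symmetric])
  qed
  have i: "integrable (MM UNIV) (\<lambda>T. H T * (\<Prod>j\<in>UNIV. ?e j (\<tau> j) (T j)))" if "\<tau> \<in> multi_le \<alpha>" for \<tau>
  proof (rule L2_mult_integrable[OF H(3) L2_prod])
    fix j show "L2 (Mm j) (\<lambda>t. ?e j (\<tau> j) t)"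
      using L2_cmult[OF dind_L2[of j "\<tau> j"], where c="- nbern (a $ j) (b $ j) (\<tau> j) (x $ j)"] Kc_L2[of 0 j] by (cases "\<tau> j = 0") simp_all
  qed
  have supp0: "multi_supp (\<lambda>_. 0) = {}" by (simp add: multi_supp_def)
  have "f x = (LINT T|MM UNIV. H T * (\<Prod>j\<in>UNIV. ?e j 0 (T j)))"
    using gder_0[OF H(1,2) z] H(4)[OF x] by simp
  then have "bernoulli_method \<alpha> a b f x = (LINT T|MM UNIV. H T * (\<Prod>j\<in>UNIV. ?e j 0 (T j))) +
      (\<Sum>\<tau>\<in>multi_le \<alpha> - {\<lambda>_. 0}. LINT T|MM UNIV. H T * (\<Prod>j\<in>UNIV. ?e j (\<tau> j) (T j)))"
    unfolding bernoulli_method_def using summand by (intro arg_cong2[where f="(+)"] sum.cong) auto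
  also have "\<dots> = (\<Sum>\<tau>\<in>multi_le \<alpha>. LINT T|MM UNIV. H T * (\<Prod>j\<in>UNIV. ?e j (\<tau> j) (T j)))"
    by (rule sum.remove[OF finite_multi_le zero_multi_le, symmetric])
  also have "\<dots> = (LINT T|MM UNIV. (\<Sum>\<tau>\<in>multi_le \<alpha>. H T * (\<Prod>j\<in>UNIV. ?e j (\<tau> j) (T j))))"
    by (rule Bochner_Integration.integral_sum[symmetric]) (rule i)
  also have "\<dots> = (LINT T|MM UNIV. H T * (\<Prod>j\<in>UNIV. \<Sum>k\<le>\<alpha>. ?e j k (T j)))"
    unfolding sum_distrib_left[symmetric] multi_le_PiE by (subst prod_sum_PiE) auto
  also have "\<dots> = (LINT T|MM UNIV. H T * (\<Prod>j\<in>UNIV. proj_ker \<alpha> (a $ j) (b $ j) (x $ j) (T j)))"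
  proof (rule integral_cong_AE)
    have Tm: "(\<lambda>T. T j) \<in> borel_measurable (MM UNIV)" for j
      unfolding M.measurable_P by (rule PiM_component_measurable) simp
    have Hm': "H \<in> borel_measurable (MM UNIV)" using H(2) by simp
    have "(\<lambda>T. ?e j k (T j)) \<in> borel_measurable (MM UNIV)" for j k
      using measurable_compose[OF Tm[of j] data_ind_measurable] Kc_measurable[OF borel_measurable_const Tm] by (cases "k = 0") simp_all
    then show "(\<lambda>T. H T * (\<Prod>j\<in>UNIV. \<Sum>k\<le>\<alpha>. ?e j k (T j))) \<in> borel_measurable (MM UNIV)"
      by (intro borel_measurable_times borel_measurable_prod borel_measurable_sum Hm')
    show "(\<lambda>T. H T * (\<Prod>j\<in>UNIV. proj_ker \<alpha> (a $ j) (b $ j) (x $ j) (T j))) \<in> borel_measurable (MM UNIV)"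
      by (intro borel_measurable_times borel_measurable_prod proj_ker_measurable borel_measurable_const Hm' Tm)
    show "AE T in MM UNIV. H T * (\<Prod>j\<in>UNIV. \<Sum>k\<le>\<alpha>. ?e j k (T j)) = H T * (\<Prod>j\<in>UNIV. proj_ker \<alpha> (a $ j) (b $ j) (x $ j) (T j))"
      using AE_MM[of UNIV]
    proof eventually_elim
      case (elim T)
      have "(\<Sum>k\<le>\<alpha>. ?e j k (T j)) = proj_ker \<alpha> (a $ j) (b $ j) (x $ j) (T j)" for j
        unfolding Kc_inside[OF xj] using proj_ker_decompose[OF ab _ \<alpha>1, of "T j" j "x $ j"] elim by simp
      then show ?case by simp
    qed
  qed
  finally show ?thesis .
qed

section \<open>The Sobolev inner product in terms of the data\<close>

definition atoms :: "('n \<Rightarrow> nat) \<Rightarrow> 'n \<Rightarrow> real" where "atoms \<tau> j = b $ j + 1 + real (\<tau> j)"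

lemma dind_integral:
  assumes "k < \<alpha>" shows "(LINT t|Mm j. dind j k t) = 1"
proof -
  have "(LINT t|Mm j. dind j k t) = (LINT t:{a $ j..b $ j}|lborel. dind j k t) + (\<Sum>i<\<alpha>. dind j k (b $ j + 1 + real i))"
    unfolding Mm_def by (rule data_measure_bounded_integral(2)[OF ab, where B=1]) (auto simp: data_ind_def indicator_def)
  also have "(LINT t:{a $ j..b $ j}|lborel. dind j k t) = 0"
  proof -
    have "indicat_real {a $ j..b $ j} t *\<^sub>R dind j k t = 0" for t using assms by (auto simp: data_ind_def indicator_def)
    then show ?thesis unfolding set_lebesgue_integral_def by (simp only: Bochner_Integration.integral_zero)
  qed
  also have "(\<Sum>i<\<alpha>. dind j k (b $ j + 1 + real i)) = (\<Sum>i<\<alpha>. if i = k then 1 else 0)"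
    by (rule sum.cong) (use assms in \<open>auto simp: data_ind_def indicator_def\<close>)
  finally show ?thesis using assms by simp
qed

text \<open>The product of the \<open>dind\<close> vanishes unless \<open>t\<close> is the tuple of
  atoms, so \<open>h\<close> can be replaced by its value there; the remaining product has integral
  1.\<close>

lemma atom_integral:
  assumes \<tau>: "\<And>j. j \<in> v \<Longrightarrow> \<tau> j < \<alpha>"
  shows "(LINT t|MM v. h (mix v z t) * (\<Prod>j\<in>v. dind j (\<tau> j) (t j))) = (h (mix v z (atoms \<tau>)) :: real)"
proof -
  have "(LINT t|MM v. h (mix v z t) * (\<Prod>j\<in>v. dind j (\<tau> j) (t j))) = (LINT t|MM v. h (mix v z (atoms \<tau>)) * (\<Prod>j\<in>v. dind j (\<tau> j) (t j)))"
  proof (intro Bochner_Integration.integral_cong refl)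
    fix t
    show "h (mix v z t) * (\<Prod>j\<in>v. dind j (\<tau> j) (t j)) = h (mix v z (atoms \<tau>)) * (\<Prod>j\<in>v. dind j (\<tau> j) (t j))"
    proof (cases "\<forall>j\<in>v. t j = atoms \<tau> j")
      case True
      then have "mix v z t = mix v z (atoms \<tau>)" by (auto simp: mix_def)
      then show ?thesis by simp
    next
      case False
      then obtain i where i: "i \<in> v" "t i \<noteq> atoms \<tau> i" by blast
      then have "dind i (\<tau> i) (t i) = 0" using \<tau>[of i] by (simp add: data_ind_def atoms_def)
      then have "(\<Prod>j\<in>v. dind j (\<tau> j) (t j)) = 0" using i by (intro prod_zero bexI[of _ i]) simp_all
      then show ?thesis by simp
    qed
  qed
  also have "\<dots> = h (mix v z (atoms \<tau>)) * (LINT t|MM v. (\<Prod>j\<in>v. dind j (\<tau> j) (t j)))"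
    by (rule integral_mult_right_zero)
  also have "(LINT t|MM v. (\<Prod>j\<in>v. dind j (\<tau> j) (t j))) = (\<Prod>j\<in>v. LINT t|Mm j. dind j (\<tau> j) t)"
    by (rule M.P.product_integral_prod) (auto intro!: L2_integrable M.fin_N dind_L2)
  also have "\<dots> = 1" by (rule prod.neutral) (use \<tau> dind_integral in blast)
  finally show ?thesis by simp
qed

text \<open>After an exchange of integrals, each kernel of order below \<alpha> integrates over its
  side to the indicator of one atom. The inner integrals of the Sobolev inner product are thus plain
  values of \<open>H\<close>.\<close>

lemma gder_fiber_average:
  assumes Hm: "H \<in> borel_measurable BP" and \<tau>: "\<tau> \<in> multi_le \<alpha>" and v: "v = - top_set \<tau>"
    and Hi: "integrable (MM v) (\<lambda>t. H (mix v z t))"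
  shows "(LINT y|LL v. gder H \<tau> (mix v z y)) = H (mix v z (atoms \<tau>))"
proof -
  define K where "K y t = (\<Prod>j\<in>v. Kc j (\<tau> j) (y j) (t j))" for y t :: "'n \<Rightarrow> real"
  have lt: "\<tau> j < \<alpha>" if "j \<in> v" for j using that \<tau> by (auto simp: v top_set_def multi_le_def order.strict_iff_order)
  have g: "gder H \<tau> (mix v z y) = (LINT t|MM v. H (mix v z t) * K y t)" for y
  proof -
    have "mix v (mix v z y) t = mix v z t" for t by (auto simp: mix_def)
    then show ?thesis unfolding gder_def v[symmetric] K_def Kp_def by simp
  qed
  have KB: "\<bar>K y t\<bar> \<le> KB" for y t
    using Kp_bounded(1)[OF \<tau>, of v y t] by (simp add: K_def Kp_def)
  interpret L: finite_measure "LL v" by (rule L.finite_P)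
  interpret M: finite_measure "MM v" by (rule M.finite_P)
  interpret pair_sigma_finite "LL v" "MM v" by unfold_locales
  have Hv: "(\<lambda>t. H (mix v z t)) \<in> borel_measurable (MM v)" using Hi by simp
  have Lc: "(\<lambda>y. y j) \<in> borel_measurable (LL v)" and Mc: "(\<lambda>y. y j) \<in> borel_measurable (MM v)" if "j \<in> v" for j
    unfolding L.measurable_P M.measurable_P by (rule PiM_component_measurable[OF that])+
  have Kmm: "(\<lambda>p. K (fst p) (snd p)) \<in> borel_measurable (LL v \<Otimes>\<^sub>M MM v)"
    unfolding K_def by (intro borel_measurable_prod Kc_measurable measurable_compose[OF measurable_fst Lc] measurable_compose[OF measurable_snd Mc])
  have bi: "integrable (LL v \<Otimes>\<^sub>M MM v) (\<lambda>(y, t). KB * H (mix v z t))"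
  proof (rule Fubini_integrable)
    show "(\<lambda>(y, t). KB * H (mix v z t)) \<in> borel_measurable (LL v \<Otimes>\<^sub>M MM v)"
      unfolding case_prod_unfold by (intro borel_measurable_times borel_measurable_const measurable_compose[OF measurable_snd Hv])
  qed (use Hi in auto)
  have i: "integrable (LL v \<Otimes>\<^sub>M MM v) (\<lambda>(y, t). H (mix v z t) * K y t)"
  proof (rule Bochner_Integration.integrable_bound[OF bi])
    show "(\<lambda>(y, t). H (mix v z t) * K y t) \<in> borel_measurable (LL v \<Otimes>\<^sub>M MM v)"
      unfolding case_prod_unfold by (intro borel_measurable_times Kmm measurable_compose[OF measurable_snd Hv])
    have "norm (H (mix v z t) * K y t) \<le> norm (KB * H (mix v z t))" for y t
      unfolding real_norm_def abs_mult using KB[of y t] by (simp add: mult.commute mult_right_mono)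
    then show "AE p in LL v \<Otimes>\<^sub>M MM v. norm (case p of (y, t) \<Rightarrow> H (mix v z t) * K y t) \<le> norm (case p of (y, t) \<Rightarrow> KB * H (mix v z t))"
      by (intro AE_I2) (simp add: case_prod_unfold)
  qed
  have "(LINT y|LL v. gder H \<tau> (mix v z y)) = (LINT t|MM v. LINT y|LL v. H (mix v z t) * K y t)"
    unfolding g by (rule Fubini_integral[OF i, symmetric])
  also have "\<dots> = (LINT t|MM v. H (mix v z t) * (\<Prod>j\<in>v. dind j (\<tau> j) (t j)))"
  proof (rule integral_cong_AE)
    have "(\<lambda>p. K (snd p) (fst p)) \<in> borel_measurable (MM v \<Otimes>\<^sub>M LL v)"
      using measurable_compose[OF measurable_Pair[OF measurable_snd measurable_fst] Kmm] by simp
    then show "(\<lambda>t. LINT y|LL v. H (mix v z t) * K y t) \<in> borel_measurable (MM v)"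
      by (intro L.borel_measurable_lebesgue_integral)
         (simp only: case_prod_unfold, intro borel_measurable_times measurable_compose[OF measurable_fst Hv])
    show "(\<lambda>t. H (mix v z t) * (\<Prod>j\<in>v. dind j (\<tau> j) (t j))) \<in> borel_measurable (MM v)"
      by (intro borel_measurable_times Hv borel_measurable_prod measurable_compose[OF Mc data_ind_measurable])
    show "AE t in MM v. (LINT y|LL v. H (mix v z t) * K y t) = H (mix v z t) * (\<Prod>j\<in>v. dind j (\<tau> j) (t j))"
      using AE_MM[of v]
    proof eventually_elim
      case (elim t)
      then show ?case unfolding K_def integral_mult_right_zero using Kc_prod_integral[of v t \<tau>] lt by simp
    qed
  qed
  also have "\<dots> = H (mix v z (atoms \<tau>))" by (rule atom_integral) (rule lt)
  finally show ?thesis .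
qed

text \<open>Mixed derivatives are unique on fibres in the directions
  \<open>multi_supp \<tau>\<close>, but the inner product integrates along
  \<open>- top_set \<tau>\<close>. A set that is null on every fibre in the first family is null in
  the box, hence null on almost every fibre in the second.\<close>

lemma LL_null_fibers:
  assumes Pm: "{z. P z} \<in> sets BP" and AE: "\<And>z. z \<in> bx \<Longrightarrow> AE y in LL u. P (mix u z y)" and z: "z \<in> bx"
  shows "AE s in LL w. AE y in LL (- w). P (mix (- w) (mix w z s) y)"
proof -
  define h where "h z = (indicator {z. \<not> P z} z :: ennreal)" for z :: "'n \<Rightarrow> real"
  have "{z. \<not> P z} = space BP - {z. P z}" by (auto simp: space_PiM)
  then have "{z. \<not> P z} \<in> sets BP" using Pm by (simp add: sets.Diff)
  then have hm: "(\<lambda>z. h z :: ennreal) \<in> borel_measurable BP" unfolding h_def by simp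
  have m: "(\<lambda>y. h (mix v z y) :: ennreal) \<in> borel_measurable (LL v)" for v z
    unfolding L.measurable_P by (rule const_mix_measurable[OF hm])
  have zero: "(\<integral>\<^sup>+y. h (mix u z y) \<partial>LL u) = 0" if "z \<in> bx" for z
    using AE[OF that] by (subst nn_integral_0_iff_AE[OF m]) (auto simp: h_def)
  have "(\<integral>\<^sup>+y. h (mix (- u \<union> u) z y) \<partial>LL (- u \<union> u)) = (\<integral>\<^sup>+s. \<integral>\<^sup>+y. h (mix u (mix (- u) z s) y) \<partial>LL u \<partial>LL (- u))"
    by (rule L.fold_nn[OF _ hm]) simp
  also have "\<dots> = (\<integral>\<^sup>+s. 0 \<partial>LL (- u))"
    by (rule nn_integral_cong_AE) (use AE_LL_bx[OF z, of "- u"] zero in auto)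
  finally have "(\<integral>\<^sup>+y. h (mix (w \<union> - w) z y) \<partial>LL (w \<union> - w)) = 0" by simp
  moreover have "(\<integral>\<^sup>+y. h (mix (w \<union> - w) z y) \<partial>LL (w \<union> - w)) = (\<integral>\<^sup>+s. \<integral>\<^sup>+y. h (mix (- w) (mix w z s) y) \<partial>LL (- w) \<partial>LL w)"
    by (rule L.fold_nn[OF _ hm]) simp
  moreover have "(\<lambda>s. \<integral>\<^sup>+y. h (mix (- w) (mix w z s) y) \<partial>LL (- w)) \<in> borel_measurable (LL w)"
  proof -
    interpret finite_measure "LL (- w)" by (rule L.finite_P)
    have zs: "z \<in> space BP" by (simp add: space_PiM)
    have f: "fst \<in> measurable (LL w \<Otimes>\<^sub>M LL (- w)) (PiM w (\<lambda>_. borel))"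
      using measurable_fst[of "LL w" "LL (- w)"] measurable_cong_sets[OF refl L.sets_P] by blast
    have s: "snd \<in> measurable (LL w \<Otimes>\<^sub>M LL (- w)) (PiM (- w) (\<lambda>_. borel))"
      using measurable_snd[of "LL w" "LL (- w)"] measurable_cong_sets[OF refl L.sets_P] by blast
    have "(\<lambda>p. h (mix (- w) (mix w z (fst p)) (snd p)) :: ennreal) \<in> borel_measurable (LL w \<Otimes>\<^sub>M LL (- w))"
      by (intro measurable_compose[OF mix_measurable hm] mix_measurable f s measurable_const zs)
    then show ?thesis by (intro borel_measurable_nn_integral) (simp add: case_prod_unfold)
  qed
  ultimately have "AE s in LL w. (\<integral>\<^sup>+y. h (mix (- w) (mix w z s) y) \<partial>LL (- w)) = 0"
    by (simp add: nn_integral_0_iff_AE)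
  then show ?thesis
  proof eventually_elim
    case (elim s)
    then have "AE y in LL (- w). h (mix (- w) (mix w z s) y) = (0::ennreal)" by (simp add: nn_integral_0_iff_AE[OF m])
    then show ?case by eventually_elim (simp add: h_def indicator_def split: if_splits)
  qed
qed

definition iso :: "('n \<Rightarrow> nat) \<Rightarrow> (('n \<Rightarrow> real) \<Rightarrow> real) \<Rightarrow> ('n \<Rightarrow> real) \<Rightarrow> real" where
  "iso \<tau> f z = (LINT y|LL (- top_set \<tau>). f (mix (- top_set \<tau>) z y))"

lemma iso_md:
  assumes f: "has_data f H" and \<tau>: "\<tau> \<in> multi_le \<alpha>" and z: "z \<in> bx"
  shows "AE s in LL (top_set \<tau>). iso \<tau> (md f \<tau>) (mix (top_set \<tau>) z s) = H (mix (- top_set \<tau>) (mix (top_set \<tau>) z s) (atoms \<tau>))"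
proof -
  let ?w = "top_set \<tau>"
  note H = has_data_facts[OF f]
  have Pm: "{z. md f \<tau> z = gder H \<tau> z} \<in> sets BP"
    using borel_measurable_eq[OF md_facts(1)[OF f \<tau>] gder_measurable[OF H(1), of \<tau>]] by (simp add: pred_def space_PiM)
  have mm: "(\<lambda>y. h (mix v z y)) \<in> borel_measurable (LL v)" if "h \<in> borel_measurable BP" for h :: "_ \<Rightarrow> real" and v z
    unfolding L.measurable_P by (rule const_mix_measurable[OF that])
  have "AE s in LL ?w. AE y in LL (- ?w). md f \<tau> (mix (- ?w) (mix ?w z s) y) = gder H \<tau> (mix (- ?w) (mix ?w z s) y)"
    by (rule LL_null_fibers[OF Pm _ z]) (rule md_facts(2)[OF f \<tau>])
  from this fiber_integrable(2)[OF H(2), of ?w z]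
  show ?thesis
  proof eventually_elim
    case (elim s)
    have "iso \<tau> (md f \<tau>) (mix ?w z s) = (LINT y|LL (- ?w). gder H \<tau> (mix (- ?w) (mix ?w z s) y))"
      unfolding iso_def by (rule integral_cong_AE) (auto intro!: mm md_facts[OF f \<tau>] gder_measurable H elim)
    also have "\<dots> = H (mix (- ?w) (mix ?w z s) (atoms \<tau>))"
      by (rule gder_fiber_average[OF H(1) \<tau> refl elim(2)])
    finally show ?case .
  qed
qed

text \<open>The interval and the atoms are disjoint and exhaust \<open>data_supp\<close>. Products
  of these partitions of unity over the coordinates add up the terms of the inner product.\<close>

lemma data_partition: "t \<in> data_supp \<alpha> (a $ j) (b $ j) \<Longrightarrow> (\<Sum>k\<le>\<alpha>. dind j k t) = 1"
proof -
  assume t: "t \<in> data_supp \<alpha> (a $ j) (b $ j)"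
  have "(\<Sum>k\<le>\<alpha>. dind j k t) = dind j \<alpha> t + (\<Sum>k<\<alpha>. dind j k t)" by (simp add: lessThan_Suc_atMost[symmetric])
  also have "(\<Sum>k<\<alpha>. dind j k t) = (\<Sum>k<\<alpha>. indicator {b $ j + 1 + real k} t)" by (rule sum.cong) (auto simp: data_ind_def)
  also have "dind j \<alpha> t + \<dots> = 1"
    using t unfolding data_supp_def
  proof
    assume t: "t \<in> {a $ j..b $ j}"
    then have "(\<Sum>k<\<alpha>. indicat_real {b $ j + 1 + real k} t) = 0" by (intro sum.neutral) (auto simp: indicator_def)
    then show ?thesis using t by (simp add: data_ind_def)
  next
    assume "t \<in> (\<lambda>k. b $ j + 1 + real k) ` {..<\<alpha>}"
    then obtain i where i: "i < \<alpha>" "t = b $ j + 1 + real i" by blast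
    then have "(\<Sum>k<\<alpha>. indicat_real {b $ j + 1 + real k} t) = (\<Sum>k<\<alpha>. if k = i then 1 else 0)"
      by (intro sum.cong) (auto simp: indicator_def)
    then show ?thesis using i by (simp add: data_ind_def)
  qed
  finally show ?thesis .
qed

text \<open>The term of \<tau> integrates \<open>H T * G T\<close> over one piece of the product
  data space: coordinates of order \<alpha> run through their interval, the others sit at the atom
  of their order. These pieces partition the space up to a null set.\<close>

theorem sob_inner_data:
  assumes f: "has_data f H" and g: "has_data g G"
  shows "sob_inner \<alpha> a b f g = (LINT T|MM UNIV. H T * G T)"
proof -
  note H = has_data_facts[OF f] and G = has_data_facts[OF g]
  let ?I = "\<lambda>\<tau> T. \<Prod>j\<in>UNIV. dind j (\<tau> j) (T j)"
  have HGm: "(\<lambda>T. H T * G T) \<in> borel_measurable BP" by (intro borel_measurable_times H G)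
  have HGi: "integrable (MM UNIV) (\<lambda>T. H T * G T)" by (rule L2_mult_integrable[OF H(3) G(3)])
  have Tm: "(\<lambda>T. T j) \<in> borel_measurable BP" for j
    by (rule PiM_component_measurable) simp
  have Im: "?I \<tau> \<in> borel_measurable BP" for \<tau>
    by (intro borel_measurable_prod measurable_compose[OF Tm data_ind_measurable])
  have HGIi: "integrable (MM UNIV) (\<lambda>T. (H T * G T) * ?I \<tau> T)" for \<tau>
  proof (rule Bochner_Integration.integrable_bound[OF HGi])
    show "(\<lambda>T. (H T * G T) * ?I \<tau> T) \<in> borel_measurable (MM UNIV)"
      unfolding M.measurable_P by (intro borel_measurable_times[OF HGm Im])
    have "\<bar>?I \<tau> T\<bar> \<le> 1" for T unfolding abs_prod by (intro prod_le_1) (auto simp: data_ind_def indicator_def)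
    then show "AE T in MM UNIV. norm ((H T * G T) * ?I \<tau> T) \<le> norm (H T * G T)"
      unfolding real_norm_def abs_mult[of "_ * _" "?I \<tau> _"] by (intro AE_I2 mult_left_le) auto
  qed
  have summand: "(let w = {j. \<tau> j = \<alpha>} in partial_integral w a b (\<lambda>x. partial_integral (- w) a b (mixed_deriv a b \<tau> f) x *
               partial_integral (- w) a b (mixed_deriv a b \<tau> g) x) a) = (LINT T|MM UNIV. (H T * G T) * ?I \<tau> T)"
    if \<tau>: "\<tau> \<in> multi_le \<alpha>" for \<tau>
  proof -
    let ?w = "top_set \<tau>" and ?z = "vec_nth a"
    have ac: "a \<in> cbox a b" using ab by (simp add: mem_box_cart less_imp_le)
    then have z: "?z \<in> bx" by (simp add: bx_cbox)
    have im: "iso \<tau> (md h \<tau>) \<in> borel_measurable BP" if "md h \<tau> \<in> borel_measurable BP" for h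
      unfolding iso_def[abs_def] by (rule L.PI_measurable[OF measurable_ident that, simplified])
    have lam: "(\<lambda>s. h (mix ?w ?z s)) \<in> borel_measurable (LL ?w)" if "h \<in> borel_measurable BP" for h :: "_ \<Rightarrow> real"
      unfolding L.measurable_P by (rule const_mix_measurable[OF that])
    note imf = im[OF md_facts(1)[OF f \<tau>]] and img = im[OF md_facts(1)[OF g \<tau>]]
    have "partial_integral ?w a b (\<lambda>x. partial_integral (- ?w) a b (mixed_deriv a b \<tau> f) x * partial_integral (- ?w) a b (mixed_deriv a b \<tau> g) x) a =
        (LINT s|LL ?w. iso \<tau> (md f \<tau>) (mix ?w ?z s) * iso \<tau> (md g \<tau>) (mix ?w ?z s))"
    proof (rule partial_integral_LL(1))
      show "(\<lambda>s. iso \<tau> (md f \<tau>) (mix ?w ?z s) * iso \<tau> (md g \<tau>) (mix ?w ?z s)) \<in> borel_measurable (LL ?w)"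
        by (intro borel_measurable_times lam imf img)
      fix s assume "s \<in> PiE ?w (\<lambda>j. {a $ j..b $ j})"
      from replace_coords_cbox[OF ac this]
      show "partial_integral (- ?w) a b (mixed_deriv a b \<tau> f) (replace_coords ?w s a) * partial_integral (- ?w) a b (mixed_deriv a b \<tau> g) (replace_coords ?w s a) =
          iso \<tau> (md f \<tau>) (mix ?w ?z s) * iso \<tau> (md g \<tau>) (mix ?w ?z s)"
        by (simp add: partial_integral_md[OF f \<tau>] partial_integral_md[OF g \<tau>] iso_def vec_nth_replace_coords)
    qed
    also have "\<dots> = (LINT s|LL ?w. H (mix (- ?w) (mix ?w ?z s) (atoms \<tau>)) * G (mix (- ?w) (mix ?w ?z s) (atoms \<tau>)))"
    proof (rule integral_cong_AE)
      have "(\<lambda>s. h (mix (- ?w) (mix ?w ?z s) (atoms \<tau>))) \<in> borel_measurable (LL ?w)" if h: "h \<in> borel_measurable BP" for h :: "_ \<Rightarrow> real"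
      proof -
        have "mix (- ?w) (mix ?w ?z s) (atoms \<tau>) = mix ?w (mix (- ?w) ?z (atoms \<tau>)) s" for s by (auto simp: mix_def)
        then show ?thesis unfolding L.measurable_P using const_mix_measurable[OF h, of ?w] by simp
      qed
      then show "(\<lambda>s. H (mix (- ?w) (mix ?w ?z s) (atoms \<tau>)) * G (mix (- ?w) (mix ?w ?z s) (atoms \<tau>))) \<in> borel_measurable (LL ?w)"
        using H(1) G(1) by (intro borel_measurable_times) 
      show "(\<lambda>s. iso \<tau> (md f \<tau>) (mix ?w ?z s) * iso \<tau> (md g \<tau>) (mix ?w ?z s)) \<in> borel_measurable (LL ?w)"
        by (intro borel_measurable_times lam imf img)
      show "AE s in LL ?w. iso \<tau> (md f \<tau>) (mix ?w ?z s) * iso \<tau> (md g \<tau>) (mix ?w ?z s) =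
          H (mix (- ?w) (mix ?w ?z s) (atoms \<tau>)) * G (mix (- ?w) (mix ?w ?z s) (atoms \<tau>))"
        using iso_md[OF f \<tau> z] iso_md[OF g \<tau> z] by eventually_elim simp
    qed
    also have "\<dots> = (LINT s|MM ?w. (\<Prod>j\<in>?w. indicat_real {a $ j..b $ j} (s j)) *\<^sub>R
        (H (mix (- ?w) (mix ?w ?z s) (atoms \<tau>)) * G (mix (- ?w) (mix ?w ?z s) (atoms \<tau>))))"
    proof (rule LL_integral_MM)
      have "mix (- ?w) (mix ?w ?z s) (atoms \<tau>) = mix ?w (mix (- ?w) ?z (atoms \<tau>)) s" for s by (auto simp: mix_def)
      then show "(\<lambda>s. H (mix (- ?w) (mix ?w ?z s) (atoms \<tau>)) * G (mix (- ?w) (mix ?w ?z s) (atoms \<tau>))) \<in> borel_measurable (PiM ?w (\<lambda>_. borel))"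
        using const_mix_measurable[OF HGm, of ?w] by simp
    qed
    \<comment> \<open>Evaluation at the atoms is rewritten as an integral against
      \<open>dind\<close>, so that the terms of all \<tau> are integrals over the same
      space.\<close>
    also have "\<dots> = (LINT s|MM ?w. LINT t|MM (- ?w). (H (mix (- ?w) (mix ?w ?z s) t) * G (mix (- ?w) (mix ?w ?z s) t)) * ?I \<tau> (mix (- ?w) (mix ?w ?z s) t))"
    proof (intro Bochner_Integration.integral_cong refl)
      fix s
      let ?p = "\<Prod>j\<in>?w. indicat_real {a $ j..b $ j} (s j)"
      have I: "?I \<tau> (mix (- ?w) (mix ?w ?z s) t) = ?p * (\<Prod>j\<in>- ?w. dind j (\<tau> j) (t j))" for t
      proof -
        have "?I \<tau> (mix (- ?w) (mix ?w ?z s) t) = (\<Prod>j\<in>- ?w. dind j (\<tau> j) (mix (- ?w) (mix ?w ?z s) t j)) * (\<Prod>j\<in>?w. dind j (\<tau> j) (mix (- ?w) (mix ?w ?z s) t j))"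
          using prod.subset_diff[of ?w UNIV "\<lambda>j. dind j (\<tau> j) (mix (- ?w) (mix ?w ?z s) t j)"] by (simp add: Compl_eq_Diff_UNIV)
        also have "(\<Prod>j\<in>- ?w. dind j (\<tau> j) (mix (- ?w) (mix ?w ?z s) t j)) = (\<Prod>j\<in>- ?w. dind j (\<tau> j) (t j))"
          by (rule prod.cong) auto
        also have "(\<Prod>j\<in>?w. dind j (\<tau> j) (mix (- ?w) (mix ?w ?z s) t j)) = ?p"
          by (rule prod.cong) (auto simp: data_ind_def top_set_def)
        finally show ?thesis by (simp only: mult.commute)
      qed
      have "(LINT t|MM (- ?w). (H (mix (- ?w) (mix ?w ?z s) t) * G (mix (- ?w) (mix ?w ?z s) t)) * ?I \<tau> (mix (- ?w) (mix ?w ?z s) t)) =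
          ?p * (LINT t|MM (- ?w). (\<lambda>T. H T * G T) (mix (- ?w) (mix ?w ?z s) t) * (\<Prod>j\<in>- ?w. dind j (\<tau> j) (t j)))"
        unfolding I mult.left_commute[of _ ?p] by (rule integral_mult_right_zero)
      also have "\<dots> = ?p * (H (mix (- ?w) (mix ?w ?z s) (atoms \<tau>)) * G (mix (- ?w) (mix ?w ?z s) (atoms \<tau>)))"
        by (subst atom_integral) (use \<tau> in \<open>auto simp: top_set_def multi_le_def order.strict_iff_order\<close>)
      finally show "?p *\<^sub>R (H (mix (- ?w) (mix ?w ?z s) (atoms \<tau>)) * G (mix (- ?w) (mix ?w ?z s) (atoms \<tau>))) =
          (LINT t|MM (- ?w). (H (mix (- ?w) (mix ?w ?z s) t) * G (mix (- ?w) (mix ?w ?z s) t)) * ?I \<tau> (mix (- ?w) (mix ?w ?z s) t))"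
        by simp
    qed
    also have "\<dots> = (LINT T|MM (?w \<union> - ?w). (H (mix (?w \<union> - ?w) ?z T) * G (mix (?w \<union> - ?w) ?z T)) * ?I \<tau> (mix (?w \<union> - ?w) ?z T))"
      by (rule M.fold_integral[symmetric, where h="\<lambda>T. (H T * G T) * ?I \<tau> T"]) (use HGIi[of \<tau>] in simp_all)
    finally show ?thesis by (simp add: Let_def top_set_def)
  qed
  have "sob_inner \<alpha> a b f g = (\<Sum>\<tau>\<in>multi_le \<alpha>. LINT T|MM UNIV. (H T * G T) * ?I \<tau> T)"
    unfolding sob_inner_def by (rule sum.cong[OF refl]) (rule summand)
  also have "\<dots> = (LINT T|MM UNIV. (\<Sum>\<tau>\<in>multi_le \<alpha>. (H T * G T) * ?I \<tau> T))"
    by (rule Bochner_Integration.integral_sum[symmetric]) (rule HGIi)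
  also have "\<dots> = (LINT T|MM UNIV. (H T * G T) * (\<Prod>j\<in>UNIV. \<Sum>k\<le>\<alpha>. dind j k (T j)))"
    unfolding sum_distrib_left[symmetric] multi_le_PiE by (subst prod_sum_PiE) auto
  also have "\<dots> = (LINT T|MM UNIV. H T * G T)"
  proof (rule integral_cong_AE)
    show "(\<lambda>T. (H T * G T) * (\<Prod>j\<in>UNIV. \<Sum>k\<le>\<alpha>. dind j k (T j))) \<in> borel_measurable (MM UNIV)"
      unfolding M.measurable_P by (intro borel_measurable_times[OF HGm] borel_measurable_prod borel_measurable_sum measurable_compose[OF Tm data_ind_measurable])
    show "AE T in MM UNIV. (H T * G T) * (\<Prod>j\<in>UNIV. \<Sum>k\<le>\<alpha>. dind j k (T j)) = H T * G T"
      using AE_MM[of UNIV] by eventually_elim (simp add: data_partition)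
  qed (use HGi in simp)
  finally show ?thesis .
qed

end

section \<open>The tensor product space in terms of the data\<close>

lemma sob1_data_cmult:
  assumes d: "sob1_data \<alpha> a b f \<eta>"
  shows "sob1_data \<alpha> a b (\<lambda>x. c * f x) (\<lambda>t. c * \<eta> t)"
proof -
  obtain D where D: "sob1_jet \<alpha> a b f D" and \<eta>: "\<eta> = (\<lambda>t. if t \<in> {a..b} then D \<alpha> t
              else \<Sum>i<\<alpha>. if t = b + 1 + real i then (LINT x:{a..b}|lborel. D i x) else 0)"
    using d unfolding sob1_data_def by blast
  note j = D[unfolded sob1_jet_def]
  have ac: "abs_continuous_on a b (\<lambda>x. c * D k x)" if k: "k < \<alpha>" for k
  proof -
    have "abs_continuous_on a b (\<lambda>_. c)" unfolding abs_continuous_on_def by (auto intro!: exI[of _ 1] simp: case_prod_unfold)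
    then show ?thesis by (intro abs_continuous_mult[where G="\<lambda>_. c"]) (use j k in blast)
  qed
  have "sob1_jet \<alpha> a b (\<lambda>x. c * f x) (\<lambda>k x. c * D k x)"
    unfolding sob1_jet_def
  proof (intro conjI allI impI ballI)
    show "c * D 0 x = c * f x" if "x \<in> {a..b}" for x using j that by simp
    show "abs_continuous_on a b (\<lambda>x. c * D k x)" if "k < \<alpha>" for k by (rule ac[OF that])
    show "((\<lambda>x. c * D k x) has_real_derivative c * D (Suc k) x) (at x within {a..b})" if "Suc k < \<alpha>" "x \<in> {a..b}" for k x
      using j that by (intro DERIV_cmult) blast
    show "AE x\<in>{a..b} in lborel. ((\<lambda>x. c * D k x) has_real_derivative c * D (Suc k) x) (at x within {a..b})" if "Suc k = \<alpha>" for k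
    proof -
      have "AE x\<in>{a..b} in lborel. (D k has_real_derivative D (Suc k) x) (at x within {a..b})" using j that by blast
      then show ?thesis by eventually_elim (auto intro: DERIV_cmult)
    qed
    have "set_borel_measurable lborel {a..b} (D \<alpha>)" "set_integrable lborel {a..b} (\<lambda>x. (D \<alpha> x)\<^sup>2)" using j by blast+
    then show "set_borel_measurable lborel {a..b} (\<lambda>x. c * D \<alpha> x)" "set_integrable lborel {a..b} (\<lambda>x. (c * D \<alpha> x)\<^sup>2)"
      by (simp_all add: set_borel_measurable_def power_mult_distrib mult.left_commute[of _ c])
  qed
  moreover have "(\<lambda>t. c * \<eta> t) = (\<lambda>t. if t \<in> {a..b} then c * D \<alpha> t
              else \<Sum>i<\<alpha>. if t = b + 1 + real i then (LINT x:{a..b}|lborel. c * D i x) else 0)"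
    unfolding \<eta> by (rule ext) (auto simp: sum_distrib_left intro!: sum.cong)
  ultimately show ?thesis unfolding sob1_data_def by blast
qed

context sobolev_box
begin

text \<open>Follows the list structure of \<open>tensor_eval\<close> and
  \<open>tensor_inner\<close>, with one admissible choice of data for each factor of each elementary
  tensor.\<close>

inductive tensor_data :: "('n \<Rightarrow> real \<Rightarrow> real) list \<Rightarrow> (('n \<Rightarrow> real) \<Rightarrow> real) \<Rightarrow> bool" where
  Nil: "tensor_data [] (\<lambda>_. 0)"
| Cons: "tensor_data (g # s) (\<lambda>T. (\<Prod>j\<in>UNIV. \<eta> j (T j)) + H T)"
    if "\<And>j. sob1_data \<alpha> (a $ j) (b $ j) (g j) (\<eta> j)" "tensor_data s H"

lemma sob1_data_L2: "sob1_data \<alpha> (a $ j) (b $ j) g \<eta> \<Longrightarrow> L2 (Mm j) \<eta>"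
  using sob1_data_integrable[OF ab, of \<alpha> j g \<eta>] measurable_cong_sets[OF M.sets_N[of j] refl] by (auto simp: L2_def Mm_def)

lemma tensor_data_L2: "tensor_data s H \<Longrightarrow> L2 (MM UNIV) H"
  by (induction rule: tensor_data.induct) (auto intro!: L2_zero L2_add L2_prod sob1_data_L2)

lemma prod_inner_data:
  assumes "\<And>j. sob1_data \<alpha> (a $ j) (b $ j) (g j) (\<eta> j)" "\<And>j. sob1_data \<alpha> (a $ j) (b $ j) (h j) (\<theta> j)"
  shows "(\<Prod>j\<in>UNIV. sob1_inner \<alpha> (a $ j) (b $ j) (g j) (h j)) = (LINT T|MM UNIV. (\<Prod>j\<in>UNIV. \<eta> j (T j)) * (\<Prod>j\<in>UNIV. \<theta> j (T j)))"
proof -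
  have "(LINT T|MM UNIV. (\<Prod>j\<in>UNIV. \<eta> j (T j)) * (\<Prod>j\<in>UNIV. \<theta> j (T j))) = (\<Prod>j\<in>UNIV. LINT t|Mm j. \<eta> j t * \<theta> j t)"
    unfolding prod.distrib[symmetric] by (rule M.P.product_integral_prod) (auto intro: L2_mult_integrable sob1_data_L2 assms)
  then show ?thesis using sob1_inner_data[OF ab \<alpha>1 assms] by (simp add: Mm_def)
qed

lemma tensor_data_inner:
  assumes s: "tensor_data s H" and t: "tensor_data t G"
  shows "tensor_inner \<alpha> a b s t = (LINT T|MM UNIV. H T * G T)"
  using s
proof (induction rule: tensor_data.induct)
  case Nil
  show ?case by (simp add: tensor_inner_def)
next
  case (Cons g \<eta> s H)
  have p: "L2 (MM UNIV) (\<lambda>T. \<Prod>j\<in>UNIV. \<eta> j (T j))" by (rule L2_prod) (rule sob1_data_L2[OF Cons(1)])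
  have "(\<Sum>h\<leftarrow>t. \<Prod>j\<in>UNIV. sob1_inner \<alpha> (a $ j) (b $ j) (g j) (h j)) = (LINT T|MM UNIV. (\<Prod>j\<in>UNIV. \<eta> j (T j)) * G T)"
    using t
  proof (induction rule: tensor_data.induct)
    case Nil
    show ?case by simp
  next
    case (Cons h \<theta> t G)
    have q: "L2 (MM UNIV) (\<lambda>T. \<Prod>j\<in>UNIV. \<theta> j (T j))" by (rule L2_prod) (rule sob1_data_L2[OF Cons(1)])
    show ?case
      using prod_inner_data[OF \<open>\<And>j. sob1_data \<alpha> (a $ j) (b $ j) (g j) (\<eta> j)\<close> Cons(1)] Cons.IH
        L2_mult_integrable[OF p q] L2_mult_integrable[OF p tensor_data_L2[OF Cons(2)]]
      by (simp add: distrib_left)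
  qed
  then show ?case using Cons.IH L2_mult_integrable[OF p tensor_data_L2[OF t]] L2_mult_integrable[OF tensor_data_L2[OF Cons(2)] tensor_data_L2[OF t]]
    by (simp add: tensor_inner_def distrib_right)
qed

lemma tensor_data_dist:
  assumes s: "tensor_data s H" and t: "tensor_data t G"
  shows "tensor_dist \<alpha> a b s t = sqrt (LINT T|MM UNIV. (H T - G T)\<^sup>2)"
proof -
  note i = L2_mult_integrable[OF tensor_data_L2 tensor_data_L2]
  have "(LINT T|MM UNIV. (H T - G T)\<^sup>2) = (LINT T|MM UNIV. H T * H T - 2 * (H T * G T) + G T * G T)"
    by (simp add: power2_eq_square algebra_simps)
  also have "\<dots> = (LINT T|MM UNIV. H T * H T) - 2 * (LINT T|MM UNIV. H T * G T) + (LINT T|MM UNIV. G T * G T)"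
    using i[OF s s] i[OF s t] i[OF t t] by simp
  finally show ?thesis unfolding tensor_dist_def tensor_data_inner[OF s s] tensor_data_inner[OF s t] tensor_data_inner[OF t t] by simp
qed

text \<open>Evaluation at \<open>x\<close> as a pairing. By \<open>ev_L2\<close> it is a continuous
  functional of the data, so convergence of data in L2 entails pointwise convergence on the
  box.\<close>

definition ev :: "real ^ 'n \<Rightarrow> ('n \<Rightarrow> real) \<Rightarrow> real" where
  "ev x T = (\<Prod>j\<in>UNIV. Kc j 0 (x $ j) (T j))"

lemma ev_L2: "L2 (MM UNIV) (ev x)"
  unfolding ev_def by (intro L2_prod Kc_L2) simp

lemma has_data_iff: "has_data f H \<longleftrightarrow> L2 (MM UNIV) H \<and> (\<forall>x\<in>cbox a b. f x = (LINT T|MM UNIV. H T * ev x T))"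
proof -
  have "gder H (\<lambda>_. 0) (vec_nth x) = (LINT T|MM UNIV. H T * ev x T)" if "L2 (MM UNIV) H" "x \<in> cbox a b" for x
    using gder_0[of H "vec_nth x"] L2_measurable[OF that(1)] M.measurable_P[of H UNIV borel] L2_integrable[OF M.finite_P that(1)] that(2)
    by (simp add: ev_def bx_cbox)
  then show ?thesis unfolding has_data_def by auto
qed

lemma tensor_data_eval:
  assumes s: "tensor_data s H" and x: "x \<in> cbox a b"
  shows "tensor_eval s x = (LINT T|MM UNIV. H T * ev x T)"
  using s
proof (induction rule: tensor_data.induct)
  case Nil
  show ?case by (simp add: tensor_eval_def)
next
  case (Cons g \<eta> s H)
  have p: "L2 (MM UNIV) (\<lambda>T. \<Prod>j\<in>UNIV. \<eta> j (T j))" by (rule L2_prod) (rule sob1_data_L2[OF Cons(1)])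
  have xj: "x $ j \<in> {a $ j..b $ j}" for j using x by (simp add: mem_box_cart)
  have "(LINT T|MM UNIV. (\<Prod>j\<in>UNIV. \<eta> j (T j)) * ev x T) = (\<Prod>j\<in>UNIV. LINT t|Mm j. \<eta> j t * Kc j 0 (x $ j) t)"
    unfolding ev_def prod.distrib[symmetric] by (rule M.P.product_integral_prod) (auto intro!: L2_mult_integrable sob1_data_L2 Cons Kc_L2)
  also have "\<dots> = (\<Prod>j\<in>UNIV. g j (x $ j))"
    using sob1_data_representation[OF ab \<alpha>1 Cons(1) xj] by (simp add: Kc_inside[OF xj] Mm_def mult.commute)
  finally show ?case
    using Cons.IH L2_mult_integrable[OF p ev_L2[of x]] L2_mult_integrable[OF tensor_data_L2[OF Cons(2)] ev_L2[of x]]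
    by (simp add: tensor_eval_def distrib_right)
qed

lemma tensor_data_append:
  assumes "tensor_data s H" and t: "tensor_data t G" shows "tensor_data (s @ t) (\<lambda>T. H T + G T)"
  using assms(1)
proof (induction rule: tensor_data.induct)
  case Nil
  then show ?case using t by simp
next
  case (Cons g \<eta> s H)
  show ?case using tensor_data.Cons[OF Cons(1) Cons.IH] by (simp only: append_Cons add.assoc)
qed

lemma tensor_data_sum:
  assumes "finite I" "\<And>i. i \<in> I \<Longrightarrow> \<exists>s. tensor_data s (H i)"
  shows "\<exists>s. tensor_data s (\<lambda>T. \<Sum>i\<in>I. H i T)"
  using assms
proof (induction I rule: finite_induct)
  case empty
  show ?case using tensor_data.Nil by auto
next
  case (insert i I)
  obtain s where s: "tensor_data s (H i)" using insert.prems[of i] by blast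
  have "\<exists>t. tensor_data t (\<lambda>T. \<Sum>i\<in>I. H i T)" using insert.prems by (intro insert.IH) blast
  then obtain t where "tensor_data t (\<lambda>T. \<Sum>i\<in>I. H i T)" by blast
  from tensor_data_append[OF s this] insert.hyps show ?case by auto
qed

lemma tensor_data_exists:
  assumes "\<forall>g\<in>set s. \<forall>j. g j \<in> sob1 \<alpha> (a $ j) (b $ j)"
  shows "\<exists>H. tensor_data s H"
  using assms
proof (induction s)
  case Nil
  show ?case using tensor_data.Nil by blast
next
  case (Cons g s)
  then obtain H where H: "tensor_data s H" by auto
  have "\<forall>j. \<exists>\<eta>. sob1_data \<alpha> (a $ j) (b $ j) (g j) \<eta>" using Cons.prems by (auto intro!: sob1_data_exists)
  then obtain \<eta> where "\<And>j. sob1_data \<alpha> (a $ j) (b $ j) (g j) (\<eta> j)" by metis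
  from tensor_data.Cons[OF this H] show ?case by blast
qed

lemma tensor_data_sob1: "tensor_data s H \<Longrightarrow> \<forall>g\<in>set s. \<forall>j. g j \<in> sob1 \<alpha> (a $ j) (b $ j)"
  by (induction rule: tensor_data.induct) (auto simp: sob1_def sob1_data_def)

text \<open>\<open>tensor_dist\<close> is the L2 distance of the data, so a Cauchy sequence of
  tensors has a limit in the data space by \<open>L2_complete\<close>; pairing with
  \<open>ev x\<close> identifies the function of the limit with \<open>f\<close>.\<close>

theorem sobolev_has_data:
  assumes "f \<in> sobolev \<alpha> a b" shows "\<exists>H. has_data f H"
proof -
  obtain s where *: "(\<forall>n. \<forall>g\<in>set (s n). \<forall>j. g j \<in> sob1 \<alpha> (a $ j) (b $ j)) \<and>
      (\<forall>e>0. \<exists>N. \<forall>m\<ge>N. \<forall>n\<ge>N. tensor_dist \<alpha> a b (s m) (s n) < e) \<and>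
      (\<forall>x\<in>cbox a b. (\<lambda>n. tensor_eval (s n) x) \<longlonglongrightarrow> f x)"
    using assms unfolding sobolev_def mem_Collect_eq by (rule exE)
  note s = spec[OF conjunct1[OF *]] and cauchy = mp[OF spec[OF conjunct1[OF conjunct2[OF *]]]]
    and lim = bspec[OF conjunct2[OF conjunct2[OF *]]]
  have "\<forall>n. \<exists>H. tensor_data (s n) H" using tensor_data_exists[OF s] by blast
  then obtain H where H: "\<And>n. tensor_data (s n) (H n)" by metis
  have "\<exists>G. L2 (MM UNIV) G \<and> (\<lambda>n. LINT T|MM UNIV. (H n T - G T)\<^sup>2) \<longlonglongrightarrow> 0"
  proof (rule L2_complete[OF M.finite_P])
    show "L2 (MM UNIV) (H n)" for n by (rule tensor_data_L2[OF H])
    show "\<exists>N. \<forall>m\<ge>N. \<forall>n\<ge>N. (LINT T|MM UNIV. (H m T - H n T)\<^sup>2) < e" if "e > 0" for e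
      using cauchy[of "sqrt e"] that unfolding tensor_data_dist[OF H H] by simp
  qed
  then obtain G where G: "L2 (MM UNIV) G" "(\<lambda>n. LINT T|MM UNIV. (H n T - G T)\<^sup>2) \<longlonglongrightarrow> 0" by blast
  have "f x = (LINT T|MM UNIV. G T * ev x T)" if x: "x \<in> cbox a b" for x
  proof (rule LIMSEQ_unique[OF lim[OF x]])
    show "(\<lambda>n. tensor_eval (s n) x) \<longlonglongrightarrow> (LINT T|MM UNIV. G T * ev x T)"
      unfolding tensor_data_eval[OF H x] by (rule L2_tendsto_pairing[OF tensor_data_L2[OF H] G(1) ev_L2]) (use G(2) in simp)
  qed
  then show ?thesis using G(1) has_data_iff by blast
qed

text \<open>The converse of \<open>sobolev_has_data\<close> for a given approximating sequence; it
  places Korobov functions in the Sobolev space.\<close>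

theorem limit_in_sobolev:
  assumes s: "\<And>n. \<exists>s. tensor_data s (H n)" and f: "has_data f G"
    and lim: "(\<lambda>n. LINT T|MM UNIV. (H n T - G T)\<^sup>2) \<longlonglongrightarrow> 0"
  shows "f \<in> sobolev \<alpha> a b"
proof -
  obtain s where s: "\<And>n. tensor_data (s n) (H n)" using s by metis
  have G: "L2 (MM UNIV) G" by (rule has_data_facts(3)[OF f])
  have sq: "integrable (MM UNIV) (\<lambda>T. (H n T - G T)\<^sup>2)" for n
    using L2_diff[OF tensor_data_L2[OF s] G, of n] by (simp add: L2_def)
  have "\<exists>N. \<forall>m\<ge>N. \<forall>n\<ge>N. tensor_dist \<alpha> a b (s m) (s n) < e" if e: "e > 0" for e
  proof -
    have "\<forall>\<^sub>F n in sequentially. (LINT T|MM UNIV. (H n T - G T)\<^sup>2) < e\<^sup>2 / 4"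
      using order_tendstoD(2)[OF lim, of "e\<^sup>2 / 4"] e by simp
    then obtain N where N: "\<And>n. n \<ge> N \<Longrightarrow> (LINT T|MM UNIV. (H n T - G T)\<^sup>2) < e\<^sup>2 / 4"
      unfolding eventually_sequentially by blast
    have "tensor_dist \<alpha> a b (s m) (s n) < e" if m: "m \<ge> N" and n: "n \<ge> N" for m n
    proof -
      \<comment> \<open>Squaring the triangle inequality costs a factor 2 on each of the two terms,
        hence the threshold \<open>e\<^sup>2 / 4\<close>.\<close>
      have "(LINT T|MM UNIV. (H m T - H n T)\<^sup>2) \<le> (LINT T|MM UNIV. 2 * (H m T - G T)\<^sup>2 + 2 * (H n T - G T)\<^sup>2)"
      proof (rule integral_mono)
        show "integrable (MM UNIV) (\<lambda>T. (H m T - H n T)\<^sup>2)"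
          using L2_diff[OF tensor_data_L2[OF s] tensor_data_L2[OF s], of m n] by (simp add: L2_def)
        show "(H m T - H n T)\<^sup>2 \<le> 2 * (H m T - G T)\<^sup>2 + 2 * (H n T - G T)\<^sup>2" for T
          using zero_le_power2[of "(H m T - G T) + (H n T - G T)"] by (simp add: power2_eq_square algebra_simps)
      qed (use sq in simp)
      also have "\<dots> = 2 * (LINT T|MM UNIV. (H m T - G T)\<^sup>2) + 2 * (LINT T|MM UNIV. (H n T - G T)\<^sup>2)"
        using sq by simp
      also have "\<dots> < e\<^sup>2" using N[OF m] N[OF n] by simp
      finally show ?thesis unfolding tensor_data_dist[OF s s] using e by (simp add: real_sqrt_less_iff[of _ "e\<^sup>2", symmetric])
    qed
    then show ?thesis by blast
  qed
  moreover have "(\<lambda>n. tensor_eval (s n) x) \<longlonglongrightarrow> f x" if x: "x \<in> cbox a b" for x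
  proof -
    have "(\<lambda>n. LINT T|MM UNIV. H n T * ev x T) \<longlonglongrightarrow> (LINT T|MM UNIV. G T * ev x T)"
      by (rule L2_tendsto_pairing[OF tensor_data_L2[OF s] G ev_L2]) (use lim in simp)
    then show ?thesis using tensor_data_eval[OF s x] f x by (simp add: has_data_iff)
  qed
  ultimately show ?thesis using tensor_data_sob1[OF s] unfolding sobolev_def by blast
qed

lemma has_data_diff:
  assumes "has_data f H" "has_data g G" shows "has_data (\<lambda>x. f x - g x) (\<lambda>T. H T - G T)"
  using assms L2_diff[of "MM UNIV" H G] L2_mult_integrable[OF _ ev_L2, of H] L2_mult_integrable[OF _ ev_L2, of G]
  by (simp add: has_data_iff left_diff_distrib)

end

section \<open>Fourier coefficients on the box\<close>

text \<open>Both measures give an open box the product of its side lengths, and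
  \<open>lborel\<close> is characterised by that.\<close>

lemma distr_vec_lambda_lborel: "distr (PiM UNIV (\<lambda>_::'n::finite. lborel)) borel vec_lambda = (lborel :: (real ^ 'n) measure)"
proof (rule lborel_eqI[symmetric])
  interpret product_sigma_finite "\<lambda>_::'n. lborel :: real measure" by unfold_locales
  have m: "vec_lambda \<in> measurable (PiM UNIV (\<lambda>_. lborel)) (borel :: (real ^ 'n) measure)"
    using measurable_component_singleton[of _ UNIV "\<lambda>_::'n. lborel :: real measure"] by (intro borel_measurable_vec_lambda) simp
  fix l u :: "real ^ 'n" assume le: "\<And>b. b \<in> Basis \<Longrightarrow> l \<bullet> b \<le> u \<bullet> b"
  have lu: "l $ j \<le> u $ j" for j using le[of "axis j 1"] by (simp add: inner_axis axis_in_Basis_iff)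
  have "vec_lambda -` box l u \<inter> space (PiM UNIV (\<lambda>_. lborel)) = PiE UNIV (\<lambda>j. {l $ j<..<u $ j})"
    by (auto simp: space_PiM mem_box_cart PiE_iff)
  then have "emeasure (distr (PiM UNIV (\<lambda>_. lborel)) borel vec_lambda) (box l u) = emeasure (PiM UNIV (\<lambda>_. lborel)) (PiE UNIV (\<lambda>j. {l $ j<..<u $ j}))"
    using emeasure_distr[OF m, of "box l u"] by simp
  also have "\<dots> = (\<Prod>j\<in>UNIV. emeasure lborel {l $ j<..<u $ j})" by (rule emeasure_PiM) auto
  also have "\<dots> = ennreal (\<Prod>j\<in>UNIV. u $ j - l $ j)" using lu by (simp add: prod_ennreal)
  also have "(\<Prod>j\<in>UNIV. u $ j - l $ j) = (\<Prod>b\<in>range (\<lambda>j. axis j 1). (u - l) \<bullet> b)"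
    by (subst prod.reindex) (auto simp: inj_on_def axis_eq_axis inner_axis)
  also have "range (\<lambda>j. axis j 1) = (Basis :: (real ^ 'n) set)" by (auto simp: Basis_vec_def)
  finally show "emeasure (distr (PiM UNIV (\<lambda>_. lborel)) borel vec_lambda) (box l u) = ennreal (\<Prod>b\<in>Basis. (u - l) \<bullet> b)" .
qed simp

context sobolev_box
begin

lemma LINT_cbox:
  fixes h :: "real ^ 'n \<Rightarrow> 'b::{banach, second_countable_topology}"
  assumes hm: "h' \<in> borel_measurable BP" and h: "\<And>x. x \<in> cbox a b \<Longrightarrow> h x = h' (vec_nth x)"
  shows "(LINT x:cbox a b|lborel. h x) = (LINT z|LL UNIV. h' z)"
proof -
  let ?P = "PiM UNIV (\<lambda>_::'n. lborel :: real measure)"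
  have sets: "sets ?P = sets BP" by (rule sets_PiM_cong) auto
  have hm': "h' \<in> borel_measurable ?P" using hm by (simp only: measurable_cong_sets[OF sets refl])
  have vm: "vec_lambda \<in> measurable ?P (borel :: (real ^ 'n) measure)"
    by (simp only: measurable_cong_sets[OF sets refl] vec_lambda_measurable)
  have c: "indicator (cbox a b) (vec_lambda z) = indicat_real (PiE UNIV (\<lambda>j. {a $ j..b $ j})) z" for z
    by (auto simp: indicator_def mem_box_cart)
  have "(LINT x:cbox a b|lborel. h x) = (LINT x|distr ?P borel vec_lambda. indicat_real (cbox a b) x *\<^sub>R h' (vec_nth x))"
    unfolding set_lebesgue_integral_def distr_vec_lambda_lborel by (intro Bochner_Integration.integral_cong) (auto simp: h indicator_def)
  also have "\<dots> = (LINT z|?P. indicat_real (cbox a b) (vec_lambda z) *\<^sub>R h' (vec_nth (vec_lambda z :: real ^ 'n)))"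
    by (rule integral_distr[OF vm]) (intro borel_measurable_scaleR borel_measurable_indicator measurable_compose[OF vec_nth_measurable_BP hm], simp)
  also have "\<dots> = (LINT z|density ?P (\<lambda>y. ennreal (indicat_real (PiE UNIV (\<lambda>j. {a $ j..b $ j})) y)). h' z)"
    unfolding vec_nth_vec_lambda c
    by (rule integral_density[symmetric]) (auto intro!: hm' borel_measurable_indicator sets_PiM_I_finite)
  finally show ?thesis unfolding LL_density_lborel by simp
qed

definition Psi :: "int ^ 'n \<Rightarrow> ('n \<Rightarrow> real) \<Rightarrow> complex" where
  "Psi h T = (\<Prod>j\<in>UNIV. psi \<alpha> (a $ j) (b $ j) (h $ j) (T j))"

definition co :: "(('n \<Rightarrow> real) \<Rightarrow> real) \<Rightarrow> int ^ 'n \<Rightarrow> complex" where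
  "co H h = (LINT T|MM UNIV. of_real (H T) * cnj (Psi h T))"

definition PK :: "real ^ 'n \<Rightarrow> ('n \<Rightarrow> real) \<Rightarrow> real" where
  "PK x T = (\<Prod>j\<in>UNIV. proj_ker \<alpha> (a $ j) (b $ j) (x $ j) (T j))"

abbreviation wt :: "int ^ 'n \<Rightarrow> real" where "wt \<equiv> kor_weight \<alpha> a b"
abbreviation phi :: "int ^ 'n \<Rightarrow> real ^ 'n \<Rightarrow> complex" where "phi \<equiv> fourier_basis a b"

lemma phi_fexp: "phi h x = (\<Prod>j\<in>UNIV. fexp (a $ j) (b $ j) (h $ j) (x $ j))"
  by (simp add: fourier_basis_def fexp_def)

lemma wt_pos: "wt h > 0"
  unfolding kor_weight_def by (intro prod_pos kor_weight1_pos ab ballI)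

lemma psi_L2: "L2 (Mm j) (psi \<alpha> (a $ j) (b $ j) k)"
  by (rule L2_Mm_bounded[OF psi_measurable psi_bounded[OF ab]])

lemma Psi_L2: "L2 (MM UNIV) (Psi h)"
  unfolding Psi_def[abs_def] by (rule L2_prod[OF psi_L2])

lemma cnj_Psi: "cnj (Psi h T) = Psi (- h) T"
  by (simp add: Psi_def cnj_psi)

lemma cnj_phi: "cnj (phi h x) = phi (- h) x"
  by (simp add: phi_fexp cnj_fexp)

lemma wt_uminus: "wt (- h) = wt h"
proof -
  have "kor_weight1 \<alpha> p q (- k) = kor_weight1 \<alpha> p q k" for p q k by (cases "k = 0") (simp_all add: kor_weight1_def)
  then show ?thesis by (simp add: kor_weight_def)
qed

lemma Psi_orthonormal: "(LINT T|MM UNIV. Psi h T * cnj (Psi k T)) = (if h = k then 1 else 0)"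
proof -
  have "(LINT T|MM UNIV. Psi h T * cnj (Psi k T)) = (\<Prod>j\<in>UNIV. LINT t|Mm j. psi \<alpha> (a $ j) (b $ j) (h $ j) t * cnj (psi \<alpha> (a $ j) (b $ j) (k $ j) t))"
    unfolding Psi_def cnj_prod prod.distrib[symmetric]
    by (rule M.P.product_integral_prod) (auto intro!: L2_mult_integrable psi_L2 L2_cnj)
  also have "\<dots> = (\<Prod>j\<in>UNIV. if h $ j = k $ j then 1 else 0)"
    unfolding Mm_def by (simp add: psi_orthonormal[OF ab \<alpha>1])
  also have "\<dots> = (if h = k then 1 else 0)" by (auto simp: vec_eq_iff)
  finally show ?thesis .
qed

text \<open>Sums of products over cubes of frequencies factor by coordinates, which carries the
  one-dimensional Parseval limits over. The cubes are also symmetric under negation, which makes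
  partial sums of real functions real.\<close>

definition boxN :: "nat \<Rightarrow> (int ^ 'n) set" where
  "boxN N = {h. \<forall>j. h $ j \<in> {- int N..int N}}"

lemma sum_boxN_prod:
  fixes f :: "'n \<Rightarrow> int \<Rightarrow> real"
  shows "(\<Sum>h\<in>boxN N. \<Prod>j\<in>UNIV. f j (h $ j)) = (\<Prod>j\<in>UNIV. \<Sum>k\<in>{- int N..int N}. f j k)"
proof -
  have "(\<Sum>h\<in>boxN N. \<Prod>j\<in>UNIV. f j (h $ j)) = (\<Sum>g\<in>PiE UNIV (\<lambda>_. {- int N..int N}). \<Prod>j\<in>UNIV. f j (g j))"
    by (rule sum.reindex_bij_witness[of _ vec_lambda vec_nth]) (auto simp: boxN_def)
  then show ?thesis by (simp add: prod_sum_PiE)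
qed

lemma finite_boxN: "finite (boxN N)"
proof (rule finite_subset)
  show "boxN N \<subseteq> vec_lambda ` PiE UNIV (\<lambda>_::'n. {- int N..int N})"
  proof
    fix h assume "h \<in> boxN N"
    then show "h \<in> vec_lambda ` PiE UNIV (\<lambda>_::'n. {- int N..int N})"
      by (intro image_eqI[of _ _ "vec_nth h"]) (auto simp: boxN_def)
  qed
qed (auto intro!: finite_imageI finite_PiE)

lemma sum_boxN_uminus: "(\<Sum>h\<in>boxN N. f (- h)) = (\<Sum>h\<in>boxN N. f h)"
  by (rule sum.reindex_bij_witness[of _ uminus uminus]) (auto simp: boxN_def minus_le_iff le_minus_iff)

lemma boxN_exhausts:
  assumes "finite X" shows "\<exists>N. X \<subseteq> boxN N"
proof -
  define N where "N = nat (Max (insert 0 ((\<lambda>(h, j). \<bar>h $ j\<bar>) ` (X \<times> UNIV))))"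
  have "\<bar>h $ j\<bar> \<le> int N" if "h \<in> X" for h j
  proof -
    have "\<bar>h $ j\<bar> \<le> Max (insert 0 ((\<lambda>(h, j). \<bar>h $ j\<bar>) ` (X \<times> UNIV)))"
      using assms that by (intro Max_ge) force+
    then show ?thesis unfolding N_def by linarith
  qed
  then have "X \<subseteq> boxN N" by (auto simp: boxN_def abs_le_iff minus_le_iff)
  then show ?thesis ..
qed

lemma boxN_mono: "M \<le> N \<Longrightarrow> boxN M \<subseteq> boxN N"
proof
  fix h assume "M \<le> N" "h \<in> boxN M"
  then have "int M \<le> int N" "- int M \<le> h $ j \<and> h $ j \<le> int M" for j by (auto simp: boxN_def)
  then have "h $ j \<in> {- int N..int N}" for j unfolding atLeastAtMost_iff by (meson neg_le_iff_le order_trans)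
  then show "h \<in> boxN N" by (simp add: boxN_def)
qed

text \<open>Every finite set of frequencies lies in some cube, so an unordered sum is also the limit
  along cubes.\<close>

lemma filterlim_boxN: "filterlim boxN (finite_subsets_at_top UNIV) sequentially"
  unfolding filterlim_finite_subsets_at_top
proof (intro allI impI)
  fix X :: "(int ^ 'n) set" assume "finite X \<and> X \<subseteq> UNIV"
  then obtain M where "X \<subseteq> boxN M" using boxN_exhausts by blast
  then show "\<forall>\<^sub>F N in sequentially. finite (boxN N) \<and> X \<subseteq> boxN N \<and> boxN N \<subseteq> UNIV"
    using boxN_mono finite_boxN by (auto simp: eventually_sequentially intro!: exI[of _ M])
qed

lemma has_sum_boxN: "(f has_sum S) UNIV \<Longrightarrow> (\<lambda>N. \<Sum>h\<in>boxN N. f h) \<longlonglongrightarrow> S"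
  unfolding has_sum_def by (rule filterlim_compose[OF _ filterlim_boxN])

lemma summable_boxN:
  fixes f :: "int ^ 'n \<Rightarrow> real"
  assumes "\<And>h. f h \<ge> 0" "\<And>N. (\<Sum>h\<in>boxN N. f h) \<le> C"
  shows "f summable_on UNIV"
proof (rule nonneg_bdd_above_summable_on)
  show "bdd_above (sum f ` {F. F \<subseteq> UNIV \<and> finite F})"
  proof (rule bdd_aboveI2)
    fix F :: "(int ^ 'n) set" assume "F \<in> {F. F \<subseteq> UNIV \<and> finite F}"
    then obtain N where "F \<subseteq> boxN N" using boxN_exhausts by blast
    then have "sum f F \<le> sum f (boxN N)" using assms(1) by (intro sum_mono2 finite_boxN) auto
    then show "sum f F \<le> C" using assms(2)[of N] by linarith
  qed
qed (rule assms)

section \<open>Finite Fourier sums in the data space\<close>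

lemma Psi_bessel:
  assumes f: "L2 (MM UNIV) f" and c: "\<And>h. h \<in> boxN N \<Longrightarrow> (LINT T|MM UNIV. f T * cnj (Psi h T)) = c h"
  shows "(LINT T|MM UNIV. (cmod (f T - (\<Sum>h\<in>boxN N. c h * Psi h T)))\<^sup>2) =
    (LINT T|MM UNIV. (cmod (f T))\<^sup>2) - (\<Sum>h\<in>boxN N. (cmod (c h))\<^sup>2)"
  by (rule bessel_identity[OF finite_boxN f Psi_L2]) (auto simp: Psi_orthonormal c)

lemma fourier_sum_L2: "L2 (MM UNIV) (\<lambda>T. \<Sum>h\<in>boxN N. c h * Psi h T)"
  by (intro L2_sum L2_cmult Psi_L2)

lemma fourier_sum_pairing:
  assumes g: "L2 (MM UNIV) g"
  shows "(LINT T|MM UNIV. (\<Sum>h\<in>boxN N. c h * Psi h T) * g T) = (\<Sum>h\<in>boxN N. c h * (LINT T|MM UNIV. Psi h T * g T))"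
proof -
  have "(LINT T|MM UNIV. (\<Sum>h\<in>boxN N. c h * Psi h T) * g T) = (LINT T|MM UNIV. (\<Sum>h\<in>boxN N. c h * (Psi h T * g T)))"
    by (simp only: sum_distrib_right mult.assoc)
  also have "\<dots> = (\<Sum>h\<in>boxN N. LINT T|MM UNIV. c h * (Psi h T * g T))"
    by (rule Bochner_Integration.integral_sum) (intro integrable_mult_right L2_mult_integrable Psi_L2 g)
  finally show ?thesis by (simp only: integral_mult_right_zero)
qed

lemma fourier_sum_coeff:
  "(LINT T|MM UNIV. (\<Sum>h\<in>boxN N. c h * Psi h T) * cnj (Psi k T)) = (if k \<in> boxN N then c k else 0)"
proof -
  have "(LINT T|MM UNIV. (\<Sum>h\<in>boxN N. c h * Psi h T) * cnj (Psi k T)) = (\<Sum>h\<in>boxN N. if h = k then c k else 0)"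
    unfolding fourier_sum_pairing[OF L2_cnj[OF Psi_L2]] Psi_orthonormal by (rule sum.cong) auto
  then show ?thesis by (simp add: finite_boxN)
qed

text \<open>Bessel's identity for the larger sum, applied once with all its own coefficients and
  once with those in the smaller cube.\<close>

lemma fourier_sum_norm:
  assumes "M \<le> N"
  shows "(LINT T|MM UNIV. (cmod ((\<Sum>h\<in>boxN N. c h * Psi h T) - (\<Sum>h\<in>boxN M. c h * Psi h T)))\<^sup>2) =
    (\<Sum>h\<in>boxN N. (cmod (c h))\<^sup>2) - (\<Sum>h\<in>boxN M. (cmod (c h))\<^sup>2)"
proof -
  have "(LINT T|MM UNIV. (cmod ((\<Sum>h\<in>boxN N. c h * Psi h T) - (\<Sum>h\<in>boxN N. c h * Psi h T)))\<^sup>2) =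
      (LINT T|MM UNIV. (cmod (\<Sum>h\<in>boxN N. c h * Psi h T))\<^sup>2) - (\<Sum>h\<in>boxN N. (cmod (c h))\<^sup>2)"
    by (rule Psi_bessel[OF fourier_sum_L2]) (simp add: fourier_sum_coeff)
  moreover have "(LINT T|MM UNIV. (cmod ((\<Sum>h\<in>boxN N. c h * Psi h T) - (\<Sum>h\<in>boxN M. c h * Psi h T)))\<^sup>2) =
      (LINT T|MM UNIV. (cmod (\<Sum>h\<in>boxN N. c h * Psi h T))\<^sup>2) - (\<Sum>h\<in>boxN M. (cmod (c h))\<^sup>2)"
    by (rule Psi_bessel[OF fourier_sum_L2]) (use boxN_mono[OF assms] in \<open>auto simp: fourier_sum_coeff\<close>)
  ultimately show ?thesis by simp
qed

section \<open>The Korobov space in terms of the data\<close>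

text \<open>\<open>fexp\<close> is itself a Sobolev function whose data are the weight times
  \<open>psi\<close>; its representation formula, read for real and imaginary parts, is the claim
  multiplied by the weight.\<close>

lemma sob_ker_psi:
  assumes x: "x \<in> {a $ j..b $ j}"
  shows "(LINT t|Mm j. of_real (Kc j 0 x t) * psi \<alpha> (a $ j) (b $ j) h t) = fexp (a $ j) (b $ j) h x / of_real (kor_weight1 \<alpha> (a $ j) (b $ j) h)"
proof -
  let ?k = "kor_weight1 \<alpha> (a $ j) (b $ j) h" and ?z = "LINT t|Mm j. of_real (Kc j 0 x t) * psi \<alpha> (a $ j) (b $ j) h t"
  have i: "integrable (Mm j) (\<lambda>t. of_real (Kc j 0 x t) * psi \<alpha> (a $ j) (b $ j) h t)"
    by (intro L2_mult_integrable L2_of_real Kc_L2 psi_L2) simp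
  have "L (fexp (a $ j) (b $ j) h x) = ?k * L ?z" if L: "L = Re \<or> L = Im" for L
  proof -
    have "L (fexp (a $ j) (b $ j) h x) = (LINT t|Mm j. Kc j 0 x t * L (of_real ?k * psi \<alpha> (a $ j) (b $ j) h t))"
      using sob1_data_representation[OF ab \<alpha>1 fexp_sob1_data[OF ab \<alpha>1 L] x] by (simp add: Mm_def Kc_inside[OF x])
    also have "\<dots> = (LINT t|Mm j. ?k * L (of_real (Kc j 0 x t) * psi \<alpha> (a $ j) (b $ j) h t))"
      by (intro Bochner_Integration.integral_cong) (use L in auto)
    also have "\<dots> = ?k * (LINT t|Mm j. L (of_real (Kc j 0 x t) * psi \<alpha> (a $ j) (b $ j) h t))"
      by (rule integral_mult_right_zero)
    also have "(LINT t|Mm j. L (of_real (Kc j 0 x t) * psi \<alpha> (a $ j) (b $ j) h t)) = L ?z"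
      using L integral_Re[OF i] integral_Im[OF i] by (elim disjE) (simp_all only:)
    finally show ?thesis .
  qed
  from this[of Re] this[of Im] have "fexp (a $ j) (b $ j) h x = of_real ?k * ?z" by (simp add: complex_eq_iff)
  then show ?thesis using kor_weight1_pos[OF ab, of \<alpha> j h] by (simp add: field_simps)
qed

text \<open>A product of instances of \<open>sob_ker_psi\<close>. The value is the same as in
  \<open>PK_Psi\<close>; together with \<open>PK_parseval\<close> this makes \<open>PK x\<close> the
  orthogonal projection of \<open>ev x\<close> on the closed span of the
  \<open>Psi h\<close>.\<close>

lemma ev_Psi: "x \<in> cbox a b \<Longrightarrow> (LINT T|MM UNIV. Psi h T * of_real (ev x T)) = phi h x / of_real (wt h)"
proof -
  assume x: "x \<in> cbox a b"
  have "(LINT T|MM UNIV. Psi h T * of_real (ev x T)) = (\<Prod>j\<in>UNIV. LINT t|Mm j. psi \<alpha> (a $ j) (b $ j) (h $ j) t * of_real (Kc j 0 (x $ j) t))"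
    unfolding Psi_def ev_def of_real_prod prod.distrib[symmetric]
    by (rule M.P.product_integral_prod) (auto intro!: L2_mult_integrable psi_L2 L2_of_real Kc_L2)
  also have "\<dots> = (\<Prod>j\<in>UNIV. fexp (a $ j) (b $ j) (h $ j) (x $ j) / of_real (kor_weight1 \<alpha> (a $ j) (b $ j) (h $ j)))"
    using x by (intro prod.cong refl) (simp add: sob_ker_psi mem_box_cart mult.commute[of "psi _ _ _ _ _"])
  finally show ?thesis by (simp add: phi_fexp kor_weight_def prod_dividef)
qed

lemma proj_ker_L2: "x \<in> {a $ j..b $ j} \<Longrightarrow> L2 (Mm j) (proj_ker \<alpha> (a $ j) (b $ j) x)"
proof -
  assume x: "x \<in> {a $ j..b $ j}"
  obtain B where "\<forall>x\<in>{a $ j..b $ j}. \<forall>t. \<bar>proj_ker \<alpha> (a $ j) (b $ j) x t\<bar> \<le> B" using proj_ker_bounded[OF ab] by blast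
  then show ?thesis using x by (intro L2_Mm_bounded[where B=B]) auto
qed

lemma PK_L2: "x \<in> cbox a b \<Longrightarrow> L2 (MM UNIV) (PK x)"
  unfolding PK_def[abs_def] by (intro L2_prod proj_ker_L2) (simp add: mem_box_cart)

lemma PK_Psi: "x \<in> cbox a b \<Longrightarrow> (LINT T|MM UNIV. of_real (PK x T) * Psi h T) = phi h x / of_real (wt h)"
proof -
  assume x: "x \<in> cbox a b"
  then have xj: "x $ j \<in> {a $ j..b $ j}" for j by (simp add: mem_box_cart)
  have "(LINT T|MM UNIV. of_real (PK x T) * Psi h T) = (\<Prod>j\<in>UNIV. LINT t|Mm j. of_real (proj_ker \<alpha> (a $ j) (b $ j) (x $ j) t) * psi \<alpha> (a $ j) (b $ j) (h $ j) t)"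
    unfolding Psi_def PK_def of_real_prod prod.distrib[symmetric]
    by (rule M.P.product_integral_prod) (auto intro!: L2_mult_integrable psi_L2 L2_of_real proj_ker_L2[OF xj])
  also have "\<dots> = (\<Prod>j\<in>UNIV. fexp (a $ j) (b $ j) (h $ j) (x $ j) / of_real (kor_weight1 \<alpha> (a $ j) (b $ j) (h $ j)))"
    using xj by (simp add: proj_ker_psi[OF ab \<alpha>1] Mm_def)
  finally show ?thesis by (simp add: phi_fexp kor_weight_def prod_dividef)
qed

text \<open>Sums over cubes factor, and each factor converges by \<open>proj_ker_parseval\<close>.
  Equality in Bessel's inequality means that \<open>PK x\<close> is the L2 limit of its Fourier
  sums.\<close>

lemma PK_parseval:
  assumes x: "x \<in> cbox a b"
  shows "(\<lambda>N. \<Sum>h\<in>boxN N. (cmod (phi h x / of_real (wt h)))\<^sup>2) \<longlonglongrightarrow> (LINT T|MM UNIV. (PK x T)\<^sup>2)"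
proof -
  have xj: "x $ j \<in> {a $ j..b $ j}" for j using x by (simp add: mem_box_cart)
  have sq: "0 \<le> b $ j - a $ j" for j using ab[of j] by simp
  have "(cmod (phi h x / of_real (wt h)))\<^sup>2 = (\<Prod>j\<in>UNIV. 1 / ((b $ j - a $ j) * (kor_weight1 \<alpha> (a $ j) (b $ j) (h $ j))\<^sup>2))" for h
    using kor_weight1_pos[OF ab, THEN less_imp_le] real_sqrt_pow2[OF sq]
    by (simp add: phi_fexp kor_weight_def norm_divide prod_norm[symmetric] cmod_fexp[OF ab] prod_dividef[symmetric] prod_power_distrib power_divide
        power_mult_distrib abs_prod)
  then have "(\<Sum>h\<in>boxN N. (cmod (phi h x / of_real (wt h)))\<^sup>2) =
      (\<Prod>j\<in>UNIV. \<Sum>k\<in>{- int N..int N}. 1 / ((b $ j - a $ j) * (kor_weight1 \<alpha> (a $ j) (b $ j) k)\<^sup>2))" for N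
    by (simp add: sum_boxN_prod[where f="\<lambda>j k. 1 / ((b $ j - a $ j) * (kor_weight1 \<alpha> (a $ j) (b $ j) k)\<^sup>2)"])
  moreover have "(LINT T|MM UNIV. (PK x T)\<^sup>2) = (\<Prod>j\<in>UNIV. LINT t|Mm j. (proj_ker \<alpha> (a $ j) (b $ j) (x $ j) t)\<^sup>2)"
    unfolding PK_def prod_power_distrib by (rule M.P.product_integral_prod) (use proj_ker_L2[OF xj] in \<open>auto simp: L2_def\<close>)
  ultimately show ?thesis
    by (simp only: Mm_def) (intro tendsto_prod proj_ker_parseval[OF ab \<alpha>1 xj])
qed

lemma tensor_data_psi_prod:
  fixes L :: "'n \<Rightarrow> complex \<Rightarrow> real"
  assumes L: "\<And>j. L j = Re \<or> L j = Im"
  shows "\<exists>s. tensor_data s (\<lambda>T. r * (\<Prod>j\<in>UNIV. L j (psi \<alpha> (a $ j) (b $ j) (h $ j) (T j))))"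
proof -
  \<comment> \<open>A multiple of an elementary tensor is elementary: one arbitrary coordinate
    absorbs the scalar \<open>r\<close>.\<close>
  obtain i :: 'n where True by blast
  define q where "q j = (if j = i then r else 1)" for j :: 'n
  let ?k = "\<lambda>j. kor_weight1 \<alpha> (a $ j) (b $ j) (h $ j)" and ?p = "\<lambda>j. psi \<alpha> (a $ j) (b $ j) (h $ j)"
  have "sob1_data \<alpha> (a $ j) (b $ j) (\<lambda>x. q j / ?k j * L j (fexp (a $ j) (b $ j) (h $ j) x)) (\<lambda>t. q j * L j (?p j t))" for j
  proof -
    have "q j / ?k j * L j (of_real (?k j) * z) = q j * L j z" for z
      using L[of j] kor_weight1_pos[OF ab, of \<alpha> j "h $ j"] by (auto simp: field_simps)
    then show ?thesis using sob1_data_cmult[OF fexp_sob1_data[OF ab[of j] \<alpha>1 L[of j], where h="h $ j"], where c="q j / ?k j"] by simp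
  qed
  from tensor_data.Cons[OF this tensor_data.Nil]
  have "\<exists>s. tensor_data s (\<lambda>T. (\<Prod>j\<in>UNIV. q j * L j (?p j (T j))) + 0)" by blast
  moreover have "(\<Prod>j\<in>UNIV. q j * L j (?p j (T j))) + 0 = r * (\<Prod>j\<in>UNIV. L j (?p j (T j)))" for T
    by (simp add: prod.distrib q_def prod.delta)
  ultimately show ?thesis by simp
qed

text \<open>The tensors are real, so the complex product is multiplied out into real and imaginary
  parts of its factors; \<open>X\<close> collects the coordinates that contribute their real
  part.\<close>

lemma tensor_data_Psi: "\<exists>s. tensor_data s (\<lambda>T. Re (c * Psi h T))"
proof -
  let ?p = "\<lambda>j. psi \<alpha> (a $ j) (b $ j) (h $ j)"
  define L where "L X j = (if j \<in> X then Re else Im)" for X and j :: 'n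
  have "Re (c * Psi h T) = (\<Sum>X\<in>Pow UNIV. Re (c * \<i> ^ card (UNIV - X)) * (\<Prod>j\<in>UNIV. L X j (?p j (T j))))" for T
  proof -
    have "Psi h T = (\<Prod>j\<in>UNIV. of_real (Re (?p j (T j))) + \<i> * of_real (Im (?p j (T j))))"
      by (simp only: Psi_def complex_eq[symmetric])
    also have "\<dots> = (\<Sum>X\<in>Pow UNIV. (\<Prod>j\<in>X. of_real (Re (?p j (T j)))) * (\<Prod>j\<in>UNIV - X. \<i> * of_real (Im (?p j (T j)))))"
      by (rule prod_add) simp
    also have "\<dots> = (\<Sum>X\<in>Pow UNIV. \<i> ^ card (UNIV - X) * of_real (\<Prod>j\<in>UNIV. L X j (?p j (T j))))"
    proof (rule sum.cong[OF refl])
      fix X :: "'n set"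
      have "(\<Prod>j\<in>UNIV. L X j (?p j (T j))) = (\<Prod>j\<in>UNIV - X. L X j (?p j (T j))) * (\<Prod>j\<in>X. L X j (?p j (T j)))"
        by (rule prod.subset_diff) auto
      also have "(\<Prod>j\<in>UNIV - X. L X j (?p j (T j))) = (\<Prod>j\<in>UNIV - X. Im (?p j (T j)))"
        by (rule prod.cong) (auto simp: L_def)
      also have "(\<Prod>j\<in>X. L X j (?p j (T j))) = (\<Prod>j\<in>X. Re (?p j (T j)))"
        by (rule prod.cong) (auto simp: L_def)
      finally show "(\<Prod>j\<in>X. complex_of_real (Re (?p j (T j)))) * (\<Prod>j\<in>UNIV - X. \<i> * of_real (Im (?p j (T j)))) =
          \<i> ^ card (UNIV - X) * of_real (\<Prod>j\<in>UNIV. L X j (?p j (T j)))"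
        by (simp add: prod.distrib mult_ac)
    qed
    finally have "c * Psi h T = (\<Sum>X\<in>Pow UNIV. (c * \<i> ^ card (UNIV - X)) * of_real (\<Prod>j\<in>UNIV. L X j (?p j (T j))))"
      by (simp only: sum_distrib_left mult.assoc)
    moreover have "Re (z * of_real r) = Re z * r" for z r by simp
    ultimately show ?thesis by (simp only: Re_sum)
  qed
  moreover have "\<exists>s. tensor_data s (\<lambda>T. \<Sum>X\<in>Pow UNIV. Re (c * \<i> ^ card (UNIV - X)) * (\<Prod>j\<in>UNIV. L X j (?p j (T j))))"
    by (rule tensor_data_sum) (auto intro!: tensor_data_psi_prod simp: L_def)
  ultimately show ?thesis by simp
qed

text \<open>The symmetry of the coefficients makes the partial sums real.\<close>

lemma fourier_synthesis:
  fixes c :: "int ^ 'n \<Rightarrow> complex"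
  assumes sym: "\<And>h. cnj (c h) = c (- h)" and sm: "(\<lambda>h. (cmod (c h))\<^sup>2) summable_on UNIV"
  obtains Gs G where "\<And>N. \<exists>s. tensor_data s (Gs N)" "L2 (MM UNIV) G" "(\<lambda>N. LINT T|MM UNIV. (Gs N T - G T)\<^sup>2) \<longlonglongrightarrow> 0"
    "\<And>N T. of_real (Gs N T) = (\<Sum>h\<in>boxN N. c h * Psi h T)"
proof -
  define Gs where "Gs N T = Re (\<Sum>h\<in>boxN N. c h * Psi h T)" for N T
  have real: "of_real (Gs N T) = (\<Sum>h\<in>boxN N. c h * Psi h T)" for N T
  proof -
    have "cnj (\<Sum>h\<in>boxN N. c h * Psi h T) = (\<Sum>h\<in>boxN N. c (- h) * Psi (- h) T)" by (simp add: sym cnj_Psi)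
    also have "\<dots> = (\<Sum>h\<in>boxN N. c h * Psi h T)" by (rule sum_boxN_uminus)
    finally show ?thesis unfolding Gs_def by (metis Reals_cnj_iff of_real_Re)
  qed
  have tens: "\<exists>s. tensor_data s (Gs N)" for N
    unfolding Gs_def[abs_def] Re_sum by (rule tensor_data_sum[OF finite_boxN tensor_data_Psi])
  let ?S = "\<lambda>N. \<Sum>h\<in>boxN N. (cmod (c h))\<^sup>2"
  have diff: "(LINT T|MM UNIV. (Gs n T - Gs m T)\<^sup>2) = ?S n - ?S m" if "m \<le> n" for m n
  proof -
    have "(Gs n T - Gs m T)\<^sup>2 = (cmod ((\<Sum>h\<in>boxN n. c h * Psi h T) - (\<Sum>h\<in>boxN m. c h * Psi h T)))\<^sup>2" for T
      unfolding real[symmetric] of_real_diff[symmetric] norm_of_real by simp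
    then show ?thesis using fourier_sum_norm[OF that] by simp
  qed
  have "\<exists>G. L2 (MM UNIV) G \<and> (\<lambda>N. LINT T|MM UNIV. (Gs N T - G T)\<^sup>2) \<longlonglongrightarrow> 0"
  proof (rule L2_complete[OF M.finite_P])
    show "L2 (MM UNIV) (Gs n)" for n using tens tensor_data_L2 by blast
    fix e :: real assume e: "e > 0"
    have "Cauchy ?S" using has_sum_boxN[OF has_sum_infsum[OF sm]] by (rule LIMSEQ_imp_Cauchy)
    then obtain N where N: "\<And>m n. m \<ge> N \<Longrightarrow> n \<ge> N \<Longrightarrow> \<bar>?S m - ?S n\<bar> < e"
      using e unfolding Cauchy_def dist_real_def by blast
    have "(LINT T|MM UNIV. (Gs m T - Gs n T)\<^sup>2) < e" if "m \<ge> N" "n \<ge> N" for m n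
    proof (cases "n \<le> m")
      case True
      then show ?thesis using diff[OF True] N[OF that] by simp
    next
      case False
      then show ?thesis using diff[of m n] N[OF that] by (simp add: power2_commute[of "Gs m _"])
    qed
    then show "\<exists>N. \<forall>m\<ge>N. \<forall>n\<ge>N. (LINT T|MM UNIV. (Gs m T - Gs n T)\<^sup>2) < e" by blast
  qed
  then show thesis using that tens real by blast
qed

text \<open>The coefficients multiplied by the weight are square-summable, so they synthesise an L2
  limit \<open>G\<close> of sums of \<open>Psi h\<close>; \<open>ev_Psi\<close> divides by the
  weight again and recovers the Fourier series of \<open>g\<close>. As \<open>G\<close> lies in the
  closed span of the \<open>Psi h\<close>, data with vanishing coefficients are orthogonal to
  it.\<close>

theorem korobov_data:
  assumes g: "g \<in> korobov \<alpha> a b"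
  obtains G where "has_data g G" "g \<in> sobolev \<alpha> a b" "\<And>h. co G h = fourier_coeff a b g h * of_real (wt h)"
    "(\<lambda>N. \<Sum>h\<in>boxN N. (cmod (fourier_coeff a b g h))\<^sup>2 * (wt h)\<^sup>2) \<longlonglongrightarrow> (LINT T|MM UNIV. G T * G T)"
    "\<And>H. L2 (MM UNIV) H \<Longrightarrow> (\<And>h. co H h = 0) \<Longrightarrow> (LINT T|MM UNIV. H T * G T) = 0"
proof -
  define c where "c h = fourier_coeff a b g h * of_real (wt h)" for h
  \<comment> \<open>\<open>g\<close> is real and the weight is even in \<open>h\<close>; this is the
    symmetry that \<open>fourier_synthesis\<close> asks for.\<close>
  have sym: "cnj (c h) = c (- h)" for h
  proof -
    let ?i = "\<lambda>x. indicat_real (cbox a b) x"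
    have "cnj (LINT x|lborel. ?i x *\<^sub>R (of_real (g x) * cnj (phi h x))) = (LINT x|lborel. cnj (?i x *\<^sub>R (of_real (g x) * cnj (phi h x))))"
      by (rule Bochner_Integration.integral_cnj[symmetric])
    also have "\<dots> = (LINT x|lborel. ?i x *\<^sub>R (of_real (g x) * cnj (phi (- h) x)))"
      by (simp only: cnj_phi complex_cnj_scaleR complex_cnj_mult complex_cnj_complex_of_real minus_minus)
    finally show ?thesis by (simp only: c_def fourier_coeff_def set_lebesgue_integral_def wt_uminus complex_cnj_mult complex_cnj_complex_of_real)
  qed
  have c2: "(cmod (c h))\<^sup>2 = (cmod (fourier_coeff a b g h))\<^sup>2 * (wt h)\<^sup>2" for h
    using wt_pos[of h] by (simp add: c_def norm_mult power_mult_distrib)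
  have gx: "((\<lambda>h. fourier_coeff a b g h * phi h x) has_sum of_real (g x)) UNIV" if "x \<in> cbox a b" for x
    using g that by (simp add: korobov_def)
  have sm: "(\<lambda>h. (cmod (c h))\<^sup>2) summable_on UNIV" using g by (simp add: korobov_def c2)
  obtain Gs G where tens: "\<And>N. \<exists>s. tensor_data s (Gs N)" and G: "L2 (MM UNIV) G"
    and lim: "(\<lambda>N. LINT T|MM UNIV. (Gs N T - G T)\<^sup>2) \<longlonglongrightarrow> 0"
    and Gs: "\<And>N T. complex_of_real (Gs N T) = (\<Sum>h\<in>boxN N. c h * Psi h T)"
    by (rule fourier_synthesis[OF sym sm]) blast
  have GsL: "L2 (MM UNIV) (Gs N)" for N using tens tensor_data_L2 by blast
  have n: "(norm (complex_of_real (Gs N T) - complex_of_real (G T)))\<^sup>2 = (Gs N T - G T)\<^sup>2" for N T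
    by (simp only: of_real_diff[symmetric] norm_of_real power2_abs)
  have pairing: "(\<lambda>N. \<Sum>h\<in>boxN N. c h * (LINT T|MM UNIV. Psi h T * k T)) \<longlonglongrightarrow> (LINT T|MM UNIV. of_real (G T) * k T)"
    if k: "L2 (MM UNIV) k" for k
  proof -
    have "(\<lambda>N. LINT T|MM UNIV. of_real (Gs N T) * k T) \<longlonglongrightarrow> (LINT T|MM UNIV. of_real (G T) * k T)"
      by (rule L2_tendsto_pairing[OF L2_of_real[OF GsL] L2_of_real[OF G] k]) (use lim n in simp)
    then show ?thesis unfolding Gs fourier_sum_pairing[OF k] .
  qed
  have data: "has_data g G" unfolding has_data_iff
  proof (intro conjI ballI G)
    fix x assume x: "x \<in> cbox a b"
    have "(\<lambda>N. \<Sum>h\<in>boxN N. fourier_coeff a b g h * phi h x) \<longlonglongrightarrow> (LINT T|MM UNIV. of_real (G T) * of_real (ev x T))"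
      using pairing[OF L2_of_real[OF ev_L2[of x]]] wt_pos[THEN less_imp_neq] unfolding ev_Psi[OF x] by (simp add: c_def)
    then have "complex_of_real (g x) = (LINT T|MM UNIV. of_real (G T) * of_real (ev x T))"
      using LIMSEQ_unique[OF has_sum_boxN[OF gx[OF x]]] by blast
    also have "\<dots> = of_real (LINT T|MM UNIV. G T * ev x T)"
      by (simp only: of_real_mult[symmetric] integral_complex_of_real)
    finally show "g x = (LINT T|MM UNIV. G T * ev x T)" by (simp only: of_real_eq_iff)
  qed
  have coG: "co G k = c k" for k
  proof -
    have l: "(\<lambda>N. \<Sum>h\<in>boxN N. c h * (if h = k then 1 else 0)) \<longlonglongrightarrow> co G k"
      using pairing[OF L2_cnj[OF Psi_L2[of k]]] unfolding Psi_orthonormal co_def .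
    have e: "\<forall>\<^sub>F N in sequentially. (\<Sum>h\<in>boxN N. c h * (if h = k then 1 else 0)) = c k"
    proof -
      obtain M where M: "{k} \<subseteq> boxN M" using boxN_exhausts[of "{k}"] by blast
      have "(\<Sum>h\<in>boxN N. c h * (if h = k then 1 else 0)) = c k" if "N \<ge> M" for N
      proof -
        have "k \<in> boxN N" using M boxN_mono[OF that] by blast
        moreover have "(\<Sum>h\<in>boxN N. c h * (if h = k then 1 else 0)) = (\<Sum>h\<in>boxN N. if h = k then c h else 0)"
          by (rule sum.cong) auto
        ultimately show ?thesis by (simp add: finite_boxN)
      qed
      then show ?thesis unfolding eventually_sequentially by blast
    qed
    show ?thesis by (rule LIMSEQ_unique[OF l tendsto_eventually[OF e]])
  qed
  \<comment> \<open>Parseval for \<open>G\<close>: by Bessel's identity the missing part of the norm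
    is the squared distance of the partial sums, which tends to 0.\<close>
  have "(\<lambda>N. (LINT T|MM UNIV. (G T)\<^sup>2) - (LINT T|MM UNIV. (Gs N T - G T)\<^sup>2)) \<longlonglongrightarrow> (LINT T|MM UNIV. (G T)\<^sup>2) - 0"
    by (intro tendsto_intros lim)
  moreover have "(LINT T|MM UNIV. (G T)\<^sup>2) - (LINT T|MM UNIV. (Gs N T - G T)\<^sup>2) = (\<Sum>h\<in>boxN N. (cmod (c h))\<^sup>2)" for N
  proof -
    have "(LINT T|MM UNIV. (cmod (of_real (G T) - (\<Sum>h\<in>boxN N. c h * Psi h T)))\<^sup>2) = (LINT T|MM UNIV. (cmod (of_real (G T)))\<^sup>2) - (\<Sum>h\<in>boxN N. (cmod (c h))\<^sup>2)"
      by (rule Psi_bessel[OF L2_of_real[OF G]]) (simp add: coG[unfolded co_def])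
    then show ?thesis unfolding Gs[symmetric] norm_minus_commute[of "of_real (G _)"] n by simp
  qed
  ultimately have norm: "(\<lambda>N. \<Sum>h\<in>boxN N. (cmod (c h))\<^sup>2) \<longlonglongrightarrow> (LINT T|MM UNIV. G T * G T)"
    by (simp add: power2_eq_square)
  have orth: "(LINT T|MM UNIV. H T * G T) = 0" if H: "L2 (MM UNIV) H" and 0: "\<And>h. co H h = 0" for H
  proof -
    have "(LINT T|MM UNIV. Psi h T * of_real (H T)) = 0" for h
      using 0[of "- h"] by (simp add: co_def cnj_Psi mult.commute)
    then have "(\<lambda>N. 0) \<longlonglongrightarrow> (LINT T|MM UNIV. complex_of_real (G T) * of_real (H T))"
      using pairing[OF L2_of_real[OF H]] by simp
    then have "complex_of_real (LINT T|MM UNIV. G T * H T) = 0"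
      unfolding of_real_mult[symmetric] integral_complex_of_real by (rule LIMSEQ_unique[OF _ tendsto_const])
    then show ?thesis by (simp add: mult.commute)
  qed
  show thesis
    by (rule that[OF data limit_in_sobolev[OF tens data lim] coG[unfolded c_def] norm[unfolded c2] orth])
qed

section \<open>The image of the Bernoulli polynomial method\<close>

text \<open>\<open>swap_fibers\<close> moves the coefficient functional onto the kernel of the
  method, where \<open>proj_ker_fourier\<close> evaluates it in each coordinate.\<close>

lemma bernoulli_fourier_coeff:
  assumes f: "has_data f H"
  shows "fourier_coeff a b (bernoulli_method \<alpha> a b f) h = co H h / of_real (wt h)"
proof -
  note H = has_data_facts[OF f]
  define q where "q j z t = of_real (indicator {a $ j..b $ j} z * proj_ker \<alpha> (a $ j) (b $ j) z t) * cnj (fexp (a $ j) (b $ j) (h $ j) z)" for j z t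
  define A where "A z T = (\<Prod>j\<in>UNIV. q j (z j) (T j))" for z T
  have "\<exists>C. \<forall>j z t. norm (q j z t) \<le> C j"
  proof (rule choice, rule allI)
    fix j
    obtain B where B: "B > 0" "\<forall>x\<in>{a $ j..b $ j}. \<forall>t. \<bar>proj_ker \<alpha> (a $ j) (b $ j) x t\<bar> \<le> B" using proj_ker_bounded[OF ab] by blast
    show "\<exists>C. \<forall>z t. norm (q j z t) \<le> C"
    proof (intro exI allI)
      fix z t
      have "\<bar>indicator {a $ j..b $ j} z * proj_ker \<alpha> (a $ j) (b $ j) z t\<bar> \<le> B" using B by (auto simp: indicator_def)
      then show "norm (q j z t) \<le> B * (1 / sqrt (b $ j - a $ j))"
        unfolding q_def norm_mult norm_of_real complex_mod_cnj cmod_fexp[OF ab] using ab[of j] by (intro mult_right_mono) auto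
    qed
  qed
  then obtain C where C: "\<And>j z t. norm (q j z t) \<le> C j" by blast
  have Ab: "norm (A z T) \<le> (\<Prod>j\<in>UNIV. C j)" for z T
    unfolding A_def prod_norm[symmetric] by (intro prod_mono) (auto simp: C)
  have qm: "(\<lambda>p. q j (u p) (v p)) \<in> borel_measurable N" if [measurable]: "u \<in> borel_measurable N" "v \<in> borel_measurable N" for j u v N
    unfolding q_def by measurable
  have Tm: "(\<lambda>T. T j :: real) \<in> borel_measurable BP" for j by (rule PiM_component_measurable) simp
  have Am: "(\<lambda>p. A (fst p) (snd p)) \<in> borel_measurable (BP \<Otimes>\<^sub>M BP)"
    unfolding A_def by (intro borel_measurable_prod qm measurable_compose[OF measurable_fst Tm] measurable_compose[OF measurable_snd Tm])
  define F where "F z = (LINT t|MM UNIV. H t *\<^sub>R A z t)" for z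
  \<comment> \<open>With \<open>w = {}\<close> every coordinate of the data is integrated, and
    \<open>u = UNIV\<close> gives the integral over the whole box.\<close>
  note sw = swap_fibers[of "{}" UNIV A, OF _ Am Ab H(1,2), simplified, folded F_def]
  have "fourier_coeff a b (bernoulli_method \<alpha> a b f) h = (LINT z|LL UNIV. F z)"
    unfolding fourier_coeff_def
  proof (rule LINT_cbox[OF sw(1)])
    fix x assume x: "x \<in> cbox a b"
    have "of_real (bernoulli_method \<alpha> a b f x) * cnj (phi h x) = (LINT T|MM UNIV. of_real (H T * PK x T) * cnj (phi h x))"
      unfolding bernoulli_method_data[OF f x] PK_def[symmetric] by (simp only: integral_complex_of_real integral_mult_left_zero)
    also have "\<dots> = F (vec_nth x)"
      unfolding F_def
    proof (intro Bochner_Integration.integral_cong refl)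
      fix T
      have "A (vec_nth x) T = of_real (PK x T) * cnj (phi h x)"
        using x by (simp add: A_def q_def PK_def phi_fexp prod.distrib mem_box_cart)
      then show "of_real (H T * PK x T) * cnj (phi h x) = H T *\<^sub>R A (vec_nth x) T" by (simp add: scaleR_conv_of_real)
    qed
    finally show "of_real (bernoulli_method \<alpha> a b f x) * cnj (phi h x) = F (vec_nth x)" .
  qed
  also have "\<dots> = (LINT T|MM UNIV. H T *\<^sub>R (LINT y|LL UNIV. A y T))" by (rule sw(3))
  also have "\<dots> = (LINT T|MM UNIV. (of_real (H T) * cnj (Psi h T)) / of_real (wt h))"
  proof (intro Bochner_Integration.integral_cong refl)
    fix T
    have "(LINT y|LL UNIV. A y T) = (\<Prod>j\<in>UNIV. LINT y|Lm j. q j y (T j))"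
      unfolding A_def
      by (rule L.P.product_integral_prod) (auto simp: Lm_def intro!: leb_bounded_integrable[OF qm C])
    also have "\<dots> = (\<Prod>j\<in>UNIV. cnj (psi \<alpha> (a $ j) (b $ j) (h $ j) (T j)) / of_real (kor_weight1 \<alpha> (a $ j) (b $ j) (h $ j)))"
    proof (rule prod.cong[OF refl])
      fix j
      have "(LINT y|Lm j. q j y (T j)) = (LINT y:{a $ j..b $ j}|lborel. q j y (T j))"
        unfolding Lm_def by (rule leb_integral(2)[OF qm]) auto
      also have "\<dots> = (LINT y:{a $ j..b $ j}|lborel. of_real (proj_ker \<alpha> (a $ j) (b $ j) y (T j)) * cnj (fexp (a $ j) (b $ j) (h $ j) y))"
        by (rule set_lebesgue_integral_cong) (auto simp: q_def)
      finally show "(LINT y|Lm j. q j y (T j)) = cnj (psi \<alpha> (a $ j) (b $ j) (h $ j) (T j)) / of_real (kor_weight1 \<alpha> (a $ j) (b $ j) (h $ j))"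
        by (simp only: proj_ker_fourier[OF ab \<alpha>1])
    qed
    also have "\<dots> = cnj (Psi h T) / of_real (wt h)" by (simp add: Psi_def kor_weight_def prod_dividef)
    finally show "H T *\<^sub>R (LINT y|LL UNIV. A y T) = (of_real (H T) * cnj (Psi h T)) / of_real (wt h)"
      by (simp add: scaleR_conv_of_real)
  qed
  finally show ?thesis by (simp only: integral_divide_zero co_def)
qed

lemma co_bessel: "L2 (MM UNIV) H \<Longrightarrow> (\<Sum>h\<in>boxN N. (cmod (co H h))\<^sup>2) \<le> (LINT T|MM UNIV. (H T)\<^sup>2)"
proof -
  assume H: "L2 (MM UNIV) H"
  have "0 \<le> (LINT T|MM UNIV. (cmod (of_real (H T) - (\<Sum>h\<in>boxN N. co H h * Psi h T)))\<^sup>2)"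
    by (rule Bochner_Integration.integral_nonneg) simp
  also have "\<dots> = (LINT T|MM UNIV. (cmod (of_real (H T)))\<^sup>2) - (\<Sum>h\<in>boxN N. (cmod (co H h))\<^sup>2)"
    by (rule Psi_bessel[OF L2_of_real[OF H]]) (simp add: co_def)
  finally show ?thesis by simp
qed

text \<open>The terms of the Fourier series are products of \<open>co H h\<close> and
  \<open>phi h x / wt h\<close>. Both are square-summable, by Bessel's inequality for
  \<open>H\<close> and by \<open>PK_parseval\<close>, which gives absolute convergence. The sum is
  identified by expanding \<open>PK x\<close> in L2 and pairing with \<open>H\<close>.\<close>

theorem bernoulli_method_korobov:
  assumes f: "has_data f H"
  shows "bernoulli_method \<alpha> a b f \<in> korobov \<alpha> a b"
proof -
  have H: "L2 (MM UNIV) H" by (rule has_data_facts(3)[OF f])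
  let ?c = "fourier_coeff a b (bernoulli_method \<alpha> a b f)"
  note c = bernoulli_fourier_coeff[OF f]
  have weighted: "(norm (?c h))\<^sup>2 * (wt h)\<^sup>2 = (cmod (co H h))\<^sup>2" for h
    using wt_pos[of h] unfolding c by (simp add: norm_divide power_divide)
  have "(\<lambda>h. (norm (?c h))\<^sup>2 * (wt h)\<^sup>2) summable_on UNIV"
    unfolding weighted by (rule summable_boxN[OF zero_le_power2 co_bessel[OF H]])
  moreover have "(\<lambda>h. norm (?c h * phi h x)) summable_on UNIV \<and>
      ((\<lambda>h. ?c h * phi h x) has_sum of_real (bernoulli_method \<alpha> a b f x)) UNIV" if x: "x \<in> cbox a b" for x
  proof
    let ?q = "\<lambda>h. phi h x / of_real (wt h)"
    have t: "?c h * phi h x = co H h * ?q h" for h unfolding c by simp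
    obtain K where K: "\<And>N. (\<Sum>h\<in>boxN N. (cmod (?q h))\<^sup>2) \<le> K"
      using convergent_imp_Bseq[OF convergentI[OF PK_parseval[OF x]]] unfolding Bseq_def by (auto simp: abs_le_iff)
    show s: "(\<lambda>h. norm (?c h * phi h x)) summable_on UNIV"
    proof (rule summable_boxN[OF norm_ge_zero])
      fix N
      have "norm (?c h * phi h x) \<le> (cmod (co H h))\<^sup>2 + (cmod (?q h))\<^sup>2" for h
        unfolding t norm_mult using abs_mult_le_sum_squares[of "cmod (co H h)" "cmod (?q h)"] by simp
      then have "(\<Sum>h\<in>boxN N. norm (?c h * phi h x)) \<le> (\<Sum>h\<in>boxN N. (cmod (co H h))\<^sup>2 + (cmod (?q h))\<^sup>2)"
        by (rule sum_mono)
      also have "\<dots> \<le> (LINT T|MM UNIV. (H T)\<^sup>2) + K"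
        unfolding sum.distrib by (rule add_mono[OF co_bessel[OF H] K])
      finally show "(\<Sum>h\<in>boxN N. norm (?c h * phi h x)) \<le> (LINT T|MM UNIV. (H T)\<^sup>2) + K" .
    qed
    have P: "L2 (MM UNIV) (PK x)" by (rule PK_L2[OF x])
    let ?PN = "\<lambda>N T. \<Sum>h\<in>boxN N. cnj (?q h) * Psi h T"
    have "(\<lambda>N. (LINT T|MM UNIV. (PK x T)\<^sup>2) - (\<Sum>h\<in>boxN N. (cmod (?q h))\<^sup>2)) \<longlonglongrightarrow> (LINT T|MM UNIV. (PK x T)\<^sup>2) - (LINT T|MM UNIV. (PK x T)\<^sup>2)"
      by (intro tendsto_intros PK_parseval x)
    moreover have "(LINT T|MM UNIV. (norm (?PN N T - of_real (PK x T)))\<^sup>2) = (LINT T|MM UNIV. (PK x T)\<^sup>2) - (\<Sum>h\<in>boxN N. (cmod (?q h))\<^sup>2)" for N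
    proof -
      have "(LINT T|MM UNIV. of_real (PK x T) * cnj (Psi h T)) = cnj (?q h)" for h
        unfolding cnj_Psi PK_Psi[OF x] by (simp add: cnj_phi wt_uminus)
      from Psi_bessel[OF L2_of_real[OF P] this] show ?thesis
        unfolding complex_mod_cnj norm_minus_commute[of "of_real (PK x _)"] norm_of_real power2_abs .
    qed
    ultimately have "(\<lambda>N. LINT T|MM UNIV. (norm (?PN N T - of_real (PK x T)))\<^sup>2) \<longlonglongrightarrow> 0" by simp
    from L2_tendsto_pairing[OF fourier_sum_L2 L2_of_real[OF P] L2_of_real[OF H] this]
    have "(\<lambda>N. \<Sum>h\<in>boxN N. cnj (?q h) * (LINT T|MM UNIV. Psi h T * of_real (H T))) \<longlonglongrightarrow> (LINT T|MM UNIV. of_real (PK x T) * of_real (H T))"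
      unfolding fourier_sum_pairing[OF L2_of_real[OF H]] .
    \<comment> \<open>The pairing produces the series with \<open>h\<close> replaced by
      \<open>- h\<close>; the cubes are symmetric, so the partial sums agree.\<close>
    moreover have "cnj (?q h) * (LINT T|MM UNIV. Psi h T * of_real (H T)) = ?c (- h) * phi (- h) x" for h
      unfolding t by (simp add: cnj_phi wt_uminus co_def cnj_Psi mult.commute)
    moreover have "(LINT T|MM UNIV. complex_of_real (PK x T) * of_real (H T)) = of_real (bernoulli_method \<alpha> a b f x)"
      unfolding bernoulli_method_data[OF f x] PK_def[symmetric] of_real_mult[symmetric] integral_complex_of_real by (simp add: mult.commute)
    ultimately have l: "(\<lambda>N. \<Sum>h\<in>boxN N. ?c h * phi h x) \<longlonglongrightarrow> of_real (bernoulli_method \<alpha> a b f x)"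
      by (simp add: sum_boxN_uminus[of "\<lambda>h. ?c h * phi h x"])
    \<comment> \<open>Absolute convergence provides the unordered sum, whose value is then read off
      along the cubes.\<close>
    have hs: "((\<lambda>h. ?c h * phi h x) has_sum (\<Sum>\<^sub>\<infinity>h. ?c h * phi h x)) UNIV"
      using abs_summable_summable[OF s] by (rule has_sum_infsum)
    show "((\<lambda>h. ?c h * phi h x) has_sum of_real (bernoulli_method \<alpha> a b f x)) UNIV"
      using hs unfolding LIMSEQ_unique[OF has_sum_boxN[OF hs] l] .
  qed
  ultimately show ?thesis unfolding korobov_def by blast
qed

text \<open>Coordinatewise this is \<open>sob_ker_proj_ker\<close>. The method at \<open>x\<close>
  and the inner product with the kernel thereby become the same integral of \<open>H\<close> against
  \<open>PK x\<close>.\<close>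

lemma kernel_has_data:
  assumes x: "x \<in> cbox a b"
  shows "has_data (\<lambda>y. kor_kernel \<alpha> a b y x) (PK x)"
  unfolding has_data_iff
proof (intro conjI ballI PK_L2 x)
  fix y assume y: "y \<in> cbox a b"
  have xj: "x $ j \<in> {a $ j..b $ j}" and yj: "y $ j \<in> {a $ j..b $ j}" for j using x y by (simp_all add: mem_box_cart)
  have "(LINT T|MM UNIV. PK x T * ev y T) = (\<Prod>j\<in>UNIV. LINT t|Mm j. proj_ker \<alpha> (a $ j) (b $ j) (x $ j) t * Kc j 0 (y $ j) t)"
    unfolding PK_def ev_def prod.distrib[symmetric]
    by (rule M.P.product_integral_prod) (auto intro!: L2_mult_integrable proj_ker_L2[OF xj] Kc_L2)
  then show "kor_kernel \<alpha> a b y x = (LINT T|MM UNIV. PK x T * ev y T)"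
    unfolding kor_kernel_def sob_ker_proj_ker[OF ab \<alpha>1 xj yj, symmetric] by (simp add: Kc_inside[OF yj] Mm_def mult.commute)
qed

lemma bernoulli_method_kernel:
  assumes f: "has_data f H" and x: "x \<in> cbox a b"
  shows "bernoulli_method \<alpha> a b f x = sob_inner \<alpha> a b f (\<lambda>y. kor_kernel \<alpha> a b y x)"
  unfolding sob_inner_data[OF f kernel_has_data[OF x]] bernoulli_method_data[OF f x] PK_def ..

section \<open>Mean value, norms and the orthogonal projection\<close>

lemma integral_data:
  assumes f: "has_data f H"
  shows "(LINT x:cbox a b|lborel. f x) = H (atoms (\<lambda>_. 0))"
proof -
  note H = has_data_facts[OF f]
  have "(LINT x:cbox a b|lborel. f x) = (LINT z|LL UNIV. gder H (\<lambda>_. 0) z)"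
    by (rule LINT_cbox[OF gder_measurable[OF H(1)] H(4)])
  also have "\<dots> = H (atoms (\<lambda>_. 0))"
    using gder_fiber_average[OF H(1) zero_multi_le, of UNIV] H(2) by simp
  finally show ?thesis .
qed

text \<open>Read off from the coefficient at frequency 0: \<open>phi 0\<close> is the constant
  \<open>1 / wt 0\<close>, and \<open>Psi 0\<close> is the indicator of the atoms of order 0, so its
  pairing with \<open>H\<close> is the value of \<open>H\<close> there, the same as in
  \<open>integral_data\<close>.\<close>

lemma bernoulli_method_integral:
  assumes f: "has_data f H"
  shows "(LINT x:cbox a b|lborel. bernoulli_method \<alpha> a b f x) = H (atoms (\<lambda>_. 0))"
proof -
  let ?F = "bernoulli_method \<alpha> a b f"
  have "phi 0 x = of_real (1 / wt 0)" for x
    by (simp add: phi_fexp fexp_0 kor_weight_def kor_weight1_def prod_dividef)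
  then have "fourier_coeff a b ?F 0 = (LINT x:cbox a b|lborel. of_real (?F x)) / of_real (wt 0)"
    by (simp add: fourier_coeff_def)
  moreover have "(LINT x:cbox a b|lborel. complex_of_real (?F x)) = of_real (LINT x:cbox a b|lborel. ?F x)"
    by (rule set_integral_complex_of_real)
  ultimately have "complex_of_real (LINT x:cbox a b|lborel. ?F x) = co H 0"
    using bernoulli_fourier_coeff[OF f, of 0] wt_pos[of 0] by simp
  also have "co H 0 = of_real (LINT T|MM UNIV. H T * (\<Prod>j\<in>UNIV. dind j 0 (T j)))"
  proof -
    have "Psi 0 T = of_real (\<Prod>j\<in>UNIV. dind j 0 (T j))" for T
      using \<alpha>1 by (auto simp: Psi_def psi_def data_ind_def indicator_def intro!: prod.cong)
    then show ?thesis unfolding co_def by (simp only: complex_cnj_complex_of_real of_real_mult[symmetric] integral_complex_of_real)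
  qed
  also have "(LINT T|MM UNIV. H T * (\<Prod>j\<in>UNIV. dind j 0 (T j))) = H (atoms (\<lambda>_. 0))"
    using atom_integral[of UNIV "\<lambda>_. 0" H] \<alpha>1 by simp
  finally show ?thesis by (simp only: of_real_eq_iff)
qed

lemma kor_norm_data:
  assumes g: "g \<in> korobov \<alpha> a b"
    and lim: "(\<lambda>N. \<Sum>h\<in>boxN N. (cmod (fourier_coeff a b g h))\<^sup>2 * (wt h)\<^sup>2) \<longlonglongrightarrow> S"
  shows "kor_norm \<alpha> a b g = sqrt S"
proof -
  let ?s = "\<lambda>h. (cmod (fourier_coeff a b g h))\<^sup>2 * (wt h)\<^sup>2"
  have hs: "(?s has_sum infsum ?s UNIV) UNIV" using g by (intro has_sum_infsum) (simp add: korobov_def)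
  have "(?s has_sum S) UNIV" using hs unfolding LIMSEQ_unique[OF has_sum_boxN[OF hs] lim] .
  then have "((\<lambda>h. complex_of_real (?s h)) has_sum of_real S) UNIV" by (rule has_sum_of_real)
  moreover have "complex_of_real (?s h) = fourier_coeff a b g h * cnj (fourier_coeff a b g h) * of_real ((wt h)\<^sup>2)" for h
    unfolding of_real_mult complex_norm_square ..
  ultimately have "kor_inner \<alpha> a b g g = of_real S" unfolding kor_inner_def by (simp only: infsumI)
  then show ?thesis by (simp add: kor_norm_def)
qed

text \<open>Data \<open>G\<close> of the image come from its membership in the Korobov space. The
  coefficients of \<open>H\<close> and \<open>G\<close> agree by
  \<open>bernoulli_fourier_coeff\<close>, so \<open>H - G\<close> has vanishing coefficients and the
  last clause of \<open>korobov_data\<close> gives orthogonality to every Korobov function.\<close>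

theorem bernoulli_method_projection:
  assumes f: "f \<in> sobolev \<alpha> a b"
  defines "F \<equiv> bernoulli_method \<alpha> a b f"
  shows "is_sob_projection \<alpha> a b (korobov \<alpha> a b) f F"
    and "kor_norm \<alpha> a b F = sob_norm \<alpha> a b F" and "sob_norm \<alpha> a b F \<le> sob_norm \<alpha> a b f"
proof -
  obtain H where H: "has_data f H" using sobolev_has_data[OF f] by blast
  have F: "F \<in> korobov \<alpha> a b" unfolding F_def by (rule bernoulli_method_korobov[OF H])
  obtain G where G: "has_data F G" and coG: "\<And>h. co G h = fourier_coeff a b F h * of_real (wt h)"
    and norm: "(\<lambda>N. \<Sum>h\<in>boxN N. (cmod (fourier_coeff a b F h))\<^sup>2 * (wt h)\<^sup>2) \<longlonglongrightarrow> (LINT T|MM UNIV. G T * G T)"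
    and orth: "\<And>H. L2 (MM UNIV) H \<Longrightarrow> (\<And>h. co H h = 0) \<Longrightarrow> (LINT T|MM UNIV. H T * G T) = 0"
    by (rule korobov_data[OF F]) blast
  note HL = has_data_facts(3)[OF H] and GL = has_data_facts(3)[OF G]
  have D: "L2 (MM UNIV) (\<lambda>T. H T - G T)" by (rule L2_diff[OF HL GL])
  have co0: "co (\<lambda>T. H T - G T) h = 0" for h
  proof -
    note i = L2_mult_integrable[OF L2_of_real L2_cnj[OF Psi_L2[of h]]]
    have "co (\<lambda>T. H T - G T) h = co H h - co G h"
      using i[OF HL] i[OF GL] by (simp add: co_def left_diff_distrib)
    then show ?thesis using wt_pos[of h] unfolding coG F_def bernoulli_fourier_coeff[OF H] by simp
  qed
  show "is_sob_projection \<alpha> a b (korobov \<alpha> a b) f F"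
    unfolding is_sob_projection_def
  proof (intro conjI F subsetI ballI)
    show "g \<in> sobolev \<alpha> a b" if "g \<in> korobov \<alpha> a b" for g
      by (rule korobov_data[OF that])
    fix g assume "g \<in> korobov \<alpha> a b"
    then obtain K where K: "has_data g K"
      and orth: "\<And>H. L2 (MM UNIV) H \<Longrightarrow> (\<And>h. co H h = 0) \<Longrightarrow> (LINT T|MM UNIV. H T * K T) = 0"
      by (rule korobov_data) blast
    show "sob_inner \<alpha> a b (\<lambda>x. f x - F x) g = 0"
      unfolding sob_inner_data[OF has_data_diff[OF H G] K] by (rule orth[OF D co0])
  qed
  show "kor_norm \<alpha> a b F = sob_norm \<alpha> a b F"
    unfolding kor_norm_data[OF F norm] sob_norm_def sob_inner_data[OF G G] ..
  \<comment> \<open>Pythagoras: the cross term of \<open>H - G\<close> with \<open>G\<close>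
    integrates to 0 by orthogonality, so the squared norms of \<open>f\<close> and \<open>F\<close>
    differ by a nonnegative number.\<close>
  have "0 \<le> (LINT T|MM UNIV. (H T - G T) * (H T - G T))" by (rule Bochner_Integration.integral_nonneg) simp
  also have "\<dots> = (LINT T|MM UNIV. H T * H T - G T * G T - 2 * ((H T - G T) * G T))"
    by (intro Bochner_Integration.integral_cong refl) (simp add: algebra_simps)
  also have "\<dots> = (LINT T|MM UNIV. H T * H T) - (LINT T|MM UNIV. G T * G T)"
    using L2_mult_integrable[OF HL HL] L2_mult_integrable[OF GL GL] L2_mult_integrable[OF D GL] orth[OF D co0] by simp
  finally show "sob_norm \<alpha> a b F \<le> sob_norm \<alpha> a b f"
    unfolding sob_norm_def sob_inner_data[OF H H] sob_inner_data[OF G G] by simp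
qed

end

theorem proposition6:
  fixes \<alpha> :: nat and a b :: "real ^ 'n::finite" and f :: "real ^ 'n \<Rightarrow> real"
  assumes "\<alpha> \<ge> 1" and "\<forall>j. a $ j < b $ j" and "f \<in> sobolev \<alpha> a b"
  shows "bernoulli_method \<alpha> a b f \<in> korobov \<alpha> a b \<and>
    is_sob_projection \<alpha> a b (korobov \<alpha> a b) f (bernoulli_method \<alpha> a b f) \<and>
    (\<forall>x\<in>cbox a b.
       bernoulli_method \<alpha> a b f x = sob_inner \<alpha> a b f (\<lambda>y. kor_kernel \<alpha> a b y x)) \<and>
    (LINT x : cbox a b | lborel. bernoulli_method \<alpha> a b f x) = (LINT x : cbox a b | lborel. f x) \<and>
    kor_norm \<alpha> a b (bernoulli_method \<alpha> a b f) = sob_norm \<alpha> a b (bernoulli_method \<alpha> a b f) \<and>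
    sob_norm \<alpha> a b (bernoulli_method \<alpha> a b f) \<le> sob_norm \<alpha> a b f"
proof -
  interpret sobolev_box \<alpha> a b using assms(1,2) by (intro sobolev_box.intro) simp_all
  obtain H where H: "has_data f H" using sobolev_has_data[OF assms(3)] by blast
  show ?thesis
    using bernoulli_method_korobov[OF H] bernoulli_method_projection[OF assms(3)] bernoulli_method_kernel[OF H]
      bernoulli_method_integral[OF H] integral_data[OF H] by simp
qed

end
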